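(* Let $A$ be a tt-ring of finite degree $d$ in a tt-category $\mathscr K$. Then there is a ring isomorphism $F_A(A)\simeq \mathbb 1_A\times A^{[2]}$ of tt-rings in the tt-category $A\text{-}\mathrm{Mod}_{\mathscr K}$, and $\deg(A^{[2]})=d-1$ in $A\text{-}\mathrm{Mod}_{\mathscr K}$.
   Context: A tt-category is an essentially small, idempotent-complete triangulated category $\mathscr K$ with a symmetric monoidal structure $(\otimes,\mathbb 1)$ such that $\otimes$ is exact in each variable. A tt-functor is an exact symmetric monoidal functor. A ring object $(A,\mu,\eta)$ is an associative unital monoid in $\mathscr K$; it is separable if $\mu$ has an $A,A$-bimodule section $\sigma:A\to A\otimes A$, $\mu\sigma=\mathrm{id}_A$. A tt-ring is a commutative separable ring object. Products $A\times B$ are $A\oplus B$ with component-wise ring structure. For a tt-ring $A$, $A\text{-}\mathrm{Mod}_{\mathscr K}$ is the Eilenberg–Moore category of $A$-modules in $\mathscr K$; it is a tt-category with its unique triangulation such that extension of scalars $F_A:\mathscr K\to A\text{-}\mathrm{Mod}_{\mathscr K}$, $x\mapsto A\otimes x$, and its forgetful right adjoint $U_A$ are both exact, and with tensor $x_1\otimes_A x_2$ the (split) coequalizer of the two action maps $x_1\otimes A\otimes x_2\rightrightarrows x_1\otimes x_2$; its unit is $\mathbb 1_A=A$, and $F_A$ is a tt-functor. An $A$-algebra in $\mathscr K$ is a tt-ring $B$ in $\mathscr K$ with a homomorphism of tt-rings $A\to B$; these correspond bijectively to tt-rings in $A\text{-}\mathrm{Mod}_{\mathscr K}$ (with underlying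 object $B$), and the two are identified. For every tt-ring $A$ in a tt-category $\mathscr K$, the tt-ring $A\otimes A$, viewed as an $A$-algebra via $1_A\otimes\eta$, admits an $A$-algebra isomorphism $h:A\otimes A\xrightarrow{\sim}A\times A'$ with $\mathrm{pr}_1 h=\mu$, for an $A$-algebra $A'$ unique up to isomorphism. The splitting tower $A^{[0]}\to A^{[1]}\to A^{[2]}\to\cdots$ of $A$ is defined by $A^{[0]}=\mathbb 1$, $A^{[1]}=A$ (with $\eta:A^{[0]}\to A^{[1]}$), and for $n\ge1$, $A^{[n+1]}=(A^{[n]})'$, where $A^{[n]}$ is regarded as a tt-ring in $A^{[n-1]}\text{-}\mathrm{Mod}_{\mathscr K}$; that is, $A^{[n+1]}$ is the $A^{[n]}$-algebra characterized up to isomorphism by an isomorphism of $A^{[n]}$-algebras $h:A^{[n]}\otimes_{A^{[n-1]}}A^{[n]}\xrightarrow{\sim}A^{[n]}\times A^{[n+1]}$ with $\mathrm{pr}_1h=\mu$. The tt-ring $A$ has finite degree $d$, written $\deg(A)=d$, if $A^{[d]}\ne0$ and $A^{[d+1]}=0$; it has infinite degree if $A^{[n]}\neq0$ for all $n\ge0$. In the statement, $A^{[2]}$, an $A$-algebra, is viewed as a tt-ring in $A\text{-}\mathrm{Mod}_{\mathscr K}$.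
   Formalization: The claim deg(A^{[2]}) = d−1 is stated only for d ≥ 1: if d = 0 then A = 0, the category A-Mod is zero, and no tt-ring there has a degree (d−1 = −1 is not a degree). The ring isomorphism is stated for all d. *)

theory Defs
  imports Main
begin

section \<open>Categories with the data of a tt-category\<close>

text \<open>
  Objects and arrows form sets inside types, so essential smallness holds automatically.
  Biproducts are part of the data, as are the associator
  \<open>Assc x y z : (x \<odot> y) \<odot> z \<rightarrow> x \<odot> (y \<odot> z)\<close>, the unitors
  \<open>Lun x : One \<odot> x \<rightarrow> x\<close> and \<open>Run x : x \<odot> One \<rightarrow> x\<close>, the symmetry
  \<open>Brd x y : x \<odot> y \<rightarrow> y \<odot> x\<close>, and the isomorphism
  \<open>ShT x y : x \<odot> ShO y \<rightarrow> ShO (x \<odot> y)\<close> which makes tensoring with \<open>x\<close> exact. A triple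
  \<open>(f, g, h)\<close> in \<open>Tri\<close> is a distinguished triangle \<open>x \<rightarrow> y \<rightarrow> z \<rightarrow> ShO x\<close>.
  \<open>Zer x y\<close> is the zero arrow from \<open>x\<close> to \<open>y\<close>.
\<close>

record ('o, 'a) tt_data =
  Obj :: "'o set"
  Arr :: "'a set"
  Dom :: "'a \<Rightarrow> 'o"
  Cod :: "'a \<Rightarrow> 'o"
  Idn :: "'o \<Rightarrow> 'a"
  Cmp :: "'a \<Rightarrow> 'a \<Rightarrow> 'a"  (infixr "\<cdot>\<index>" 70)
  Zer :: "'o \<Rightarrow> 'o \<Rightarrow> 'a"
  Pls :: "'a \<Rightarrow> 'a \<Rightarrow> 'a"  (infixl "\<oplus>\<index>" 65)
  DSum :: "'o \<Rightarrow> 'o \<Rightarrow> 'o"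
  Inj1 :: "'o \<Rightarrow> 'o \<Rightarrow> 'a"
  Inj2 :: "'o \<Rightarrow> 'o \<Rightarrow> 'a"
  Prj1 :: "'o \<Rightarrow> 'o \<Rightarrow> 'a"
  Prj2 :: "'o \<Rightarrow> 'o \<Rightarrow> 'a"
  TenO :: "'o \<Rightarrow> 'o \<Rightarrow> 'o"  (infixr "\<odot>\<index>" 80)
  TenA :: "'a \<Rightarrow> 'a \<Rightarrow> 'a"  (infixr "\<otimes>\<index>" 80)
  One :: "'o"
  Assc :: "'o \<Rightarrow> 'o \<Rightarrow> 'o \<Rightarrow> 'a"
  Lun :: "'o \<Rightarrow> 'a"
  Run :: "'o \<Rightarrow> 'a"
  Brd :: "'o \<Rightarrow> 'o \<Rightarrow> 'a"
  ShO :: "'o \<Rightarrow> 'o"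
  ShA :: "'a \<Rightarrow> 'a"
  Tri :: "('a \<times> 'a \<times> 'a) set"
  ShT :: "'o \<Rightarrow> 'o \<Rightarrow> 'a"

definition Hom :: "('o, 'a) tt_data \<Rightarrow> 'o \<Rightarrow> 'o \<Rightarrow> 'a set" where
  "Hom C x y = {f \<in> Arr C. Dom C f = x \<and> Cod C f = y}"

definition inverse_arr :: "('o, 'a) tt_data \<Rightarrow> 'a \<Rightarrow> 'a \<Rightarrow> bool" where
  "inverse_arr C f g \<longleftrightarrow> f \<in> Arr C \<and> g \<in> Hom C (Cod C f) (Dom C f) \<and>
     g \<cdot>\<^bsub>C\<^esub> f = Idn C (Dom C f) \<and> f \<cdot>\<^bsub>C\<^esub> g = Idn C (Cod C f)"

definition is_iso :: "('o, 'a) tt_data \<Rightarrow> 'a \<Rightarrow> bool" where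
  "is_iso C f \<longleftrightarrow> (\<exists>g. inverse_arr C f g)"

definition Inv :: "('o, 'a) tt_data \<Rightarrow> 'a \<Rightarrow> 'a" where
  "Inv C f = (THE g. inverse_arr C f g)"

definition Neg :: "('o, 'a) tt_data \<Rightarrow> 'a \<Rightarrow> 'a" where
  "Neg C f = (THE g. g \<in> Hom C (Dom C f) (Cod C f) \<and> f \<oplus>\<^bsub>C\<^esub> g = Zer C (Dom C f) (Cod C f))"

definition zero_object :: "('o, 'a) tt_data \<Rightarrow> 'o \<Rightarrow> bool" where
  "zero_object C z \<longleftrightarrow> z \<in> Obj C \<and>
     (\<forall>x\<in>Obj C. (\<exists>!f. f \<in> Hom C x z) \<and> (\<exists>!f. f \<in> Hom C z x))"

definition coequalizer :: "('o, 'a) tt_data \<Rightarrow> 'a \<Rightarrow> 'a \<Rightarrow> 'a \<Rightarrow> bool" where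
  "coequalizer C f g q \<longleftrightarrow>
     f \<in> Arr C \<and> g \<in> Hom C (Dom C f) (Cod C f) \<and> q \<in> Arr C \<and> Dom C q = Cod C f \<and>
     q \<cdot>\<^bsub>C\<^esub> f = q \<cdot>\<^bsub>C\<^esub> g \<and>
     (\<forall>t\<in>Arr C. Dom C t = Cod C f \<and> t \<cdot>\<^bsub>C\<^esub> f = t \<cdot>\<^bsub>C\<^esub> g \<longrightarrow>
        (\<exists>!k. k \<in> Hom C (Cod C q) (Cod C t) \<and> k \<cdot>\<^bsub>C\<^esub> q = t))"

text \<open>For an epimorphism \<open>q\<close>, the unique arrow through which \<open>t\<close> factors over \<open>q\<close>.\<close>

definition descend :: "('o, 'a) tt_data \<Rightarrow> 'a \<Rightarrow> 'a \<Rightarrow> 'a" where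
  "descend C q t = (THE k. k \<in> Hom C (Cod C q) (Cod C t) \<and> k \<cdot>\<^bsub>C\<^esub> q = t)"

definition additive_functor ::
  "('o, 'a) tt_data \<Rightarrow> ('p, 'b) tt_data \<Rightarrow> ('o \<Rightarrow> 'p) \<Rightarrow> ('a \<Rightarrow> 'b) \<Rightarrow> bool" where
  "additive_functor C D Fo Fa \<longleftrightarrow>
     (\<forall>x\<in>Obj C. Fo x \<in> Obj D \<and> Fa (Idn C x) = Idn D (Fo x)) \<and>
     (\<forall>f\<in>Arr C. Fa f \<in> Hom D (Fo (Dom C f)) (Fo (Cod C f))) \<and>
     (\<forall>f\<in>Arr C. \<forall>g\<in>Arr C. Dom C g = Cod C f \<longrightarrow> Fa (g \<cdot>\<^bsub>C\<^esub> f) = Fa g \<cdot>\<^bsub>D\<^esub> Fa f) \<and>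
     (\<forall>f\<in>Arr C. \<forall>g\<in>Arr C. Dom C g = Dom C f \<and> Cod C g = Cod C f \<longrightarrow>
        Fa (f \<oplus>\<^bsub>C\<^esub> g) = Fa f \<oplus>\<^bsub>D\<^esub> Fa g)"

definition exact_functor ::
  "('o, 'a) tt_data \<Rightarrow> ('p, 'b) tt_data \<Rightarrow> ('o \<Rightarrow> 'p) \<Rightarrow> ('a \<Rightarrow> 'b) \<Rightarrow> ('o \<Rightarrow> 'b) \<Rightarrow> bool" where
  "exact_functor C D Fo Fa \<theta> \<longleftrightarrow> additive_functor C D Fo Fa \<and>
     (\<forall>x\<in>Obj C. \<theta> x \<in> Hom D (Fo (ShO C x)) (ShO D (Fo x)) \<and> is_iso D (\<theta> x)) \<and>
     (\<forall>f\<in>Arr C. \<theta> (Cod C f) \<cdot>\<^bsub>D\<^esub> Fa (ShA C f) = ShA D (Fa f) \<cdot>\<^bsub>D\<^esub> \<theta> (Dom C f)) \<and>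
     (\<forall>f g h. (f, g, h) \<in> Tri C \<longrightarrow> (Fa f, Fa g, \<theta> (Dom C f) \<cdot>\<^bsub>D\<^esub> Fa h) \<in> Tri D)"


section \<open>tt-categories\<close>

locale additive_cat =
  fixes C :: "('o, 'a) tt_data" (structure)
  assumes dom_obj: "f \<in> Arr C \<Longrightarrow> Dom C f \<in> Obj C"
    and cod_obj: "f \<in> Arr C \<Longrightarrow> Cod C f \<in> Obj C"
    and id_hom: "x \<in> Obj C \<Longrightarrow> Idn C x \<in> Hom C x x"
    and comp_hom: "\<lbrakk>f \<in> Hom C x y; g \<in> Hom C y z\<rbrakk> \<Longrightarrow> g \<cdot> f \<in> Hom C x z"
    and comp_id_right: "f \<in> Hom C x y \<Longrightarrow> f \<cdot> Idn C x = f"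
    and comp_id_left: "f \<in> Hom C x y \<Longrightarrow> Idn C y \<cdot> f = f"
    and comp_assoc: "\<lbrakk>f \<in> Hom C w x; g \<in> Hom C x y; h \<in> Hom C y z\<rbrakk>
      \<Longrightarrow> (h \<cdot> g) \<cdot> f = h \<cdot> (g \<cdot> f)"
    and zero_hom: "\<lbrakk>x \<in> Obj C; y \<in> Obj C\<rbrakk> \<Longrightarrow> Zer C x y \<in> Hom C x y"
    and plus_hom: "\<lbrakk>f \<in> Hom C x y; g \<in> Hom C x y\<rbrakk> \<Longrightarrow> f \<oplus> g \<in> Hom C x y"
    and plus_assoc: "\<lbrakk>f \<in> Hom C x y; g \<in> Hom C x y; h \<in> Hom C x y\<rbrakk>
      \<Longrightarrow> (f \<oplus> g) \<oplus> h = f \<oplus> (g \<oplus> h)"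
    and plus_comm: "\<lbrakk>f \<in> Hom C x y; g \<in> Hom C x y\<rbrakk> \<Longrightarrow> f \<oplus> g = g \<oplus> f"
    and plus_zero: "f \<in> Hom C x y \<Longrightarrow> f \<oplus> Zer C x y = f"
    and plus_inverse: "f \<in> Hom C x y \<Longrightarrow> \<exists>g\<in>Hom C x y. f \<oplus> g = Zer C x y"
    and comp_plus_right: "\<lbrakk>f \<in> Hom C x y; g \<in> Hom C x y; h \<in> Hom C y z\<rbrakk>
      \<Longrightarrow> h \<cdot> (f \<oplus> g) = (h \<cdot> f) \<oplus> (h \<cdot> g)"
    and comp_plus_left: "\<lbrakk>f \<in> Hom C y z; g \<in> Hom C y z; h \<in> Hom C x y\<rbrakk>
      \<Longrightarrow> (f \<oplus> g) \<cdot> h = (f \<cdot> h) \<oplus> (g \<cdot> h)"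
    and zero_object_exists: "\<exists>z. zero_object C z"
    and dsum_obj: "\<lbrakk>x \<in> Obj C; y \<in> Obj C\<rbrakk> \<Longrightarrow> DSum C x y \<in> Obj C"
    and inj1_hom: "\<lbrakk>x \<in> Obj C; y \<in> Obj C\<rbrakk> \<Longrightarrow> Inj1 C x y \<in> Hom C x (DSum C x y)"
    and inj2_hom: "\<lbrakk>x \<in> Obj C; y \<in> Obj C\<rbrakk> \<Longrightarrow> Inj2 C x y \<in> Hom C y (DSum C x y)"
    and prj1_hom: "\<lbrakk>x \<in> Obj C; y \<in> Obj C\<rbrakk> \<Longrightarrow> Prj1 C x y \<in> Hom C (DSum C x y) x"
    and prj2_hom: "\<lbrakk>x \<in> Obj C; y \<in> Obj C\<rbrakk> \<Longrightarrow> Prj2 C x y \<in> Hom C (DSum C x y) y"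
    and prj1_inj1: "\<lbrakk>x \<in> Obj C; y \<in> Obj C\<rbrakk> \<Longrightarrow> Prj1 C x y \<cdot> Inj1 C x y = Idn C x"
    and prj2_inj2: "\<lbrakk>x \<in> Obj C; y \<in> Obj C\<rbrakk> \<Longrightarrow> Prj2 C x y \<cdot> Inj2 C x y = Idn C y"
    and prj1_inj2: "\<lbrakk>x \<in> Obj C; y \<in> Obj C\<rbrakk> \<Longrightarrow> Prj1 C x y \<cdot> Inj2 C x y = Zer C y x"
    and prj2_inj1: "\<lbrakk>x \<in> Obj C; y \<in> Obj C\<rbrakk> \<Longrightarrow> Prj2 C x y \<cdot> Inj1 C x y = Zer C x y"
    and inj_prj_sum: "\<lbrakk>x \<in> Obj C; y \<in> Obj C\<rbrakk>
      \<Longrightarrow> (Inj1 C x y \<cdot> Prj1 C x y) \<oplus> (Inj2 C x y \<cdot> Prj2 C x y) = Idn C (DSum C x y)"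

locale idempotent_complete_cat = additive_cat +
  assumes idempotents_split: "\<lbrakk>e \<in> Hom C x x; e \<cdot> e = e\<rbrakk>
      \<Longrightarrow> \<exists>y\<in>Obj C. \<exists>r\<in>Hom C x y. \<exists>s\<in>Hom C y x. s \<cdot> r = e \<and> r \<cdot> s = Idn C y"

locale triangulated_cat = additive_cat +
  assumes shift_functor: "additive_functor C C (ShO C) (ShA C)"
    and shift_fully_faithful: "\<lbrakk>x \<in> Obj C; y \<in> Obj C\<rbrakk>
      \<Longrightarrow> bij_betw (ShA C) (Hom C x y) (Hom C (ShO C x) (ShO C y))"
    and shift_essentially_surjective: "y \<in> Obj C
      \<Longrightarrow> \<exists>x\<in>Obj C. \<exists>f\<in>Hom C (ShO C x) y. is_iso C f"
    and triangle_hom: "(f, g, h) \<in> Tri C \<Longrightarrow> f \<in> Arr C \<and>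
      g \<in> Hom C (Cod C f) (Cod C g) \<and> h \<in> Hom C (Cod C g) (ShO C (Dom C f))"
    and triangle_iso_closed: "\<lbrakk>(f, g, h) \<in> Tri C;
        a \<in> Hom C (Dom C f) x; b \<in> Hom C (Cod C f) y; c \<in> Hom C (Cod C g) z;
        is_iso C a; is_iso C b; is_iso C c;
        f' \<in> Hom C x y; g' \<in> Hom C y z; h' \<in> Hom C z (ShO C x);
        f' \<cdot> a = b \<cdot> f; g' \<cdot> b = c \<cdot> g; h' \<cdot> c = ShA C a \<cdot> h\<rbrakk>
      \<Longrightarrow> (f', g', h') \<in> Tri C"
    and triangle_id: "\<lbrakk>x \<in> Obj C; zero_object C z\<rbrakk>
      \<Longrightarrow> (Idn C x, Zer C x z, Zer C z (ShO C x)) \<in> Tri C"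
    and triangle_cone: "f \<in> Arr C \<Longrightarrow> \<exists>g h. (f, g, h) \<in> Tri C"
    and triangle_rotate: "\<lbrakk>f \<in> Hom C x y; g \<in> Hom C y z; h \<in> Hom C z (ShO C x)\<rbrakk>
      \<Longrightarrow> (f, g, h) \<in> Tri C \<longleftrightarrow> (g, h, Neg C (ShA C f)) \<in> Tri C"
    and triangle_morphism: "\<lbrakk>(f, g, h) \<in> Tri C; (f', g', h') \<in> Tri C;
        a \<in> Hom C (Dom C f) (Dom C f'); b \<in> Hom C (Cod C f) (Cod C f'); f' \<cdot> a = b \<cdot> f\<rbrakk>
      \<Longrightarrow> \<exists>c\<in>Hom C (Cod C g) (Cod C g'). g' \<cdot> b = c \<cdot> g \<and> h' \<cdot> c = ShA C a \<cdot> h"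
    and octahedral: "\<lbrakk>f \<in> Hom C x y; g \<in> Hom C y z; (f, f1, f2) \<in> Tri C;
        (g, g1, g2) \<in> Tri C; (g \<cdot> f, k1, k2) \<in> Tri C\<rbrakk>
      \<Longrightarrow> \<exists>a\<in>Hom C (Cod C f1) (Cod C k1). \<exists>b\<in>Hom C (Cod C k1) (Cod C g1).
            (a, b, ShA C f1 \<cdot> g2) \<in> Tri C \<and> a \<cdot> f1 = k1 \<cdot> g \<and> k2 \<cdot> a = f2 \<and>
            b \<cdot> k1 = g1 \<and> g2 \<cdot> b = ShA C f \<cdot> k2"

locale symmetric_monoidal_cat = additive_cat +
  assumes one_obj: "One C \<in> Obj C"
    and tensor_obj: "\<lbrakk>x \<in> Obj C; y \<in> Obj C\<rbrakk> \<Longrightarrow> x \<odot> y \<in> Obj C"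
    and tensor_hom: "\<lbrakk>f \<in> Hom C x x'; g \<in> Hom C y y'\<rbrakk> \<Longrightarrow> f \<otimes> g \<in> Hom C (x \<odot> y) (x' \<odot> y')"
    and tensor_id: "\<lbrakk>x \<in> Obj C; y \<in> Obj C\<rbrakk> \<Longrightarrow> Idn C x \<otimes> Idn C y = Idn C (x \<odot> y)"
    and tensor_comp: "\<lbrakk>f \<in> Hom C x x'; f' \<in> Hom C x' x''; g \<in> Hom C y y'; g' \<in> Hom C y' y''\<rbrakk>
      \<Longrightarrow> (f' \<cdot> f) \<otimes> (g' \<cdot> g) = (f' \<otimes> g') \<cdot> (f \<otimes> g)"
    and assc_hom: "\<lbrakk>x \<in> Obj C; y \<in> Obj C; z \<in> Obj C\<rbrakk>
      \<Longrightarrow> Assc C x y z \<in> Hom C ((x \<odot> y) \<odot> z) (x \<odot> (y \<odot> z)) \<and> is_iso C (Assc C x y z)"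
    and lun_hom: "x \<in> Obj C \<Longrightarrow> Lun C x \<in> Hom C (One C \<odot> x) x \<and> is_iso C (Lun C x)"
    and run_hom: "x \<in> Obj C \<Longrightarrow> Run C x \<in> Hom C (x \<odot> One C) x \<and> is_iso C (Run C x)"
    and brd_hom: "\<lbrakk>x \<in> Obj C; y \<in> Obj C\<rbrakk> \<Longrightarrow> Brd C x y \<in> Hom C (x \<odot> y) (y \<odot> x)"
    and assc_natural: "\<lbrakk>f \<in> Hom C x x'; g \<in> Hom C y y'; h \<in> Hom C z z'\<rbrakk>
      \<Longrightarrow> (f \<otimes> (g \<otimes> h)) \<cdot> Assc C x y z = Assc C x' y' z' \<cdot> ((f \<otimes> g) \<otimes> h)"
    and lun_natural: "f \<in> Hom C x y \<Longrightarrow> f \<cdot> Lun C x = Lun C y \<cdot> (Idn C (One C) \<otimes> f)"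
    and run_natural: "f \<in> Hom C x y \<Longrightarrow> f \<cdot> Run C x = Run C y \<cdot> (f \<otimes> Idn C (One C))"
    and brd_natural: "\<lbrakk>f \<in> Hom C x x'; g \<in> Hom C y y'\<rbrakk>
      \<Longrightarrow> (g \<otimes> f) \<cdot> Brd C x y = Brd C x' y' \<cdot> (f \<otimes> g)"
    and pentagon: "\<lbrakk>w \<in> Obj C; x \<in> Obj C; y \<in> Obj C; z \<in> Obj C\<rbrakk>
      \<Longrightarrow> Assc C w x (y \<odot> z) \<cdot> Assc C (w \<odot> x) y z
          = (Idn C w \<otimes> Assc C x y z) \<cdot> Assc C w (x \<odot> y) z \<cdot> (Assc C w x y \<otimes> Idn C z)"
    and triangle_axiom: "\<lbrakk>x \<in> Obj C; y \<in> Obj C\<rbrakk>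
      \<Longrightarrow> (Idn C x \<otimes> Lun C y) \<cdot> Assc C x (One C) y = Run C x \<otimes> Idn C y"
    and hexagon: "\<lbrakk>x \<in> Obj C; y \<in> Obj C; z \<in> Obj C\<rbrakk>
      \<Longrightarrow> Assc C y z x \<cdot> Brd C x (y \<odot> z) \<cdot> Assc C x y z
          = (Idn C y \<otimes> Brd C x z) \<cdot> Assc C y x z \<cdot> (Brd C x y \<otimes> Idn C z)"
    and brd_symmetric: "\<lbrakk>x \<in> Obj C; y \<in> Obj C\<rbrakk> \<Longrightarrow> Brd C y x \<cdot> Brd C x y = Idn C (x \<odot> y)"

text \<open>
  Exactness of the tensor product in each variable includes that the comparison isomorphisms
  \<open>ShT\<close> are natural in both variables and compatible with the unitor and the associator:
  this is what makes \<open>A \<odot> _\<close> an exact monad for every ring object \<open>A\<close>. The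
  comparison isomorphisms for the other variable are obtained from \<open>ShT\<close> by the symmetry.
\<close>

locale tt_category = idempotent_complete_cat + triangulated_cat + symmetric_monoidal_cat +
  assumes tensor_exact_right: "x \<in> Obj C
      \<Longrightarrow> exact_functor C C (\<lambda>y. x \<odot> y) (\<lambda>f. Idn C x \<otimes> f) (\<lambda>y. ShT C x y)"
    and tensor_exact_left: "x \<in> Obj C
      \<Longrightarrow> exact_functor C C (\<lambda>y. y \<odot> x) (\<lambda>f. f \<otimes> Idn C x)
            (\<lambda>y. ShA C (Brd C x y) \<cdot> ShT C x y \<cdot> Brd C (ShO C y) x)"
    and sht_natural: "\<lbrakk>f \<in> Hom C x x'; y \<in> Obj C\<rbrakk>
      \<Longrightarrow> ShA C (f \<otimes> Idn C y) \<cdot> ShT C x y = ShT C x' y \<cdot> (f \<otimes> Idn C (ShO C y))"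
    and sht_unit: "y \<in> Obj C \<Longrightarrow> ShA C (Lun C y) \<cdot> ShT C (One C) y = Lun C (ShO C y)"
    and sht_assoc: "\<lbrakk>x \<in> Obj C; y \<in> Obj C; z \<in> Obj C\<rbrakk>
      \<Longrightarrow> ShA C (Assc C x y z) \<cdot> ShT C (x \<odot> y) z
          = ShT C x (y \<odot> z) \<cdot> (Idn C x \<otimes> ShT C y z) \<cdot> Assc C x y (ShO C z)"


section \<open>tt-rings\<close>

record ('o, 'a) ring_data =
  carr :: 'o
  mlt :: 'a
  unt :: 'a

definition ring_object :: "('o, 'a) tt_data \<Rightarrow> ('o, 'a) ring_data \<Rightarrow> bool" where
  "ring_object C R \<longleftrightarrow> (let x = carr R; i = Idn C x in
     x \<in> Obj C \<and> mlt R \<in> Hom C (x \<odot>\<^bsub>C\<^esub> x) x \<and> unt R \<in> Hom C (One C) x \<and>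
     mlt R \<cdot>\<^bsub>C\<^esub> (mlt R \<otimes>\<^bsub>C\<^esub> i) = mlt R \<cdot>\<^bsub>C\<^esub> (i \<otimes>\<^bsub>C\<^esub> mlt R) \<cdot>\<^bsub>C\<^esub> Assc C x x x \<and>
     mlt R \<cdot>\<^bsub>C\<^esub> (unt R \<otimes>\<^bsub>C\<^esub> i) = Lun C x \<and>
     mlt R \<cdot>\<^bsub>C\<^esub> (i \<otimes>\<^bsub>C\<^esub> unt R) = Run C x)"

definition commutative_ring :: "('o, 'a) tt_data \<Rightarrow> ('o, 'a) ring_data \<Rightarrow> bool" where
  "commutative_ring C R \<longleftrightarrow> mlt R \<cdot>\<^bsub>C\<^esub> Brd C (carr R) (carr R) = mlt R"

definition separable_ring :: "('o, 'a) tt_data \<Rightarrow> ('o, 'a) ring_data \<Rightarrow> bool" where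
  "separable_ring C R \<longleftrightarrow> (let x = carr R; i = Idn C x in
     \<exists>s\<in>Hom C x (x \<odot>\<^bsub>C\<^esub> x).
       mlt R \<cdot>\<^bsub>C\<^esub> s = i \<and>
       s \<cdot>\<^bsub>C\<^esub> mlt R = (mlt R \<otimes>\<^bsub>C\<^esub> i) \<cdot>\<^bsub>C\<^esub> Inv C (Assc C x x x) \<cdot>\<^bsub>C\<^esub> (i \<otimes>\<^bsub>C\<^esub> s) \<and>
       s \<cdot>\<^bsub>C\<^esub> mlt R = (i \<otimes>\<^bsub>C\<^esub> mlt R) \<cdot>\<^bsub>C\<^esub> Assc C x x x \<cdot>\<^bsub>C\<^esub> (s \<otimes>\<^bsub>C\<^esub> i))"

definition tt_ring :: "('o, 'a) tt_data \<Rightarrow> ('o, 'a) ring_data \<Rightarrow> bool" where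
  "tt_ring C R \<longleftrightarrow> ring_object C R \<and> commutative_ring C R \<and> separable_ring C R"

definition tt_ring_hom ::
  "('o, 'a) tt_data \<Rightarrow> ('o, 'a) ring_data \<Rightarrow> ('o, 'a) ring_data \<Rightarrow> 'a \<Rightarrow> bool" where
  "tt_ring_hom C R S u \<longleftrightarrow> u \<in> Hom C (carr R) (carr S) \<and>
     u \<cdot>\<^bsub>C\<^esub> mlt R = mlt S \<cdot>\<^bsub>C\<^esub> (u \<otimes>\<^bsub>C\<^esub> u) \<and> u \<cdot>\<^bsub>C\<^esub> unt R = unt S"

definition tt_ring_iso ::
  "('o, 'a) tt_data \<Rightarrow> ('o, 'a) ring_data \<Rightarrow> ('o, 'a) ring_data \<Rightarrow> 'a \<Rightarrow> bool" where
  "tt_ring_iso C R S u \<longleftrightarrow> tt_ring_hom C R S u \<and> is_iso C u"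

definition isomorphic_tt_rings ::
  "('o, 'a) tt_data \<Rightarrow> ('o, 'a) ring_data \<Rightarrow> ('o, 'a) ring_data \<Rightarrow> bool" where
  "isomorphic_tt_rings C R S \<longleftrightarrow> tt_ring C R \<and> tt_ring C S \<and> (\<exists>u. tt_ring_iso C R S u)"

definition unit_ring :: "('o, 'a) tt_data \<Rightarrow> ('o, 'a) ring_data" where
  "unit_ring C = \<lparr>carr = One C, mlt = Lun C (One C), unt = Idn C (One C)\<rparr>"

definition prod_ring ::
  "('o, 'a) tt_data \<Rightarrow> ('o, 'a) ring_data \<Rightarrow> ('o, 'a) ring_data \<Rightarrow> ('o, 'a) ring_data" where
  "prod_ring C R S = (let x = carr R; y = carr S; p = Prj1 C x y; q = Prj2 C x y in
     \<lparr>carr = DSum C x y,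
      mlt = (Inj1 C x y \<cdot>\<^bsub>C\<^esub> mlt R \<cdot>\<^bsub>C\<^esub> (p \<otimes>\<^bsub>C\<^esub> p)) \<oplus>\<^bsub>C\<^esub> (Inj2 C x y \<cdot>\<^bsub>C\<^esub> mlt S \<cdot>\<^bsub>C\<^esub> (q \<otimes>\<^bsub>C\<^esub> q)),
      unt = (Inj1 C x y \<cdot>\<^bsub>C\<^esub> unt R) \<oplus>\<^bsub>C\<^esub> (Inj2 C x y \<cdot>\<^bsub>C\<^esub> unt S)\<rparr>)"

text \<open>The interchange \<open>(w \<odot> x) \<odot> (y \<odot> z) \<rightarrow> (w \<odot> y) \<odot> (x \<odot> z)\<close>.\<close>

definition interchange :: "('o, 'a) tt_data \<Rightarrow> 'o \<Rightarrow> 'o \<Rightarrow> 'o \<Rightarrow> 'o \<Rightarrow> 'a" where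
  "interchange C w x y z =
     Inv C (Assc C w y (x \<odot>\<^bsub>C\<^esub> z)) \<cdot>\<^bsub>C\<^esub>
     (Idn C w \<otimes>\<^bsub>C\<^esub> (Assc C y x z \<cdot>\<^bsub>C\<^esub> (Brd C x y \<otimes>\<^bsub>C\<^esub> Idn C z) \<cdot>\<^bsub>C\<^esub> Inv C (Assc C x y z))) \<cdot>\<^bsub>C\<^esub>
     Assc C w x (y \<odot>\<^bsub>C\<^esub> z)"

definition tensor_ring ::
  "('o, 'a) tt_data \<Rightarrow> ('o, 'a) ring_data \<Rightarrow> ('o, 'a) ring_data \<Rightarrow> ('o, 'a) ring_data" where
  "tensor_ring C R S =
     \<lparr>carr = carr R \<odot>\<^bsub>C\<^esub> carr S,
      mlt = (mlt R \<otimes>\<^bsub>C\<^esub> mlt S) \<cdot>\<^bsub>C\<^esub> interchange C (carr R) (carr S) (carr R) (carr S),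
      unt = (unt R \<otimes>\<^bsub>C\<^esub> unt S) \<cdot>\<^bsub>C\<^esub> Inv C (Lun C (One C))\<rparr>"


section \<open>The category of modules over a tt-ring\<close>

text \<open>
  A module is a pair \<open>(x, r)\<close> with action \<open>r : A \<odot> x \<rightarrow> x\<close>; an arrow of modules is a triple
  consisting of its source, the underlying arrow and its target.
\<close>

type_synonym ('o, 'a) mod_obj = "'o \<times> 'a"
type_synonym ('o, 'a) mod_arr = "('o \<times> 'a) \<times> 'a \<times> ('o \<times> 'a)"

definition is_module :: "('o, 'a) tt_data \<Rightarrow> ('o, 'a) ring_data \<Rightarrow> ('o, 'a) mod_obj \<Rightarrow> bool" where
  "is_module C A m \<longleftrightarrow> (let a = carr A; x = fst m; r = snd m in
     x \<in> Obj C \<and> r \<in> Hom C (a \<odot>\<^bsub>C\<^esub> x) x \<and>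
     r \<cdot>\<^bsub>C\<^esub> (mlt A \<otimes>\<^bsub>C\<^esub> Idn C x) = r \<cdot>\<^bsub>C\<^esub> (Idn C a \<otimes>\<^bsub>C\<^esub> r) \<cdot>\<^bsub>C\<^esub> Assc C a a x \<and>
     r \<cdot>\<^bsub>C\<^esub> (unt A \<otimes>\<^bsub>C\<^esub> Idn C x) = Lun C x)"

definition is_module_arr ::
  "('o, 'a) tt_data \<Rightarrow> ('o, 'a) ring_data \<Rightarrow> ('o, 'a) mod_arr \<Rightarrow> bool" where
  "is_module_arr C A F \<longleftrightarrow> (case F of (m, f, n) \<Rightarrow>
     is_module C A m \<and> is_module C A n \<and> f \<in> Hom C (fst m) (fst n) \<and>
     f \<cdot>\<^bsub>C\<^esub> snd m = snd n \<cdot>\<^bsub>C\<^esub> (Idn C (carr A) \<otimes>\<^bsub>C\<^esub> f))"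

text \<open>
  A chosen coequalizer \<open>fst m \<odot> fst n \<rightarrow> m \<otimes>\<^sub>A n\<close> of the two actions
  \<open>(fst m \<odot> A) \<odot> fst n \<rightarrow> fst m \<odot> fst n\<close>; the right action on \<open>m\<close> is obtained from
  the left one by the symmetry. For a tt-ring it exists because \<open>A\<close> is separable and
  idempotents split.
\<close>

definition ten_proj ::
  "('o, 'a) tt_data \<Rightarrow> ('o, 'a) ring_data \<Rightarrow> ('o, 'a) mod_obj \<Rightarrow> ('o, 'a) mod_obj \<Rightarrow> 'a" where
  "ten_proj C A m n = (SOME q. coequalizer C
     ((snd m \<cdot>\<^bsub>C\<^esub> Brd C (fst m) (carr A)) \<otimes>\<^bsub>C\<^esub> Idn C (fst n))
     ((Idn C (fst m) \<otimes>\<^bsub>C\<^esub> snd n) \<cdot>\<^bsub>C\<^esub> Assc C (fst m) (carr A) (fst n)) q)"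

definition ten_obj ::
  "('o, 'a) tt_data \<Rightarrow> ('o, 'a) ring_data \<Rightarrow> ('o, 'a) mod_obj \<Rightarrow> ('o, 'a) mod_obj
     \<Rightarrow> ('o, 'a) mod_obj" where
  "ten_obj C A m n = (let q = ten_proj C A m n in
     (Cod C q,
      descend C (Idn C (carr A) \<otimes>\<^bsub>C\<^esub> q)
        (q \<cdot>\<^bsub>C\<^esub> (snd m \<otimes>\<^bsub>C\<^esub> Idn C (fst n)) \<cdot>\<^bsub>C\<^esub> Inv C (Assc C (carr A) (fst m) (fst n)))))"

definition dsum_obj ::
  "('o, 'a) tt_data \<Rightarrow> ('o, 'a) ring_data \<Rightarrow> ('o, 'a) mod_obj \<Rightarrow> ('o, 'a) mod_obj
     \<Rightarrow> ('o, 'a) mod_obj" where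
  "dsum_obj C A m n = (let x = fst m; y = fst n; i = Idn C (carr A) in
     (DSum C x y,
      (Inj1 C x y \<cdot>\<^bsub>C\<^esub> snd m \<cdot>\<^bsub>C\<^esub> (i \<otimes>\<^bsub>C\<^esub> Prj1 C x y)) \<oplus>\<^bsub>C\<^esub>
      (Inj2 C x y \<cdot>\<^bsub>C\<^esub> snd n \<cdot>\<^bsub>C\<^esub> (i \<otimes>\<^bsub>C\<^esub> Prj2 C x y))))"

definition shift_obj ::
  "('o, 'a) tt_data \<Rightarrow> ('o, 'a) ring_data \<Rightarrow> ('o, 'a) mod_obj \<Rightarrow> ('o, 'a) mod_obj" where
  "shift_obj C A m = (ShO C (fst m), ShA C (snd m) \<cdot>\<^bsub>C\<^esub> ShT C (carr A) (fst m))"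

text \<open>
  The monoidal structure is induced from that of \<open>C\<close> along the coequalizers. A triangle of
  modules is distinguished iff the forgetful functor sends it to a distinguished triangle; for
  separable \<open>A\<close> this is the unique triangulation for which extension of scalars and
  the forgetful functor are exact.
\<close>

definition Modc ::
  "('o, 'a) tt_data \<Rightarrow> ('o, 'a) ring_data
     \<Rightarrow> (('o, 'a) mod_obj, ('o, 'a) mod_arr) tt_data" where
  "Modc C A = \<lparr>
     Obj = {m. is_module C A m},
     Arr = {F. is_module_arr C A F},
     Dom = (\<lambda>(m, f, n). m),
     Cod = (\<lambda>(m, f, n). n),
     Idn = (\<lambda>m. (m, Idn C (fst m), m)),
     Cmp = (\<lambda>(m', g, n') (m, f, n). (m, g \<cdot>\<^bsub>C\<^esub> f, n')),
     Zer = (\<lambda>m n. (m, Zer C (fst m) (fst n), n)),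
     Pls = (\<lambda>(m, f, n) (m', g, n'). (m, f \<oplus>\<^bsub>C\<^esub> g, n)),
     DSum = dsum_obj C A,
     Inj1 = (\<lambda>m n. (m, Inj1 C (fst m) (fst n), dsum_obj C A m n)),
     Inj2 = (\<lambda>m n. (n, Inj2 C (fst m) (fst n), dsum_obj C A m n)),
     Prj1 = (\<lambda>m n. (dsum_obj C A m n, Prj1 C (fst m) (fst n), m)),
     Prj2 = (\<lambda>m n. (dsum_obj C A m n, Prj2 C (fst m) (fst n), n)),
     TenO = ten_obj C A,
     TenA = (\<lambda>(m, f, n) (m', g, n').
       (ten_obj C A m m',
        descend C (ten_proj C A m m') (ten_proj C A n n' \<cdot>\<^bsub>C\<^esub> (f \<otimes>\<^bsub>C\<^esub> g)),
        ten_obj C A n n')),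
     One = (carr A, mlt A),
     Assc = (\<lambda>l m n.
       (ten_obj C A (ten_obj C A l m) n,
        descend C
          (ten_proj C A (ten_obj C A l m) n \<cdot>\<^bsub>C\<^esub> (ten_proj C A l m \<otimes>\<^bsub>C\<^esub> Idn C (fst n)))
          (ten_proj C A l (ten_obj C A m n) \<cdot>\<^bsub>C\<^esub> (Idn C (fst l) \<otimes>\<^bsub>C\<^esub> ten_proj C A m n) \<cdot>\<^bsub>C\<^esub>
            Assc C (fst l) (fst m) (fst n)),
        ten_obj C A l (ten_obj C A m n))),
     Lun = (\<lambda>m.
       (ten_obj C A (carr A, mlt A) m,
        descend C (ten_proj C A (carr A, mlt A) m) (snd m),
        m)),
     Run = (\<lambda>m.
       (ten_obj C A m (carr A, mlt A),
        descend C (ten_proj C A m (carr A, mlt A)) (snd m \<cdot>\<^bsub>C\<^esub> Brd C (fst m) (carr A)),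
        m)),
     Brd = (\<lambda>m n.
       (ten_obj C A m n,
        descend C (ten_proj C A m n) (ten_proj C A n m \<cdot>\<^bsub>C\<^esub> Brd C (fst m) (fst n)),
        ten_obj C A n m)),
     ShO = shift_obj C A,
     ShA = (\<lambda>(m, f, n). (shift_obj C A m, ShA C f, shift_obj C A n)),
     Tri = {((m, f, n), (n', g, l), (l', h, k)) | m f n n' g l l' h k.
       is_module_arr C A (m, f, n) \<and> is_module_arr C A (n', g, l) \<and> is_module_arr C A (l', h, k) \<and>
       n' = n \<and> l' = l \<and> k = shift_obj C A m \<and> (f, g, h) \<in> Tri C},
     ShT = (\<lambda>m n.
       (ten_obj C A m (shift_obj C A n),
        descend C (ten_proj C A m (shift_obj C A n))
          (ShA C (ten_proj C A m n) \<cdot>\<^bsub>C\<^esub> ShT C (fst m) (fst n)),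
        shift_obj C A (ten_obj C A m n)))
   \<rparr>"

text \<open>
  A homomorphism \<open>f : A \<rightarrow> B\<close> of tt-rings in \<open>C\<close> turns \<open>B\<close> into a ring in \<open>A\<close>-modules.
\<close>

definition alg_mod :: "('o, 'a) tt_data \<Rightarrow> 'a \<Rightarrow> ('o, 'a) ring_data \<Rightarrow> ('o, 'a) mod_obj" where
  "alg_mod C f B = (carr B, mlt B \<cdot>\<^bsub>C\<^esub> (f \<otimes>\<^bsub>C\<^esub> Idn C (carr B)))"

definition alg_ring ::
  "('o, 'a) tt_data \<Rightarrow> ('o, 'a) ring_data \<Rightarrow> 'a \<Rightarrow> ('o, 'a) ring_data
     \<Rightarrow> (('o, 'a) mod_obj, ('o, 'a) mod_arr) ring_data" where
  "alg_ring C A f B = (let b = alg_mod C f B in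
     \<lparr>carr = b,
      mlt = (ten_obj C A b b, descend C (ten_proj C A b b) (mlt B), b),
      unt = ((carr A, mlt A), f, b)\<rparr>)"

text \<open>
  Extension of scalars \<open>F\<^sub>A\<close> on objects and arrows, its monoidal comparison arrows
  \<open>F\<^sub>A x \<otimes>\<^sub>A F\<^sub>A y \<rightarrow> F\<^sub>A (x \<odot> y)\<close> and \<open>1\<^sub>A \<rightarrow> F\<^sub>A 1\<close>, and the induced map on ring objects.
\<close>

definition ext_obj ::
  "('o, 'a) tt_data \<Rightarrow> ('o, 'a) ring_data \<Rightarrow> 'o \<Rightarrow> ('o, 'a) mod_obj" where
  "ext_obj C A x = (carr A \<odot>\<^bsub>C\<^esub> x,
     (mlt A \<otimes>\<^bsub>C\<^esub> Idn C x) \<cdot>\<^bsub>C\<^esub> Inv C (Assc C (carr A) (carr A) x))"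

definition ext_arr ::
  "('o, 'a) tt_data \<Rightarrow> ('o, 'a) ring_data \<Rightarrow> 'a \<Rightarrow> ('o, 'a) mod_arr" where
  "ext_arr C A f = (ext_obj C A (Dom C f), Idn C (carr A) \<otimes>\<^bsub>C\<^esub> f, ext_obj C A (Cod C f))"

definition ext_tensor ::
  "('o, 'a) tt_data \<Rightarrow> ('o, 'a) ring_data \<Rightarrow> 'o \<Rightarrow> 'o \<Rightarrow> ('o, 'a) mod_arr" where
  "ext_tensor C A x y =
     (ten_obj C A (ext_obj C A x) (ext_obj C A y),
      descend C (ten_proj C A (ext_obj C A x) (ext_obj C A y))
        ((mlt A \<otimes>\<^bsub>C\<^esub> Idn C (x \<odot>\<^bsub>C\<^esub> y)) \<cdot>\<^bsub>C\<^esub> interchange C (carr A) x (carr A) y),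
      ext_obj C A (x \<odot>\<^bsub>C\<^esub> y))"

definition ext_one ::
  "('o, 'a) tt_data \<Rightarrow> ('o, 'a) ring_data \<Rightarrow> ('o, 'a) mod_arr" where
  "ext_one C A = ((carr A, mlt A), Inv C (Run C (carr A)), ext_obj C A (One C))"

definition ext_ring ::
  "('o, 'a) tt_data \<Rightarrow> ('o, 'a) ring_data \<Rightarrow> ('o, 'a) ring_data
     \<Rightarrow> (('o, 'a) mod_obj, ('o, 'a) mod_arr) ring_data" where
  "ext_ring C A R =
     \<lparr>carr = ext_obj C A (carr R),
      mlt = ext_arr C A (mlt R) \<cdot>\<^bsub>Modc C A\<^esub> ext_tensor C A (carr R) (carr R),
      unt = ext_arr C A (unt R) \<cdot>\<^bsub>Modc C A\<^esub> ext_one C A\<rparr>"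


section \<open>The splitting tower and the degree\<close>

text \<open>
  \<open>h\<close> is an isomorphism of \<open>B\<close>-algebras from \<open>B \<otimes> B\<close>, with structure map
  \<open>1\<^sub>B \<otimes> \<eta>\<close>, to \<open>B \<times> B'\<close>, where \<open>B'\<close> is a \<open>B\<close>-algebra via \<open>g\<close>.
\<close>

definition is_splitting ::
  "('o, 'a) tt_data \<Rightarrow> ('o, 'a) ring_data \<Rightarrow> ('o, 'a) ring_data \<Rightarrow> 'a \<Rightarrow> bool" where
  "is_splitting C B B' g \<longleftrightarrow> tt_ring C B' \<and> tt_ring_hom C B B' g \<and>
     (let b = carr B; b' = carr B' in
      \<exists>h. tt_ring_iso C (tensor_ring C B B) (prod_ring C B B') h \<and>
        h \<cdot>\<^bsub>C\<^esub> (Idn C b \<otimes>\<^bsub>C\<^esub> unt B) \<cdot>\<^bsub>C\<^esub> Inv C (Run C b) = Inj1 C b b' \<oplus>\<^bsub>C\<^esub> (Inj2 C b b' \<cdot>\<^bsub>C\<^esub> g) \<and>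
        Prj1 C b b' \<cdot>\<^bsub>C\<^esub> h = mlt B)"

text \<open>
  The splitting tower is determined up to isomorphism only: \<open>T n\<close> is an \<open>n\<close>-th stage
  and \<open>t n : T n \<rightarrow> T (n + 1)\<close> is the structure map. In the step from \<open>T n\<close> to
  \<open>T (n + 1)\<close>, both are regarded as rings in modules over \<open>T (n - 1)\<close>.
\<close>

definition splitting_tower ::
  "('o, 'a) tt_data \<Rightarrow> ('o, 'a) ring_data \<Rightarrow> (nat \<Rightarrow> ('o, 'a) ring_data) \<Rightarrow> (nat \<Rightarrow> 'a) \<Rightarrow> bool"
  where
  "splitting_tower C A T t \<longleftrightarrow>
     T 0 = unit_ring C \<and> T 1 = A \<and> t 0 = unt A \<and>
     (\<forall>n. tt_ring C (T n) \<and> tt_ring_hom C (T n) (T (n + 1)) (t n)) \<and>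
     (\<forall>n\<ge>1. let S = T (n - 1); s = t (n - 1);
              B = alg_ring C S s (T n);
              B' = alg_ring C S (t n \<cdot>\<^bsub>C\<^esub> s) (T (n + 1))
            in is_splitting (Modc C S) B B' (carr B, t n, carr B'))"

definition tower_degree ::
  "('o, 'a) tt_data \<Rightarrow> (nat \<Rightarrow> ('o, 'a) ring_data) \<Rightarrow> nat \<Rightarrow> bool" where
  "tower_degree C T d \<longleftrightarrow>
     \<not> zero_object C (carr (T d)) \<and> zero_object C (carr (T (d + 1)))"

definition has_degree :: "('o, 'a) tt_data \<Rightarrow> ('o, 'a) ring_data \<Rightarrow> nat \<Rightarrow> bool" where
  "has_degree C A d \<longleftrightarrow> (\<exists>T t. splitting_tower C A T t \<and> tower_degree C T d)"

end

theory Submission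
  imports Defs
begin

text \<open>
  A splitting \<open>B \<otimes>\<^sub>S B \<cong> B \<times> B'\<close> over \<open>S\<close> amounts to a map \<open>h : B \<otimes> B \<rightarrow> B \<times> B'\<close> in
  the base category which is multiplicative, compatible with the \<open>B\<close>-algebra structures, and a
  coequalizer of the two actions of \<open>S\<close>. This description does not see whether \<open>S\<close>, \<open>B\<close>, \<open>B'\<close> live in
  \<open>K\<close> or, via a ring map \<open>A \<rightarrow> S\<close>, in \<open>A\<close>-modules: \<open>h\<close> factors through \<open>B \<otimes>\<^sub>A B\<close> and the factor is
  again such a coequalizer. Hence the stages \<open>A\<^sup>[\<^sup>1\<^sup>], A\<^sup>[\<^sup>2\<^sup>], \<dots>\<close> of the tower of \<open>A\<close>, regarded as
  \<open>A\<close>-algebras, form the splitting tower of \<open>A\<^sup>[\<^sup>2\<^sup>]\<close> over \<open>A\<close>, and the degree drops by one. Over \<open>S = \<one>\<close>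
  every map is balanced, so \<open>h\<close> is an isomorphism \<open>A \<otimes> A \<cong> A \<times> A\<^sup>[\<^sup>2\<^sup>]\<close>; read in \<open>A\<close>-modules it is the
  asserted splitting of \<open>F\<^sub>A(A)\<close>.

  The argument runs in an additive, idempotent-complete symmetric monoidal category with biadditive
  tensor product, a structure inherited by the modules over a tt-ring:
  by separability the coequalizers defining \<open>\<otimes>\<^sub>A\<close> are split, so they are preserved by every functor.
\<close>

section \<open>Additive categories\<close>

text \<open>The obstacle is that the two towers live in different categories. A step of the tower of
  \<open>A\<close> is a condition in modules over \<open>T (n - 1)\<close> in \<open>K\<close>; the
  matching step of the new tower is a condition in modules over a ring that itself lives in
  \<open>A\<close>-modules. An equivalence between these module categories would have to carry all
  monoidal structure, and the tensor products agree only up to isomorphism, since each comes from an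
  arbitrary choice of coequalizer. A map out of \<open>B \<odot> B\<close> in the base category
  depends on none of these choices. The lemma \<open>is_splitting_iff\<close> translates on both
  sides, because the locale \<open>ring_modules\<close> is stated over an arbitrary base and is
  instantiated at \<open>K\<close> and again at \<open>Modc K A\<close>. The price is that
  \<open>Modc K A\<close> has to satisfy all axioms of the base, with explicit associators and
  braidings. Its monoidal axioms are checked after precomposition with the split epimorphisms
  \<open>proj\<close>, which turns each of them into a statement about \<open>K\<close>.\<close>

lemma Hom_iff: "f \<in> Hom C x y \<longleftrightarrow> f \<in> Arr C \<and> Dom C f = x \<and> Cod C f = y"
  by (simp add: Hom_def)

context additive_cat
begin

lemma Idn_typed [simp]:
  assumes "x \<in> Obj C"
  shows "Idn C x \<in> Arr C" "Dom C (Idn C x) = x" "Cod C (Idn C x) = x"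
  using id_hom[OF assms] by (auto simp: Hom_iff)

lemma comp_typed [simp]:
  assumes "f \<in> Arr C" "g \<in> Arr C" "Dom C g = Cod C f"
  shows "g \<cdot> f \<in> Arr C" "Dom C (g \<cdot> f) = Dom C f" "Cod C (g \<cdot> f) = Cod C g"
  using comp_hom[of f "Dom C f" "Cod C f" g "Cod C g"] assms by (auto simp: Hom_iff)

lemma plus_typed [simp]:
  assumes "f \<in> Arr C" "g \<in> Arr C" "Dom C g = Dom C f" "Cod C g = Cod C f"
  shows "f \<oplus> g \<in> Arr C" "Dom C (f \<oplus> g) = Dom C f" "Cod C (f \<oplus> g) = Cod C f"
  using plus_hom[of f "Dom C f" "Cod C f" g] assms by (auto simp: Hom_iff)

lemma Zer_typed [simp]:
  assumes "x \<in> Obj C" "y \<in> Obj C"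
  shows "Zer C x y \<in> Arr C" "Dom C (Zer C x y) = x" "Cod C (Zer C x y) = y"
  using zero_hom[OF assms] by (auto simp: Hom_iff)

lemma biprod_typed [simp]:
  assumes "x \<in> Obj C" "y \<in> Obj C"
  shows "DSum C x y \<in> Obj C"
    "Inj1 C x y \<in> Arr C" "Dom C (Inj1 C x y) = x" "Cod C (Inj1 C x y) = DSum C x y"
    "Inj2 C x y \<in> Arr C" "Dom C (Inj2 C x y) = y" "Cod C (Inj2 C x y) = DSum C x y"
    "Prj1 C x y \<in> Arr C" "Dom C (Prj1 C x y) = DSum C x y" "Cod C (Prj1 C x y) = x"
    "Prj2 C x y \<in> Arr C" "Dom C (Prj2 C x y) = DSum C x y" "Cod C (Prj2 C x y) = y"
  using dsum_obj[OF assms] inj1_hom[OF assms] inj2_hom[OF assms] prj1_hom[OF assms]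
    prj2_hom[OF assms] by (auto simp: Hom_iff)

declare dom_obj [simp] cod_obj [simp]

lemma id_left [simp]: "\<lbrakk>f \<in> Arr C; Cod C f = x\<rbrakk> \<Longrightarrow> Idn C x \<cdot> f = f"
  and id_right [simp]: "\<lbrakk>f \<in> Arr C; Dom C f = x\<rbrakk> \<Longrightarrow> f \<cdot> Idn C x = f"
  by (auto intro!: comp_id_left comp_id_right simp: Hom_iff)

lemma assoc [simp]:
  "\<lbrakk>f \<in> Arr C; g \<in> Arr C; h \<in> Arr C; Dom C g = Cod C f; Dom C h = Cod C g\<rbrakk>
    \<Longrightarrow> (h \<cdot> g) \<cdot> f = h \<cdot> (g \<cdot> f)"
  by (auto intro!: comp_assoc simp: Hom_iff)

text \<open>Composites are normalized to right-nested form, where \<open>g \<cdot> f\<close> is no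
  longer a subterm once a further factor \<open>k\<close> follows. This and \<open>tail3\<close>
  restate an equation in the form that applies there.\<close>

lemma tail:
  "\<lbrakk>g \<cdot> f = r; f \<in> Arr C; g \<in> Arr C; Dom C g = Cod C f; k \<in> Arr C; Cod C k = Dom C f\<rbrakk>
    \<Longrightarrow> g \<cdot> (f \<cdot> k) = r \<cdot> k"
  using assoc[of k f g] by simp

lemma tail3:
  "\<lbrakk>h \<cdot> g \<cdot> f = r; f \<in> Arr C; g \<in> Arr C; h \<in> Arr C; Dom C g = Cod C f; Dom C h = Cod C g;
    k \<in> Arr C; Cod C k = Dom C f\<rbrakk> \<Longrightarrow> h \<cdot> (g \<cdot> (f \<cdot> k)) = r \<cdot> k"
  using assoc[of k "g \<cdot> f" h] assoc[of k f g] by simp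

lemma plus_right:
  "\<lbrakk>f \<in> Arr C; g \<in> Arr C; h \<in> Arr C; Dom C g = Dom C f; Cod C g = Cod C f; Dom C h = Cod C f\<rbrakk>
    \<Longrightarrow> h \<cdot> (f \<oplus> g) = (h \<cdot> f) \<oplus> (h \<cdot> g)"
  by (rule comp_plus_right[of f "Dom C f" "Cod C f" g h "Cod C h"]) (auto simp: Hom_iff)

lemma plus_left:
  "\<lbrakk>f \<in> Arr C; g \<in> Arr C; h \<in> Arr C; Dom C g = Dom C f; Cod C g = Cod C f; Cod C h = Dom C f\<rbrakk>
    \<Longrightarrow> (f \<oplus> g) \<cdot> h = (f \<cdot> h) \<oplus> (g \<cdot> h)"
  by (rule comp_plus_left[of f "Dom C f" "Cod C f" g h "Dom C h"]) (auto simp: Hom_iff)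

lemma plus_Zer_right: "\<lbrakk>f \<in> Arr C; Dom C f = x; Cod C f = y\<rbrakk> \<Longrightarrow> f \<oplus> Zer C x y = f"
  by (auto intro!: plus_zero simp: Hom_iff)

lemma plus_Zer_left: "\<lbrakk>f \<in> Arr C; Dom C f = x; Cod C f = y\<rbrakk> \<Longrightarrow> Zer C x y \<oplus> f = f"
  using plus_comm[of f x y "Zer C x y"] zero_hom[of x y] plus_Zer_right[of f x y]
  by (auto simp: Hom_iff)

text \<open>The only idempotent of a group is its neutral element. Biadditivity makes composites and
  tensors with \<open>Zer\<close> idempotent, and this is how the absorption laws for
  \<open>Zer\<close> are obtained.\<close>

lemma plus_idem_zero:
  assumes "f \<in> Hom C x y" "f \<oplus> f = f"
  shows "f = Zer C x y"
proof -
  obtain g where g: "g \<in> Hom C x y" "f \<oplus> g = Zer C x y"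
    using plus_inverse[OF assms(1)] by blast
  have "f = f \<oplus> (f \<oplus> g)" using g plus_zero[OF assms(1)] by simp
  also have "\<dots> = f \<oplus> g" using assms g plus_assoc[of f x y f g] by simp
  finally show ?thesis using g by simp
qed

lemma comp_Zer_right:
  assumes "f \<in> Arr C" "Dom C f = y" "x \<in> Obj C"
  shows "f \<cdot> Zer C x y = Zer C x (Cod C f)"
proof (rule plus_idem_zero)
  have y: "y \<in> Obj C" using assms by auto
  show "f \<cdot> Zer C x y \<in> Hom C x (Cod C f)" using assms y by (simp add: Hom_iff)
  show "f \<cdot> Zer C x y \<oplus> f \<cdot> Zer C x y = f \<cdot> Zer C x y"
    using plus_right[of "Zer C x y" "Zer C x y" f] assms y by (simp add: plus_Zer_right)
qed

lemma comp_Zer_left: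
  assumes "f \<in> Arr C" "Cod C f = x" "y \<in> Obj C"
  shows "Zer C x y \<cdot> f = Zer C (Dom C f) y"
proof (rule plus_idem_zero)
  have x: "x \<in> Obj C" using assms by auto
  show "Zer C x y \<cdot> f \<in> Hom C (Dom C f) y" using assms x by (simp add: Hom_iff)
  show "Zer C x y \<cdot> f \<oplus> Zer C x y \<cdot> f = Zer C x y \<cdot> f"
    using plus_left[of "Zer C x y" "Zer C x y" f] assms x by (simp add: plus_Zer_right)
qed

declare prj1_inj1 [simp] prj2_inj2 [simp] prj1_inj2 [simp] prj2_inj1 [simp]

lemma prj_inj_tail [simp]:
  assumes "x \<in> Obj C" "y \<in> Obj C" "k \<in> Arr C"
  shows "Cod C k = x \<Longrightarrow> Prj1 C x y \<cdot> (Inj1 C x y \<cdot> k) = k"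
    "Cod C k = y \<Longrightarrow> Prj2 C x y \<cdot> (Inj2 C x y \<cdot> k) = k"
    "Cod C k = y \<Longrightarrow> Prj1 C x y \<cdot> (Inj2 C x y \<cdot> k) = Zer C (Dom C k) x"
    "Cod C k = x \<Longrightarrow> Prj2 C x y \<cdot> (Inj1 C x y \<cdot> k) = Zer C (Dom C k) y"
  using assms by (simp_all add: tail[OF prj1_inj1] tail[OF prj2_inj2] tail[OF prj1_inj2]
      tail[OF prj2_inj1] comp_Zer_left)

text \<open>Every arrow into or out of \<open>x\<close> factors through \<open>Idn C x\<close>,
  hence vanishes. Being zero thus becomes one equation between endomorphisms, which can be compared
  in \<open>C\<close> and in modules.\<close>

lemma zero_objectI:
  assumes x: "x \<in> Obj C" and eq: "Idn C x = Zer C x x"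
  shows "zero_object C x"
proof -
  have 1: "\<exists>!f. f \<in> Hom C y x" if y: "y \<in> Obj C" for y
  proof (rule ex1I[of _ "Zer C y x"])
    show "Zer C y x \<in> Hom C y x" using x y by (rule zero_hom[rotated])
    fix f assume f: "f \<in> Hom C y x"
    then have "f = Idn C x \<cdot> f" by (simp add: Hom_iff)
    then show "f = Zer C y x" using f x by (simp add: eq comp_Zer_left Hom_iff)
  qed
  have 2: "\<exists>!f. f \<in> Hom C x y" if y: "y \<in> Obj C" for y
  proof (rule ex1I[of _ "Zer C x y"])
    show "Zer C x y \<in> Hom C x y" using x y by (rule zero_hom)
    fix f assume f: "f \<in> Hom C x y"
    then have "f = f \<cdot> Idn C x" by (simp add: Hom_iff)
    then show "f = Zer C x y" using f x by (simp add: eq comp_Zer_right Hom_iff)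
  qed
  show ?thesis unfolding zero_object_def using x 1 2 by blast
qed

lemma zero_object_iff: "zero_object C x \<longleftrightarrow> x \<in> Obj C \<and> Idn C x = Zer C x x"
proof
  assume "zero_object C x"
  then have x: "x \<in> Obj C" and u: "\<exists>!f. f \<in> Hom C x x" by (auto simp: zero_object_def)
  then show "x \<in> Obj C \<and> Idn C x = Zer C x x"
    using id_hom[OF x] zero_hom[OF x x] by blast
qed (use zero_objectI in blast)

lemma inverse_arr_unique:
  assumes "inverse_arr C f g" "inverse_arr C f g'"
  shows "g = g'"
proof -
  have g: "g \<in> Arr C" "Dom C g = Cod C f" "Cod C g = Dom C f"
    and g': "g' \<in> Arr C" "Dom C g' = Cod C f" "Cod C g' = Dom C f" and f: "f \<in> Arr C"
    and e: "g \<cdot> f = Idn C (Dom C f)" "f \<cdot> g' = Idn C (Cod C f)"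
    using assms by (auto simp: inverse_arr_def Hom_iff)
  have "g = g \<cdot> (f \<cdot> g')" using e g by simp
  also have "\<dots> = (g \<cdot> f) \<cdot> g'" using f g g' by simp
  also have "\<dots> = g'" using g' by (simp add: e)
  finally show ?thesis .
qed

lemma Inv_eq: "inverse_arr C f g \<Longrightarrow> Inv C f = g"
  unfolding Inv_def using inverse_arr_unique by blast

lemma Inv_eqI:
  "\<lbrakk>f \<in> Arr C; g \<in> Arr C; Dom C g = Cod C f; Cod C g = Dom C f;
    g \<cdot> f = Idn C (Dom C f); f \<cdot> g = Idn C (Cod C f)\<rbrakk> \<Longrightarrow> is_iso C f \<and> Inv C f = g"
  using Inv_eq[of f g] by (auto simp: inverse_arr_def Hom_iff is_iso_def)

lemma is_isoI:
  "\<lbrakk>f \<in> Arr C; g \<in> Arr C; Dom C g = Cod C f; Cod C g = Dom C f;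
    g \<cdot> f = Idn C (Dom C f); f \<cdot> g = Idn C (Cod C f)\<rbrakk> \<Longrightarrow> is_iso C f"
  using Inv_eqI[of f g] by simp

lemma Inv_typed [simp]:
  assumes "is_iso C f"
  shows "Inv C f \<in> Arr C" "Dom C (Inv C f) = Cod C f" "Cod C (Inv C f) = Dom C f"
    "Inv C f \<cdot> f = Idn C (Dom C f)" "f \<cdot> Inv C f = Idn C (Cod C f)"
proof -
  obtain g where "inverse_arr C f g" using assms by (auto simp: is_iso_def)
  then have "inverse_arr C f (Inv C f)" using Inv_eq by simp
  then show "Inv C f \<in> Arr C" "Dom C (Inv C f) = Cod C f" "Cod C (Inv C f) = Dom C f"
    "Inv C f \<cdot> f = Idn C (Dom C f)" "f \<cdot> Inv C f = Idn C (Cod C f)"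
    by (auto simp: inverse_arr_def Hom_iff)
qed

lemma is_iso_Arr: "is_iso C f \<Longrightarrow> f \<in> Arr C"
  by (auto simp: is_iso_def inverse_arr_def)

lemma Inv_tail [simp]:
  assumes "is_iso C f" "k \<in> Arr C"
  shows "Cod C k = Dom C f \<Longrightarrow> Inv C f \<cdot> (f \<cdot> k) = k"
    "Cod C k = Cod C f \<Longrightarrow> f \<cdot> (Inv C f \<cdot> k) = k"
  using assms is_iso_Arr[OF assms(1)] by (auto simp: tail)

lemma is_iso_Idn: "x \<in> Obj C \<Longrightarrow> is_iso C (Idn C x)"
  by (rule is_isoI[where g = "Idn C x"]) auto

lemma is_iso_Inv: "is_iso C f \<Longrightarrow> is_iso C (Inv C f) \<and> Inv C (Inv C f) = f"
  by (rule Inv_eqI) (auto simp: is_iso_Arr)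

lemma is_iso_comp:
  assumes "is_iso C f" "is_iso C g" "Dom C g = Cod C f"
  shows "is_iso C (g \<cdot> f)"
  by (rule is_isoI[where g = "Inv C f \<cdot> Inv C g"]) (use assms in \<open>auto simp: is_iso_Arr\<close>)

lemma iso_cancel_right:
  assumes "is_iso C p" "f \<cdot> p = g \<cdot> p" "f \<in> Arr C" "g \<in> Arr C" "Dom C f = Cod C p" "Dom C g = Cod C p"
  shows "f = g"
proof -
  have "f = (f \<cdot> p) \<cdot> Inv C p" using assms(1,3-) by (simp add: is_iso_Arr)
  also have "\<dots> = g" unfolding assms(2) using assms(1,3-) by (simp add: is_iso_Arr)
  finally show ?thesis .
qed

lemma iso_cancel_left:
  assumes "is_iso C p" "p \<cdot> f = p \<cdot> g" "f \<in> Arr C" "g \<in> Arr C" "Cod C f = Dom C p" "Cod C g = Dom C p"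
  shows "f = g"
proof -
  have "f = Inv C p \<cdot> (p \<cdot> f)" using assms(1,3-) by (simp add: is_iso_Arr)
  also have "\<dots> = g" unfolding assms(2) using assms(1,3-) by (simp add: is_iso_Arr)
  finally show ?thesis .
qed

section \<open>Split epimorphisms and factorizations through them\<close>

definition split_epi :: "'a \<Rightarrow> bool" where
  "split_epi q \<longleftrightarrow> q \<in> Arr C \<and> (\<exists>s\<in>Hom C (Cod C q) (Dom C q). q \<cdot> s = Idn C (Cod C q))"

lemma split_epiI:
  "\<lbrakk>q \<in> Arr C; s \<in> Arr C; Dom C s = Cod C q; Cod C s = Dom C q; q \<cdot> s = Idn C (Cod C q)\<rbrakk>
    \<Longrightarrow> split_epi q"
  by (auto simp: split_epi_def Hom_iff)

lemma split_epiE: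
  assumes "split_epi q"
  obtains s where "s \<in> Arr C" "Dom C s = Cod C q" "Cod C s = Dom C q" "q \<cdot> s = Idn C (Cod C q)"
  using assms by (auto simp: split_epi_def Hom_iff)

lemma split_epi_Arr: "split_epi q \<Longrightarrow> q \<in> Arr C"
  by (simp add: split_epi_def)

lemma iso_split_epi: "is_iso C f \<Longrightarrow> split_epi f"
  by (rule split_epiI[where s = "Inv C f"]) (auto simp: is_iso_Arr)

lemma split_epi_comp:
  assumes "split_epi p" "split_epi q" "Dom C q = Cod C p"
  shows "split_epi (q \<cdot> p)"
proof -
  obtain s where s: "s \<in> Arr C" "Dom C s = Cod C p" "Cod C s = Dom C p" "p \<cdot> s = Idn C (Cod C p)"
    using assms(1) by (rule split_epiE)
  obtain t where t: "t \<in> Arr C" "Dom C t = Cod C q" "Cod C t = Dom C q" "q \<cdot> t = Idn C (Cod C q)"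
    using assms(2) by (rule split_epiE)
  show ?thesis
    by (rule split_epiI[where s = "s \<cdot> t"])
      (use assms s t in \<open>auto simp: split_epi_Arr tail[OF s(4)]\<close>)
qed

lemma split_epi_cancel:
  assumes "split_epi q" "f \<cdot> q = g \<cdot> q" "f \<in> Arr C" "g \<in> Arr C" "Dom C f = Cod C q" "Dom C g = Cod C q"
  shows "f = g"
proof -
  obtain s where s: "s \<in> Arr C" "Dom C s = Cod C q" "Cod C s = Dom C q" "q \<cdot> s = Idn C (Cod C q)"
    using assms(1) by (rule split_epiE)
  have "f = (f \<cdot> q) \<cdot> s" using assms(1,3-) s by (simp add: split_epi_Arr)
  also have "\<dots> = g" unfolding assms(2) using assms(1,3-) s by (simp add: split_epi_Arr)
  finally show ?thesis .
qed

text \<open>The definite description in \<open>descend\<close> is met by any factorization, since a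
  split epimorphism is epi.\<close>

lemma descend_eq:
  assumes "split_epi q" "k \<in> Arr C" "Dom C k = Cod C q" "k \<cdot> q = t"
  shows "descend C q t = k"
  unfolding descend_def
proof (rule the_equality)
  show "k \<in> Hom C (Cod C q) (Cod C t) \<and> k \<cdot> q = t"
    using assms by (auto simp: Hom_iff split_epi_Arr)
  fix k' assume "k' \<in> Hom C (Cod C q) (Cod C t) \<and> k' \<cdot> q = t"
  then show "k' = k"
    using split_epi_cancel[OF assms(1), of k' k] assms(2-4) by (simp add: Hom_iff)
qed

end

section \<open>Calculus of the tensor product\<close>

context symmetric_monoidal_cat
begin

lemma ten_typed [simp]:
  "\<lbrakk>x \<in> Obj C; y \<in> Obj C\<rbrakk> \<Longrightarrow> x \<odot> y \<in> Obj C"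
  "\<lbrakk>f \<in> Arr C; g \<in> Arr C\<rbrakk> \<Longrightarrow> f \<otimes> g \<in> Arr C"
  "\<lbrakk>f \<in> Arr C; g \<in> Arr C\<rbrakk> \<Longrightarrow> Dom C (f \<otimes> g) = Dom C f \<odot> Dom C g"
  "\<lbrakk>f \<in> Arr C; g \<in> Arr C\<rbrakk> \<Longrightarrow> Cod C (f \<otimes> g) = Cod C f \<odot> Cod C g"
  using tensor_obj[of x y] tensor_hom[of f "Dom C f" "Cod C f" g "Dom C g" "Cod C g"]
  by (auto simp: Hom_iff)

declare one_obj [simp] tensor_id [simp]

lemma coherence_typed [simp]:
  assumes "x \<in> Obj C"
  shows "Lun C x \<in> Arr C" "Dom C (Lun C x) = One C \<odot> x" "Cod C (Lun C x) = x" "is_iso C (Lun C x)"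
    "Run C x \<in> Arr C" "Dom C (Run C x) = x \<odot> One C" "Cod C (Run C x) = x" "is_iso C (Run C x)"
    "y \<in> Obj C \<Longrightarrow> Brd C x y \<in> Arr C" "y \<in> Obj C \<Longrightarrow> Dom C (Brd C x y) = x \<odot> y"
    "y \<in> Obj C \<Longrightarrow> Cod C (Brd C x y) = y \<odot> x"
    "\<lbrakk>y \<in> Obj C; z \<in> Obj C\<rbrakk> \<Longrightarrow> Assc C x y z \<in> Arr C"
    "\<lbrakk>y \<in> Obj C; z \<in> Obj C\<rbrakk> \<Longrightarrow> Dom C (Assc C x y z) = (x \<odot> y) \<odot> z"
    "\<lbrakk>y \<in> Obj C; z \<in> Obj C\<rbrakk> \<Longrightarrow> Cod C (Assc C x y z) = x \<odot> (y \<odot> z)"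
    "\<lbrakk>y \<in> Obj C; z \<in> Obj C\<rbrakk> \<Longrightarrow> is_iso C (Assc C x y z)"
  using lun_hom[OF assms] run_hom[OF assms] brd_hom[OF assms, of y] assc_hom[OF assms, of y z]
  by (auto simp: Hom_iff)

lemma brd_brd [simp]:
  "\<lbrakk>x \<in> Obj C; y \<in> Obj C\<rbrakk> \<Longrightarrow> Brd C y x \<cdot> Brd C x y = Idn C (x \<odot> y)"
  "\<lbrakk>x \<in> Obj C; y \<in> Obj C; k \<in> Arr C; Cod C k = x \<odot> y\<rbrakk> \<Longrightarrow> Brd C y x \<cdot> (Brd C x y \<cdot> k) = k"
  by (simp_all add: brd_symmetric tail[OF brd_symmetric])

lemma is_iso_Brd [simp]: "\<lbrakk>x \<in> Obj C; y \<in> Obj C\<rbrakk> \<Longrightarrow> is_iso C (Brd C x y)"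
  by (rule is_isoI[where g = "Brd C y x"]) auto

text \<open>Functoriality of the tensor product, oriented so that consecutive tensors fuse into one.
  The naturality laws below act on unfused tensors, so calculations that use both often apply them
  one after the other.\<close>

lemma merge:
  assumes "f \<in> Arr C" "f' \<in> Arr C" "g \<in> Arr C" "g' \<in> Arr C" "Dom C f' = Cod C f" "Dom C g' = Cod C g"
  shows "(f' \<otimes> g') \<cdot> (f \<otimes> g) = (f' \<cdot> f) \<otimes> (g' \<cdot> g)"
    "\<lbrakk>k \<in> Arr C; Cod C k = Dom C f \<odot> Dom C g\<rbrakk>
      \<Longrightarrow> (f' \<otimes> g') \<cdot> ((f \<otimes> g) \<cdot> k) = ((f' \<cdot> f) \<otimes> (g' \<cdot> g)) \<cdot> k"
proof -
  show "(f' \<otimes> g') \<cdot> (f \<otimes> g) = (f' \<cdot> f) \<otimes> (g' \<cdot> g)"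
    using tensor_comp[of f "Dom C f" "Cod C f" f' "Cod C f'" g "Dom C g" "Cod C g" g' "Cod C g'"] assms
    by (auto simp: Hom_iff)
  then show "\<lbrakk>k \<in> Arr C; Cod C k = Dom C f \<odot> Dom C g\<rbrakk>
      \<Longrightarrow> (f' \<otimes> g') \<cdot> ((f \<otimes> g) \<cdot> k) = ((f' \<cdot> f) \<otimes> (g' \<cdot> g)) \<cdot> k"
    using assms by (subst tail) auto
qed

lemma is_iso_ten [simp]:
  assumes "is_iso C f" "is_iso C g"
  shows "is_iso C (f \<otimes> g)" "Inv C (f \<otimes> g) = Inv C f \<otimes> Inv C g"
proof -
  have "is_iso C (f \<otimes> g) \<and> Inv C (f \<otimes> g) = Inv C f \<otimes> Inv C g"
    by (rule Inv_eqI) (use assms in \<open>simp_all add: is_iso_Arr merge\<close>)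
  then show "is_iso C (f \<otimes> g)" "Inv C (f \<otimes> g) = Inv C f \<otimes> Inv C g" by auto
qed

declare is_iso_Idn [simp]

text \<open>Tensoring can destroy epimorphisms in general, but a section is preserved by every
  functor. This is what allows identities out of iterated tensor products over \<open>A\<close> to
  be checked on tensor products in \<open>C\<close>.\<close>

lemma split_epi_ten:
  assumes "split_epi p" "split_epi q"
  shows "split_epi (p \<otimes> q)"
proof -
  obtain s where s: "s \<in> Arr C" "Dom C s = Cod C p" "Cod C s = Dom C p" "p \<cdot> s = Idn C (Cod C p)"
    using assms(1) by (rule split_epiE)
  obtain t where t: "t \<in> Arr C" "Dom C t = Cod C q" "Cod C t = Dom C q" "q \<cdot> t = Idn C (Cod C q)"
    using assms(2) by (rule split_epiE)
  show ?thesis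
    by (rule split_epiI[where s = "s \<otimes> t"])
      (use assms s t in \<open>simp_all add: split_epi_Arr merge\<close>)
qed

lemma split_epi_Idn [simp]: "x \<in> Obj C \<Longrightarrow> split_epi (Idn C x)"
  by (rule iso_split_epi) simp

lemma assc_nat:
  assumes "f \<in> Arr C" "g \<in> Arr C" "h \<in> Arr C" "Cod C f = x'" "Cod C g = y'" "Cod C h = z'"
  shows "Assc C x' y' z' \<cdot> ((f \<otimes> g) \<otimes> h) = (f \<otimes> (g \<otimes> h)) \<cdot> Assc C (Dom C f) (Dom C g) (Dom C h)"
    "\<lbrakk>k \<in> Arr C; Cod C k = (Dom C f \<odot> Dom C g) \<odot> Dom C h\<rbrakk> \<Longrightarrow>
      Assc C x' y' z' \<cdot> (((f \<otimes> g) \<otimes> h) \<cdot> k) = (f \<otimes> (g \<otimes> h)) \<cdot> (Assc C (Dom C f) (Dom C g) (Dom C h) \<cdot> k)"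
proof -
  show *: "Assc C x' y' z' \<cdot> ((f \<otimes> g) \<otimes> h) = (f \<otimes> (g \<otimes> h)) \<cdot> Assc C (Dom C f) (Dom C g) (Dom C h)"
    by (rule assc_natural[symmetric]) (use assms in \<open>auto simp: Hom_iff\<close>)
  show "\<lbrakk>k \<in> Arr C; Cod C k = (Dom C f \<odot> Dom C g) \<odot> Dom C h\<rbrakk> \<Longrightarrow>
      Assc C x' y' z' \<cdot> (((f \<otimes> g) \<otimes> h) \<cdot> k) = (f \<otimes> (g \<otimes> h)) \<cdot> (Assc C (Dom C f) (Dom C g) (Dom C h) \<cdot> k)"
    using assms dom_obj cod_obj by (subst tail[OF *]) auto
qed

text \<open>A naturality square read against its invertible sides; the source of the naturality laws
  for inverted structure maps.\<close>

lemma Inv_nat: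
  assumes "is_iso C p" "is_iso C p'" "f \<in> Arr C" "f' \<in> Arr C" "p' \<cdot> f = f' \<cdot> p"
    "Dom C p' = Cod C f" "Dom C f = Dom C p" "Dom C f' = Cod C p" "Cod C f' = Cod C p'"
  shows "Inv C p' \<cdot> f' = f \<cdot> Inv C p"
proof -
  have "Inv C p' \<cdot> f' = Inv C p' \<cdot> (f' \<cdot> p) \<cdot> Inv C p" using assms(1-4,6-) by (simp add: is_iso_Arr)
  also have "\<dots> = f \<cdot> Inv C p" unfolding assms(5)[symmetric]
    using assms(1-4,6-) by (simp add: is_iso_Arr)
  finally show ?thesis .
qed

lemma assc_inv_nat:
  assumes "f \<in> Arr C" "g \<in> Arr C" "h \<in> Arr C" "Cod C f = x'" "Cod C g = y'" "Cod C h = z'"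
  shows "Inv C (Assc C x' y' z') \<cdot> (f \<otimes> (g \<otimes> h))
      = ((f \<otimes> g) \<otimes> h) \<cdot> Inv C (Assc C (Dom C f) (Dom C g) (Dom C h))"
    "\<lbrakk>k \<in> Arr C; Cod C k = Dom C f \<odot> (Dom C g \<odot> Dom C h)\<rbrakk> \<Longrightarrow>
      Inv C (Assc C x' y' z') \<cdot> ((f \<otimes> (g \<otimes> h)) \<cdot> k)
      = ((f \<otimes> g) \<otimes> h) \<cdot> (Inv C (Assc C (Dom C f) (Dom C g) (Dom C h)) \<cdot> k)"
proof -
  have o: "x' \<in> Obj C" "y' \<in> Obj C" "z' \<in> Obj C" using assms by auto
  show *: "Inv C (Assc C x' y' z') \<cdot> (f \<otimes> (g \<otimes> h))
      = ((f \<otimes> g) \<otimes> h) \<cdot> Inv C (Assc C (Dom C f) (Dom C g) (Dom C h))"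
    by (rule Inv_nat) (use assms o in \<open>simp_all add: assc_nat\<close>)
  show "\<lbrakk>k \<in> Arr C; Cod C k = Dom C f \<odot> (Dom C g \<odot> Dom C h)\<rbrakk> \<Longrightarrow>
      Inv C (Assc C x' y' z') \<cdot> ((f \<otimes> (g \<otimes> h)) \<cdot> k)
      = ((f \<otimes> g) \<otimes> h) \<cdot> (Inv C (Assc C (Dom C f) (Dom C g) (Dom C h)) \<cdot> k)"
    using assms o by (subst tail[OF *]) auto
qed

text \<open>The simplifier collapses \<open>Idn x \<otimes> Idn y\<close>, which the general naturality rules then fail to match.\<close>

lemma assc_nat_Idn:
  assumes "x \<in> Obj C" "y \<in> Obj C" "h \<in> Arr C" "Cod C h = z'"
  shows "Assc C x y z' \<cdot> (Idn C (x \<odot> y) \<otimes> h) = (Idn C x \<otimes> (Idn C y \<otimes> h)) \<cdot> Assc C x y (Dom C h)"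
    "\<lbrakk>k \<in> Arr C; Cod C k = (x \<odot> y) \<odot> Dom C h\<rbrakk> \<Longrightarrow> Assc C x y z' \<cdot> ((Idn C (x \<odot> y) \<otimes> h) \<cdot> k)
      = (Idn C x \<otimes> (Idn C y \<otimes> h)) \<cdot> (Assc C x y (Dom C h) \<cdot> k)"
  using assc_nat[of "Idn C x" "Idn C y" h x y z'] assc_nat(2)[of "Idn C x" "Idn C y" h x y z' k] assms by auto

lemma assc_inv_nat_Idn:
  assumes "y \<in> Obj C" "z \<in> Obj C" "f \<in> Arr C" "Cod C f = x'"
  shows "Inv C (Assc C x' y z) \<cdot> (f \<otimes> Idn C (y \<odot> z))
      = ((f \<otimes> Idn C y) \<otimes> Idn C z) \<cdot> Inv C (Assc C (Dom C f) y z)"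
    "\<lbrakk>k \<in> Arr C; Cod C k = Dom C f \<odot> (y \<odot> z)\<rbrakk> \<Longrightarrow> Inv C (Assc C x' y z) \<cdot> ((f \<otimes> Idn C (y \<odot> z)) \<cdot> k)
      = ((f \<otimes> Idn C y) \<otimes> Idn C z) \<cdot> (Inv C (Assc C (Dom C f) y z) \<cdot> k)"
  using assc_inv_nat[of f "Idn C y" "Idn C z" x' y z] assc_inv_nat(2)[of f "Idn C y" "Idn C z" x' y z k] assms by auto

lemma brd_nat:
  assumes "f \<in> Arr C" "g \<in> Arr C" "Cod C f = x'" "Cod C g = y'"
  shows "Brd C x' y' \<cdot> (f \<otimes> g) = (g \<otimes> f) \<cdot> Brd C (Dom C f) (Dom C g)"
    "\<lbrakk>k \<in> Arr C; Cod C k = Dom C f \<odot> Dom C g\<rbrakk> \<Longrightarrow>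
      Brd C x' y' \<cdot> ((f \<otimes> g) \<cdot> k) = (g \<otimes> f) \<cdot> (Brd C (Dom C f) (Dom C g) \<cdot> k)"
proof -
  show *: "Brd C x' y' \<cdot> (f \<otimes> g) = (g \<otimes> f) \<cdot> Brd C (Dom C f) (Dom C g)"
    by (rule brd_natural[symmetric]) (use assms in \<open>auto simp: Hom_iff\<close>)
  show "\<lbrakk>k \<in> Arr C; Cod C k = Dom C f \<odot> Dom C g\<rbrakk> \<Longrightarrow>
      Brd C x' y' \<cdot> ((f \<otimes> g) \<cdot> k) = (g \<otimes> f) \<cdot> (Brd C (Dom C f) (Dom C g) \<cdot> k)"
    using assms dom_obj cod_obj by (subst tail[OF *]) auto
qed

lemma lun_nat:
  assumes "f \<in> Arr C" "Cod C f = y"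
  shows "Lun C y \<cdot> (Idn C (One C) \<otimes> f) = f \<cdot> Lun C (Dom C f)"
    "\<lbrakk>k \<in> Arr C; Cod C k = One C \<odot> Dom C f\<rbrakk>
      \<Longrightarrow> Lun C y \<cdot> ((Idn C (One C) \<otimes> f) \<cdot> k) = f \<cdot> (Lun C (Dom C f) \<cdot> k)"
proof -
  show *: "Lun C y \<cdot> (Idn C (One C) \<otimes> f) = f \<cdot> Lun C (Dom C f)"
    by (rule lun_natural[symmetric]) (use assms in \<open>auto simp: Hom_iff\<close>)
  show "\<lbrakk>k \<in> Arr C; Cod C k = One C \<odot> Dom C f\<rbrakk>
      \<Longrightarrow> Lun C y \<cdot> ((Idn C (One C) \<otimes> f) \<cdot> k) = f \<cdot> (Lun C (Dom C f) \<cdot> k)"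
    using assms dom_obj cod_obj by (subst tail[OF *]) auto
qed

lemma run_nat:
  assumes "f \<in> Arr C" "Cod C f = y"
  shows "Run C y \<cdot> (f \<otimes> Idn C (One C)) = f \<cdot> Run C (Dom C f)"
    "\<lbrakk>k \<in> Arr C; Cod C k = Dom C f \<odot> One C\<rbrakk>
      \<Longrightarrow> Run C y \<cdot> ((f \<otimes> Idn C (One C)) \<cdot> k) = f \<cdot> (Run C (Dom C f) \<cdot> k)"
proof -
  show *: "Run C y \<cdot> (f \<otimes> Idn C (One C)) = f \<cdot> Run C (Dom C f)"
    by (rule run_natural[symmetric]) (use assms in \<open>auto simp: Hom_iff\<close>)
  show "\<lbrakk>k \<in> Arr C; Cod C k = Dom C f \<odot> One C\<rbrakk>
      \<Longrightarrow> Run C y \<cdot> ((f \<otimes> Idn C (One C)) \<cdot> k) = f \<cdot> (Run C (Dom C f) \<cdot> k)"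
    using assms dom_obj cod_obj by (subst tail[OF *]) auto
qed

lemma lun_inv_nat:
  assumes "f \<in> Arr C" "Cod C f = y"
  shows "Inv C (Lun C y) \<cdot> f = (Idn C (One C) \<otimes> f) \<cdot> Inv C (Lun C (Dom C f))"
proof -
  have "y \<in> Obj C" using assms by auto
  then show ?thesis
    by (intro Inv_nat) (use assms in \<open>simp_all add: lun_nat\<close>)
qed

lemma run_inv_nat:
  assumes "f \<in> Arr C" "Cod C f = y"
  shows "Inv C (Run C y) \<cdot> f = (f \<otimes> Idn C (One C)) \<cdot> Inv C (Run C (Dom C f))"
proof -
  have "y \<in> Obj C" using assms by auto
  then show ?thesis
    by (intro Inv_nat) (use assms in \<open>simp_all add: run_nat\<close>)
qed

end

section \<open>Coherence in symmetric monoidal categories\<close>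

context symmetric_monoidal_cat
begin

text \<open>\<open>Lun\<close> is a natural isomorphism, so tensoring with \<open>One\<close> is
  conjugate to the identity. The derived unit laws below become visible only after tensoring with
  \<open>One\<close>; this removes the extra factor.\<close>

lemma One_ten_cancel:
  assumes "Idn C (One C) \<otimes> f = Idn C (One C) \<otimes> g" "f \<in> Arr C" "g \<in> Arr C"
    "Dom C f = Dom C g" "Cod C f = Cod C g"
  shows "f = g"
proof (rule iso_cancel_right[of "Lun C (Dom C g)"])
  have o: "Dom C g \<in> Obj C" "Cod C g \<in> Obj C" using assms by auto
  show "f \<cdot> Lun C (Dom C g) = g \<cdot> Lun C (Dom C g)"
    using assms(1) lun_nat(1)[of f] lun_nat(1)[of g] assms(2-) by simp
qed (use assms in auto)

lemma ten_One_cancel: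
  assumes "f \<otimes> Idn C (One C) = g \<otimes> Idn C (One C)" "f \<in> Arr C" "g \<in> Arr C"
    "Dom C f = Dom C g" "Cod C f = Cod C g"
  shows "f = g"
proof (rule iso_cancel_right[of "Run C (Dom C g)"])
  have o: "Dom C g \<in> Obj C" "Cod C g \<in> Obj C" using assms by auto
  show "f \<cdot> Run C (Dom C g) = g \<cdot> Run C (Dom C g)"
    using assms(1) run_nat(1)[of f] run_nat(1)[of g] assms(2-) by simp
qed (use assms in auto)

text \<open>The axioms contain the triangle with the unit in the middle; the one with the unit on
  the left is a consequence, due to Kelly. After tensoring with \<open>One\<close> on the left it is
  read off from the pentagon for \<open>One\<close>, \<open>One\<close>, \<open>x\<close>,
  \<open>y\<close>, two of whose edges are resolved by the middle triangle.\<close>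

lemma lun_ten:
  assumes o: "x \<in> Obj C" "y \<in> Obj C"
  shows "Lun C (x \<odot> y) \<cdot> Assc C (One C) x y = Lun C x \<otimes> Idn C y"
proof -
  let ?e = "One C"
  let ?i = "Idn C ?e"
  let ?p = "Assc C ?e (?e \<odot> x) y \<cdot> (Assc C ?e ?e x \<otimes> Idn C y)"
  have "(?i \<otimes> (Lun C (x \<odot> y) \<cdot> Assc C ?e x y)) \<cdot> ?p
      = (?i \<otimes> Lun C (x \<odot> y)) \<cdot> ((?i \<otimes> Assc C ?e x y) \<cdot> ?p)"
    using o by (simp add: merge)
  also have "\<dots> = (?i \<otimes> Lun C (x \<odot> y)) \<cdot> Assc C ?e ?e (x \<odot> y) \<cdot> Assc C (?e \<odot> ?e) x y"
    using o by (simp add: pentagon)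
  also have "\<dots> = (Run C ?e \<otimes> Idn C (x \<odot> y)) \<cdot> Assc C (?e \<odot> ?e) x y"
    using o by (simp add: tail[OF triangle_axiom])
  also have "\<dots> = Assc C ?e x y \<cdot> ((Run C ?e \<otimes> Idn C x) \<otimes> Idn C y)"
    using o by (simp add: assc_nat)
  also have "\<dots> = Assc C ?e x y \<cdot> (((?i \<otimes> Lun C x) \<cdot> Assc C ?e ?e x) \<otimes> Idn C y)"
    using o by (simp add: triangle_axiom)
  also have "\<dots> = Assc C ?e x y \<cdot> ((?i \<otimes> Lun C x) \<otimes> Idn C y) \<cdot> (Assc C ?e ?e x \<otimes> Idn C y)"
    using o by (simp add: merge)
  also have "\<dots> = (?i \<otimes> (Lun C x \<otimes> Idn C y)) \<cdot> ?p"
    using o by (simp add: assc_nat)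
  finally have *: "(?i \<otimes> (Lun C (x \<odot> y) \<cdot> Assc C ?e x y)) \<cdot> ?p = (?i \<otimes> (Lun C x \<otimes> Idn C y)) \<cdot> ?p" .
  have "?i \<otimes> (Lun C (x \<odot> y) \<cdot> Assc C ?e x y) = ?i \<otimes> (Lun C x \<otimes> Idn C y)"
    by (rule iso_cancel_right[OF _ *]) (use o in \<open>auto intro!: is_iso_comp\<close>)
  then show ?thesis by (rule One_ten_cancel) (use o in auto)
qed

text \<open>Naturality of \<open>Lun\<close> at \<open>Lun C (One C)\<close> identifies
  \<open>Idn \<otimes> Lun\<close> with \<open>Lun\<close> at \<open>One \<odot> One\<close>; then
  \<open>lun_ten\<close> and the triangle axiom have the same left-hand side.\<close>

lemma lun_One_eq_run_One: "Lun C (One C) = Run C (One C)"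
proof -
  let ?e = "One C"
  have "Lun C ?e \<cdot> (Idn C ?e \<otimes> Lun C ?e) = Lun C ?e \<cdot> Lun C (?e \<odot> ?e)"
    by (simp add: lun_nat)
  then have 1: "Idn C ?e \<otimes> Lun C ?e = Lun C (?e \<odot> ?e)"
    by (rule iso_cancel_left[rotated]) auto
  have "Lun C ?e \<otimes> Idn C ?e = Run C ?e \<otimes> Idn C ?e"
    using lun_ten[of ?e ?e] triangle_axiom[of ?e ?e] 1 by simp
  then show ?thesis by (rule ten_One_cancel) auto
qed

text \<open>Compatibility of the symmetry with the unitors follows from the hexagon with two unit
  arguments: after tensoring with \<open>One\<close> on the right, both sides are carried around it
  to the same composite.\<close>

lemma lun_brd:
  assumes x: "x \<in> Obj C"
  shows "Lun C x \<cdot> Brd C x (One C) = Run C x"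
proof -
  let ?e = "One C"
  let ?l = "Lun C (?e \<odot> x)"
  have "Brd C x ?e \<cdot> ((Lun C x \<cdot> Brd C x ?e) \<otimes> Idn C ?e)
      = Brd C x ?e \<cdot> (Lun C x \<otimes> Idn C ?e) \<cdot> (Brd C x ?e \<otimes> Idn C ?e)"
    using x by (simp add: merge)
  also have "\<dots> = Brd C x ?e \<cdot> Lun C (x \<odot> ?e) \<cdot> Assc C ?e x ?e \<cdot> (Brd C x ?e \<otimes> Idn C ?e)"
    using x by (simp add: lun_ten[symmetric])
  also have "\<dots> = ?l \<cdot> (Idn C ?e \<otimes> Brd C x ?e) \<cdot> Assc C ?e x ?e \<cdot> (Brd C x ?e \<otimes> Idn C ?e)"
    using x by (simp add: lun_nat)
  also have "\<dots> = ?l \<cdot> Assc C ?e ?e x \<cdot> Brd C x (?e \<odot> ?e) \<cdot> Assc C x ?e ?e"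
    using x by (simp add: hexagon)
  also have "\<dots> = (Lun C ?e \<otimes> Idn C x) \<cdot> Brd C x (?e \<odot> ?e) \<cdot> Assc C x ?e ?e"
    using x by (simp add: tail[OF lun_ten])
  also have "\<dots> = Brd C x ?e \<cdot> (Idn C x \<otimes> Lun C ?e) \<cdot> Assc C x ?e ?e"
    using x by (simp add: brd_nat)
  also have "\<dots> = Brd C x ?e \<cdot> (Run C x \<otimes> Idn C ?e)"
    using x by (simp add: triangle_axiom)
  finally have *: "Brd C x ?e \<cdot> ((Lun C x \<cdot> Brd C x ?e) \<otimes> Idn C ?e)
      = Brd C x ?e \<cdot> (Run C x \<otimes> Idn C ?e)" .
  have "(Lun C x \<cdot> Brd C x ?e) \<otimes> Idn C ?e = Run C x \<otimes> Idn C ?e"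
    by (rule iso_cancel_left[OF _ *]) (use x in auto)
  then show ?thesis by (rule ten_One_cancel) (use x in auto)
qed

text \<open>The second hexagon. In a symmetric category \<open>Brd C (x \<odot> y) z\<close> is
  inverse to \<open>Brd C z (x \<odot> y)\<close>, which the hexagon axiom expands.\<close>

lemma brd_ten_left:
  assumes o: "x \<in> Obj C" "y \<in> Obj C" "z \<in> Obj C"
  shows "Brd C (x \<odot> y) z = Assc C z x y \<cdot> (Brd C x z \<otimes> Idn C y) \<cdot> Inv C (Assc C x z y)
    \<cdot> (Idn C x \<otimes> Brd C y z) \<cdot> Assc C x y z" (is "_ = ?r")
proof (rule iso_cancel_left[of "Inv C (Assc C z x y)"])
  let ?p = "Inv C (Assc C x y z) \<cdot> (Idn C x \<otimes> Brd C z y) \<cdot> Assc C x z y \<cdot> (Brd C z x \<otimes> Idn C y)"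
  have h: "?p = Brd C z (x \<odot> y) \<cdot> Assc C z x y"
    using o by (simp add: hexagon[symmetric])
  have p: "?p \<cdot> (Inv C (Assc C z x y) \<cdot> ?r) = Idn C ((x \<odot> y) \<odot> z)"
    using o by (simp add: merge)
  have "Inv C (Assc C z x y) \<cdot> Brd C (x \<odot> y) z
    = Inv C (Assc C z x y) \<cdot> Brd C (x \<odot> y) z \<cdot> (?p \<cdot> (Inv C (Assc C z x y) \<cdot> ?r))"
    unfolding p using o by simp
  also have "\<dots> = Inv C (Assc C z x y) \<cdot> ?r"
    unfolding h using o by simp
  finally show "Inv C (Assc C z x y) \<cdot> Brd C (x \<odot> y) z = Inv C (Assc C z x y) \<cdot> ?r" .
qed (use o in \<open>auto simp: is_iso_Inv\<close>)

lemma pentagon_inv: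
  assumes o: "w \<in> Obj C" "x \<in> Obj C" "y \<in> Obj C" "z \<in> Obj C"
  shows "Inv C (Assc C w x (y \<odot> z)) \<cdot> (Idn C w \<otimes> Assc C x y z)
    = Assc C (w \<odot> x) y z \<cdot> (Inv C (Assc C w x y) \<otimes> Idn C z) \<cdot> Inv C (Assc C w (x \<odot> y) z)"
proof (rule iso_cancel_right)
  let ?p = "Assc C w (x \<odot> y) z \<cdot> (Assc C w x y \<otimes> Idn C z)"
  show "is_iso C ?p" using o by (auto intro!: is_iso_comp)
  have "(Inv C (Assc C w x (y \<odot> z)) \<cdot> (Idn C w \<otimes> Assc C x y z)) \<cdot> ?p
    = Inv C (Assc C w x (y \<odot> z)) \<cdot> (Assc C w x (y \<odot> z) \<cdot> Assc C (w \<odot> x) y z)"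
    using o by (subst pentagon) auto
  also have "\<dots> = (Assc C (w \<odot> x) y z \<cdot> (Inv C (Assc C w x y) \<otimes> Idn C z) \<cdot> Inv C (Assc C w (x \<odot> y) z)) \<cdot> ?p"
    using o by (simp add: merge)
  finally show "(Inv C (Assc C w x (y \<odot> z)) \<cdot> (Idn C w \<otimes> Assc C x y z)) \<cdot> ?p
    = (Assc C (w \<odot> x) y z \<cdot> (Inv C (Assc C w x y) \<otimes> Idn C z) \<cdot> Inv C (Assc C w (x \<odot> y) z)) \<cdot> ?p" .
qed (use o in auto)

text \<open>Elementwise \<open>(c \<otimes> x) \<otimes> y \<mapsto> x \<otimes> (c \<otimes>
  y)\<close>. Modules carry left actions only, so a scalar that moves from the first tensor factor
  to the second has to cross \<open>x\<close>. The crossing is treated as one map with its own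
  coherence laws, which hide the pentagon and the hexagon.\<close>

definition past :: "'a \<Rightarrow> 'a \<Rightarrow> 'a \<Rightarrow> 'b" where
  "past a x y = Assc C x a y \<cdot> (Brd C a x \<otimes> Idn C y)"

lemma past_typed [simp]:
  assumes "a \<in> Obj C" "x \<in> Obj C" "y \<in> Obj C"
  shows "past a x y \<in> Arr C" "Dom C (past a x y) = (a \<odot> x) \<odot> y"
    "Cod C (past a x y) = x \<odot> (a \<odot> y)" "is_iso C (past a x y)"
  unfolding past_def using assms by (auto intro!: is_iso_comp)

lemma past_nat:
  assumes "f \<in> Arr C" "g \<in> Arr C" "h \<in> Arr C" "Cod C f = a'" "Cod C g = x'" "Cod C h = y'"
  shows "past a' x' y' \<cdot> ((f \<otimes> g) \<otimes> h) = (g \<otimes> (f \<otimes> h)) \<cdot> past (Dom C f) (Dom C g) (Dom C h)"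
    "\<lbrakk>k \<in> Arr C; Cod C k = (Dom C f \<odot> Dom C g) \<odot> Dom C h\<rbrakk> \<Longrightarrow>
      past a' x' y' \<cdot> (((f \<otimes> g) \<otimes> h) \<cdot> k) = (g \<otimes> (f \<otimes> h)) \<cdot> (past (Dom C f) (Dom C g) (Dom C h) \<cdot> k)"
proof -
  have o: "a' \<in> Obj C" "x' \<in> Obj C" "y' \<in> Obj C" using assms by auto
  have "past a' x' y' \<cdot> ((f \<otimes> g) \<otimes> h) = Assc C x' a' y' \<cdot> ((Brd C a' x' \<cdot> (f \<otimes> g)) \<otimes> h)"
    unfolding past_def using assms o by (simp add: merge)
  also have "\<dots> = Assc C x' a' y' \<cdot> (((g \<otimes> f) \<otimes> h) \<cdot> (Brd C (Dom C f) (Dom C g) \<otimes> Idn C (Dom C h)))"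
    using assms o by (simp add: merge brd_nat)
  also have "\<dots> = (g \<otimes> (f \<otimes> h)) \<cdot> past (Dom C f) (Dom C g) (Dom C h)"
    unfolding past_def using assms o by (simp add: assc_nat)
  finally show *: "past a' x' y' \<cdot> ((f \<otimes> g) \<otimes> h) = (g \<otimes> (f \<otimes> h)) \<cdot> past (Dom C f) (Dom C g) (Dom C h)" .
  show "\<lbrakk>k \<in> Arr C; Cod C k = (Dom C f \<odot> Dom C g) \<odot> Dom C h\<rbrakk> \<Longrightarrow>
      past a' x' y' \<cdot> (((f \<otimes> g) \<otimes> h) \<cdot> k) = (g \<otimes> (f \<otimes> h)) \<cdot> (past (Dom C f) (Dom C g) (Dom C h) \<cdot> k)"
    using assms o by (subst tail[OF *]) auto
qed

lemma past_nat_Idn: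
  assumes "a \<in> Obj C" "x \<in> Obj C" "h \<in> Arr C" "Cod C h = y'"
  shows "past a x y' \<cdot> (Idn C (a \<odot> x) \<otimes> h) = (Idn C x \<otimes> (Idn C a \<otimes> h)) \<cdot> past a x (Dom C h)"
    "\<lbrakk>k \<in> Arr C; Cod C k = (a \<odot> x) \<odot> Dom C h\<rbrakk> \<Longrightarrow> past a x y' \<cdot> ((Idn C (a \<odot> x) \<otimes> h) \<cdot> k)
      = (Idn C x \<otimes> (Idn C a \<otimes> h)) \<cdot> (past a x (Dom C h) \<cdot> k)"
  using past_nat[of "Idn C a" "Idn C x" h a x y'] past_nat(2)[of "Idn C a" "Idn C x" h a x y' k] assms
  by auto

text \<open>The factors to the right of the scalar keep their order, so besides naturality only the
  pentagon enters.\<close>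

lemma past_assc:
  assumes o: "a \<in> Obj C" "x \<in> Obj C" "y \<in> Obj C" "z \<in> Obj C"
  shows "(Idn C x \<otimes> Assc C a y z) \<cdot> Assc C x (a \<odot> y) z \<cdot> (past a x y \<otimes> Idn C z)
    = past a x (y \<odot> z) \<cdot> Assc C (a \<odot> x) y z"
proof -
  have "(Idn C x \<otimes> Assc C a y z) \<cdot> Assc C x (a \<odot> y) z \<cdot> (past a x y \<otimes> Idn C z)
    = ((Idn C x \<otimes> Assc C a y z) \<cdot> Assc C x (a \<odot> y) z \<cdot> (Assc C x a y \<otimes> Idn C z))
      \<cdot> ((Brd C a x \<otimes> Idn C y) \<otimes> Idn C z)"
    unfolding past_def using o by (simp add: merge)
  also have "\<dots> = Assc C x a (y \<odot> z) \<cdot> (Assc C (x \<odot> a) y z \<cdot> ((Brd C a x \<otimes> Idn C y) \<otimes> Idn C z))"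
    using o by (simp add: pentagon[symmetric])
  also have "\<dots> = past a x (y \<odot> z) \<cdot> Assc C (a \<odot> x) y z"
    unfolding past_def using o by (simp add: assc_nat)
  finally show ?thesis .
qed

text \<open>Crossing \<open>x \<odot> y\<close> at once is crossing \<open>x\<close> and then
  \<open>y\<close>; this is the hexagon with a further factor \<open>z\<close> on the right.\<close>

lemma past_ten:
  assumes o: "a \<in> Obj C" "x \<in> Obj C" "y \<in> Obj C" "z \<in> Obj C"
  shows "(Idn C x \<otimes> past a y z) \<cdot> Assc C x (a \<odot> y) z \<cdot> (past a x y \<otimes> Idn C z)
    = Assc C x y (a \<odot> z) \<cdot> past a (x \<odot> y) z \<cdot> (Assc C a x y \<otimes> Idn C z)"
proof -
  have "Assc C x y (a \<odot> z) \<cdot> past a (x \<odot> y) z \<cdot> (Assc C a x y \<otimes> Idn C z)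
    = (Assc C x y (a \<odot> z) \<cdot> Assc C (x \<odot> y) a z) \<cdot> ((Brd C a (x \<odot> y) \<cdot> Assc C a x y) \<otimes> Idn C z)"
    unfolding past_def using o by (simp add: merge)
  also have "\<dots> = (Idn C x \<otimes> Assc C y a z) \<cdot> Assc C x (y \<odot> a) z
      \<cdot> ((Assc C x y a \<cdot> Brd C a (x \<odot> y) \<cdot> Assc C a x y) \<otimes> Idn C z)"
    using o by (subst pentagon) (simp_all add: merge)
  also have "\<dots> = (Idn C x \<otimes> Assc C y a z) \<cdot> Assc C x (y \<odot> a) z
      \<cdot> (((Idn C x \<otimes> Brd C a y) \<cdot> past a x y) \<otimes> Idn C z)"
    unfolding past_def using o by (simp add: hexagon)
  also have "\<dots> = (Idn C x \<otimes> Assc C y a z) \<cdot> (Assc C x (y \<odot> a) z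
      \<cdot> ((Idn C x \<otimes> Brd C a y) \<otimes> Idn C z)) \<cdot> (past a x y \<otimes> Idn C z)"
    using o by (simp add: merge)
  also have "\<dots> = (Idn C x \<otimes> past a y z) \<cdot> Assc C x (a \<odot> y) z \<cdot> (past a x y \<otimes> Idn C z)"
    using o by (simp add: assc_nat merge past_def)
  finally show ?thesis by simp
qed

text \<open>Two scalars that cross \<open>x\<close> one after the other arrive in reversed order,
  which \<open>Brd C a b\<close> repairs. For a commutative ring the braiding is absorbed by the
  multiplication, so two successive crossings amount to a crossing by the product.\<close>

lemma past_past:
  assumes o: "a \<in> Obj C" "b \<in> Obj C" "x \<in> Obj C" "y \<in> Obj C"
  shows "(Idn C x \<otimes> ((Brd C a b \<otimes> Idn C y) \<cdot> Inv C (Assc C a b y))) \<cdot> past a x (b \<odot> y) \<cdot> past b (a \<odot> x) y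
    = past (b \<odot> a) x y \<cdot> (Inv C (Assc C b a x) \<otimes> Idn C y)"
proof -
  have hx: "(Idn C x \<otimes> Brd C a b) \<cdot> Assc C x a b \<cdot> Brd C b (x \<odot> a)
      = Assc C x b a \<cdot> (Brd C b x \<otimes> Idn C a) \<cdot> Inv C (Assc C b x a)"
  proof (rule iso_cancel_right[of "Assc C b x a"])
    show "((Idn C x \<otimes> Brd C a b) \<cdot> Assc C x a b \<cdot> Brd C b (x \<odot> a)) \<cdot> Assc C b x a
      = (Assc C x b a \<cdot> (Brd C b x \<otimes> Idn C a) \<cdot> Inv C (Assc C b x a)) \<cdot> Assc C b x a"
      using o by (simp add: hexagon merge)
  qed (use o in auto)
  have bx: "(Idn C x \<otimes> Brd C a b) \<cdot> past a x b \<cdot> Brd C b (a \<odot> x) = Brd C (b \<odot> a) x \<cdot> Inv C (Assc C b a x)"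
  proof -
    have "(Idn C x \<otimes> Brd C a b) \<cdot> past a x b \<cdot> Brd C b (a \<odot> x)
      = ((Idn C x \<otimes> Brd C a b) \<cdot> Assc C x a b \<cdot> Brd C b (x \<odot> a)) \<cdot> (Idn C b \<otimes> Brd C a x)"
      unfolding past_def using o by (simp add: brd_nat)
    also have "\<dots> = Brd C (b \<odot> a) x \<cdot> Inv C (Assc C b a x)"
      unfolding hx using o by (simp add: brd_ten_left)
    finally show ?thesis .
  qed
  have p: "past a x (b \<odot> y) \<cdot> Assc C (a \<odot> x) b y
    = (Idn C x \<otimes> Assc C a b y) \<cdot> Assc C x (a \<odot> b) y \<cdot> (past a x b \<otimes> Idn C y)"
    using o by (simp add: past_assc)
  have "(Idn C x \<otimes> ((Brd C a b \<otimes> Idn C y) \<cdot> Inv C (Assc C a b y))) \<cdot> past a x (b \<odot> y) \<cdot> past b (a \<odot> x) y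
    = (Idn C x \<otimes> ((Brd C a b \<otimes> Idn C y) \<cdot> Inv C (Assc C a b y)))
      \<cdot> (past a x (b \<odot> y) \<cdot> Assc C (a \<odot> x) b y) \<cdot> (Brd C b (a \<odot> x) \<otimes> Idn C y)"
    using o by (simp add: past_def[of b])
  also have "\<dots> = (Idn C x \<otimes> (Brd C a b \<otimes> Idn C y)) \<cdot> Assc C x (a \<odot> b) y
      \<cdot> ((past a x b \<cdot> Brd C b (a \<odot> x)) \<otimes> Idn C y)"
    unfolding p using o by (simp add: merge)
  also have "\<dots> = (Assc C x (b \<odot> a) y \<cdot> ((Idn C x \<otimes> Brd C a b) \<otimes> Idn C y))
      \<cdot> ((past a x b \<cdot> Brd C b (a \<odot> x)) \<otimes> Idn C y)"
    using o by (simp add: assc_nat)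
  also have "\<dots> = Assc C x (b \<odot> a) y \<cdot> (((Idn C x \<otimes> Brd C a b) \<cdot> past a x b \<cdot> Brd C b (a \<odot> x)) \<otimes> Idn C y)"
    using o by (simp add: merge)
  also have "\<dots> = past (b \<odot> a) x y \<cdot> (Inv C (Assc C b a x) \<otimes> Idn C y)"
    unfolding bx using o by (simp add: past_def merge)
  finally show ?thesis .
qed

end

section \<open>Modules over a tt-ring\<close>

text \<open>The whiskering axioms are what exactness of the tensor product in each variable
  provides. The locale is closed under passing to modules (\<open>Modc_additive_monoidal\<close>),
  so everything proved from it holds again inside \<open>A\<close>-modules.\<close>

locale additive_monoidal_cat = idempotent_complete_cat C + symmetric_monoidal_cat C
  for C :: "('o, 'a) tt_data" (structure) +
  assumes whisker_plus_right: "\<lbrakk>x \<in> Obj C; f \<in> Arr C; g \<in> Arr C; Dom C g = Dom C f; Cod C g = Cod C f\<rbrakk>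
      \<Longrightarrow> Idn C x \<otimes> (f \<oplus> g) = (Idn C x \<otimes> f) \<oplus> (Idn C x \<otimes> g)"
    and whisker_plus_left: "\<lbrakk>x \<in> Obj C; f \<in> Arr C; g \<in> Arr C; Dom C g = Dom C f; Cod C g = Cod C f\<rbrakk>
      \<Longrightarrow> (f \<oplus> g) \<otimes> Idn C x = (f \<otimes> Idn C x) \<oplus> (g \<otimes> Idn C x)"
begin

lemma ten_plus_right:
  assumes "h \<in> Arr C" "f \<in> Arr C" "g \<in> Arr C" "Dom C g = Dom C f" "Cod C g = Cod C f"
  shows "h \<otimes> (f \<oplus> g) = (h \<otimes> f) \<oplus> (h \<otimes> g)"
proof -
  have "h \<otimes> (f \<oplus> g) = (h \<otimes> Idn C (Cod C f)) \<cdot> (Idn C (Dom C h) \<otimes> (f \<oplus> g))"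
    using assms by (simp add: merge)
  also have "\<dots> = (h \<otimes> f) \<oplus> (h \<otimes> g)"
    using assms by (simp add: whisker_plus_right plus_right merge)
  finally show ?thesis .
qed

lemma ten_plus_left:
  assumes "h \<in> Arr C" "f \<in> Arr C" "g \<in> Arr C" "Dom C g = Dom C f" "Cod C g = Cod C f"
  shows "(f \<oplus> g) \<otimes> h = (f \<otimes> h) \<oplus> (g \<otimes> h)"
proof -
  have "(f \<oplus> g) \<otimes> h = (Idn C (Cod C f) \<otimes> h) \<cdot> ((f \<oplus> g) \<otimes> Idn C (Dom C h))"
    using assms by (simp add: merge)
  also have "\<dots> = (f \<otimes> h) \<oplus> (g \<otimes> h)"
    using assms by (simp add: whisker_plus_left plus_right merge)
  finally show ?thesis .
qed

lemma ten_Zer_right: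
  assumes "h \<in> Arr C" "x \<in> Obj C" "y \<in> Obj C"
  shows "h \<otimes> Zer C x y = Zer C (Dom C h \<odot> x) (Cod C h \<odot> y)"
  by (rule plus_idem_zero)
    (use assms in \<open>simp_all add: Hom_iff ten_plus_right[symmetric] plus_Zer_right\<close>)

lemma ten_Zer_left:
  assumes "h \<in> Arr C" "x \<in> Obj C" "y \<in> Obj C"
  shows "Zer C x y \<otimes> h = Zer C (x \<odot> Dom C h) (y \<odot> Cod C h)"
  by (rule plus_idem_zero)
    (use assms in \<open>simp_all add: Hom_iff ten_plus_left[symmetric] plus_Zer_right\<close>)

end

locale ring_modules = additive_monoidal_cat C for C :: "('o, 'a) tt_data" (structure) +
  fixes A :: "('o, 'a) ring_data"
  assumes A: "tt_ring C A"
begin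

abbreviation "a \<equiv> carr A"
abbreviation "proj \<equiv> ten_proj C A"
abbreviation "Ten \<equiv> ten_obj C A"
abbreviation "module \<equiv> is_module C A"

lemma A_typed [simp]:
  "a \<in> Obj C" "mlt A \<in> Arr C" "Dom C (mlt A) = a \<odot> a" "Cod C (mlt A) = a"
  "unt A \<in> Arr C" "Dom C (unt A) = One C" "Cod C (unt A) = a"
  using A by (auto simp: tt_ring_def ring_object_def Let_def Hom_iff)

lemma A_assoc: "mlt A \<cdot> (mlt A \<otimes> Idn C a) = mlt A \<cdot> (Idn C a \<otimes> mlt A) \<cdot> Assc C a a a"
  and A_unit_left: "mlt A \<cdot> (unt A \<otimes> Idn C a) = Lun C a"
  and A_unit_right: "mlt A \<cdot> (Idn C a \<otimes> unt A) = Run C a"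
  and A_comm: "mlt A \<cdot> Brd C a a = mlt A"
  using A by (auto simp: tt_ring_def ring_object_def commutative_ring_def Let_def)

lemma A_separable:
  obtains s where "s \<in> Arr C" "Dom C s = a" "Cod C s = a \<odot> a" "mlt A \<cdot> s = Idn C a"
    "s \<cdot> mlt A = (mlt A \<otimes> Idn C a) \<cdot> Inv C (Assc C a a a) \<cdot> (Idn C a \<otimes> s)"
    "s \<cdot> mlt A = (Idn C a \<otimes> mlt A) \<cdot> Assc C a a a \<cdot> (s \<otimes> Idn C a)"
  using A by (auto simp: tt_ring_def separable_ring_def Let_def Hom_iff)

lemma module_typed [simp]:
  assumes "module m"
  shows "fst m \<in> Obj C" "snd m \<in> Arr C" "Dom C (snd m) = a \<odot> fst m" "Cod C (snd m) = fst m"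
  using assms by (auto simp: is_module_def Let_def Hom_iff)

lemma act_mlt: "module m \<Longrightarrow>
    snd m \<cdot> (mlt A \<otimes> Idn C (fst m)) = snd m \<cdot> (Idn C a \<otimes> snd m) \<cdot> Assc C a a (fst m)"
  and act_unt: "module m \<Longrightarrow> snd m \<cdot> (unt A \<otimes> Idn C (fst m)) = Lun C (fst m)"
  unfolding is_module_def Let_def by blast+

lemma moduleI:
  assumes "fst m \<in> Obj C" "snd m \<in> Arr C" "Dom C (snd m) = a \<odot> fst m" "Cod C (snd m) = fst m"
    "snd m \<cdot> (mlt A \<otimes> Idn C (fst m)) = snd m \<cdot> (Idn C a \<otimes> snd m) \<cdot> Assc C a a (fst m)"
    "snd m \<cdot> (unt A \<otimes> Idn C (fst m)) = Lun C (fst m)"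
  shows "module m"
  unfolding is_module_def Let_def Hom_iff using assms by blast

lemma A_module [simp]: "module (a, mlt A)"
  by (rule moduleI) (simp_all add: A_assoc A_unit_left)

lemma act_act: "module m \<Longrightarrow>
    snd m \<cdot> (Idn C a \<otimes> snd m) = snd m \<cdot> (mlt A \<otimes> Idn C (fst m)) \<cdot> Inv C (Assc C a a (fst m))"
  by (simp add: tail[OF act_mlt])

text \<open>Commutativity of \<open>A\<close>: the two sides let a pair of scalars act in opposite
  orders, and the braiding between them is absorbed by \<open>mlt A\<close>.\<close>

lemma act_act_past:
  assumes m: "module m"
  shows "snd m \<cdot> (Idn C a \<otimes> snd m) \<cdot> past a a (fst m) = snd m \<cdot> (Idn C a \<otimes> snd m) \<cdot> Assc C a a (fst m)"
proof -
  have "snd m \<cdot> (Idn C a \<otimes> snd m) \<cdot> past a a (fst m)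
      = (snd m \<cdot> (Idn C a \<otimes> snd m) \<cdot> Assc C a a (fst m)) \<cdot> (Brd C a a \<otimes> Idn C (fst m))"
    unfolding past_def using m by simp
  also have "\<dots> = snd m \<cdot> (mlt A \<otimes> Idn C (fst m))"
    unfolding act_mlt[OF m, symmetric] using m by (simp add: merge A_comm)
  finally show ?thesis using m by (simp add: act_mlt)
qed

text \<open>A module is a direct summand of a free one because \<open>A\<close> is separable: for the separability
  element \<open>s \<cdot> unt A = \<Sum> u \<otimes> u'\<close>, the section is \<open>x \<mapsto> \<Sum> u \<otimes> u' x\<close>.\<close>

lemma act_section:
  assumes m: "module m"
  obtains c where "c \<in> Arr C" "Dom C c = fst m" "Cod C c = a \<odot> fst m" "snd m \<cdot> c = Idn C (fst m)"
    "c \<cdot> snd m = (mlt A \<otimes> Idn C (fst m)) \<cdot> Inv C (Assc C a a (fst m)) \<cdot> (Idn C a \<otimes> c)"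
proof -
  let ?x = "fst m" and ?r = "snd m" and ?i = "Idn C a" and ?I = "Idn C (fst m)"
  obtain s where s: "s \<in> Arr C" "Dom C s = a" "Cod C s = a \<odot> a" and s1: "mlt A \<cdot> s = Idn C a"
    and s2: "s \<cdot> mlt A = (mlt A \<otimes> ?i) \<cdot> Inv C (Assc C a a a) \<cdot> (?i \<otimes> s)"
    and s3: "s \<cdot> mlt A = (?i \<otimes> mlt A) \<cdot> Assc C a a a \<cdot> (s \<otimes> ?i)"
    by (rule A_separable)
  \<comment> \<open>For \<open>s b = \<Sum> u \<otimes> u'\<close> this is
    \<open>b \<otimes> x \<mapsto> \<Sum> u \<otimes> u' x\<close>. Both sides of the linearity
    claim for the section turn out to be \<open>z\<close>: right linearity of \<open>s\<close> gives
    \<open>z_act\<close> and hence \<open>c \<cdot> ?r = z\<close>, left linearity gives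
    \<open>z_mlt\<close>.\<close>
  define z where "z = (?i \<otimes> ?r) \<cdot> Assc C a a ?x \<cdot> (s \<otimes> ?I)"
  define l where "l = Inv C (Assc C a a ?x)"
  have z: "z \<in> Arr C" "Dom C z = a \<odot> ?x" "Cod C z = a \<odot> ?x" unfolding z_def using m s by auto
  have l: "l \<in> Arr C" "Dom C l = a \<odot> (a \<odot> ?x)" "Cod C l = (a \<odot> a) \<odot> ?x" unfolding l_def using m by auto
  have z_act: "z \<cdot> (?i \<otimes> ?r) = z \<cdot> (mlt A \<otimes> ?I) \<cdot> l"
  proof (rule iso_cancel_right[of "Assc C a a ?x"])
    have "(z \<cdot> (?i \<otimes> ?r)) \<cdot> Assc C a a ?x
      = (?i \<otimes> ?r) \<cdot> (Assc C a a ?x \<cdot> (Idn C (a \<odot> a) \<otimes> ?r)) \<cdot> ((s \<otimes> Idn C (a \<odot> ?x)) \<cdot> Assc C a a ?x)"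
      unfolding z_def using m s by (simp add: merge)
    also have "\<dots> = (?i \<otimes> ?r) \<cdot> (?i \<otimes> (?i \<otimes> ?r)) \<cdot> Assc C a a (a \<odot> ?x) \<cdot> ((s \<otimes> Idn C (a \<odot> ?x)) \<cdot> Assc C a a ?x)"
      using m s by (simp add: assc_nat_Idn)
    also have "\<dots> = (?i \<otimes> (?r \<cdot> (?i \<otimes> ?r))) \<cdot> Assc C a a (a \<odot> ?x) \<cdot> Assc C (a \<odot> a) a ?x \<cdot> ((s \<otimes> ?i) \<otimes> ?I)"
      using m s assc_nat[of s ?i ?I "a \<odot> a" a ?x] by (simp add: merge)
    also have "\<dots> = (?i \<otimes> (?r \<cdot> (?i \<otimes> ?r) \<cdot> Assc C a a ?x)) \<cdot> Assc C a (a \<odot> a) ?x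
        \<cdot> ((Assc C a a a \<cdot> (s \<otimes> ?i)) \<otimes> ?I)"
      using m s by (subst tail[OF pentagon]) (simp_all add: merge)
    also have "\<dots> = (?i \<otimes> ?r) \<cdot> ((?i \<otimes> (mlt A \<otimes> ?I)) \<cdot> Assc C a (a \<odot> a) ?x) \<cdot> ((Assc C a a a \<cdot> (s \<otimes> ?i)) \<otimes> ?I)"
      using m s by (simp add: merge act_mlt)
    also have "\<dots> = (?i \<otimes> ?r) \<cdot> (Assc C a a ?x \<cdot> ((?i \<otimes> mlt A) \<otimes> ?I)) \<cdot> ((Assc C a a a \<cdot> (s \<otimes> ?i)) \<otimes> ?I)"
      using m s by (simp add: assc_nat)
    also have "\<dots> = (?i \<otimes> ?r) \<cdot> Assc C a a ?x \<cdot> ((s \<cdot> mlt A) \<otimes> ?I)"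
      unfolding s3 using m s by (simp add: merge)
    also have "\<dots> = (z \<cdot> (mlt A \<otimes> ?I) \<cdot> l) \<cdot> Assc C a a ?x"
      unfolding z_def l_def using m s by (simp add: merge)
    finally show "(z \<cdot> (?i \<otimes> ?r)) \<cdot> Assc C a a ?x = (z \<cdot> (mlt A \<otimes> ?I) \<cdot> l) \<cdot> Assc C a a ?x" .
  qed (use m s z l in auto)
  have z_mlt: "(mlt A \<otimes> ?I) \<cdot> l \<cdot> (?i \<otimes> z) = z \<cdot> (mlt A \<otimes> ?I) \<cdot> l"
  proof -
    have "(mlt A \<otimes> ?I) \<cdot> l \<cdot> (?i \<otimes> z)
      = (mlt A \<otimes> ?I) \<cdot> (Inv C (Assc C a a ?x) \<cdot> (?i \<otimes> (?i \<otimes> ?r))) \<cdot> (?i \<otimes> (Assc C a a ?x \<cdot> (s \<otimes> ?I)))"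
      unfolding z_def l_def using m s by (simp add: merge)
    also have "\<dots> = (mlt A \<otimes> ?I) \<cdot> (Idn C (a \<odot> a) \<otimes> ?r) \<cdot> Inv C (Assc C a a (a \<odot> ?x)) \<cdot> (?i \<otimes> (Assc C a a ?x \<cdot> (s \<otimes> ?I)))"
      using m s by (simp add: assc_inv_nat)
    also have "\<dots> = (mlt A \<otimes> ?r) \<cdot> Inv C (Assc C a a (a \<odot> ?x)) \<cdot> (?i \<otimes> (Assc C a a ?x \<cdot> (s \<otimes> ?I)))"
      using m s by (simp add: merge)
    also have "\<dots> = (mlt A \<otimes> ?r) \<cdot> Assc C (a \<odot> a) a ?x \<cdot> (Inv C (Assc C a a a) \<otimes> ?I)
        \<cdot> Inv C (Assc C a (a \<odot> a) ?x) \<cdot> (?i \<otimes> (s \<otimes> ?I))"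
      using m s tail[OF pentagon_inv[of a a a ?x], of "?i \<otimes> (s \<otimes> ?I)"] by (simp add: merge)
    also have "\<dots> = (?i \<otimes> ?r) \<cdot> ((mlt A \<otimes> Idn C (a \<odot> ?x)) \<cdot> Assc C (a \<odot> a) a ?x)
        \<cdot> ((Inv C (Assc C a a a) \<cdot> (?i \<otimes> s)) \<otimes> ?I) \<cdot> l"
      unfolding l_def using m s by (simp add: merge assc_inv_nat)
    also have "\<dots> = (?i \<otimes> ?r) \<cdot> (Assc C a a ?x \<cdot> ((mlt A \<otimes> ?i) \<otimes> ?I))
        \<cdot> ((Inv C (Assc C a a a) \<cdot> (?i \<otimes> s)) \<otimes> ?I) \<cdot> l"
      using m assc_nat[of "mlt A" ?i ?I a a ?x] by simp
    also have "\<dots> = (?i \<otimes> ?r) \<cdot> Assc C a a ?x \<cdot> ((s \<cdot> mlt A) \<otimes> ?I) \<cdot> l"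
      unfolding s2 using m s l by (simp add: merge)
    also have "\<dots> = z \<cdot> (mlt A \<otimes> ?I) \<cdot> l"
      unfolding z_def using m s l by (simp add: merge)
    finally show ?thesis .
  qed
  \<comment> \<open>The value of \<open>z\<close> at the unit of \<open>A\<close>.\<close>
  define c where "c = z \<cdot> (unt A \<otimes> ?I) \<cdot> Inv C (Lun C ?x)"
  have c: "c \<in> Arr C" "Dom C c = ?x" "Cod C c = a \<odot> ?x" unfolding c_def using m z by auto
  have "c \<cdot> ?r = (z \<cdot> (?i \<otimes> ?r)) \<cdot> (unt A \<otimes> Idn C (a \<odot> ?x)) \<cdot> Inv C (Lun C (a \<odot> ?x))"
    unfolding c_def using m z by (simp add: lun_inv_nat merge)
  also have "\<dots> = z \<cdot> (mlt A \<otimes> ?I) \<cdot> (l \<cdot> (unt A \<otimes> Idn C (a \<odot> ?x))) \<cdot> Inv C (Lun C (a \<odot> ?x))"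
    unfolding z_act using m z l by simp
  also have "\<dots> = z \<cdot> (Lun C a \<otimes> ?I) \<cdot> Inv C (Assc C (One C) a ?x) \<cdot> Inv C (Lun C (a \<odot> ?x))"
    unfolding l_def using m z by (simp add: assc_inv_nat_Idn merge A_unit_left)
  also have "\<dots> = z" using m z by (simp add: lun_ten[symmetric])
  finally have cr: "c \<cdot> ?r = z" .
  have "(mlt A \<otimes> ?I) \<cdot> l \<cdot> (?i \<otimes> c)
      = ((mlt A \<otimes> ?I) \<cdot> l \<cdot> (?i \<otimes> z)) \<cdot> (?i \<otimes> ((unt A \<otimes> ?I) \<cdot> Inv C (Lun C ?x)))"
    unfolding c_def using m z l by (simp add: merge)
  also have "\<dots> = z \<cdot> (mlt A \<otimes> ?I) \<cdot> (l \<cdot> (?i \<otimes> (unt A \<otimes> ?I))) \<cdot> (?i \<otimes> Inv C (Lun C ?x))"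
    unfolding z_mlt using m z l by (simp add: merge)
  also have "\<dots> = z \<cdot> (Run C a \<otimes> ?I) \<cdot> Inv C (Assc C a (One C) ?x) \<cdot> (?i \<otimes> Inv C (Lun C ?x))"
    unfolding l_def using m z by (simp add: assc_inv_nat merge A_unit_right)
  also have "\<dots> = z" using m z by (simp add: triangle_axiom[symmetric] merge)
  finally have mc: "(mlt A \<otimes> ?I) \<cdot> l \<cdot> (?i \<otimes> c) = z" .
  have "?r \<cdot> c = (?r \<cdot> (?i \<otimes> ?r) \<cdot> Assc C a a ?x) \<cdot> (s \<otimes> ?I) \<cdot> (unt A \<otimes> ?I) \<cdot> Inv C (Lun C ?x)"
    unfolding c_def z_def using m s by simp
  also have "\<dots> = ?r \<cdot> (((mlt A \<cdot> s) \<cdot> unt A) \<otimes> ?I) \<cdot> Inv C (Lun C ?x)"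
    unfolding act_mlt[OF m, symmetric] using m s by (simp add: merge)
  also have "\<dots> = Idn C ?x"
    unfolding s1 using m by (simp add: tail[OF act_unt])
  finally have rc: "?r \<cdot> c = Idn C ?x" .
  show ?thesis
    by (rule that[OF c rc]) (use cr mc in \<open>simp add: l_def\<close>)
qed

text \<open>\<open>\<beta>\<close> coequalizes the two actions; the ring acts from the left, so that it is moved past \<open>fst m\<close>
  to reach \<open>fst n\<close>.\<close>

definition balanced :: "'o \<times> 'a \<Rightarrow> 'o \<times> 'a \<Rightarrow> 'a \<Rightarrow> bool" where
  "balanced m n \<beta> \<longleftrightarrow> \<beta> \<in> Arr C \<and> Dom C \<beta> = fst m \<odot> fst n \<and>
     \<beta> \<cdot> (snd m \<otimes> Idn C (fst n)) = \<beta> \<cdot> (Idn C (fst m) \<otimes> snd n) \<cdot> past a (fst m) (fst n)"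

text \<open>The coequalizer behind \<open>ten_proj\<close> uses the right action on
  \<open>m\<close>; composing with the invertible braiding of \<open>A\<close> and
  \<open>fst m\<close> turns its condition into the one with left actions.\<close>

lemma balanced_iff:
  assumes m: "module m" and n: "module n" and b: "\<beta> \<in> Arr C" "Dom C \<beta> = fst m \<odot> fst n"
  shows "balanced m n \<beta> \<longleftrightarrow> \<beta> \<cdot> ((snd m \<cdot> Brd C (fst m) a) \<otimes> Idn C (fst n))
    = \<beta> \<cdot> (Idn C (fst m) \<otimes> snd n) \<cdot> Assc C (fst m) a (fst n)" (is "_ \<longleftrightarrow> ?l = ?r")
proof -
  let ?B = "Brd C a (fst m) \<otimes> Idn C (fst n)"
  have 1: "?l \<cdot> ?B = \<beta> \<cdot> (snd m \<otimes> Idn C (fst n))" using m n b by (simp add: merge)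
  have 2: "?r \<cdot> ?B = \<beta> \<cdot> (Idn C (fst m) \<otimes> snd n) \<cdot> past a (fst m) (fst n)"
    unfolding past_def using m n b by simp
  have "?l = ?r \<longleftrightarrow> ?l \<cdot> ?B = ?r \<cdot> ?B"
  proof
    assume "?l \<cdot> ?B = ?r \<cdot> ?B"
    then show "?l = ?r" by (rule iso_cancel_right[rotated]) (use m n b in auto)
  qed (simp only:)
  then show ?thesis unfolding 1 2 balanced_def using b by simp
qed

text \<open>In elements the balanced endomorphism is
  \<open>x \<otimes> y \<mapsto> \<Sum> u' x \<otimes> u y\<close>, with
  \<open>\<Sum> u \<otimes> u'\<close> the separability element. The section \<open>c\<close> of the
  action is linear, so a scalar on \<open>x\<close> reappears as a factor of \<open>u\<close>;
  commutativity then moves it onto \<open>y\<close>. Together with the section \<open>t\<close> of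
  the first action this exhibits the coequalizer as split.\<close>

lemma balanced_split:
  assumes m: "module m" and n: "module n"
  obtains t where "t \<in> Arr C" "Dom C t = fst m \<odot> fst n" "Cod C t = (a \<odot> fst m) \<odot> fst n"
    "(snd m \<otimes> Idn C (fst n)) \<cdot> t = Idn C (fst m \<odot> fst n)"
    "balanced m n ((Idn C (fst m) \<otimes> snd n) \<cdot> past a (fst m) (fst n) \<cdot> t)"
proof -
  let ?x = "fst m" and ?y = "fst n" and ?r = "snd m" and ?s = "snd n"
  obtain c where c: "c \<in> Arr C" "Dom C c = ?x" "Cod C c = a \<odot> ?x" and rc: "?r \<cdot> c = Idn C ?x"
    and cr: "c \<cdot> ?r = (mlt A \<otimes> Idn C ?x) \<cdot> Inv C (Assc C a a ?x) \<cdot> (Idn C a \<otimes> c)"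
    by (rule act_section[OF m])
  let ?e = "(Idn C ?x \<otimes> ?s) \<cdot> past a ?x ?y \<cdot> (c \<otimes> Idn C ?y)"
  have "?e \<cdot> (?r \<otimes> Idn C ?y) = (Idn C ?x \<otimes> ?s) \<cdot> past a ?x ?y \<cdot> ((c \<cdot> ?r) \<otimes> Idn C ?y)"
    using m n c by (simp add: merge)
  also have "\<dots> = (Idn C ?x \<otimes> ?s) \<cdot> (past a ?x ?y \<cdot> ((mlt A \<otimes> Idn C ?x) \<otimes> Idn C ?y))
     \<cdot> ((Inv C (Assc C a a ?x) \<cdot> (Idn C a \<otimes> c)) \<otimes> Idn C ?y)"
    unfolding cr using m n c by (simp add: merge)
  also have "\<dots> = (Idn C ?x \<otimes> (?s \<cdot> (mlt A \<otimes> Idn C ?y))) \<cdot> past (a \<odot> a) ?x ?y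
     \<cdot> ((Inv C (Assc C a a ?x) \<cdot> (Idn C a \<otimes> c)) \<otimes> Idn C ?y)"
    using m n c by (simp add: past_nat merge)
  also have "\<dots> = (Idn C ?x \<otimes> (?s \<cdot> (mlt A \<otimes> Idn C ?y)))
     \<cdot> (past (a \<odot> a) ?x ?y \<cdot> (Inv C (Assc C a a ?x) \<otimes> Idn C ?y)) \<cdot> ((Idn C a \<otimes> c) \<otimes> Idn C ?y)"
    using m n c by (simp add: merge)
  also have "\<dots> = (Idn C ?x \<otimes> (?s \<cdot> ((mlt A \<cdot> Brd C a a) \<otimes> Idn C ?y) \<cdot> Inv C (Assc C a a ?y)))
     \<cdot> past a ?x (a \<odot> ?y) \<cdot> (past a (a \<odot> ?x) ?y \<cdot> ((Idn C a \<otimes> c) \<otimes> Idn C ?y))"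
    using m n c by (subst past_past[symmetric]) (simp_all add: merge)
  also have "\<dots> = (Idn C ?x \<otimes> (?s \<cdot> (Idn C a \<otimes> ?s)))
     \<cdot> past a ?x (a \<odot> ?y) \<cdot> ((c \<otimes> Idn C (a \<odot> ?y)) \<cdot> past a ?x ?y)"
    using m n c by (simp add: past_nat A_comm act_act)
  also have "\<dots> = (Idn C ?x \<otimes> ?s) \<cdot> ((Idn C ?x \<otimes> (Idn C a \<otimes> ?s)) \<cdot> past a ?x (a \<odot> ?y))
      \<cdot> ((c \<otimes> Idn C (a \<odot> ?y)) \<cdot> past a ?x ?y)"
    using m n c by (simp add: merge)
  also have "\<dots> = (Idn C ?x \<otimes> ?s) \<cdot> (past a ?x ?y \<cdot> (Idn C (a \<odot> ?x) \<otimes> ?s)) \<cdot> ((c \<otimes> Idn C (a \<odot> ?y)) \<cdot> past a ?x ?y)"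
    using m n c by (simp add: past_nat_Idn)
  also have "\<dots> = ?e \<cdot> (Idn C ?x \<otimes> ?s) \<cdot> past a ?x ?y"
    using m n c by (simp add: merge)
  finally have "balanced m n ?e" unfolding balanced_def using m n c by simp
  then show ?thesis
    by (intro that[of "c \<otimes> Idn C ?y"]) (use m n c rc in \<open>auto simp: merge\<close>)
qed

lemma coequalizer_iff:
  assumes m: "module m" and n: "module n"
  shows "coequalizer C ((snd m \<cdot> Brd C (fst m) a) \<otimes> Idn C (fst n))
      ((Idn C (fst m) \<otimes> snd n) \<cdot> Assc C (fst m) a (fst n)) q \<longleftrightarrow>
    balanced m n q \<and> (\<forall>\<beta>. balanced m n \<beta> \<longrightarrow>
      (\<exists>!k. k \<in> Hom C (Cod C q) (Cod C \<beta>) \<and> k \<cdot> q = \<beta>))"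
proof -
  let ?f = "(snd m \<cdot> Brd C (fst m) a) \<otimes> Idn C (fst n)"
  let ?g = "(Idn C (fst m) \<otimes> snd n) \<cdot> Assc C (fst m) a (fst n)"
  have f: "?f \<in> Arr C" "Cod C ?f = fst m \<odot> fst n" and g: "?g \<in> Hom C (Dom C ?f) (fst m \<odot> fst n)"
    using m n by (simp_all add: Hom_iff)
  have eq: "balanced m n \<beta> \<longleftrightarrow> \<beta> \<in> Arr C \<and> Dom C \<beta> = fst m \<odot> fst n \<and>
    \<beta> \<cdot> ((snd m \<cdot> Brd C (fst m) a) \<otimes> Idn C (fst n))
      = \<beta> \<cdot> (Idn C (fst m) \<otimes> snd n) \<cdot> Assc C (fst m) a (fst n)" for \<beta>
    using balanced_iff[OF m n, of \<beta>] unfolding balanced_def by blast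
  show ?thesis unfolding coequalizer_def eq f(2) using f(1) g by blast
qed

text \<open>Splitting the idempotent of \<open>balanced_split\<close> yields one coequalizer, so the
  choice in \<open>ten_proj\<close> is made among existing ones. The chosen one is isomorphic to it
  and inherits its splitting. The second claim records the equations of this splitting;
  factorizations along \<open>proj\<close> are computed from them.\<close>

lemma proj_split:
  assumes m: "module m" and n: "module n"
  shows "balanced m n (proj m n)"
    and "\<exists>s t. s \<in> Arr C \<and> Dom C s = Cod C (proj m n) \<and> Cod C s = fst m \<odot> fst n \<and>
      proj m n \<cdot> s = Idn C (Cod C (proj m n)) \<and>
      t \<in> Arr C \<and> Dom C t = fst m \<odot> fst n \<and> Cod C t = (a \<odot> fst m) \<odot> fst n \<and>
      (snd m \<otimes> Idn C (fst n)) \<cdot> t = Idn C (fst m \<odot> fst n) \<and>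
      s \<cdot> proj m n = (Idn C (fst m) \<otimes> snd n) \<cdot> past a (fst m) (fst n) \<cdot> t"
proof -
  let ?d = "snd m \<otimes> Idn C (fst n)" and ?d' = "(Idn C (fst m) \<otimes> snd n) \<cdot> past a (fst m) (fst n)"
  obtain t where t: "t \<in> Arr C" "Dom C t = fst m \<odot> fst n" "Cod C t = (a \<odot> fst m) \<odot> fst n"
    and dt: "?d \<cdot> t = Idn C (fst m \<odot> fst n)"
    and be: "balanced m n ((Idn C (fst m) \<otimes> snd n) \<cdot> past a (fst m) (fst n) \<cdot> t)"
    by (rule balanced_split[OF m n])
  define e where "e = ?d' \<cdot> t"
  have e: "e \<in> Hom C (fst m \<odot> fst n) (fst m \<odot> fst n)" unfolding e_def using m n t by (auto simp: Hom_iff)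
  \<comment> \<open>Applied to \<open>e\<close> itself, which is balanced, this gives
    idempotence.\<close>
  have bal: "\<beta> \<cdot> e = \<beta>" if "balanced m n \<beta>" for \<beta>
  proof -
    have b: "\<beta> \<in> Arr C" "Dom C \<beta> = fst m \<odot> fst n" "\<beta> \<cdot> ?d = \<beta> \<cdot> ?d'"
      using that by (auto simp: balanced_def)
    have "\<beta> \<cdot> e = (\<beta> \<cdot> ?d') \<cdot> t" unfolding e_def using m n t b(1,2) by simp
    also have "\<dots> = \<beta> \<cdot> (?d \<cdot> t)" unfolding b(3)[symmetric] using m n t b(1,2) by simp
    finally show ?thesis unfolding dt using b by simp
  qed
  have be': "balanced m n e" using be m n t by (simp add: e_def)
  obtain y p j where y: "y \<in> Obj C" and p': "p \<in> Hom C (fst m \<odot> fst n) y"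
    and j': "j \<in> Hom C y (fst m \<odot> fst n)" and jp: "j \<cdot> p = e" and pj: "p \<cdot> j = Idn C y"
    using idempotents_split[OF e bal[OF be']] by blast
  have p: "p \<in> Arr C" "Dom C p = fst m \<odot> fst n" "Cod C p = y"
    and j: "j \<in> Arr C" "Dom C j = y" "Cod C j = fst m \<odot> fst n"
    using p' j' by (auto simp: Hom_iff)
  have "balanced m n p"
  proof -
    have "p \<cdot> ?d = (p \<cdot> j) \<cdot> p \<cdot> ?d" unfolding pj using p m n by simp
    also have "\<dots> = p \<cdot> (e \<cdot> ?d)" unfolding jp[symmetric] using m n p j by simp
    also have "\<dots> = p \<cdot> (e \<cdot> ?d')" using be' by (simp add: balanced_def)
    also have "\<dots> = (p \<cdot> j) \<cdot> p \<cdot> ?d'" unfolding jp[symmetric] using m n p j by simp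
    also have "\<dots> = p \<cdot> ?d'" unfolding pj using p m n by simp
    finally show ?thesis unfolding balanced_def using p by simp
  qed
  moreover have "\<exists>!k. k \<in> Hom C (Cod C p) (Cod C \<beta>) \<and> k \<cdot> p = \<beta>" if \<beta>: "balanced m n \<beta>" for \<beta>
  proof (rule ex1I[of _ "\<beta> \<cdot> j"])
    have b: "\<beta> \<in> Arr C" "Dom C \<beta> = fst m \<odot> fst n" using \<beta> by (auto simp: balanced_def)
    show "\<beta> \<cdot> j \<in> Hom C (Cod C p) (Cod C \<beta>) \<and> (\<beta> \<cdot> j) \<cdot> p = \<beta>"
      using b p j bal[OF \<beta>] by (simp add: Hom_iff jp)
    fix k assume "k \<in> Hom C (Cod C p) (Cod C \<beta>) \<and> k \<cdot> p = \<beta>"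
    then have k: "k \<in> Arr C" "Dom C k = y" and kp: "k \<cdot> p = \<beta>" using p by (auto simp: Hom_iff)
    have "k = k \<cdot> (p \<cdot> j)" using k pj by simp
    also have "\<dots> = (k \<cdot> p) \<cdot> j" using k p j by simp
    finally show "k = \<beta> \<cdot> j" unfolding kp .
  qed
  ultimately have "\<exists>q. coequalizer C ((snd m \<cdot> Brd C (fst m) a) \<otimes> Idn C (fst n))
      ((Idn C (fst m) \<otimes> snd n) \<cdot> Assc C (fst m) a (fst n)) q"
    unfolding coequalizer_iff[OF m n] by blast
  then have "coequalizer C ((snd m \<cdot> Brd C (fst m) a) \<otimes> Idn C (fst n))
      ((Idn C (fst m) \<otimes> snd n) \<cdot> Assc C (fst m) a (fst n)) (proj m n)"
    unfolding ten_proj_def by (rule someI_ex)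
  then have bq: "balanced m n (proj m n)" and uq: "\<And>\<beta>. balanced m n \<beta> \<Longrightarrow>
      \<exists>!k. k \<in> Hom C (Cod C (proj m n)) (Cod C \<beta>) \<and> k \<cdot> proj m n = \<beta>"
    unfolding coequalizer_iff[OF m n] by blast+
  show "balanced m n (proj m n)" by (rule bq)
  let ?q = "proj m n"
  have q: "?q \<in> Arr C" "Dom C ?q = fst m \<odot> fst n" using bq by (auto simp: balanced_def)
  \<comment> \<open>Comparison of the chosen coequalizer with the split one:
    \<open>j \<cdot> k\<close> is a section of \<open>?q\<close>, by uniqueness of factorizations
    through \<open>?q\<close>.\<close>
  obtain k where k: "k \<in> Arr C" "Dom C k = Cod C ?q" "Cod C k = y" "k \<cdot> ?q = p"
    using uq[OF \<open>balanced m n p\<close>] p by (auto simp: Hom_iff)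
  have "?q \<cdot> (j \<cdot> k) = Idn C (Cod C ?q)"
  proof -
    have "(?q \<cdot> (j \<cdot> k)) \<cdot> ?q = ?q \<cdot> (j \<cdot> p)" using q k(1-3) j k(4) by simp
    also have "\<dots> = ?q" unfolding jp by (rule bal[OF bq])
    finally have "(?q \<cdot> (j \<cdot> k)) \<cdot> ?q = ?q" .
    moreover have "Idn C (Cod C ?q) \<cdot> ?q = ?q" using q by simp
    moreover have "?q \<cdot> (j \<cdot> k) \<in> Hom C (Cod C ?q) (Cod C ?q)" using q k j by (simp add: Hom_iff)
    moreover have "Idn C (Cod C ?q) \<in> Hom C (Cod C ?q) (Cod C ?q)" using q by (simp add: Hom_iff)
    ultimately show ?thesis using uq[OF bq] by blast
  qed
  moreover have "(j \<cdot> k) \<cdot> ?q = ?d' \<cdot> t" using q k j jp by (simp add: e_def)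
  ultimately show "\<exists>s t. s \<in> Arr C \<and> Dom C s = Cod C (proj m n) \<and> Cod C s = fst m \<odot> fst n \<and>
      proj m n \<cdot> s = Idn C (Cod C (proj m n)) \<and>
      t \<in> Arr C \<and> Dom C t = fst m \<odot> fst n \<and> Cod C t = (a \<odot> fst m) \<odot> fst n \<and>
      (snd m \<otimes> Idn C (fst n)) \<cdot> t = Idn C (fst m \<odot> fst n) \<and>
      s \<cdot> proj m n = (Idn C (fst m) \<otimes> snd n) \<cdot> past a (fst m) (fst n) \<cdot> t"
    using t dt j k m n by (intro exI[of _ "j \<cdot> k"] exI[of _ t]) simp
qed

section \<open>The tensor product of modules\<close>

lemma fst_Ten: "fst (Ten m n) = Cod C (proj m n)"
  by (simp add: ten_obj_def Let_def)

lemma proj_typed [simp]: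
  assumes "module m" "module n"
  shows "proj m n \<in> Arr C" "Dom C (proj m n) = fst m \<odot> fst n" "Cod C (proj m n) = fst (Ten m n)"
  using proj_split(1)[OF assms] by (auto simp: balanced_def fst_Ten)

lemma proj_balanced:
  assumes "module m" "module n"
  shows "proj m n \<cdot> (snd m \<otimes> Idn C (fst n)) = proj m n \<cdot> (Idn C (fst m) \<otimes> snd n) \<cdot> past a (fst m) (fst n)"
  using proj_split(1)[OF assms] by (auto simp: balanced_def)

lemma proj_splitE:
  assumes "module m" "module n"
  obtains s t where "s \<in> Arr C" "Dom C s = fst (Ten m n)" "Cod C s = fst m \<odot> fst n"
    "proj m n \<cdot> s = Idn C (fst (Ten m n))"
    "t \<in> Arr C" "Dom C t = fst m \<odot> fst n" "Cod C t = (a \<odot> fst m) \<odot> fst n"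
    "(snd m \<otimes> Idn C (fst n)) \<cdot> t = Idn C (fst m \<odot> fst n)"
    "s \<cdot> proj m n = (Idn C (fst m) \<otimes> snd n) \<cdot> past a (fst m) (fst n) \<cdot> t"
  using proj_split(2)[OF assms] unfolding fst_Ten by blast

lemma Ten_obj [simp]: "module m \<Longrightarrow> module n \<Longrightarrow> fst (Ten m n) \<in> Obj C"
  using cod_obj[of "proj m n"] by simp

lemma proj_split_epi [simp]:
  assumes "module m" "module n" shows "split_epi (proj m n)"
  by (rule proj_splitE[OF assms], rule split_epiI) (use assms in auto)

text \<open>The factor is \<open>\<beta> \<cdot> s\<close> for the section \<open>s\<close> of
  \<open>proj\<close>; balancedness enters through the section \<open>t\<close> of the
  action.\<close>

lemma descend_proj:
  assumes m: "module m" and n: "module n" and b: "balanced m n \<beta>"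
  shows "descend C (proj m n) \<beta> \<in> Arr C" "Dom C (descend C (proj m n) \<beta>) = fst (Ten m n)"
    "Cod C (descend C (proj m n) \<beta>) = Cod C \<beta>" "descend C (proj m n) \<beta> \<cdot> proj m n = \<beta>"
proof -
  have \<beta>: "\<beta> \<in> Arr C" "Dom C \<beta> = fst m \<odot> fst n" and
    eq: "\<beta> \<cdot> (snd m \<otimes> Idn C (fst n)) = \<beta> \<cdot> (Idn C (fst m) \<otimes> snd n) \<cdot> past a (fst m) (fst n)"
    using b by (auto simp: balanced_def)
  obtain s t where s: "s \<in> Arr C" "Dom C s = fst (Ten m n)" "Cod C s = fst m \<odot> fst n"
    and t: "t \<in> Arr C" "Dom C t = fst m \<odot> fst n" "Cod C t = (a \<odot> fst m) \<odot> fst n"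
    and st: "(snd m \<otimes> Idn C (fst n)) \<cdot> t = Idn C (fst m \<odot> fst n)"
      "s \<cdot> proj m n = (Idn C (fst m) \<otimes> snd n) \<cdot> past a (fst m) (fst n) \<cdot> t"
    by (rule proj_splitE[OF m n])
  have *: "(\<beta> \<cdot> s) \<cdot> proj m n = \<beta>"
  proof -
    have "(\<beta> \<cdot> s) \<cdot> proj m n = (\<beta> \<cdot> (Idn C (fst m) \<otimes> snd n) \<cdot> past a (fst m) (fst n)) \<cdot> t"
      using \<beta> s t m n st(2) by simp
    also have "\<dots> = \<beta> \<cdot> ((snd m \<otimes> Idn C (fst n)) \<cdot> t)" unfolding eq[symmetric] using \<beta> t m n by simp
    finally show ?thesis unfolding st(1) using \<beta> by simp
  qed
  have d: "descend C (proj m n) \<beta> = \<beta> \<cdot> s"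
    by (rule descend_eq) (use m n s \<beta> * in auto)
  show "descend C (proj m n) \<beta> \<in> Arr C" "Dom C (descend C (proj m n) \<beta>) = fst (Ten m n)"
    "Cod C (descend C (proj m n) \<beta>) = Cod C \<beta>" "descend C (proj m n) \<beta> \<cdot> proj m n = \<beta>"
    unfolding d using \<beta> s * by auto
qed

text \<open>A split coequalizer stays one after tensoring with \<open>w\<close>; the factor is
  \<open>\<beta>\<close> composed with the whiskered section. The mirror statement
  \<open>descend_proj_left\<close> serves tensoring on the other side.\<close>

lemma descend_proj_right:
  assumes m: "module m" and n: "module n" and w: "w \<in> Obj C"
    and \<beta>: "\<beta> \<in> Arr C" "Dom C \<beta> = w \<odot> (fst m \<odot> fst n)"
    and eq: "\<beta> \<cdot> (Idn C w \<otimes> (snd m \<otimes> Idn C (fst n)))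
      = \<beta> \<cdot> (Idn C w \<otimes> ((Idn C (fst m) \<otimes> snd n) \<cdot> past a (fst m) (fst n)))"
  obtains k where "k \<in> Arr C" "Dom C k = w \<odot> fst (Ten m n)" "Cod C k = Cod C \<beta>"
    "k \<cdot> (Idn C w \<otimes> proj m n) = \<beta>"
proof -
  obtain s t where s: "s \<in> Arr C" "Dom C s = fst (Ten m n)" "Cod C s = fst m \<odot> fst n"
    and t: "t \<in> Arr C" "Dom C t = fst m \<odot> fst n" "Cod C t = (a \<odot> fst m) \<odot> fst n"
    and st: "(snd m \<otimes> Idn C (fst n)) \<cdot> t = Idn C (fst m \<odot> fst n)"
      "s \<cdot> proj m n = (Idn C (fst m) \<otimes> snd n) \<cdot> past a (fst m) (fst n) \<cdot> t"
    by (rule proj_splitE[OF m n])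
  have "(\<beta> \<cdot> (Idn C w \<otimes> s)) \<cdot> (Idn C w \<otimes> proj m n)
      = (\<beta> \<cdot> (Idn C w \<otimes> ((Idn C (fst m) \<otimes> snd n) \<cdot> past a (fst m) (fst n)))) \<cdot> (Idn C w \<otimes> t)"
    using \<beta> s t m n w st(2) by (simp add: merge)
  also have "\<dots> = \<beta> \<cdot> (Idn C w \<otimes> ((snd m \<otimes> Idn C (fst n)) \<cdot> t))"
    unfolding eq[symmetric] using \<beta> t m n w by (simp add: merge)
  finally have "(\<beta> \<cdot> (Idn C w \<otimes> s)) \<cdot> (Idn C w \<otimes> proj m n) = \<beta>" unfolding st(1) using \<beta> w m n by simp
  then show ?thesis by (intro that[of "\<beta> \<cdot> (Idn C w \<otimes> s)"]) (use \<beta> s w in auto)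
qed

lemma descend_proj_left:
  assumes m: "module m" and n: "module n" and w: "w \<in> Obj C"
    and \<beta>: "\<beta> \<in> Arr C" "Dom C \<beta> = (fst m \<odot> fst n) \<odot> w"
    and eq: "\<beta> \<cdot> ((snd m \<otimes> Idn C (fst n)) \<otimes> Idn C w)
      = \<beta> \<cdot> (((Idn C (fst m) \<otimes> snd n) \<cdot> past a (fst m) (fst n)) \<otimes> Idn C w)"
  obtains k where "k \<in> Arr C" "Dom C k = fst (Ten m n) \<odot> w" "Cod C k = Cod C \<beta>"
    "k \<cdot> (proj m n \<otimes> Idn C w) = \<beta>"
proof -
  obtain s t where s: "s \<in> Arr C" "Dom C s = fst (Ten m n)" "Cod C s = fst m \<odot> fst n"
    and t: "t \<in> Arr C" "Dom C t = fst m \<odot> fst n" "Cod C t = (a \<odot> fst m) \<odot> fst n"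
    and st: "(snd m \<otimes> Idn C (fst n)) \<cdot> t = Idn C (fst m \<odot> fst n)"
      "s \<cdot> proj m n = (Idn C (fst m) \<otimes> snd n) \<cdot> past a (fst m) (fst n) \<cdot> t"
    by (rule proj_splitE[OF m n])
  have "(\<beta> \<cdot> (s \<otimes> Idn C w)) \<cdot> (proj m n \<otimes> Idn C w)
      = (\<beta> \<cdot> (((Idn C (fst m) \<otimes> snd n) \<cdot> past a (fst m) (fst n)) \<otimes> Idn C w)) \<cdot> (t \<otimes> Idn C w)"
    using \<beta> s t m n w st(2) by (simp add: merge)
  also have "\<dots> = \<beta> \<cdot> (((snd m \<otimes> Idn C (fst n)) \<cdot> t) \<otimes> Idn C w)"
    unfolding eq[symmetric] using \<beta> t m n w by (simp add: merge)
  finally have "(\<beta> \<cdot> (s \<otimes> Idn C w)) \<cdot> (proj m n \<otimes> Idn C w) = \<beta>" unfolding st(1) using \<beta> w m n by simp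
  then show ?thesis by (intro that[of "\<beta> \<cdot> (s \<otimes> Idn C w)"]) (use \<beta> s w in auto)
qed

text \<open>The action on the tensor product is that on the first factor. It respects the
  identification of scalars because two scalars acting on \<open>m\<close> commute, which is
  \<open>act_act_past\<close>; composing with the isomorphism \<open>?P\<close> brings both scalars
  next to \<open>fst m\<close>.\<close>

lemma act_proj0:
  assumes m: "module m" and n: "module n"
  shows "snd (Ten m n) \<in> Arr C \<and> Dom C (snd (Ten m n)) = a \<odot> fst (Ten m n) \<and>
    Cod C (snd (Ten m n)) = fst (Ten m n) \<and>
    snd (Ten m n) \<cdot> (Idn C a \<otimes> proj m n)
      = proj m n \<cdot> (snd m \<otimes> Idn C (fst n)) \<cdot> Inv C (Assc C a (fst m) (fst n))"
proof -
  let ?x = "fst m" and ?y = "fst n" and ?r = "snd m" and ?s = "snd n"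
  let ?q = "proj m n"
  let ?\<beta> = "?q \<cdot> (?r \<otimes> Idn C ?y) \<cdot> Inv C (Assc C a ?x ?y)"
  let ?P = "Assc C a (a \<odot> ?x) ?y \<cdot> (past a a ?x \<otimes> Idn C ?y)"
  have eq: "?\<beta> \<cdot> (Idn C a \<otimes> (?r \<otimes> Idn C ?y)) = ?\<beta> \<cdot> (Idn C a \<otimes> ((Idn C ?x \<otimes> ?s) \<cdot> past a ?x ?y))"
  proof (rule iso_cancel_right[of ?P])
    have "(?\<beta> \<cdot> (Idn C a \<otimes> (?r \<otimes> Idn C ?y))) \<cdot> ?P
        = ?q \<cdot> ((?r \<cdot> (Idn C a \<otimes> ?r) \<cdot> past a a ?x) \<otimes> Idn C ?y)"
      using m n by (simp add: assc_inv_nat merge)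
    also have "\<dots> = (?q \<cdot> (?r \<otimes> Idn C ?y)) \<cdot> (((Idn C a \<otimes> ?r) \<cdot> Assc C a a ?x) \<otimes> Idn C ?y)"
      unfolding act_act_past[OF m] using m n by (simp add: merge)
    also have "\<dots> = ?q \<cdot> (Idn C ?x \<otimes> ?s) \<cdot> (past a ?x ?y \<cdot> ((Idn C a \<otimes> ?r) \<otimes> Idn C ?y)) \<cdot> (Assc C a a ?x \<otimes> Idn C ?y)"
      unfolding proj_balanced[OF m n] using m n by (simp add: merge)
    also have "\<dots> = ?q \<cdot> (?r \<otimes> ?s) \<cdot> past a (a \<odot> ?x) ?y \<cdot> (Assc C a a ?x \<otimes> Idn C ?y)"
      using m n by (simp add: past_nat merge)
    also have "\<dots> = ?q \<cdot> (?r \<otimes> ?s) \<cdot> Inv C (Assc C a ?x (a \<odot> ?y))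
        \<cdot> (Assc C a ?x (a \<odot> ?y) \<cdot> past a (a \<odot> ?x) ?y \<cdot> (Assc C a a ?x \<otimes> Idn C ?y))"
      using m n by simp
    also have "\<dots> = ?q \<cdot> (?r \<otimes> Idn C ?y) \<cdot> (Idn C (a \<odot> ?x) \<otimes> ?s) \<cdot> Inv C (Assc C a ?x (a \<odot> ?y))
        \<cdot> (Idn C a \<otimes> past a ?x ?y) \<cdot> ?P"
      using m n by (simp add: past_ten[symmetric] merge)
    also have "\<dots> = ?q \<cdot> (?r \<otimes> Idn C ?y) \<cdot> (Inv C (Assc C a ?x ?y) \<cdot> (Idn C a \<otimes> (Idn C ?x \<otimes> ?s)))
        \<cdot> (Idn C a \<otimes> past a ?x ?y) \<cdot> ?P"
      using m n by (simp add: assc_inv_nat)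
    also have "\<dots> = (?\<beta> \<cdot> (Idn C a \<otimes> ((Idn C ?x \<otimes> ?s) \<cdot> past a ?x ?y))) \<cdot> ?P"
      using m n by (simp add: merge)
    finally show "(?\<beta> \<cdot> (Idn C a \<otimes> (?r \<otimes> Idn C ?y))) \<cdot> ?P
      = (?\<beta> \<cdot> (Idn C a \<otimes> ((Idn C ?x \<otimes> ?s) \<cdot> past a ?x ?y))) \<cdot> ?P" .
  qed (use m n in \<open>auto intro!: is_iso_comp\<close>)
  obtain k where k: "k \<in> Arr C" "Dom C k = a \<odot> fst (Ten m n)" "Cod C k = Cod C ?\<beta>"
    "k \<cdot> (Idn C a \<otimes> ?q) = ?\<beta>"
    by (rule descend_proj_right[OF m n _ _ _ eq]) (use m n in auto)
  have "snd (Ten m n) = descend C (Idn C a \<otimes> ?q) ?\<beta>"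
    by (simp add: ten_obj_def Let_def)
  also have "\<dots> = k"
    by (rule descend_eq) (use k m n in \<open>auto intro!: split_epi_ten\<close>)
  finally show ?thesis using k m n by simp
qed

lemma Ten_typed [simp]:
  assumes "module m" "module n"
  shows "snd (Ten m n) \<in> Arr C" "Dom C (snd (Ten m n)) = a \<odot> fst (Ten m n)"
    "Cod C (snd (Ten m n)) = fst (Ten m n)"
  using act_proj0[OF assms] by auto

lemma act_proj [simp]:
  assumes "module m" "module n"
  shows "snd (Ten m n) \<cdot> (Idn C a \<otimes> proj m n)
      = proj m n \<cdot> (snd m \<otimes> Idn C (fst n)) \<cdot> Inv C (Assc C a (fst m) (fst n))"
    "\<lbrakk>k \<in> Arr C; Cod C k = a \<odot> (fst m \<odot> fst n)\<rbrakk> \<Longrightarrow> snd (Ten m n) \<cdot> ((Idn C a \<otimes> proj m n) \<cdot> k)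
      = proj m n \<cdot> (snd m \<otimes> Idn C (fst n)) \<cdot> (Inv C (Assc C a (fst m) (fst n)) \<cdot> k)"
    "\<lbrakk>f \<in> Arr C; Cod C f = fst m \<odot> fst n\<rbrakk> \<Longrightarrow> snd (Ten m n) \<cdot> (Idn C a \<otimes> (proj m n \<cdot> f))
      = proj m n \<cdot> (snd m \<otimes> Idn C (fst n)) \<cdot> (Inv C (Assc C a (fst m) (fst n)) \<cdot> (Idn C a \<otimes> f))"
    "\<lbrakk>f \<in> Arr C; Cod C f = fst m \<odot> fst n; k \<in> Arr C; Cod C k = a \<odot> Dom C f\<rbrakk> \<Longrightarrow>
      snd (Ten m n) \<cdot> ((Idn C a \<otimes> (proj m n \<cdot> f)) \<cdot> k)
      = proj m n \<cdot> (snd m \<otimes> Idn C (fst n)) \<cdot> (Inv C (Assc C a (fst m) (fst n)) \<cdot> ((Idn C a \<otimes> f) \<cdot> k))"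
proof -
  show *: "snd (Ten m n) \<cdot> (Idn C a \<otimes> proj m n)
      = proj m n \<cdot> (snd m \<otimes> Idn C (fst n)) \<cdot> Inv C (Assc C a (fst m) (fst n))"
    using act_proj0[OF assms] by simp
  show 2: "snd (Ten m n) \<cdot> ((Idn C a \<otimes> proj m n) \<cdot> k)
      = proj m n \<cdot> (snd m \<otimes> Idn C (fst n)) \<cdot> (Inv C (Assc C a (fst m) (fst n)) \<cdot> k)"
    if "k \<in> Arr C" "Cod C k = a \<odot> (fst m \<odot> fst n)" for k
    using that assms by (subst tail[OF *]) simp_all
  have 3: "Idn C a \<otimes> (proj m n \<cdot> f) = (Idn C a \<otimes> proj m n) \<cdot> (Idn C a \<otimes> f)"
    if "f \<in> Arr C" "Cod C f = fst m \<odot> fst n" for f using that assms by (simp add: merge)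
  show "snd (Ten m n) \<cdot> (Idn C a \<otimes> (proj m n \<cdot> f))
      = proj m n \<cdot> (snd m \<otimes> Idn C (fst n)) \<cdot> (Inv C (Assc C a (fst m) (fst n)) \<cdot> (Idn C a \<otimes> f))"
    if "f \<in> Arr C" "Cod C f = fst m \<odot> fst n"
    unfolding 3[OF that] using 2[of "Idn C a \<otimes> f"] that by simp
  show "snd (Ten m n) \<cdot> ((Idn C a \<otimes> (proj m n \<cdot> f)) \<cdot> k)
      = proj m n \<cdot> (snd m \<otimes> Idn C (fst n)) \<cdot> (Inv C (Assc C a (fst m) (fst n)) \<cdot> ((Idn C a \<otimes> f) \<cdot> k))"
    if "f \<in> Arr C" "Cod C f = fst m \<odot> fst n" "k \<in> Arr C" "Cod C k = a \<odot> Dom C f"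
    unfolding 3[OF that(1,2)] using 2[of "(Idn C a \<otimes> f) \<cdot> k"] that assms by simp
qed

text \<open>Both axioms may be tested after the split epimorphism \<open>proj\<close> whiskered by
  the scalars, where the action is that of \<open>m\<close>.\<close>

lemma Ten_module [simp]:
  assumes m: "module m" and n: "module n"
  shows "module (Ten m n)"
proof (rule moduleI)
  let ?x = "fst m" and ?y = "fst n" and ?r = "snd m" and ?q = "proj m n" and ?w = "snd (Ten m n)"
  let ?Q = "fst (Ten m n)"
  show "?w \<cdot> (mlt A \<otimes> Idn C ?Q) = ?w \<cdot> (Idn C a \<otimes> ?w) \<cdot> Assc C a a ?Q"
  proof (rule split_epi_cancel[of "Idn C (a \<odot> a) \<otimes> ?q"])
    have "(?w \<cdot> (mlt A \<otimes> Idn C ?Q)) \<cdot> (Idn C (a \<odot> a) \<otimes> ?q) = ?w \<cdot> ((Idn C a \<otimes> ?q) \<cdot> (mlt A \<otimes> Idn C (?x \<odot> ?y)))"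
      using m n by (simp add: merge del: act_proj)
    also have "\<dots> = ?q \<cdot> (?r \<otimes> Idn C ?y) \<cdot> (Inv C (Assc C a ?x ?y) \<cdot> (mlt A \<otimes> Idn C (?x \<odot> ?y)))"
      using m n by simp
    also have "\<dots> = ?q \<cdot> ((?r \<cdot> (mlt A \<otimes> Idn C ?x)) \<otimes> Idn C ?y) \<cdot> Inv C (Assc C (a \<odot> a) ?x ?y)"
      using m n by (simp add: assc_inv_nat_Idn merge)
    also have "\<dots> = ?q \<cdot> ((?r \<cdot> (Idn C a \<otimes> ?r)) \<otimes> Idn C ?y) \<cdot> ((Assc C a a ?x \<otimes> Idn C ?y) \<cdot> Inv C (Assc C (a \<odot> a) ?x ?y))"
      using m n by (simp add: act_mlt merge)
    also have "(Assc C a a ?x \<otimes> Idn C ?y) \<cdot> Inv C (Assc C (a \<odot> a) ?x ?y)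
      = Inv C (Assc C a (a \<odot> ?x) ?y) \<cdot> (Idn C a \<otimes> Inv C (Assc C a ?x ?y)) \<cdot> Assc C a a (?x \<odot> ?y)"
    proof -
      have "(Idn C a \<otimes> Inv C (Assc C a ?x ?y)) \<cdot> Assc C a a (?x \<odot> ?y)
        = (Idn C a \<otimes> Inv C (Assc C a ?x ?y)) \<cdot> (Assc C a a (?x \<odot> ?y) \<cdot> Assc C (a \<odot> a) ?x ?y) \<cdot> Inv C (Assc C (a \<odot> a) ?x ?y)"
        using m n by simp
      also have "\<dots> = Assc C a (a \<odot> ?x) ?y \<cdot> ((Assc C a a ?x \<otimes> Idn C ?y) \<cdot> Inv C (Assc C (a \<odot> a) ?x ?y))"
        using m n by (subst pentagon) (simp_all add: merge)
      finally show ?thesis using m n by simp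
    qed
    also have "?q \<cdot> ((?r \<cdot> (Idn C a \<otimes> ?r)) \<otimes> Idn C ?y) \<cdot> Inv C (Assc C a (a \<odot> ?x) ?y)
        \<cdot> (Idn C a \<otimes> Inv C (Assc C a ?x ?y)) \<cdot> Assc C a a (?x \<odot> ?y)
      = ?q \<cdot> (?r \<otimes> Idn C ?y) \<cdot> (((Idn C a \<otimes> ?r) \<otimes> Idn C ?y) \<cdot> Inv C (Assc C a (a \<odot> ?x) ?y))
        \<cdot> (Idn C a \<otimes> Inv C (Assc C a ?x ?y)) \<cdot> Assc C a a (?x \<odot> ?y)"
      using m n by (simp add: merge)
    also have "\<dots> = ?q \<cdot> (?r \<otimes> Idn C ?y) \<cdot> (Inv C (Assc C a ?x ?y) \<cdot> (Idn C a \<otimes> (?r \<otimes> Idn C ?y)))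
        \<cdot> (Idn C a \<otimes> Inv C (Assc C a ?x ?y)) \<cdot> Assc C a a (?x \<odot> ?y)"
      using m n by (simp add: assc_inv_nat)
    also have "\<dots> = ?w \<cdot> (Idn C a \<otimes> (?w \<cdot> (Idn C a \<otimes> ?q))) \<cdot> Assc C a a (?x \<odot> ?y)"
      using m n by (simp add: merge)
    also have "\<dots> = ?w \<cdot> (Idn C a \<otimes> ?w) \<cdot> ((Idn C a \<otimes> (Idn C a \<otimes> ?q)) \<cdot> Assc C a a (?x \<odot> ?y))"
      using m n by (simp add: merge del: act_proj)
    also have "\<dots> = (?w \<cdot> (Idn C a \<otimes> ?w) \<cdot> Assc C a a ?Q) \<cdot> (Idn C (a \<odot> a) \<otimes> ?q)"
      using m n by (simp add: assc_nat_Idn del: act_proj)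
    finally show "(?w \<cdot> (mlt A \<otimes> Idn C ?Q)) \<cdot> (Idn C (a \<odot> a) \<otimes> ?q)
      = (?w \<cdot> (Idn C a \<otimes> ?w) \<cdot> Assc C a a ?Q) \<cdot> (Idn C (a \<odot> a) \<otimes> ?q)" .
  qed (use m n in \<open>auto intro!: split_epi_ten\<close>)
  show "?w \<cdot> (unt A \<otimes> Idn C ?Q) = Lun C ?Q"
  proof (rule split_epi_cancel[of "Idn C (One C) \<otimes> ?q"])
    have "(?w \<cdot> (unt A \<otimes> Idn C ?Q)) \<cdot> (Idn C (One C) \<otimes> ?q) = ?w \<cdot> ((Idn C a \<otimes> ?q) \<cdot> (unt A \<otimes> Idn C (?x \<odot> ?y)))"
      using m n by (simp add: merge del: act_proj)
    also have "\<dots> = ?q \<cdot> (?r \<otimes> Idn C ?y) \<cdot> (Inv C (Assc C a ?x ?y) \<cdot> (unt A \<otimes> Idn C (?x \<odot> ?y)))"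
      using m n by simp
    also have "\<dots> = ?q \<cdot> (Lun C ?x \<otimes> Idn C ?y) \<cdot> Inv C (Assc C (One C) ?x ?y)"
      using m n by (simp add: assc_inv_nat_Idn merge act_unt)
    also have "\<dots> = Lun C ?Q \<cdot> (Idn C (One C) \<otimes> ?q)"
      using m n by (simp add: lun_ten[symmetric] lun_nat)
    finally show "(?w \<cdot> (unt A \<otimes> Idn C ?Q)) \<cdot> (Idn C (One C) \<otimes> ?q) = Lun C ?Q \<cdot> (Idn C (One C) \<otimes> ?q)" .
  qed (use m n in \<open>auto intro!: split_epi_ten\<close>)
qed (use m n in auto)

section \<open>Linear maps and the underlying arrows of the monoidal structure\<close>

definition linear :: "'o \<times> 'a \<Rightarrow> 'a \<Rightarrow> 'o \<times> 'a \<Rightarrow> bool" where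
  "linear m f n \<longleftrightarrow> is_module_arr C A (m, f, n)"

lemma linear_iff: "linear m f n \<longleftrightarrow> module m \<and> module n \<and> f \<in> Arr C \<and> Dom C f = fst m \<and>
    Cod C f = fst n \<and> f \<cdot> snd m = snd n \<cdot> (Idn C a \<otimes> f)"
  by (auto simp: linear_def is_module_arr_def Hom_iff)

definition und_ten where
  "und_ten m m' n n' f g = descend C (proj m m') (proj n n' \<cdot> (f \<otimes> g))"

lemma und_ten:
  assumes f: "linear m f n" and f': "linear m' f' n'"
  shows "linear (Ten m m') (und_ten m m' n n' f f') (Ten n n')"
    and "und_ten m m' n n' f f' \<cdot> proj m m' = proj n n' \<cdot> (f \<otimes> f')"
proof -
  have m: "module m" "module m'" "module n" "module n'" using assms by (auto simp: linear_iff)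
  have t: "f \<in> Arr C" "Dom C f = fst m" "Cod C f = fst n" "f' \<in> Arr C" "Dom C f' = fst m'" "Cod C f' = fst n'"
    and e: "f \<cdot> snd m = snd n \<cdot> (Idn C a \<otimes> f)" "f' \<cdot> snd m' = snd n' \<cdot> (Idn C a \<otimes> f')"
    using assms by (auto simp: linear_iff)
  have "(proj n n' \<cdot> (f \<otimes> f')) \<cdot> (snd m \<otimes> Idn C (fst m'))
      = (proj n n' \<cdot> (snd n \<otimes> Idn C (fst n'))) \<cdot> ((Idn C a \<otimes> f) \<otimes> f')"
    using m t by (simp add: merge e)
  also have "\<dots> = proj n n' \<cdot> (Idn C (fst n) \<otimes> snd n') \<cdot> (past a (fst n) (fst n') \<cdot> ((Idn C a \<otimes> f) \<otimes> f'))"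
    using m t by (simp add: proj_balanced)
  also have "\<dots> = (proj n n' \<cdot> (f \<otimes> f')) \<cdot> (Idn C (fst m) \<otimes> snd m') \<cdot> past a (fst m) (fst m')"
    using m t by (simp add: past_nat merge e)
  finally have b: "balanced m m' (proj n n' \<cdot> (f \<otimes> f'))"
    using m t by (simp add: balanced_def)
  note d = descend_proj[OF m(1,2) b, folded und_ten_def[of m m' n n' f f']]
  show p: "und_ten m m' n n' f f' \<cdot> proj m m' = proj n n' \<cdot> (f \<otimes> f')" by (rule d(4))
  let ?k = "und_ten m m' n n' f f'"
  have k: "?k \<in> Arr C" "Dom C ?k = fst (Ten m m')" "Cod C ?k = fst (Ten n n')" using d m t by auto
  have "?k \<cdot> snd (Ten m m') = snd (Ten n n') \<cdot> (Idn C a \<otimes> ?k)"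
  proof (rule split_epi_cancel[of "Idn C a \<otimes> proj m m'"])
    have "(?k \<cdot> snd (Ten m m')) \<cdot> (Idn C a \<otimes> proj m m')
      = (?k \<cdot> proj m m') \<cdot> (snd m \<otimes> Idn C (fst m')) \<cdot> Inv C (Assc C a (fst m) (fst m'))"
      using k m by simp
    also have "\<dots> = proj n n' \<cdot> (snd n \<otimes> Idn C (fst n')) \<cdot> ((Idn C a \<otimes> f) \<otimes> f') \<cdot> Inv C (Assc C a (fst m) (fst m'))"
      unfolding p using m t by (simp add: merge e)
    also have "\<dots> = snd (Ten n n') \<cdot> (Idn C a \<otimes> (proj n n' \<cdot> (f \<otimes> f')))"
      using m t by (simp add: assc_inv_nat)
    also have "\<dots> = (snd (Ten n n') \<cdot> (Idn C a \<otimes> ?k)) \<cdot> (Idn C a \<otimes> proj m m')"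
      unfolding p[symmetric] using m k by (simp add: merge)
    finally show "(?k \<cdot> snd (Ten m m')) \<cdot> (Idn C a \<otimes> proj m m')
      = (snd (Ten n n') \<cdot> (Idn C a \<otimes> ?k)) \<cdot> (Idn C a \<otimes> proj m m')" .
  qed (use m k in \<open>auto intro!: split_epi_ten\<close>)
  then show "linear (Ten m m') ?k (Ten n n')" using m k by (simp add: linear_iff)
qed

definition und_brd where
  "und_brd m n = descend C (proj m n) (proj n m \<cdot> Brd C (fst m) (fst n))"

lemma und_brd:
  assumes m: "module m" and n: "module n"
  shows "linear (Ten m n) (und_brd m n) (Ten n m)"
    and "und_brd m n \<cdot> proj m n = proj n m \<cdot> Brd C (fst m) (fst n)"
proof -
  let ?x = "fst m" and ?y = "fst n" and ?r = "snd m" and ?s = "snd n" and ?q = "proj n m"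
  \<comment> \<open>The two hexagons written with \<open>past\<close>. The right-hand side of
    \<open>c2\<close> is a factor of that of \<open>c1\<close>, so
    \<open>Brd C (a \<odot> ?x) ?y\<close> consists of two crossings around
    \<open>Brd C ?x (a \<odot> ?y)\<close>.\<close>
  have c1: "Brd C (a \<odot> ?x) ?y = past a ?y ?x \<cdot> Inv C (Assc C a ?y ?x) \<cdot> (Idn C a \<otimes> Brd C ?x ?y) \<cdot> Assc C a ?x ?y"
    using m n by (simp add: brd_ten_left past_def)
  have c2: "Brd C ?x (a \<odot> ?y) \<cdot> past a ?x ?y = Inv C (Assc C a ?y ?x) \<cdot> (Idn C a \<otimes> Brd C ?x ?y) \<cdot> Assc C a ?x ?y"
  proof -
    have "Brd C ?x (a \<odot> ?y) \<cdot> past a ?x ?y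
      = Inv C (Assc C a ?y ?x) \<cdot> (Assc C a ?y ?x \<cdot> Brd C ?x (a \<odot> ?y) \<cdot> Assc C ?x a ?y) \<cdot> (Brd C a ?x \<otimes> Idn C ?y)"
      using m n by (simp add: past_def)
    also have "\<dots> = Inv C (Assc C a ?y ?x) \<cdot> (Idn C a \<otimes> Brd C ?x ?y) \<cdot> Assc C a ?x ?y"
      using m n by (subst hexagon) (simp_all add: merge)
    finally show ?thesis .
  qed
  have "(?q \<cdot> Brd C ?x ?y) \<cdot> (?r \<otimes> Idn C ?y) = ?q \<cdot> (Idn C ?y \<otimes> ?r) \<cdot> Brd C (a \<odot> ?x) ?y"
    using m n by (simp add: brd_nat)
  also have "\<dots> = (?q \<cdot> (Idn C ?y \<otimes> ?r) \<cdot> past a ?y ?x) \<cdot> (Brd C ?x (a \<odot> ?y) \<cdot> past a ?x ?y)"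
    unfolding c1 c2 using m n by simp
  also have "\<dots> = (?q \<cdot> Brd C ?x ?y) \<cdot> (Idn C ?x \<otimes> ?s) \<cdot> past a ?x ?y"
    unfolding proj_balanced[OF n m, symmetric] using m n by (simp add: brd_nat)
  finally have b: "balanced m n (?q \<cdot> Brd C ?x ?y)" using m n by (simp add: balanced_def)
  note d = descend_proj[OF m n b, folded und_brd_def[of m n]]
  show p: "und_brd m n \<cdot> proj m n = ?q \<cdot> Brd C ?x ?y" by (rule d(4))
  let ?k = "und_brd m n"
  have k: "?k \<in> Arr C" "Dom C ?k = fst (Ten m n)" "Cod C ?k = fst (Ten n m)" using d m n by auto
  have "?k \<cdot> snd (Ten m n) = snd (Ten n m) \<cdot> (Idn C a \<otimes> ?k)"
  proof (rule split_epi_cancel[of "Idn C a \<otimes> proj m n"])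
    have "(?k \<cdot> snd (Ten m n)) \<cdot> (Idn C a \<otimes> proj m n)
      = (?k \<cdot> proj m n) \<cdot> (?r \<otimes> Idn C ?y) \<cdot> Inv C (Assc C a ?x ?y)"
      using k m n by simp
    also have "\<dots> = ?q \<cdot> (Idn C ?y \<otimes> ?r) \<cdot> Brd C (a \<odot> ?x) ?y \<cdot> Inv C (Assc C a ?x ?y)"
      unfolding p using m n by (simp add: brd_nat)
    also have "\<dots> = (?q \<cdot> (Idn C ?y \<otimes> ?r) \<cdot> past a ?y ?x) \<cdot> Inv C (Assc C a ?y ?x) \<cdot> (Idn C a \<otimes> Brd C ?x ?y)"
      unfolding c1 using m n by simp
    also have "\<dots> = snd (Ten n m) \<cdot> (Idn C a \<otimes> (?q \<cdot> Brd C ?x ?y))"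
      unfolding proj_balanced[OF n m, symmetric] using m n by simp
    also have "\<dots> = (snd (Ten n m) \<cdot> (Idn C a \<otimes> ?k)) \<cdot> (Idn C a \<otimes> proj m n)"
      unfolding p[symmetric] using m n k by (simp add: merge)
    finally show "(?k \<cdot> snd (Ten m n)) \<cdot> (Idn C a \<otimes> proj m n)
      = (snd (Ten n m) \<cdot> (Idn C a \<otimes> ?k)) \<cdot> (Idn C a \<otimes> proj m n)" .
  qed (use m n k in \<open>auto intro!: split_epi_ten\<close>)
  then show "linear (Ten m n) ?k (Ten n m)" using m n k by (simp add: linear_iff)
qed

definition und_lun where "und_lun m = descend C (proj (a, mlt A) m) (snd m)"

text \<open>The inverse sends \<open>x\<close> to the class of \<open>1 \<otimes> x\<close>. One
  composite is the unit law of the module; the other says that \<open>c \<otimes> x\<close> and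
  \<open>1 \<otimes> c x\<close> have the same class, which is balancedness together with
  commutativity of \<open>A\<close>.\<close>

lemma und_lun:
  assumes m: "module m"
  shows "linear (Ten (a, mlt A) m) (und_lun m) m" and "und_lun m \<cdot> proj (a, mlt A) m = snd m"
    and "is_iso C (und_lun m)"
    and "Inv C (und_lun m) = proj (a, mlt A) m \<cdot> (unt A \<otimes> Idn C (fst m)) \<cdot> Inv C (Lun C (fst m))"
proof -
  let ?A = "(a, mlt A)" and ?x = "fst m" and ?r = "snd m" and ?k = "und_lun m"
  let ?q = "proj ?A m"
  have b: "balanced ?A m ?r"
    unfolding balanced_def using m by (simp add: act_act_past act_mlt)
  note d = descend_proj[OF A_module m b, folded und_lun_def[of m]]
  show p: "?k \<cdot> ?q = ?r" by (rule d(4))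
  have k: "?k \<in> Arr C" "Dom C ?k = fst (Ten ?A m)" "Cod C ?k = ?x" using d m by auto
  have "?k \<cdot> snd (Ten ?A m) = ?r \<cdot> (Idn C a \<otimes> ?k)"
  proof (rule split_epi_cancel[of "Idn C a \<otimes> ?q"])
    have "(?k \<cdot> snd (Ten ?A m)) \<cdot> (Idn C a \<otimes> ?q)
      = (?k \<cdot> ?q) \<cdot> (mlt A \<otimes> Idn C ?x) \<cdot> Inv C (Assc C a a ?x)"
      using k m by simp
    also have "\<dots> = ?r \<cdot> (Idn C a \<otimes> (?k \<cdot> ?q))"
      unfolding p using m by (simp add: act_act)
    also have "\<dots> = (?r \<cdot> (Idn C a \<otimes> ?k)) \<cdot> (Idn C a \<otimes> ?q)"
      using m k by (simp add: merge)
    finally show "(?k \<cdot> snd (Ten ?A m)) \<cdot> (Idn C a \<otimes> ?q) = (?r \<cdot> (Idn C a \<otimes> ?k)) \<cdot> (Idn C a \<otimes> ?q)" .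
  qed (use m k in \<open>auto intro!: split_epi_ten\<close>)
  then show "linear (Ten ?A m) ?k m" using m k by (simp add: linear_iff)
  let ?g = "?q \<cdot> (unt A \<otimes> Idn C ?x) \<cdot> Inv C (Lun C ?x)"
  have kg: "?k \<cdot> ?g = Idn C ?x"
    using m k tail[OF p, of "(unt A \<otimes> Idn C ?x) \<cdot> Inv C (Lun C ?x)"] by (simp add: tail[OF act_unt])
  \<comment> \<open>In elements: \<open>b \<otimes> c x\<close> and \<open>b c \<otimes> x\<close>
    have the same class.\<close>
  have q: "?q \<cdot> (Idn C a \<otimes> ?r) = ?q \<cdot> (mlt A \<otimes> Idn C ?x) \<cdot> Inv C (Assc C a a ?x)"
  proof -
    have "?q \<cdot> (Idn C a \<otimes> ?r) = (?q \<cdot> (Idn C a \<otimes> ?r) \<cdot> past a a ?x) \<cdot> (Brd C a a \<otimes> Idn C ?x) \<cdot> Inv C (Assc C a a ?x)"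
      using m by (simp add: past_def merge)
    also have "\<dots> = (?q \<cdot> (mlt A \<otimes> Idn C ?x)) \<cdot> (Brd C a a \<otimes> Idn C ?x) \<cdot> Inv C (Assc C a a ?x)"
      using proj_balanced[OF A_module m] by simp
    also have "\<dots> = ?q \<cdot> (mlt A \<otimes> Idn C ?x) \<cdot> Inv C (Assc C a a ?x)"
      using m by (simp add: merge A_comm)
    finally show ?thesis .
  qed
  have "?g \<cdot> ?k = Idn C (fst (Ten ?A m))"
  proof (rule split_epi_cancel[of ?q])
    have "(?g \<cdot> ?k) \<cdot> ?q = ?q \<cdot> (unt A \<otimes> Idn C ?x) \<cdot> (Inv C (Lun C ?x) \<cdot> ?r)"
      using m k p by simp
    also have "\<dots> = (?q \<cdot> (Idn C a \<otimes> ?r)) \<cdot> (unt A \<otimes> Idn C (a \<odot> ?x)) \<cdot> Inv C (Lun C (a \<odot> ?x))"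
      using m by (simp add: lun_inv_nat merge)
    also have "\<dots> = ?q \<cdot> (mlt A \<otimes> Idn C ?x) \<cdot> ((unt A \<otimes> Idn C a) \<otimes> Idn C ?x)
        \<cdot> Inv C (Assc C (One C) a ?x) \<cdot> Inv C (Lun C (a \<odot> ?x))"
      unfolding q using m by (simp add: assc_inv_nat_Idn)
    also have "\<dots> = ?q \<cdot> (Lun C a \<otimes> Idn C ?x) \<cdot> Inv C (Assc C (One C) a ?x) \<cdot> Inv C (Lun C (a \<odot> ?x))"
      using m by (simp add: merge A_unit_left)
    also have "\<dots> = Idn C (fst (Ten ?A m)) \<cdot> ?q"
      using m by (simp add: lun_ten[symmetric])
    finally show "(?g \<cdot> ?k) \<cdot> ?q = Idn C (fst (Ten ?A m)) \<cdot> ?q" .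
  qed (use m k in auto)
  then show "is_iso C ?k" "Inv C ?k = ?g"
    using Inv_eqI[of ?k ?g] k kg m by auto
qed

definition und_run where
  "und_run m = descend C (proj m (a, mlt A)) (snd m \<cdot> Brd C (fst m) a)"

lemma linear_comp: "linear l f m \<Longrightarrow> linear m g n \<Longrightarrow> linear l (g \<cdot> f) n"
  unfolding linear_iff
  using assoc[of "snd l" f g] assoc[of "Idn C a \<otimes> f" "snd m" g] assoc[of "Idn C a \<otimes> f" "Idn C a \<otimes> g" "snd n"]
  by (auto simp: merge simp flip: assoc)

text \<open>Both sides factor the same map through \<open>proj m (a, mlt A)\<close>. The right
  unitor thus inherits linearity and invertibility from the left unitor and the braiding.\<close>

lemma und_run_eq:
  assumes m: "module m"
  shows "und_run m = und_lun m \<cdot> und_brd m (a, mlt A)"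
  unfolding und_run_def
  using m und_lun[OF m] und_brd[OF m A_module]
    tail[OF und_lun(2)[OF m], of "Brd C (fst m) a"]
  by (intro descend_eq) (auto simp: linear_iff)

lemma und_run:
  assumes m: "module m"
  shows "linear (Ten m (a, mlt A)) (und_run m) m" and "und_run m \<cdot> proj m (a, mlt A) = snd m \<cdot> Brd C (fst m) a"
proof -
  show "linear (Ten m (a, mlt A)) (und_run m) m"
    unfolding und_run_eq[OF m] using und_lun(1)[OF m] und_brd(1)[OF m A_module] by (rule linear_comp[rotated])
  show "und_run m \<cdot> proj m (a, mlt A) = snd m \<cdot> Brd C (fst m) a"
    unfolding und_run_eq[OF m] using m und_lun[OF m] und_brd[OF m A_module]
    tail[OF und_lun(2)[OF m], of "Brd C (fst m) a"] by (simp add: linear_iff)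
qed

section \<open>The associator of modules\<close>

definition und_assc where
  "und_assc l m n = descend C (proj (Ten l m) n \<cdot> (proj l m \<otimes> Idn C (fst n)))
     (proj l (Ten m n) \<cdot> (Idn C (fst l) \<otimes> proj m n) \<cdot> Assc C (fst l) (fst m) (fst n))"

context
  fixes l m n
  assumes l: "module l" and m: "module m" and n: "module n"
begin

text \<open>A scalar on \<open>l\<close> passes to \<open>Ten m n\<close>, whose action is the one
  on \<open>m\<close>. This is the common first step of both balancedness conditions for the
  associator.\<close>

lemma proj_assc_act:
  "proj l (Ten m n) \<cdot> (Idn C (fst l) \<otimes> proj m n) \<cdot> Assc C (fst l) (fst m) (fst n)
      \<cdot> ((snd l \<otimes> Idn C (fst m)) \<otimes> Idn C (fst n))
    = proj l (Ten m n) \<cdot> (Idn C (fst l) \<otimes> (proj m n \<cdot> (snd m \<otimes> Idn C (fst n))))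
      \<cdot> Assc C (fst l) (a \<odot> fst m) (fst n) \<cdot> (past a (fst l) (fst m) \<otimes> Idn C (fst n))"
proof -
  let ?x = "fst l" and ?y = "fst m" and ?z = "fst n" and ?Q = "fst (Ten m n)"
  have "proj l (Ten m n) \<cdot> (Idn C ?x \<otimes> proj m n) \<cdot> Assc C ?x ?y ?z \<cdot> ((snd l \<otimes> Idn C ?y) \<otimes> Idn C ?z)
    = (proj l (Ten m n) \<cdot> (snd l \<otimes> Idn C ?Q)) \<cdot> (Idn C (a \<odot> ?x) \<otimes> proj m n) \<cdot> Assc C (a \<odot> ?x) ?y ?z"
    using l m n by (simp add: assc_nat merge)
  also have "\<dots> = proj l (Ten m n) \<cdot> (Idn C ?x \<otimes> snd (Ten m n))
      \<cdot> (past a ?x ?Q \<cdot> (Idn C (a \<odot> ?x) \<otimes> proj m n)) \<cdot> Assc C (a \<odot> ?x) ?y ?z"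
    using l m n by (simp add: proj_balanced)
  also have "\<dots> = proj l (Ten m n) \<cdot> (Idn C ?x \<otimes> (proj m n \<cdot> (snd m \<otimes> Idn C ?z)))
      \<cdot> (Idn C ?x \<otimes> Inv C (Assc C a ?y ?z)) \<cdot> (past a ?x (?y \<odot> ?z) \<cdot> Assc C (a \<odot> ?x) ?y ?z)"
    using l m n by (simp add: past_nat_Idn merge)
  also have "\<dots> = proj l (Ten m n) \<cdot> (Idn C ?x \<otimes> (proj m n \<cdot> (snd m \<otimes> Idn C ?z)))
      \<cdot> Assc C ?x (a \<odot> ?y) ?z \<cdot> (past a ?x ?y \<otimes> Idn C ?z)"
    using l m n by (simp add: past_assc[symmetric] merge)
  finally show ?thesis .
qed

text \<open>Descent in two stages. The map \<open>?T\<close> is balanced over the inner pair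
  \<open>l\<close>, \<open>m\<close>, which gives \<open>f\<close>; then \<open>f\<close> is
  balanced for the outer pair. The second condition is an equation on a tensor product over
  \<open>A\<close> and is tested after the split epimorphism covering the inner projection.\<close>

lemma und_assc0:
  obtains k where "k \<in> Arr C" "Dom C k = fst (Ten (Ten l m) n)" "Cod C k = fst (Ten l (Ten m n))"
    "k \<cdot> proj (Ten l m) n \<cdot> (proj l m \<otimes> Idn C (fst n))
      = proj l (Ten m n) \<cdot> (Idn C (fst l) \<otimes> proj m n) \<cdot> Assc C (fst l) (fst m) (fst n)"
proof -
  let ?x = "fst l" and ?y = "fst m" and ?z = "fst n" and ?Q = "fst (Ten l m)"
  let ?T = "proj l (Ten m n) \<cdot> (Idn C ?x \<otimes> proj m n) \<cdot> Assc C ?x ?y ?z"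
  have T: "?T \<in> Arr C" "Dom C ?T = (?x \<odot> ?y) \<odot> ?z" "Cod C ?T = fst (Ten l (Ten m n))"
    using l m n by auto
  have eq: "?T \<cdot> ((snd l \<otimes> Idn C ?y) \<otimes> Idn C ?z)
      = ?T \<cdot> (((Idn C ?x \<otimes> snd m) \<cdot> past a ?x ?y) \<otimes> Idn C ?z)"
  proof -
    have "?T \<cdot> ((snd l \<otimes> Idn C ?y) \<otimes> Idn C ?z) = proj l (Ten m n) \<cdot> (Idn C ?x \<otimes> proj m n)
      \<cdot> ((Idn C ?x \<otimes> (snd m \<otimes> Idn C ?z)) \<cdot> Assc C ?x (a \<odot> ?y) ?z) \<cdot> (past a ?x ?y \<otimes> Idn C ?z)"
      using l m n proj_assc_act by (simp add: merge)
    also have "\<dots> = proj l (Ten m n) \<cdot> (Idn C ?x \<otimes> proj m n)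
      \<cdot> (Assc C ?x ?y ?z \<cdot> ((Idn C ?x \<otimes> snd m) \<otimes> Idn C ?z)) \<cdot> (past a ?x ?y \<otimes> Idn C ?z)"
      using l m n by (simp add: assc_nat)
    also have "\<dots> = ?T \<cdot> (((Idn C ?x \<otimes> snd m) \<cdot> past a ?x ?y) \<otimes> Idn C ?z)"
      using l m n by (simp add: merge)
    finally show ?thesis .
  qed
  obtain f where f: "f \<in> Arr C" "Dom C f = ?Q \<odot> ?z" "Cod C f = Cod C ?T"
    and fT: "f \<cdot> (proj l m \<otimes> Idn C ?z) = ?T"
    by (rule descend_proj_left[OF l m _ T(1,2) eq]) (use n in auto)
  have "f \<cdot> (snd (Ten l m) \<otimes> Idn C ?z) = f \<cdot> (Idn C ?Q \<otimes> snd n) \<cdot> past a ?Q ?z"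
  proof (rule split_epi_cancel[of "(Idn C a \<otimes> proj l m) \<otimes> Idn C ?z"])
    have "(f \<cdot> (snd (Ten l m) \<otimes> Idn C ?z)) \<cdot> ((Idn C a \<otimes> proj l m) \<otimes> Idn C ?z)
      = (f \<cdot> (proj l m \<otimes> Idn C ?z)) \<cdot> ((snd l \<otimes> Idn C ?y) \<otimes> Idn C ?z) \<cdot> (Inv C (Assc C a ?x ?y) \<otimes> Idn C ?z)"
      using l m n f by (simp add: merge)
    also have "\<dots> = (?T \<cdot> ((snd l \<otimes> Idn C ?y) \<otimes> Idn C ?z)) \<cdot> (Inv C (Assc C a ?x ?y) \<otimes> Idn C ?z)"
      unfolding fT using l m n by simp
    also have "\<dots> = proj l (Ten m n) \<cdot> (Idn C ?x \<otimes> (proj m n \<cdot> (Idn C ?y \<otimes> snd n)))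
      \<cdot> ((Idn C ?x \<otimes> past a ?y ?z) \<cdot> Assc C ?x (a \<odot> ?y) ?z \<cdot> (past a ?x ?y \<otimes> Idn C ?z))
      \<cdot> (Inv C (Assc C a ?x ?y) \<otimes> Idn C ?z)"
      using l m n proj_assc_act proj_balanced[OF m n] by (simp add: merge)
    also have "\<dots> = proj l (Ten m n) \<cdot> (Idn C ?x \<otimes> proj m n)
      \<cdot> ((Idn C ?x \<otimes> (Idn C ?y \<otimes> snd n)) \<cdot> Assc C ?x ?y (a \<odot> ?z)) \<cdot> past a (?x \<odot> ?y) ?z"
      using l m n by (simp add: past_ten merge)
    also have "\<dots> = ?T \<cdot> (Idn C (?x \<odot> ?y) \<otimes> snd n) \<cdot> past a (?x \<odot> ?y) ?z"
      using l m n by (simp add: assc_nat_Idn)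
    also have "\<dots> = f \<cdot> (proj l m \<otimes> snd n) \<cdot> past a (?x \<odot> ?y) ?z"
      unfolding fT[symmetric] using l m n f by (simp add: merge)
    also have "\<dots> = f \<cdot> (Idn C ?Q \<otimes> snd n) \<cdot> (proj l m \<otimes> Idn C (a \<odot> ?z)) \<cdot> past a (?x \<odot> ?y) ?z"
      using l m n f by (simp add: merge)
    also have "\<dots> = (f \<cdot> (Idn C ?Q \<otimes> snd n) \<cdot> past a ?Q ?z) \<cdot> ((Idn C a \<otimes> proj l m) \<otimes> Idn C ?z)"
      using l m n f by (simp add: past_nat)
    finally show "(f \<cdot> (snd (Ten l m) \<otimes> Idn C ?z)) \<cdot> ((Idn C a \<otimes> proj l m) \<otimes> Idn C ?z)
      = (f \<cdot> (Idn C ?Q \<otimes> snd n) \<cdot> past a ?Q ?z) \<cdot> ((Idn C a \<otimes> proj l m) \<otimes> Idn C ?z)" .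
  qed (use l m n f in \<open>auto intro!: split_epi_ten\<close>)
  then have b: "balanced (Ten l m) n f" using f by (simp add: balanced_def)
  note d = descend_proj[OF Ten_module[OF l m] n b]
  show ?thesis
    by (rule that[OF d(1,2)]) (use d f T l m n fT tail[OF d(4)] in simp_all)
qed

lemma und_assc_typed [simp]:
  "und_assc l m n \<in> Arr C" "Dom C (und_assc l m n) = fst (Ten (Ten l m) n)"
  "Cod C (und_assc l m n) = fst (Ten l (Ten m n))"
  and und_assc: "und_assc l m n \<cdot> proj (Ten l m) n \<cdot> (proj l m \<otimes> Idn C (fst n))
      = proj l (Ten m n) \<cdot> (Idn C (fst l) \<otimes> proj m n) \<cdot> Assc C (fst l) (fst m) (fst n)"
proof -
  obtain k where k: "k \<in> Arr C" "Dom C k = fst (Ten (Ten l m) n)" "Cod C k = fst (Ten l (Ten m n))"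
    and eq: "k \<cdot> proj (Ten l m) n \<cdot> (proj l m \<otimes> Idn C (fst n))
      = proj l (Ten m n) \<cdot> (Idn C (fst l) \<otimes> proj m n) \<cdot> Assc C (fst l) (fst m) (fst n)"
    by (rule und_assc0)
  have "und_assc l m n = k"
    unfolding und_assc_def
    by (rule descend_eq) (use l m n k eq in \<open>auto intro!: split_epi_ten split_epi_comp\<close>)
  then show "und_assc l m n \<in> Arr C" "Dom C (und_assc l m n) = fst (Ten (Ten l m) n)"
    "Cod C (und_assc l m n) = fst (Ten l (Ten m n))"
    "und_assc l m n \<cdot> proj (Ten l m) n \<cdot> (proj l m \<otimes> Idn C (fst n))
      = proj l (Ten m n) \<cdot> (Idn C (fst l) \<otimes> proj m n) \<cdot> Assc C (fst l) (fst m) (fst n)"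
    using k eq by auto
qed

text \<open>Invertibility is not automatic for a descended map, so the inverse associator of
  \<open>C\<close> is descended as well, now with \<open>m\<close>, \<open>n\<close> as the inner
  pair.\<close>

lemma und_assc_inverse:
  obtains k where "k \<in> Arr C" "Dom C k = fst (Ten l (Ten m n))" "Cod C k = fst (Ten (Ten l m) n)"
    "k \<cdot> proj l (Ten m n) \<cdot> (Idn C (fst l) \<otimes> proj m n)
      = proj (Ten l m) n \<cdot> (proj l m \<otimes> Idn C (fst n)) \<cdot> Inv C (Assc C (fst l) (fst m) (fst n))"
proof -
  let ?x = "fst l" and ?y = "fst m" and ?z = "fst n" and ?Q = "fst (Ten m n)" and ?R = "fst (Ten l m)"
  let ?T = "proj (Ten l m) n \<cdot> (proj l m \<otimes> Idn C ?z) \<cdot> Inv C (Assc C ?x ?y ?z)"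
  have T: "?T \<in> Arr C" "Dom C ?T = ?x \<odot> (?y \<odot> ?z)" "Cod C ?T = fst (Ten (Ten l m) n)"
    using l m n by auto
  \<comment> \<open>A scalar acting on \<open>l\<close> is carried across
    \<open>?x \<odot> ?y\<close> to \<open>n\<close>. Both balancedness conditions below rest on
    this.\<close>
  have key: "proj (Ten l m) n \<cdot> ((proj l m \<cdot> (snd l \<otimes> Idn C ?y)) \<otimes> Idn C ?z)
      = ?T \<cdot> (Idn C ?x \<otimes> (Idn C ?y \<otimes> snd n)) \<cdot> Assc C ?x ?y (a \<odot> ?z) \<cdot> past a (?x \<odot> ?y) ?z
        \<cdot> (Assc C a ?x ?y \<otimes> Idn C ?z)"
  proof -
    have "proj (Ten l m) n \<cdot> ((proj l m \<cdot> (snd l \<otimes> Idn C ?y)) \<otimes> Idn C ?z)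
      = (proj (Ten l m) n \<cdot> (snd (Ten l m) \<otimes> Idn C ?z)) \<cdot> (((Idn C a \<otimes> proj l m) \<cdot> Assc C a ?x ?y) \<otimes> Idn C ?z)"
      using l m n by (simp add: merge)
    also have "\<dots> = proj (Ten l m) n \<cdot> (Idn C ?R \<otimes> snd n) \<cdot> (past a ?R ?z \<cdot> ((Idn C a \<otimes> proj l m) \<otimes> Idn C ?z))
        \<cdot> (Assc C a ?x ?y \<otimes> Idn C ?z)"
      using l m n by (simp add: proj_balanced merge)
    also have "\<dots> = proj (Ten l m) n \<cdot> (proj l m \<otimes> Idn C ?z) \<cdot> (Idn C (?x \<odot> ?y) \<otimes> snd n) \<cdot> past a (?x \<odot> ?y) ?z
        \<cdot> (Assc C a ?x ?y \<otimes> Idn C ?z)"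
      using l m n by (simp add: past_nat merge)
    also have "\<dots> = ?T \<cdot> (Assc C ?x ?y ?z \<cdot> (Idn C (?x \<odot> ?y) \<otimes> snd n)) \<cdot> past a (?x \<odot> ?y) ?z
        \<cdot> (Assc C a ?x ?y \<otimes> Idn C ?z)"
      using l m n by simp
    also have "\<dots> = ?T \<cdot> (Idn C ?x \<otimes> (Idn C ?y \<otimes> snd n)) \<cdot> Assc C ?x ?y (a \<odot> ?z) \<cdot> past a (?x \<odot> ?y) ?z
        \<cdot> (Assc C a ?x ?y \<otimes> Idn C ?z)"
      using l m n by (simp add: assc_nat_Idn)
    finally show ?thesis .
  qed
  have eq: "?T \<cdot> (Idn C ?x \<otimes> (snd m \<otimes> Idn C ?z))
      = ?T \<cdot> (Idn C ?x \<otimes> ((Idn C ?y \<otimes> snd n) \<cdot> past a ?y ?z))"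
  proof (rule iso_cancel_right[of "Assc C ?x (a \<odot> ?y) ?z \<cdot> (past a ?x ?y \<otimes> Idn C ?z)"])
    have "(?T \<cdot> (Idn C ?x \<otimes> (snd m \<otimes> Idn C ?z))) \<cdot> Assc C ?x (a \<odot> ?y) ?z \<cdot> (past a ?x ?y \<otimes> Idn C ?z)
      = ?T \<cdot> ((Idn C ?x \<otimes> (snd m \<otimes> Idn C ?z)) \<cdot> Assc C ?x (a \<odot> ?y) ?z) \<cdot> (past a ?x ?y \<otimes> Idn C ?z)"
      using l m n by simp
    also have "\<dots> = ?T \<cdot> (Assc C ?x ?y ?z \<cdot> ((Idn C ?x \<otimes> snd m) \<otimes> Idn C ?z)) \<cdot> (past a ?x ?y \<otimes> Idn C ?z)"
      using l m n by (simp add: assc_nat)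
    also have "\<dots> = proj (Ten l m) n \<cdot> ((proj l m \<cdot> (Idn C ?x \<otimes> snd m) \<cdot> past a ?x ?y) \<otimes> Idn C ?z)"
      using l m n by (simp add: merge)
    also have "\<dots> = ?T \<cdot> (Idn C ?x \<otimes> (Idn C ?y \<otimes> snd n)) \<cdot> Assc C ?x ?y (a \<odot> ?z) \<cdot> past a (?x \<odot> ?y) ?z
        \<cdot> (Assc C a ?x ?y \<otimes> Idn C ?z)"
      unfolding proj_balanced[OF l m, symmetric] key ..
    also have "\<dots> = (?T \<cdot> (Idn C ?x \<otimes> ((Idn C ?y \<otimes> snd n) \<cdot> past a ?y ?z)))
        \<cdot> Assc C ?x (a \<odot> ?y) ?z \<cdot> (past a ?x ?y \<otimes> Idn C ?z)"
      using l m n past_ten[of a ?x ?y ?z, symmetric] by (simp add: merge)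
    finally show "(?T \<cdot> (Idn C ?x \<otimes> (snd m \<otimes> Idn C ?z))) \<cdot> Assc C ?x (a \<odot> ?y) ?z \<cdot> (past a ?x ?y \<otimes> Idn C ?z)
      = (?T \<cdot> (Idn C ?x \<otimes> ((Idn C ?y \<otimes> snd n) \<cdot> past a ?y ?z)))
        \<cdot> Assc C ?x (a \<odot> ?y) ?z \<cdot> (past a ?x ?y \<otimes> Idn C ?z)" .
  qed (use l m n in \<open>auto intro!: is_iso_comp\<close>)
  obtain f where f: "f \<in> Arr C" "Dom C f = ?x \<odot> ?Q" "Cod C f = Cod C ?T"
    and fT: "f \<cdot> (Idn C ?x \<otimes> proj m n) = ?T"
    by (rule descend_proj_right[OF m n _ T(1,2) eq]) (use l in auto)
  have "f \<cdot> (snd l \<otimes> Idn C ?Q) = f \<cdot> (Idn C ?x \<otimes> snd (Ten m n)) \<cdot> past a ?x ?Q"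
  proof (rule split_epi_cancel[of "(Idn C (a \<odot> ?x) \<otimes> proj m n) \<cdot> Assc C (a \<odot> ?x) ?y ?z"])
    have "(f \<cdot> (snd l \<otimes> Idn C ?Q)) \<cdot> (Idn C (a \<odot> ?x) \<otimes> proj m n) \<cdot> Assc C (a \<odot> ?x) ?y ?z
      = (f \<cdot> (Idn C ?x \<otimes> proj m n)) \<cdot> ((snd l \<otimes> Idn C (?y \<odot> ?z)) \<cdot> Assc C (a \<odot> ?x) ?y ?z)"
      using l m n f by (simp add: merge)
    also have "\<dots> = ?T \<cdot> (Assc C ?x ?y ?z \<cdot> ((snd l \<otimes> Idn C ?y) \<otimes> Idn C ?z))"
      unfolding fT using l m n assc_nat[of "snd l" "Idn C ?y" "Idn C ?z" ?x ?y ?z] by simp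
    also have "\<dots> = proj (Ten l m) n \<cdot> ((proj l m \<cdot> (snd l \<otimes> Idn C ?y)) \<otimes> Idn C ?z)"
      using l m n by (simp add: merge)
    also have "\<dots> = (?T \<cdot> (Idn C ?x \<otimes> ((Idn C ?y \<otimes> snd n) \<cdot> past a ?y ?z)))
        \<cdot> Assc C ?x (a \<odot> ?y) ?z \<cdot> (past a ?x ?y \<otimes> Idn C ?z)"
      unfolding key using l m n past_ten[of a ?x ?y ?z, symmetric] by (simp add: merge)
    also have "\<dots> = (?T \<cdot> (Idn C ?x \<otimes> (snd m \<otimes> Idn C ?z)))
        \<cdot> Assc C ?x (a \<odot> ?y) ?z \<cdot> (past a ?x ?y \<otimes> Idn C ?z)"
      unfolding eq ..
    also have "\<dots> = f \<cdot> (Idn C ?x \<otimes> (proj m n \<cdot> (snd m \<otimes> Idn C ?z)))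
        \<cdot> Assc C ?x (a \<odot> ?y) ?z \<cdot> (past a ?x ?y \<otimes> Idn C ?z)"
      unfolding fT[symmetric] using l m n f by (simp add: merge)
    also have "\<dots> = f \<cdot> (Idn C ?x \<otimes> (snd (Ten m n) \<cdot> (Idn C a \<otimes> proj m n)))
        \<cdot> ((Idn C ?x \<otimes> Assc C a ?y ?z) \<cdot> Assc C ?x (a \<odot> ?y) ?z \<cdot> (past a ?x ?y \<otimes> Idn C ?z))"
      using l m n f by (simp add: merge)
    also have "\<dots> = f \<cdot> (Idn C ?x \<otimes> snd (Ten m n)) \<cdot> ((Idn C ?x \<otimes> (Idn C a \<otimes> proj m n))
        \<cdot> past a ?x (?y \<odot> ?z)) \<cdot> Assc C (a \<odot> ?x) ?y ?z"
      using l m n f by (simp add: past_assc merge del: act_proj)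
    also have "\<dots> = (f \<cdot> (Idn C ?x \<otimes> snd (Ten m n)) \<cdot> past a ?x ?Q)
        \<cdot> (Idn C (a \<odot> ?x) \<otimes> proj m n) \<cdot> Assc C (a \<odot> ?x) ?y ?z"
      using l m n f by (simp add: past_nat_Idn)
    finally show "(f \<cdot> (snd l \<otimes> Idn C ?Q)) \<cdot> (Idn C (a \<odot> ?x) \<otimes> proj m n) \<cdot> Assc C (a \<odot> ?x) ?y ?z
      = (f \<cdot> (Idn C ?x \<otimes> snd (Ten m n)) \<cdot> past a ?x ?Q)
        \<cdot> (Idn C (a \<odot> ?x) \<otimes> proj m n) \<cdot> Assc C (a \<odot> ?x) ?y ?z" .
  qed (use l m n f in \<open>auto intro!: split_epi_ten split_epi_comp intro: iso_split_epi\<close>)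
  then have b: "balanced l (Ten m n) f" using f by (simp add: balanced_def)
  note d = descend_proj[OF l Ten_module[OF m n] b]
  show ?thesis
    by (rule that[OF d(1,2)]) (use d f T l m n fT tail[OF d(4)] in simp_all)
qed

lemma und_assc_iso: "is_iso C (und_assc l m n)"
proof -
  let ?x = "fst l" and ?y = "fst m" and ?z = "fst n"
  let ?p = "proj (Ten l m) n \<cdot> (proj l m \<otimes> Idn C ?z)"
  let ?p' = "proj l (Ten m n) \<cdot> (Idn C ?x \<otimes> proj m n)"
  obtain k where k: "k \<in> Arr C" "Dom C k = fst (Ten l (Ten m n))" "Cod C k = fst (Ten (Ten l m) n)"
    and kp: "k \<cdot> ?p' = proj (Ten l m) n \<cdot> (proj l m \<otimes> Idn C ?z) \<cdot> Inv C (Assc C ?x ?y ?z)"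
    by (rule und_assc_inverse)
  have up: "und_assc l m n \<cdot> ?p = proj l (Ten m n) \<cdot> (Idn C ?x \<otimes> proj m n) \<cdot> Assc C ?x ?y ?z"
    by (rule und_assc)
  have "k \<cdot> und_assc l m n = Idn C (fst (Ten (Ten l m) n))"
  proof (rule split_epi_cancel[of ?p])
    have "(k \<cdot> und_assc l m n) \<cdot> ?p = k \<cdot> (und_assc l m n \<cdot> ?p)" using k l m n by simp
    also have "\<dots> = (k \<cdot> ?p') \<cdot> Assc C ?x ?y ?z" unfolding up using k l m n by simp
    also have "\<dots> = Idn C (fst (Ten (Ten l m) n)) \<cdot> ?p" unfolding kp using k l m n by simp
    finally show "(k \<cdot> und_assc l m n) \<cdot> ?p = Idn C (fst (Ten (Ten l m) n)) \<cdot> ?p" .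
  qed (use l m n k in \<open>auto intro!: split_epi_ten split_epi_comp\<close>)
  moreover have "und_assc l m n \<cdot> k = Idn C (fst (Ten l (Ten m n)))"
  proof (rule split_epi_cancel[of ?p'])
    have "(und_assc l m n \<cdot> k) \<cdot> ?p' = und_assc l m n \<cdot> (k \<cdot> ?p')" using k l m n by simp
    also have "\<dots> = (und_assc l m n \<cdot> ?p) \<cdot> Inv C (Assc C ?x ?y ?z)" unfolding kp using k l m n by simp
    also have "\<dots> = Idn C (fst (Ten l (Ten m n))) \<cdot> ?p'" unfolding up using k l m n by simp
    finally show "(und_assc l m n \<cdot> k) \<cdot> ?p' = Idn C (fst (Ten l (Ten m n))) \<cdot> ?p'" .
  qed (use l m n k in \<open>auto intro!: split_epi_ten split_epi_comp\<close>)
  ultimately show ?thesis by (intro is_isoI[where g = k]) (use k l m n in auto)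
qed

text \<open>Scalars act on the leftmost factor on both sides; the pentagon with the scalar as a
  fourth factor compares the two actions.\<close>

lemma und_assc_linear: "linear (Ten (Ten l m) n) (und_assc l m n) (Ten l (Ten m n))"
proof -
  let ?x = "fst l" and ?y = "fst m" and ?z = "fst n" and ?k = "und_assc l m n"
  let ?p = "proj (Ten l m) n \<cdot> (proj l m \<otimes> Idn C ?z)"
  have "?k \<cdot> snd (Ten (Ten l m) n) = snd (Ten l (Ten m n)) \<cdot> (Idn C a \<otimes> ?k)"
  proof (rule split_epi_cancel[of "Idn C a \<otimes> ?p"])
    have "(?k \<cdot> snd (Ten (Ten l m) n)) \<cdot> (Idn C a \<otimes> ?p)
      = ?k \<cdot> proj (Ten l m) n \<cdot> (snd (Ten l m) \<otimes> Idn C ?z)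
        \<cdot> (Inv C (Assc C a (fst (Ten l m)) ?z) \<cdot> (Idn C a \<otimes> (proj l m \<otimes> Idn C ?z)))"
      using l m n by simp
    also have "\<dots> = (?k \<cdot> ?p) \<cdot> ((snd l \<otimes> Idn C ?y) \<otimes> Idn C ?z)
        \<cdot> (Inv C (Assc C a ?x ?y) \<otimes> Idn C ?z) \<cdot> Inv C (Assc C a (?x \<odot> ?y) ?z)"
      using l m n by (simp add: assc_inv_nat merge)
    also have "\<dots> = proj l (Ten m n) \<cdot> (snd l \<otimes> proj m n)
        \<cdot> (Assc C (a \<odot> ?x) ?y ?z \<cdot> (Inv C (Assc C a ?x ?y) \<otimes> Idn C ?z) \<cdot> Inv C (Assc C a (?x \<odot> ?y) ?z))"
    proof -
      have "(?k \<cdot> ?p) \<cdot> ((snd l \<otimes> Idn C ?y) \<otimes> Idn C ?z)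
        = proj l (Ten m n) \<cdot> (snd l \<otimes> proj m n) \<cdot> Assc C (a \<odot> ?x) ?y ?z"
        unfolding und_assc using l m n by (simp add: assc_nat) (simp add: merge)
      from tail[OF this] show ?thesis using l m n by simp
    qed
    also have "\<dots> = proj l (Ten m n) \<cdot> (snd l \<otimes> Idn C (fst (Ten m n))) \<cdot> (Idn C (a \<odot> ?x) \<otimes> proj m n)
        \<cdot> Inv C (Assc C a ?x (?y \<odot> ?z)) \<cdot> (Idn C a \<otimes> Assc C ?x ?y ?z)"
      using l m n by (simp add: pentagon_inv merge)
    also have "\<dots> = proj l (Ten m n) \<cdot> (snd l \<otimes> Idn C (fst (Ten m n)))
        \<cdot> (Inv C (Assc C a ?x (fst (Ten m n))) \<cdot> (Idn C a \<otimes> (Idn C ?x \<otimes> proj m n))) \<cdot> (Idn C a \<otimes> Assc C ?x ?y ?z)"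
      using l m n by (simp add: assc_inv_nat)
    also have "\<dots> = proj l (Ten m n) \<cdot> (snd l \<otimes> Idn C (fst (Ten m n)))
        \<cdot> Inv C (Assc C a ?x (fst (Ten m n))) \<cdot> (Idn C a \<otimes> ((Idn C ?x \<otimes> proj m n) \<cdot> Assc C ?x ?y ?z))"
      using l m n by (simp add: merge)
    also have "\<dots> = snd (Ten l (Ten m n)) \<cdot> (Idn C a \<otimes> (?k \<cdot> ?p))"
      unfolding und_assc using l m n by simp
    also have "\<dots> = (snd (Ten l (Ten m n)) \<cdot> (Idn C a \<otimes> ?k)) \<cdot> (Idn C a \<otimes> ?p)"
      using l m n by (simp add: merge)
    finally show "(?k \<cdot> snd (Ten (Ten l m) n)) \<cdot> (Idn C a \<otimes> ?p)
      = (snd (Ten l (Ten m n)) \<cdot> (Idn C a \<otimes> ?k)) \<cdot> (Idn C a \<otimes> ?p)" .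
  qed (use l m n in \<open>auto intro!: split_epi_ten split_epi_comp\<close>)
  then show ?thesis using l m n by (simp add: linear_iff)
qed

end

end

section \<open>The category of modules\<close>

context additive_cat
begin

lemma dsum_eqI:
  assumes "x \<in> Obj C" "y \<in> Obj C" "f \<in> Arr C" "g \<in> Arr C" "Cod C f = DSum C x y" "Cod C g = DSum C x y"
    "Dom C f = Dom C g" "Prj1 C x y \<cdot> f = Prj1 C x y \<cdot> g" "Prj2 C x y \<cdot> f = Prj2 C x y \<cdot> g"
  shows "f = g"
proof -
  have e: "h = Inj1 C x y \<cdot> (Prj1 C x y \<cdot> h) \<oplus> Inj2 C x y \<cdot> (Prj2 C x y \<cdot> h)"
    if "h \<in> Arr C" "Cod C h = DSum C x y" for h
  proof -
    have "h = (Inj1 C x y \<cdot> Prj1 C x y \<oplus> Inj2 C x y \<cdot> Prj2 C x y) \<cdot> h"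
      using assms(1,2) that by (simp add: inj_prj_sum)
    then show ?thesis using assms(1,2) that by (simp add: plus_left)
  qed
  have "f = Inj1 C x y \<cdot> (Prj1 C x y \<cdot> g) \<oplus> Inj2 C x y \<cdot> (Prj2 C x y \<cdot> g)"
    using e[OF assms(3,5)] unfolding assms(8,9) .
  also have "\<dots> = g" by (rule e[OF assms(4,6), symmetric])
  finally show ?thesis .
qed

lemma plus_cancel_left:
  assumes "f \<in> Hom C x y" "g \<in> Hom C x y" "h \<in> Hom C x y" "f \<oplus> g = f \<oplus> h"
  shows "g = h"
proof -
  obtain k where k: "k \<in> Hom C x y" "f \<oplus> k = Zer C x y" using plus_inverse[OF assms(1)] by blast
  have z: "u = (k \<oplus> f) \<oplus> u" if "u \<in> Hom C x y" for u
    using that k plus_comm[OF assms(1) k(1)] plus_Zer_left[of u x y] by (simp add: Hom_iff)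
  have "g = k \<oplus> (f \<oplus> g)" using z[OF assms(2)] plus_assoc[OF k(1) assms(1,2)] by simp
  also have "\<dots> = h" unfolding assms(4) using z[OF assms(3)] plus_assoc[OF k(1) assms(1,3)] by simp
  finally show ?thesis .
qed

lemma Prj_into_dsum:
  assumes "x \<in> Obj C" "y \<in> Obj C" "f \<in> Arr C" "g \<in> Arr C" "Dom C g = Dom C f" "Cod C f = x" "Cod C g = y"
  shows "Prj1 C x y \<cdot> (Inj1 C x y \<cdot> f \<oplus> Inj2 C x y \<cdot> g) = f"
    "Prj2 C x y \<cdot> (Inj1 C x y \<cdot> f \<oplus> Inj2 C x y \<cdot> g) = g"
  using assms by (simp_all add: plus_right plus_Zer_left plus_Zer_right)

end

abbreviation und :: "('o, 'a) mod_arr \<Rightarrow> 'a" where "und F \<equiv> fst (snd F)"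

section \<open>Additive structure of the category of modules\<close>

context ring_modules
begin

abbreviation "D \<equiv> Modc C A"

lemma Modc_sel:
  "Obj D = {m. module m}" "Arr D = {F. linear (fst F) (und F) (snd (snd F))}"
  "Dom D F = fst F" "Cod D F = snd (snd F)" "Idn D m = (m, Idn C (fst m), m)"
  "G \<cdot>\<^bsub>D\<^esub> F = (fst F, und G \<cdot> und F, snd (snd G))"
  "Zer D m n = (m, Zer C (fst m) (fst n), n)" "F \<oplus>\<^bsub>D\<^esub> G = (fst F, und F \<oplus> und G, snd (snd F))"
  "DSum D m n = dsum_obj C A m n"
  "Inj1 D m n = (m, Inj1 C (fst m) (fst n), dsum_obj C A m n)"
  "Inj2 D m n = (n, Inj2 C (fst m) (fst n), dsum_obj C A m n)"
  "Prj1 D m n = (dsum_obj C A m n, Prj1 C (fst m) (fst n), m)"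
  "Prj2 D m n = (dsum_obj C A m n, Prj2 C (fst m) (fst n), n)"
  "m \<odot>\<^bsub>D\<^esub> n = Ten m n"
  "F \<otimes>\<^bsub>D\<^esub> G = (Ten (fst F) (fst G),
    und_ten (fst F) (fst G) (snd (snd F)) (snd (snd G)) (und F) (und G), Ten (snd (snd F)) (snd (snd G)))"
  "One D = (a, mlt A)"
  "Assc D l m n = (Ten (Ten l m) n, und_assc l m n, Ten l (Ten m n))"
  "Lun D m = (Ten (a, mlt A) m, und_lun m, m)"
  "Run D m = (Ten m (a, mlt A), und_run m, m)"
  "Brd D m n = (Ten m n, und_brd m n, Ten n m)"
  by (auto simp: Modc_def case_prod_beta linear_def und_ten_def und_assc_def und_lun_def und_run_def und_brd_def)

lemma Modc_Hom_iff: "F \<in> Hom D m n \<longleftrightarrow> linear m (und F) n \<and> fst F = m \<and> snd (snd F) = n"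
  by (auto simp: Hom_iff Modc_sel)

lemma linear_module: "linear m f n \<Longrightarrow> module m" "linear m f n \<Longrightarrow> module n"
  by (auto simp: linear_iff)

lemma linear_Idn [simp]: "module m \<Longrightarrow> linear m (Idn C (fst m)) m"
  by (simp add: linear_iff)

lemma linear_Zer: "module m \<Longrightarrow> module n \<Longrightarrow> linear m (Zer C (fst m) (fst n)) n"
  by (simp add: linear_iff comp_Zer_left comp_Zer_right ten_Zer_right)

lemma linear_plus: "linear m f n \<Longrightarrow> linear m g n \<Longrightarrow> linear m (f \<oplus> g) n"
  by (simp add: linear_iff plus_left plus_right ten_plus_right)

text \<open>Additive inverses are given by existence only, so linearity of \<open>g\<close> is not
  computed but cancelled from linearity of \<open>f\<close> and of the zero map.\<close>

lemma linear_uminus: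
  assumes f: "linear m f n" and g: "g \<in> Hom C (fst m) (fst n)" and z: "f \<oplus> g = Zer C (fst m) (fst n)"
  shows "linear m g n"
proof -
  have m: "module m" "module n" and f': "f \<in> Arr C" "Dom C f = fst m" "Cod C f = fst n"
    and lf: "f \<cdot> snd m = snd n \<cdot> (Idn C a \<otimes> f)"
    using f by (auto simp: linear_iff)
  have g': "g \<in> Arr C" "Dom C g = fst m" "Cod C g = fst n" using g by (auto simp: Hom_iff)
  have "f \<cdot> snd m \<oplus> g \<cdot> snd m = (f \<oplus> g) \<cdot> snd m" using m f' g' by (simp add: plus_left)
  also have "\<dots> = snd n \<cdot> (Idn C a \<otimes> (f \<oplus> g))"
    unfolding z using m by (simp add: comp_Zer_left comp_Zer_right ten_Zer_right)
  also have "\<dots> = f \<cdot> snd m \<oplus> snd n \<cdot> (Idn C a \<otimes> g)"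
    unfolding lf using m f' g' by (simp add: plus_right ten_plus_right)
  finally have "g \<cdot> snd m = snd n \<cdot> (Idn C a \<otimes> g)"
    by (rule plus_cancel_left[rotated -1, where x = "a \<odot> fst m" and y = "fst n"])
      (use m f' g' in \<open>auto simp: Hom_iff\<close>)
  then show ?thesis using m g' by (simp add: linear_iff)
qed

lemma dsum_fst [simp]: "fst (dsum_obj C A m n) = DSum C (fst m) (fst n)"
  by (simp add: dsum_obj_def Let_def)

lemma dsum_act:
  assumes "module m" "module n"
  shows "snd (dsum_obj C A m n) \<in> Arr C" "Dom C (snd (dsum_obj C A m n)) = a \<odot> DSum C (fst m) (fst n)"
    "Cod C (snd (dsum_obj C A m n)) = DSum C (fst m) (fst n)"
    "Prj1 C (fst m) (fst n) \<cdot> snd (dsum_obj C A m n) = snd m \<cdot> (Idn C a \<otimes> Prj1 C (fst m) (fst n))"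
    "Prj2 C (fst m) (fst n) \<cdot> snd (dsum_obj C A m n) = snd n \<cdot> (Idn C a \<otimes> Prj2 C (fst m) (fst n))"
  using assms by (simp_all add: dsum_obj_def Let_def Prj_into_dsum)

lemma dsum_module [simp]:
  assumes m: "module m" and n: "module n"
  shows "module (dsum_obj C A m n)"
proof (rule moduleI)
  let ?s = "dsum_obj C A m n"
  let ?p1 = "Prj1 C (fst m) (fst n)" and ?p2 = "Prj2 C (fst m) (fst n)"
  note [simp] = dsum_act[OF m n] tail[OF dsum_act(4)[OF m n]] tail[OF dsum_act(5)[OF m n]]
  \<comment> \<open>Stated for any \<open>p\<close> that intertwines the action of the sum with that
    of a module \<open>k\<close>, so that both projections are instances; equality of maps into a
    biproduct is tested on these.\<close>
  have 1: "p \<cdot> (snd ?s \<cdot> (mlt A \<otimes> Idn C (fst ?s))) = p \<cdot> (snd ?s \<cdot> (Idn C a \<otimes> snd ?s) \<cdot> Assc C a a (fst ?s))"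
    and 2: "p \<cdot> (snd ?s \<cdot> (unt A \<otimes> Idn C (fst ?s))) = p \<cdot> Lun C (fst ?s)"
    if p: "p \<in> Arr C" "Dom C p = fst ?s" "Cod C p = fst k" "p \<cdot> snd ?s = snd k \<cdot> (Idn C a \<otimes> p)" and k: "module k" for p k
  proof -
    note [simp] = tail[OF p(4)]
    have "p \<cdot> (snd ?s \<cdot> (mlt A \<otimes> Idn C (fst ?s))) = (snd k \<cdot> (mlt A \<otimes> Idn C (fst k))) \<cdot> (Idn C (a \<odot> a) \<otimes> p)"
      using m n p(1-3) k by (simp add: merge)
    also have "\<dots> = snd k \<cdot> (Idn C a \<otimes> snd k) \<cdot> ((Idn C a \<otimes> (Idn C a \<otimes> p)) \<cdot> Assc C a a (fst ?s))"
      unfolding act_mlt[OF k] using m n p(1-3) k by (simp add: assc_nat_Idn)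
    also have "\<dots> = p \<cdot> (snd ?s \<cdot> (Idn C a \<otimes> snd ?s) \<cdot> Assc C a a (fst ?s))"
      using m n p k by (simp add: merge)
    finally show "p \<cdot> (snd ?s \<cdot> (mlt A \<otimes> Idn C (fst ?s))) = p \<cdot> (snd ?s \<cdot> (Idn C a \<otimes> snd ?s) \<cdot> Assc C a a (fst ?s))" .
    have "p \<cdot> (snd ?s \<cdot> (unt A \<otimes> Idn C (fst ?s))) = (snd k \<cdot> (unt A \<otimes> Idn C (fst k))) \<cdot> (Idn C (One C) \<otimes> p)"
      using m n p(1-3) k by (simp add: merge)
    also have "\<dots> = p \<cdot> Lun C (fst ?s)"
      unfolding act_unt[OF k] using m n p(1-3) k by (simp add: lun_nat)
    finally show "p \<cdot> (snd ?s \<cdot> (unt A \<otimes> Idn C (fst ?s))) = p \<cdot> Lun C (fst ?s)" .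
  qed
  show "snd ?s \<cdot> (mlt A \<otimes> Idn C (fst ?s)) = snd ?s \<cdot> (Idn C a \<otimes> snd ?s) \<cdot> Assc C a a (fst ?s)"
    by (rule dsum_eqI[OF _ _ _ _ _ _ _ 1[of ?p1 m] 1[of ?p2 n]]) (use m n in auto)
  show "snd ?s \<cdot> (unt A \<otimes> Idn C (fst ?s)) = Lun C (fst ?s)"
    by (rule dsum_eqI[OF _ _ _ _ _ _ _ 2[of ?p1 m] 2[of ?p2 n]]) (use m n in auto)
qed (use m n dsum_act[OF m n] in auto)

lemma dsum_linear:
  assumes m: "module m" and n: "module n"
  shows "linear (dsum_obj C A m n) (Prj1 C (fst m) (fst n)) m" "linear (dsum_obj C A m n) (Prj2 C (fst m) (fst n)) n"
    "linear m (Inj1 C (fst m) (fst n)) (dsum_obj C A m n)" "linear n (Inj2 C (fst m) (fst n)) (dsum_obj C A m n)"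
proof -
  note a = dsum_act[OF m n]
  show "linear (dsum_obj C A m n) (Prj1 C (fst m) (fst n)) m" "linear (dsum_obj C A m n) (Prj2 C (fst m) (fst n)) n"
    using m n a by (auto simp: linear_iff)
  have "Inj1 C (fst m) (fst n) \<cdot> snd m = snd (dsum_obj C A m n) \<cdot> (Idn C a \<otimes> Inj1 C (fst m) (fst n))"
    by (rule dsum_eqI[of "fst m" "fst n"])
      (use m n a(1-3) in \<open>simp_all add: tail[OF a(4)] tail[OF a(5)] merge comp_Zer_left comp_Zer_right ten_Zer_right\<close>)
  then show "linear m (Inj1 C (fst m) (fst n)) (dsum_obj C A m n)" using m n by (simp add: linear_iff)
  have "Inj2 C (fst m) (fst n) \<cdot> snd n = snd (dsum_obj C A m n) \<cdot> (Idn C a \<otimes> Inj2 C (fst m) (fst n))"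
    by (rule dsum_eqI[of "fst m" "fst n"])
      (use m n a(1-3) in \<open>simp_all add: tail[OF a(4)] tail[OF a(5)] merge comp_Zer_left comp_Zer_right ten_Zer_right\<close>)
  then show "linear n (Inj2 C (fst m) (fst n)) (dsum_obj C A m n)" using m n by (simp add: linear_iff)
qed

text \<open>Vanishing does not see the action, so the degree of a tower in \<open>A\<close>-modules
  can be read off from underlying objects.\<close>

lemma Modc_zero_object:
  assumes m: "module m"
  shows "zero_object D m \<longleftrightarrow> zero_object C (fst m)"
proof
  assume "zero_object D m"
  then have "\<exists>!F. F \<in> Hom D m m" using m unfolding zero_object_def Modc_sel(1) mem_Collect_eq by blast
  moreover have "(m, Idn C (fst m), m) \<in> Hom D m m" "(m, Zer C (fst m) (fst m), m) \<in> Hom D m m"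
    using m by (auto simp: Modc_Hom_iff linear_Zer)
  ultimately have "(m, Idn C (fst m), m) = (m, Zer C (fst m) (fst m), m)" by blast
  then show "zero_object C (fst m)" using m by (intro zero_objectI) auto
next
  assume z: "zero_object C (fst m)"
  have "\<exists>!F. F \<in> Hom D n m" "\<exists>!F. F \<in> Hom D m n" if n: "module n" for n
  proof -
    have u: "\<exists>!f. f \<in> Hom C (fst n) (fst m)" "\<exists>!f. f \<in> Hom C (fst m) (fst n)"
      using z n by (auto simp: zero_object_def)
    show "\<exists>!F. F \<in> Hom D n m"
    proof (rule ex1I[of _ "(n, Zer C (fst n) (fst m), m)"])
      show "(n, Zer C (fst n) (fst m), m) \<in> Hom D n m" using m n by (simp add: Modc_Hom_iff linear_Zer)
      fix F assume "F \<in> Hom D n m"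
      then have F: "linear n (und F) m" "fst F = n" "snd (snd F) = m" by (auto simp: Modc_Hom_iff)
      then have "und F \<in> Hom C (fst n) (fst m)" by (simp add: linear_iff Hom_iff)
      then have "und F = Zer C (fst n) (fst m)" using u(1) zero_hom[of "fst n" "fst m"] m n by auto
      then show "F = (n, Zer C (fst n) (fst m), m)" using F by (auto simp: prod_eq_iff)
    qed
    show "\<exists>!F. F \<in> Hom D m n"
    proof (rule ex1I[of _ "(m, Zer C (fst m) (fst n), n)"])
      show "(m, Zer C (fst m) (fst n), n) \<in> Hom D m n" using m n by (simp add: Modc_Hom_iff linear_Zer)
      fix F assume "F \<in> Hom D m n"
      then have F: "linear m (und F) n" "fst F = m" "snd (snd F) = n" by (auto simp: Modc_Hom_iff)
      then have "und F \<in> Hom C (fst m) (fst n)" by (simp add: linear_iff Hom_iff)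
      then have "und F = Zer C (fst m) (fst n)" using u(2) zero_hom[of "fst m" "fst n"] m n by auto
      then show "F = (m, Zer C (fst m) (fst n), n)" using F by (auto simp: prod_eq_iff)
    qed
  qed
  then show "zero_object D m" unfolding zero_object_def Modc_sel(1) mem_Collect_eq using m by blast
qed

text \<open>A zero object of \<open>C\<close> carries the zero action; the module axioms hold
  because parallel arrows into a zero object coincide.\<close>

lemma zero_module_exists: "\<exists>m. module m \<and> zero_object C (fst m)"
proof -
  obtain z where z: "zero_object C z" using zero_object_exists by blast
  then have zo: "z \<in> Obj C" and iz: "Idn C z = Zer C z z" by (auto simp: zero_object_iff)
  have eq: "f = g" if "f \<in> Hom C x z" "g \<in> Hom C x z" for f g x
    using z that dom_obj[of f] unfolding zero_object_def Hom_iff by blast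
  let ?r = "Zer C (a \<odot> z) z"
  have "?r \<cdot> (mlt A \<otimes> Idn C z) = ?r \<cdot> (Idn C a \<otimes> ?r) \<cdot> Assc C a a z"
    by (rule eq[of _ "(a \<odot> a) \<odot> z"]) (use zo in \<open>auto simp: Hom_iff\<close>)
  moreover have "?r \<cdot> (unt A \<otimes> Idn C z) = Lun C z"
    by (rule eq[of _ "One C \<odot> z"]) (use zo in \<open>auto simp: Hom_iff\<close>)
  ultimately have "module (z, ?r)" using zo by (intro moduleI) auto
  then show ?thesis using z by auto
qed

lemma Modc_additive: "additive_cat D"
proof (unfold_locales, goal_cases)
  \<comment> \<open>Cases are numbered by the order of the assumptions of
    \<open>additive_cat\<close>: 13 is the additive inverse, 16 the zero object, 18 to 21 the
    injections and projections.\<close>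
  case (13 F m n)
  then have l: "linear m (und F) n" "fst F = m" "snd (snd F) = n" by (auto simp: Modc_Hom_iff)
  then have "und F \<in> Hom C (fst m) (fst n)" by (auto simp: linear_iff Hom_iff)
  then obtain g where g: "g \<in> Hom C (fst m) (fst n)" "und F \<oplus> g = Zer C (fst m) (fst n)"
    using plus_inverse by blast
  show ?case
    by (rule bexI[of _ "(m, g, n)"]) (use l g linear_uminus[OF l(1) g] in \<open>auto simp: Modc_sel Modc_Hom_iff\<close>)
next
  case 16
  obtain m where "module m" "zero_object C (fst m)" using zero_module_exists by blast
  then show ?case using Modc_zero_object by blast
next
  case (4 F l m G n)
  then show ?case by (auto simp: Modc_sel Modc_Hom_iff intro: linear_comp)
next
  case (10 F m n G H)
  then show ?case
    using plus_assoc[of "und F" "fst m" "fst n" "und G" "und H"]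
    by (auto simp: Modc_sel Modc_Hom_iff linear_iff Hom_iff)
next
  case (11 F m n G)
  then show ?case
    using plus_comm[of "und F" "fst m" "fst n" "und G"]
    by (auto simp: Modc_sel Modc_Hom_iff linear_iff Hom_iff)
next
  case (8 m n)
  then show ?case by (simp add: Modc_sel Modc_Hom_iff linear_Zer)
next
  case (9 F m n G)
  then show ?case by (auto simp: Modc_sel Modc_Hom_iff linear_plus)
next
  case (18 m n)
  then show ?case by (simp add: Modc_sel Modc_Hom_iff dsum_linear)
next
  case (19 m n)
  then show ?case by (simp add: Modc_sel Modc_Hom_iff dsum_linear)
next
  case (20 m n)
  then show ?case by (simp add: Modc_sel Modc_Hom_iff dsum_linear)
next
  case (21 m n)
  then show ?case by (simp add: Modc_sel Modc_Hom_iff dsum_linear)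
qed (auto simp: Modc_sel Modc_Hom_iff prod_eq_iff plus_Zer_right plus_left plus_right inj_prj_sum linear_iff)

section \<open>The monoidal axioms for modules\<close>

lemma und_ten_typed [simp]:
  assumes "linear m f n" "linear m' f' n'"
  shows "und_ten m m' n n' f f' \<in> Arr C" "Dom C (und_ten m m' n n' f f') = fst (Ten m m')"
    "Cod C (und_ten m m' n n' f f') = fst (Ten n n')"
  using und_ten(1)[OF assms] by (auto simp: linear_iff)

lemma und_brd_typed [simp]:
  assumes "module m" "module n"
  shows "und_brd m n \<in> Arr C" "Dom C (und_brd m n) = fst (Ten m n)" "Cod C (und_brd m n) = fst (Ten n m)"
  using und_brd(1)[OF assms] by (auto simp: linear_iff)

lemma und_lun_typed [simp]:
  assumes "module m"
  shows "und_lun m \<in> Arr C" "Dom C (und_lun m) = fst (Ten (a, mlt A) m)" "Cod C (und_lun m) = fst m"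
    "und_run m \<in> Arr C" "Dom C (und_run m) = fst (Ten m (a, mlt A))" "Cod C (und_run m) = fst m"
  using und_lun(1)[OF assms] und_run(1)[OF assms] by (auto simp: linear_iff)

lemma und_linear [simp]:
  "linear m f n \<Longrightarrow> linear m' f' n' \<Longrightarrow> linear (Ten m m') (und_ten m m' n n' f f') (Ten n n')"
  "module m \<Longrightarrow> module n \<Longrightarrow> linear (Ten m n) (und_brd m n) (Ten n m)"
  "module m \<Longrightarrow> linear (Ten (a, mlt A) m) (und_lun m) m"
  "module m \<Longrightarrow> linear (Ten m (a, mlt A)) (und_run m) m"
  "module l \<Longrightarrow> module m \<Longrightarrow> module n \<Longrightarrow> linear (Ten (Ten l m) n) (und_assc l m n) (Ten l (Ten m n))"
  by (simp_all add: und_ten und_brd und_lun und_run und_assc_linear)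

text \<open>Precomposed with a projection, a structure map of modules is computed in
  \<open>C\<close>. With the analogous rules for braiding, unitors and associator, each coherence
  law is carried to \<open>C\<close>, verified there, and cancelled back along the
  projections.\<close>

lemma und_ten_proj:
  assumes l: "linear m f n" "linear m' f' n'"
  shows "und_ten m m' n n' f f' \<cdot> proj m m' = proj n n' \<cdot> (f \<otimes> f')"
    "\<lbrakk>k \<in> Arr C; Cod C k = fst m \<odot> fst m'\<rbrakk> \<Longrightarrow>
      und_ten m m' n n' f f' \<cdot> (proj m m' \<cdot> k) = proj n n' \<cdot> ((f \<otimes> f') \<cdot> k)"
proof -
  show *: "und_ten m m' n n' f f' \<cdot> proj m m' = proj n n' \<cdot> (f \<otimes> f')" using l by (rule und_ten)
  have t: "module m" "module m'" "module n" "module n'" "f \<in> Arr C" "Dom C f = fst m" "Cod C f = fst n"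
    "f' \<in> Arr C" "Dom C f' = fst m'" "Cod C f' = fst n'" using l by (auto simp: linear_iff)
  show "\<lbrakk>k \<in> Arr C; Cod C k = fst m \<odot> fst m'\<rbrakk> \<Longrightarrow>
      und_ten m m' n n' f f' \<cdot> (proj m m' \<cdot> k) = proj n n' \<cdot> ((f \<otimes> f') \<cdot> k)"
    using t l by (subst tail[OF *]) auto
qed

lemma und_brd_proj:
  assumes m: "module m" "module n"
  shows "und_brd m n \<cdot> proj m n = proj n m \<cdot> Brd C (fst m) (fst n)"
    "\<lbrakk>k \<in> Arr C; Cod C k = fst m \<odot> fst n\<rbrakk> \<Longrightarrow>
      und_brd m n \<cdot> (proj m n \<cdot> k) = proj n m \<cdot> (Brd C (fst m) (fst n) \<cdot> k)"
proof -
  show *: "und_brd m n \<cdot> proj m n = proj n m \<cdot> Brd C (fst m) (fst n)" using m by (rule und_brd)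
  show "\<lbrakk>k \<in> Arr C; Cod C k = fst m \<odot> fst n\<rbrakk> \<Longrightarrow>
      und_brd m n \<cdot> (proj m n \<cdot> k) = proj n m \<cdot> (Brd C (fst m) (fst n) \<cdot> k)"
    using m by (subst tail[OF *]) auto
qed

lemma und_lun_proj:
  assumes m: "module m"
  shows "und_lun m \<cdot> proj (a, mlt A) m = snd m"
    "\<lbrakk>k \<in> Arr C; Cod C k = a \<odot> fst m\<rbrakk> \<Longrightarrow> und_lun m \<cdot> (proj (a, mlt A) m \<cdot> k) = snd m \<cdot> k"
    "und_run m \<cdot> proj m (a, mlt A) = snd m \<cdot> Brd C (fst m) a"
    "\<lbrakk>k \<in> Arr C; Cod C k = fst m \<odot> a\<rbrakk> \<Longrightarrow>
      und_run m \<cdot> (proj m (a, mlt A) \<cdot> k) = snd m \<cdot> (Brd C (fst m) a \<cdot> k)"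
proof -
  show 1: "und_lun m \<cdot> proj (a, mlt A) m = snd m" using m by (rule und_lun)
  show 2: "und_run m \<cdot> proj m (a, mlt A) = snd m \<cdot> Brd C (fst m) a" using m by (rule und_run)
  show "\<lbrakk>k \<in> Arr C; Cod C k = a \<odot> fst m\<rbrakk> \<Longrightarrow> und_lun m \<cdot> (proj (a, mlt A) m \<cdot> k) = snd m \<cdot> k"
    using m by (subst tail[OF 1]) auto
  show "\<lbrakk>k \<in> Arr C; Cod C k = fst m \<odot> a\<rbrakk> \<Longrightarrow>
      und_run m \<cdot> (proj m (a, mlt A) \<cdot> k) = snd m \<cdot> (Brd C (fst m) a \<cdot> k)"
    using m by (subst tail[OF 2]) auto
qed

lemma und_assc_proj:
  assumes m: "module l" "module m" "module n"
  shows "und_assc l m n \<cdot> (proj (Ten l m) n \<cdot> (proj l m \<otimes> Idn C (fst n)))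
      = proj l (Ten m n) \<cdot> ((Idn C (fst l) \<otimes> proj m n) \<cdot> Assc C (fst l) (fst m) (fst n))"
    "\<lbrakk>k \<in> Arr C; Cod C k = (fst l \<odot> fst m) \<odot> fst n\<rbrakk> \<Longrightarrow>
     und_assc l m n \<cdot> (proj (Ten l m) n \<cdot> ((proj l m \<otimes> Idn C (fst n)) \<cdot> k))
      = proj l (Ten m n) \<cdot> ((Idn C (fst l) \<otimes> proj m n) \<cdot> (Assc C (fst l) (fst m) (fst n) \<cdot> k))"
proof -
  show *: "und_assc l m n \<cdot> (proj (Ten l m) n \<cdot> (proj l m \<otimes> Idn C (fst n)))
      = proj l (Ten m n) \<cdot> ((Idn C (fst l) \<otimes> proj m n) \<cdot> Assc C (fst l) (fst m) (fst n))"
    using m by (rule und_assc)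
  show "\<lbrakk>k \<in> Arr C; Cod C k = (fst l \<odot> fst m) \<odot> fst n\<rbrakk> \<Longrightarrow>
     und_assc l m n \<cdot> (proj (Ten l m) n \<cdot> ((proj l m \<otimes> Idn C (fst n)) \<cdot> k))
      = proj l (Ten m n) \<cdot> ((Idn C (fst l) \<otimes> proj m n) \<cdot> (Assc C (fst l) (fst m) (fst n) \<cdot> k))"
    using m by (subst tail3[OF *]) auto
qed

lemma proj_cancel:
  assumes "module m" "module n" "f \<cdot> proj m n = g \<cdot> proj m n" "f \<in> Arr C" "g \<in> Arr C"
    "Dom C f = fst (Ten m n)" "Dom C g = fst (Ten m n)"
  shows "f = g"
  using assms by (intro split_epi_cancel[OF proj_split_epi[OF assms(1,2)] assms(3)]) auto

lemma proj_assc_cancel: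
  assumes "module l" "module m" "module n"
    "f \<cdot> (proj (Ten l m) n \<cdot> (proj l m \<otimes> Idn C (fst n))) = g \<cdot> (proj (Ten l m) n \<cdot> (proj l m \<otimes> Idn C (fst n)))"
    "f \<in> Arr C" "g \<in> Arr C" "Dom C f = fst (Ten (Ten l m) n)" "Dom C g = fst (Ten (Ten l m) n)"
  shows "f = g"
proof (rule split_epi_cancel[OF _ assms(4)])
  show "split_epi (proj (Ten l m) n \<cdot> (proj l m \<otimes> Idn C (fst n)))"
    using assms(1-3) by (auto intro!: split_epi_ten split_epi_comp)
qed (use assms(1-3,5-) in auto)

lemma und_ten_comp:
  assumes l: "linear l f m" "linear m g n" "linear l' f' m'" "linear m' g' n'"
  shows "und_ten l l' n n' (g \<cdot> f) (g' \<cdot> f') = und_ten m m' n n' g g' \<cdot> und_ten l l' m m' f f'"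
proof (rule proj_cancel[of l l'])
  note c = linear_comp[OF l(1,2)] linear_comp[OF l(3,4)]
  have t: "module l" "module l'" "module m" "module m'" "module n" "module n'"
    "f \<in> Arr C" "Dom C f = fst l" "Cod C f = fst m" "f' \<in> Arr C" "Dom C f' = fst l'" "Cod C f' = fst m'"
    "g \<in> Arr C" "Dom C g = fst m" "Cod C g = fst n" "g' \<in> Arr C" "Dom C g' = fst m'" "Cod C g' = fst n'"
    using l by (auto simp: linear_iff)
  show "und_ten l l' n n' (g \<cdot> f) (g' \<cdot> f') \<cdot> proj l l' = (und_ten m m' n n' g g' \<cdot> und_ten l l' m m' f f') \<cdot> proj l l'"
    using l c t by (simp add: und_ten_proj merge)
qed (use l linear_comp[OF l(1,2)] linear_comp[OF l(3,4)] in \<open>auto simp: linear_module\<close>)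

lemma und_ten_Idn:
  assumes "module m" "module n"
  shows "und_ten m n m n (Idn C (fst m)) (Idn C (fst n)) = Idn C (fst (Ten m n))"
  by (rule proj_cancel[of m n]) (use assms in \<open>auto simp: und_ten_proj\<close>)

lemma und_assc_natural:
  assumes l: "linear l f l'" "linear m g m'" "linear n h n'"
  shows "und_ten l (Ten m n) l' (Ten m' n') f (und_ten m n m' n' g h) \<cdot> und_assc l m n
    = und_assc l' m' n' \<cdot> und_ten (Ten l m) n (Ten l' m') n' (und_ten l m l' m' f g) h"
proof -
  have m: "module l" "module m" "module n" "module l'" "module m'" "module n'"
    and t: "f \<in> Arr C" "Dom C f = fst l" "Cod C f = fst l'" "g \<in> Arr C" "Dom C g = fst m" "Cod C g = fst m'"
      "h \<in> Arr C" "Dom C h = fst n" "Cod C h = fst n'"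
    using l by (auto simp: linear_iff)
  let ?fg = "und_ten l m l' m' f g" and ?gh = "und_ten m n m' n' g h"
  let ?F = "und_ten l (Ten m n) l' (Ten m' n') f ?gh" and ?G = "und_ten (Ten l m) n (Ten l' m') n' ?fg h"
  let ?p = "proj (Ten l m) n \<cdot> (proj l m \<otimes> Idn C (fst n))"
  show ?thesis
  proof (rule proj_assc_cancel[of l m n])
    have "(?F \<cdot> und_assc l m n) \<cdot> ?p
        = proj l' (Ten m' n') \<cdot> (f \<otimes> (?gh \<cdot> proj m n)) \<cdot> Assc C (fst l) (fst m) (fst n)"
      using l m t by (simp add: und_assc_proj und_ten_proj(2)) (simp add: merge)
    also have "\<dots> = proj l' (Ten m' n') \<cdot> (Idn C (fst l') \<otimes> proj m' n') \<cdot> ((f \<otimes> (g \<otimes> h)) \<cdot> Assc C (fst l) (fst m) (fst n))"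
      using l m t by (simp add: und_ten_proj merge)
    also have "\<dots> = (und_assc l' m' n' \<cdot> (proj (Ten l' m') n' \<cdot> (proj l' m' \<otimes> Idn C (fst n')))) \<cdot> ((f \<otimes> g) \<otimes> h)"
      using l m t by (simp add: und_assc_proj assc_nat)
    also have "\<dots> = und_assc l' m' n' \<cdot> proj (Ten l' m') n' \<cdot> ((?fg \<cdot> proj l m) \<otimes> h)"
      using l m t by (simp add: und_ten_proj merge)
    also have "\<dots> = (und_assc l' m' n' \<cdot> ?G) \<cdot> ?p"
      using l m t by (simp add: und_ten_proj(2)) (simp add: merge)
    finally show "(?F \<cdot> und_assc l m n) \<cdot> ?p = (und_assc l' m' n' \<cdot> ?G) \<cdot> ?p" .
  qed (use l m in auto)
qed

text \<open>Tested along \<open>?p\<close>, the projection from the fourfold tensor product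
  bracketed to the left. Naturality of the associator moves the inner projections aside, after which
  the pentagon of \<open>C\<close> remains.\<close>

lemma und_pentagon:
  assumes m: "module w" "module x" "module y" "module z"
  shows "und_assc w x (Ten y z) \<cdot> und_assc (Ten w x) y z
    = und_ten w (Ten (Ten x y) z) w (Ten x (Ten y z)) (Idn C (fst w)) (und_assc x y z)
      \<cdot> und_assc w (Ten x y) z
      \<cdot> und_ten (Ten (Ten w x) y) z (Ten w (Ten x y)) z (und_assc w x y) (Idn C (fst z))"
proof -
  let ?w = "fst w" and ?x = "fst x" and ?y = "fst y" and ?z = "fst z"
  let ?i = "Idn C"
  let ?F = "und_ten w (Ten (Ten x y) z) w (Ten x (Ten y z)) (Idn C (fst w)) (und_assc x y z)"
  let ?G = "und_ten (Ten (Ten w x) y) z (Ten w (Ten x y)) z (und_assc w x y) (Idn C (fst z))"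
  let ?p = "proj (Ten (Ten w x) y) z \<cdot> ((proj (Ten w x) y \<cdot> (proj w x \<otimes> ?i ?y)) \<otimes> ?i ?z)"
  show ?thesis
  proof (rule split_epi_cancel[of ?p])
    have "(und_assc w x (Ten y z) \<cdot> und_assc (Ten w x) y z) \<cdot> ?p
      = und_assc w x (Ten y z) \<cdot> (und_assc (Ten w x) y z \<cdot> (proj (Ten (Ten w x) y) z \<cdot> (proj (Ten w x) y \<otimes> ?i ?z)))
        \<cdot> ((proj w x \<otimes> ?i ?y) \<otimes> ?i ?z)"
      using m by (simp add: merge)
    also have "\<dots> = und_assc w x (Ten y z) \<cdot> proj (Ten w x) (Ten y z) \<cdot> (?i (fst (Ten w x)) \<otimes> proj y z)
        \<cdot> (Assc C (fst (Ten w x)) ?y ?z \<cdot> ((proj w x \<otimes> ?i ?y) \<otimes> ?i ?z))"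
      using m by (simp add: und_assc_proj)
    also have "\<dots> = und_assc w x (Ten y z) \<cdot> proj (Ten w x) (Ten y z) \<cdot> (proj w x \<otimes> proj y z)
        \<cdot> Assc C (?w \<odot> ?x) ?y ?z"
      using m by (simp add: assc_nat) (simp add: merge)
    also have "\<dots> = (und_assc w x (Ten y z) \<cdot> (proj (Ten w x) (Ten y z) \<cdot> (proj w x \<otimes> ?i (fst (Ten y z)))))
        \<cdot> (?i (?w \<odot> ?x) \<otimes> proj y z) \<cdot> Assc C (?w \<odot> ?x) ?y ?z"
      using m by (simp add: merge)
    also have "\<dots> = proj w (Ten x (Ten y z)) \<cdot> (?i ?w \<otimes> proj x (Ten y z)) \<cdot> (Assc C ?w ?x (fst (Ten y z))
        \<cdot> (?i (?w \<odot> ?x) \<otimes> proj y z)) \<cdot> Assc C (?w \<odot> ?x) ?y ?z"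
      using m by (simp add: und_assc_proj)
    also have "\<dots> = proj w (Ten x (Ten y z)) \<cdot> (?i ?w \<otimes> (proj x (Ten y z) \<cdot> (?i ?x \<otimes> proj y z)))
        \<cdot> (Assc C ?w ?x (?y \<odot> ?z) \<cdot> Assc C (?w \<odot> ?x) ?y ?z)"
      using m by (simp add: assc_nat_Idn) (simp add: merge)
    also have "\<dots> = proj w (Ten x (Ten y z)) \<cdot> (?i ?w \<otimes> (proj x (Ten y z) \<cdot> (?i ?x \<otimes> proj y z) \<cdot> Assc C ?x ?y ?z))
        \<cdot> Assc C ?w (?x \<odot> ?y) ?z \<cdot> (Assc C ?w ?x ?y \<otimes> ?i ?z)"
      using m by (simp add: pentagon merge)
    also have "\<dots> = proj w (Ten x (Ten y z)) \<cdot> (?i ?w \<otimes> (und_assc x y z \<cdot> proj (Ten x y) z \<cdot> (proj x y \<otimes> ?i ?z)))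
        \<cdot> Assc C ?w (?x \<odot> ?y) ?z \<cdot> (Assc C ?w ?x ?y \<otimes> ?i ?z)"
      using m by (simp add: und_assc_proj)
    also have "\<dots> = (?F \<cdot> proj w (Ten (Ten x y) z)) \<cdot> (?i ?w \<otimes> proj (Ten x y) z) \<cdot> ((?i ?w \<otimes> (proj x y \<otimes> ?i ?z))
        \<cdot> Assc C ?w (?x \<odot> ?y) ?z) \<cdot> (Assc C ?w ?x ?y \<otimes> ?i ?z)"
      using m by (simp add: und_ten_proj) (simp add: merge)
    also have "\<dots> = ?F \<cdot> (und_assc w (Ten x y) z \<cdot> (proj (Ten w (Ten x y)) z \<cdot> (proj w (Ten x y) \<otimes> ?i ?z)))
        \<cdot> ((?i ?w \<otimes> proj x y) \<otimes> ?i ?z) \<cdot> (Assc C ?w ?x ?y \<otimes> ?i ?z)"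
      using m by (simp add: und_assc_proj assc_nat)
    also have "\<dots> = ?F \<cdot> und_assc w (Ten x y) z \<cdot> proj (Ten w (Ten x y)) z
        \<cdot> ((proj w (Ten x y) \<cdot> (?i ?w \<otimes> proj x y) \<cdot> Assc C ?w ?x ?y) \<otimes> ?i ?z)"
      using m by (simp add: merge)
    also have "\<dots> = ?F \<cdot> und_assc w (Ten x y) z \<cdot> proj (Ten w (Ten x y)) z
        \<cdot> ((und_assc w x y \<cdot> proj (Ten w x) y \<cdot> (proj w x \<otimes> ?i ?y)) \<otimes> ?i ?z)"
      using m by (simp add: und_assc_proj)
    also have "\<dots> = ?F \<cdot> und_assc w (Ten x y) z \<cdot> ?G \<cdot> ?p"
      using m by (simp add: und_ten_proj(2)) (simp add: merge)
    also have "\<dots> = (?F \<cdot> und_assc w (Ten x y) z \<cdot> ?G) \<cdot> ?p"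
      using m by simp
    finally show "(und_assc w x (Ten y z) \<cdot> und_assc (Ten w x) y z) \<cdot> ?p = (?F \<cdot> und_assc w (Ten x y) z \<cdot> ?G) \<cdot> ?p" .
  qed (use m in \<open>auto intro!: split_epi_ten split_epi_comp\<close>)
qed

text \<open>After precomposition the two sides are exactly the two composites that
  \<open>proj x y\<close> makes equal: a scalar in the middle may act to the right or to the
  left.\<close>

lemma und_triangle:
  assumes m: "module x" "module y"
  shows "und_ten x (Ten (a, mlt A) y) x y (Idn C (fst x)) (und_lun y) \<cdot> und_assc x (a, mlt A) y
    = und_ten (Ten x (a, mlt A)) y x y (und_run x) (Idn C (fst y))"
proof (rule proj_assc_cancel[of x "(a, mlt A)" y])
  let ?A = "(a, mlt A)"
  have "balanced x y (proj x y)" using m by (rule proj_split)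
  then have b: "proj x y \<cdot> ((snd x \<cdot> Brd C (fst x) a) \<otimes> Idn C (fst y))
    = proj x y \<cdot> (Idn C (fst x) \<otimes> snd y) \<cdot> Assc C (fst x) a (fst y)"
    using m by (subst (asm) balanced_iff) auto
  have "(und_ten x (Ten ?A y) x y (Idn C (fst x)) (und_lun y) \<cdot> und_assc x ?A y)
      \<cdot> (proj (Ten x ?A) y \<cdot> (proj x ?A \<otimes> Idn C (fst y)))
    = proj x y \<cdot> (Idn C (fst x) \<otimes> (und_lun y \<cdot> proj ?A y)) \<cdot> Assc C (fst x) a (fst y)"
    using m by (simp add: und_assc_proj und_ten_proj) (simp add: merge)
  also have "\<dots> = proj x y \<cdot> ((und_run x \<cdot> proj x ?A) \<otimes> Idn C (fst y))"
    using m b by (simp add: und_lun_proj)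
  also have "\<dots> = und_ten (Ten x ?A) y x y (und_run x) (Idn C (fst y)) \<cdot> (proj (Ten x ?A) y \<cdot> (proj x ?A \<otimes> Idn C (fst y)))"
    using m by (simp add: und_ten_proj) (simp add: merge)
  finally show "(und_ten x (Ten ?A y) x y (Idn C (fst x)) (und_lun y) \<cdot> und_assc x ?A y)
      \<cdot> (proj (Ten x ?A) y \<cdot> (proj x ?A \<otimes> Idn C (fst y)))
    = und_ten (Ten x ?A) y x y (und_run x) (Idn C (fst y)) \<cdot> (proj (Ten x ?A) y \<cdot> (proj x ?A \<otimes> Idn C (fst y)))" .
qed (use m in auto)

lemma und_hexagon:
  assumes m: "module x" "module y" "module z"
  shows "und_assc y z x \<cdot> und_brd x (Ten y z) \<cdot> und_assc x y z
    = und_ten y (Ten x z) y (Ten z x) (Idn C (fst y)) (und_brd x z) \<cdot> und_assc y x z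
      \<cdot> und_ten (Ten x y) z (Ten y x) z (und_brd x y) (Idn C (fst z))"
proof (rule proj_assc_cancel[of x y z])
  let ?x = "fst x" and ?y = "fst y" and ?z = "fst z" and ?i = "Idn C"
  let ?p = "proj (Ten x y) z \<cdot> (proj x y \<otimes> ?i ?z)"
  let ?F = "und_ten y (Ten x z) y (Ten z x) (Idn C (fst y)) (und_brd x z)"
  let ?G = "und_ten (Ten x y) z (Ten y x) z (und_brd x y) (Idn C (fst z))"
  have "(und_assc y z x \<cdot> und_brd x (Ten y z) \<cdot> und_assc x y z) \<cdot> ?p
    = und_assc y z x \<cdot> proj (Ten y z) x \<cdot> (Brd C ?x (fst (Ten y z)) \<cdot> (?i ?x \<otimes> proj y z)) \<cdot> Assc C ?x ?y ?z"
    using m by (simp add: und_assc_proj und_brd_proj)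
  also have "\<dots> = (und_assc y z x \<cdot> (proj (Ten y z) x \<cdot> (proj y z \<otimes> ?i ?x))) \<cdot> Brd C ?x (?y \<odot> ?z) \<cdot> Assc C ?x ?y ?z"
    using m by (simp add: brd_nat)
  also have "\<dots> = proj y (Ten z x) \<cdot> (?i ?y \<otimes> proj z x) \<cdot> (Assc C ?y ?z ?x \<cdot> Brd C ?x (?y \<odot> ?z) \<cdot> Assc C ?x ?y ?z)"
    using m by (simp add: und_assc_proj)
  also have "\<dots> = proj y (Ten z x) \<cdot> (?i ?y \<otimes> (proj z x \<cdot> Brd C ?x ?z)) \<cdot> Assc C ?y ?x ?z \<cdot> (Brd C ?x ?y \<otimes> ?i ?z)"
    using m by (simp add: hexagon) (simp add: merge)
  also have "\<dots> = (?F \<cdot> proj y (Ten x z)) \<cdot> (?i ?y \<otimes> proj x z) \<cdot> Assc C ?y ?x ?z \<cdot> (Brd C ?x ?y \<otimes> ?i ?z)"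
    using m by (simp add: und_ten_proj) (simp add: merge und_brd_proj)
  also have "\<dots> = ?F \<cdot> (und_assc y x z \<cdot> (proj (Ten y x) z \<cdot> (proj y x \<otimes> ?i ?z))) \<cdot> (Brd C ?x ?y \<otimes> ?i ?z)"
    using m by (simp add: und_assc_proj)
  also have "\<dots> = ?F \<cdot> und_assc y x z \<cdot> proj (Ten y x) z \<cdot> ((und_brd x y \<cdot> proj x y) \<otimes> ?i ?z)"
    using m by (simp add: merge und_brd_proj)
  also have "\<dots> = (?F \<cdot> und_assc y x z \<cdot> ?G) \<cdot> ?p"
    using m by (simp add: und_ten_proj(2)) (simp add: merge)
  finally show "(und_assc y z x \<cdot> und_brd x (Ten y z) \<cdot> und_assc x y z) \<cdot> ?p
    = (?F \<cdot> und_assc y x z \<cdot> ?G) \<cdot> ?p" .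
qed (use m in auto)

lemma linear_Inv:
  assumes f: "linear m f n" and i: "is_iso C f"
  shows "linear n (Inv C f) m"
proof -
  have m: "module m" "module n" and t: "f \<in> Arr C" "Dom C f = fst m" "Cod C f = fst n"
    and l: "f \<cdot> snd m = snd n \<cdot> (Idn C a \<otimes> f)" using f by (auto simp: linear_iff)
  have "Inv C f \<cdot> snd n = snd m \<cdot> Inv C (Idn C a \<otimes> f)"
    by (rule Inv_nat) (use m t l i in simp_all)
  then have "Inv C f \<cdot> snd n = snd m \<cdot> (Idn C a \<otimes> Inv C f)"
    using Inv_eqI[of "Idn C a" "Idn C a"] i by simp
  then show ?thesis using m t i by (simp add: linear_iff)
qed

text \<open>The inverse of an invertible linear map is linear, so invertibility of a module arrow is
  decided in \<open>C\<close>.\<close>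

lemma Modc_iso:
  assumes F: "linear (fst F) (und F) (snd (snd F))" and i: "is_iso C (und F)"
  shows "is_iso D F \<and> Inv D F = (snd (snd F), Inv C (und F), fst F)"
proof -
  interpret D: additive_cat D by (rule Modc_additive)
  show ?thesis
    by (rule D.Inv_eqI) (use F i linear_Inv[OF F i] in \<open>auto simp: Modc_sel linear_iff\<close>)
qed

lemma Modc_symmetric_monoidal: "symmetric_monoidal_cat D"
proof (intro symmetric_monoidal_cat.intro Modc_additive, unfold_locales, goal_cases)
  \<comment> \<open>Numbering as in \<open>symmetric_monoidal_cat\<close>: 5 is functoriality, 6 to
    8 are invertibility of associator and unitors, 10 to 13 naturality, 14 to 17 the coherence
    axioms.\<close>
  case (5 F m m' F' m'' G n n' G' n'')
  then show ?case
    using und_ten_comp[of m "und F" m' "und F'" m'' n "und G" n' "und G'" n'']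
    by (auto simp: Modc_sel Modc_Hom_iff)
next
  case (6 l m n)
  then show ?case
    using Modc_iso[of "(Ten (Ten l m) n, und_assc l m n, Ten l (Ten m n))"] und_assc_iso[of l m n]
    by (simp add: Modc_sel Modc_Hom_iff)
next
  case (7 m)
  then show ?case
    using Modc_iso[of "(Ten (a, mlt A) m, und_lun m, m)"] und_lun(3)[of m]
    by (simp add: Modc_sel Modc_Hom_iff)
next
  case (8 m)
  have "is_iso C (und_brd m (a, mlt A))" if "module m"
  proof (rule is_isoI[where g = "und_brd (a, mlt A) m"])
    show "und_brd (a, mlt A) m \<cdot> und_brd m (a, mlt A) = Idn C (Dom C (und_brd m (a, mlt A)))"
      by (rule proj_cancel[of m "(a, mlt A)"]) (use that in \<open>simp_all add: und_brd_proj\<close>)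
    show "und_brd m (a, mlt A) \<cdot> und_brd (a, mlt A) m = Idn C (Cod C (und_brd m (a, mlt A)))"
      by (rule proj_cancel[of "(a, mlt A)" m]) (use that in \<open>simp_all add: und_brd_proj\<close>)
  qed (use that in simp_all)
  then have "is_iso C (und_run m)" if "module m"
    unfolding und_run_eq[OF that] using that und_lun(3)[OF that] by (intro is_iso_comp) auto
  with 8 show ?case
    using Modc_iso[of "(Ten m (a, mlt A), und_run m, m)"] by (simp add: Modc_sel Modc_Hom_iff)
next
  case (10 F l l' G m m' H n n')
  then show ?case
    using und_assc_natural[of l "und F" l' m "und G" m' n "und H" n']
    by (auto simp: Modc_sel Modc_Hom_iff)
next
  case (11 F m n)
  have "und F \<cdot> und_lun m = und_lun n \<cdot> und_ten (a, mlt A) m (a, mlt A) n (Idn C a) (und F)"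
    if F: "linear m (und F) n"
  proof (rule proj_cancel[of "(a, mlt A)" m])
    note l = linear_Idn[OF A_module, simplified]
    have m: "module m" "module n" "und F \<in> Arr C" "Dom C (und F) = fst m" "Cod C (und F) = fst n"
      "und F \<cdot> snd m = snd n \<cdot> (Idn C a \<otimes> und F)" using F by (auto simp: linear_iff)
    show "(und F \<cdot> und_lun m) \<cdot> proj (a, mlt A) m
      = (und_lun n \<cdot> und_ten (a, mlt A) m (a, mlt A) n (Idn C a) (und F)) \<cdot> proj (a, mlt A) m"
      using m F l by (simp add: und_lun_proj und_ten_proj)
  qed (use F linear_Idn[OF A_module] linear_iff in simp_all)
  with 11 show ?case by (auto simp: Modc_sel Modc_Hom_iff)
next
  case (12 F m n)
  have "und F \<cdot> und_run m = und_run n \<cdot> und_ten m (a, mlt A) n (a, mlt A) (und F) (Idn C a)"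
    if F: "linear m (und F) n"
  proof (rule proj_cancel[of m "(a, mlt A)"])
    note l = linear_Idn[OF A_module, simplified]
    have m: "module m" "module n" "und F \<in> Arr C" "Dom C (und F) = fst m" "Cod C (und F) = fst n"
      "und F \<cdot> snd m = snd n \<cdot> (Idn C a \<otimes> und F)" using F by (auto simp: linear_iff)
    show "(und F \<cdot> und_run m) \<cdot> proj m (a, mlt A)
      = (und_run n \<cdot> und_ten m (a, mlt A) n (a, mlt A) (und F) (Idn C a)) \<cdot> proj m (a, mlt A)"
      using m F l tail[OF m(6), of "Brd C (fst m) a"] by (simp add: und_lun_proj und_ten_proj brd_nat)
  qed (use F linear_Idn[OF A_module] linear_iff in simp_all)
  with 12 show ?case by (auto simp: Modc_sel Modc_Hom_iff)
next
  case (13 F m m' G n n')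
  have "und_ten n m n' m' (und G) (und F) \<cdot> und_brd m n = und_brd m' n' \<cdot> und_ten m n m' n' (und F) (und G)"
    if l: "linear m (und F) m'" "linear n (und G) n'"
  proof (rule proj_cancel[of m n])
    have m: "module m" "module n" "module m'" "module n'" "und F \<in> Arr C" "Dom C (und F) = fst m"
      "Cod C (und F) = fst m'" "und G \<in> Arr C" "Dom C (und G) = fst n" "Cod C (und G) = fst n'"
      using l by (auto simp: linear_iff)
    show "(und_ten n m n' m' (und G) (und F) \<cdot> und_brd m n) \<cdot> proj m n
      = (und_brd m' n' \<cdot> und_ten m n m' n' (und F) (und G)) \<cdot> proj m n"
      using m l by (simp add: und_brd_proj und_ten_proj brd_nat)
  qed (use l linear_iff in simp_all)
  with 13 show ?case by (auto simp: Modc_sel Modc_Hom_iff)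
next
  case (14 w x y z)
  then show ?case using und_pentagon[of w x y z] by (simp add: Modc_sel)
next
  case (15 x y)
  then show ?case using und_triangle[of x y] by (simp add: Modc_sel)
next
  case (16 x y z)
  then show ?case using und_hexagon[of x y z] by (simp add: Modc_sel)
next
  case (17 x y)
  have "und_brd y x \<cdot> und_brd x y = Idn C (fst (Ten x y))" if "module x" "module y"
    by (rule proj_cancel[of x y]) (use that in \<open>simp_all add: und_brd_proj\<close>)
  with 17 show ?case by (simp add: Modc_sel)
qed (auto simp: Modc_sel Modc_Hom_iff und_ten_Idn)

lemma Modc_idempotent_complete: "idempotent_complete_cat D"
proof (intro idempotent_complete_cat.intro Modc_additive, unfold_locales, goal_cases)
  case (1 E m)
  then have l: "linear m (und E) m" and E: "fst E = m" "snd (snd E) = m" by (auto simp: Modc_Hom_iff)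
  then have m: "module m" and t: "und E \<in> Arr C" "Dom C (und E) = fst m" "Cod C (und E) = fst m"
    and le: "und E \<cdot> snd m = snd m \<cdot> (Idn C a \<otimes> und E)" by (auto simp: linear_iff)
  have "und E \<cdot> und E = und E" using 1(2) by (simp add: Modc_sel prod_eq_iff)
  then obtain y p j where y: "y \<in> Obj C" and p': "p \<in> Hom C (fst m) y" and j': "j \<in> Hom C y (fst m)"
    and jp: "j \<cdot> p = und E" and pj: "p \<cdot> j = Idn C y"
    using idempotents_split[of "und E" "fst m"] t by (auto simp: Hom_iff)
  have p: "p \<in> Arr C" "Dom C p = fst m" "Cod C p = y" and j: "j \<in> Arr C" "Dom C j = y" "Cod C j = fst m"
    using p' j' by (auto simp: Hom_iff)
  \<comment> \<open>The action induced on the summand: include, act, project. Linearity of the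
    idempotent makes \<open>j\<close> and \<open>p\<close> intertwine it with the action of
    \<open>m\<close>.\<close>
  let ?r = "p \<cdot> snd m \<cdot> (Idn C a \<otimes> j)"
  have lj: "j \<cdot> ?r = snd m \<cdot> (Idn C a \<otimes> j)"
  proof -
    have "j \<cdot> ?r = (und E \<cdot> snd m) \<cdot> (Idn C a \<otimes> j)" unfolding jp[symmetric] using p j m by simp
    also have "\<dots> = (snd m \<cdot> (Idn C a \<otimes> (j \<cdot> p))) \<cdot> (Idn C a \<otimes> j)" unfolding le jp ..
    also have "\<dots> = snd m \<cdot> (Idn C a \<otimes> (j \<cdot> (p \<cdot> j)))" using p j m by (simp add: merge)
    finally show ?thesis unfolding pj using p j m by simp
  qed
  have lp: "p \<cdot> snd m = ?r \<cdot> (Idn C a \<otimes> p)"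
  proof -
    have "?r \<cdot> (Idn C a \<otimes> p) = p \<cdot> (snd m \<cdot> (Idn C a \<otimes> und E))" unfolding jp[symmetric] using p j m by (simp add: merge)
    also have "\<dots> = p \<cdot> ((j \<cdot> p) \<cdot> snd m)" unfolding jp le ..
    also have "\<dots> = (p \<cdot> j) \<cdot> p \<cdot> snd m" using p j m by simp
    finally show ?thesis unfolding pj using p m by simp
  qed
  have "module (y, ?r)"
  proof (rule moduleI)
    have "?r \<cdot> (mlt A \<otimes> Idn C y) = p \<cdot> (snd m \<cdot> (mlt A \<otimes> Idn C (fst m))) \<cdot> (Idn C (a \<odot> a) \<otimes> j)"
      using p j m y by (simp add: merge)
    also have "\<dots> = p \<cdot> snd m \<cdot> (Idn C a \<otimes> snd m) \<cdot> (Assc C a a (fst m) \<cdot> (Idn C (a \<odot> a) \<otimes> j))"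
      unfolding act_mlt[OF m] using p j m y by simp
    also have "\<dots> = p \<cdot> snd m \<cdot> (Idn C a \<otimes> (j \<cdot> ?r)) \<cdot> Assc C a a y"
      unfolding lj using p j m y by (simp add: assc_nat_Idn) (simp add: merge)
    also have "\<dots> = ?r \<cdot> (Idn C a \<otimes> ?r) \<cdot> Assc C a a y"
      using p j m y by (simp add: merge)
    finally show "snd (y, ?r) \<cdot> (mlt A \<otimes> Idn C (fst (y, ?r))) = snd (y, ?r) \<cdot> (Idn C a \<otimes> snd (y, ?r)) \<cdot> Assc C a a (fst (y, ?r))"
      by simp
    have "?r \<cdot> (unt A \<otimes> Idn C y) = p \<cdot> (snd m \<cdot> (unt A \<otimes> Idn C (fst m))) \<cdot> (Idn C (One C) \<otimes> j)"
      using p j m y by (simp add: merge)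
    also have "\<dots> = (p \<cdot> j) \<cdot> Lun C y"
      unfolding act_unt[OF m] using p j m y by (simp add: lun_nat)
    finally show "snd (y, ?r) \<cdot> (unt A \<otimes> Idn C (fst (y, ?r))) = Lun C (fst (y, ?r))"
      unfolding pj using y by simp
  qed (use y p j m in auto)
  moreover have "linear m p (y, ?r)" "linear (y, ?r) j m"
    using calculation m p j lp lj by (auto simp: linear_iff)
  ultimately show ?case
    using E jp pj
    by (intro bexI[of _ "(y, ?r)"] bexI[of _ "(m, p, (y, ?r))"] bexI[of _ "((y, ?r), j, m)"])
      (auto simp: Modc_sel Modc_Hom_iff prod_eq_iff)
qed

lemma und_ten_plus:
  assumes "linear m f n" "linear m g n" "linear m' h n'"
  shows "und_ten m m' n n' (f \<oplus> g) h = und_ten m m' n n' f h \<oplus> und_ten m m' n n' g h"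
    "und_ten m' m n' n h (f \<oplus> g) = und_ten m' m n' n h f \<oplus> und_ten m' m n' n h g"
proof -
  have t: "module m" "module n" "module m'" "module n'" "f \<in> Arr C" "Dom C f = fst m" "Cod C f = fst n"
    "g \<in> Arr C" "Dom C g = fst m" "Cod C g = fst n" "h \<in> Arr C" "Dom C h = fst m'" "Cod C h = fst n'"
    using assms by (auto simp: linear_iff)
  note l = assms linear_plus[OF assms(1,2)]
  show "und_ten m m' n n' (f \<oplus> g) h = und_ten m m' n n' f h \<oplus> und_ten m m' n n' g h"
    by (rule proj_cancel[of m m']) (use t l in \<open>simp_all add: und_ten_proj plus_left plus_right ten_plus_left\<close>)
  show "und_ten m' m n' n h (f \<oplus> g) = und_ten m' m n' n h f \<oplus> und_ten m' m n' n h g"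
    by (rule proj_cancel[of m' m]) (use t l in \<open>simp_all add: und_ten_proj plus_left plus_right ten_plus_right\<close>)
qed

lemma Modc_additive_monoidal: "additive_monoidal_cat D"
  by (intro additive_monoidal_cat.intro Modc_symmetric_monoidal Modc_idempotent_complete, unfold_locales)
    (auto simp: Modc_sel und_ten_plus)

end

section \<open>Rings in the category of modules\<close>

context additive_monoidal_cat
begin

lemma tt_ringI:
  assumes "carr R \<in> Obj C" "mlt R \<in> Arr C" "Dom C (mlt R) = carr R \<odot> carr R" "Cod C (mlt R) = carr R"
    "unt R \<in> Arr C" "Dom C (unt R) = One C" "Cod C (unt R) = carr R"
    "mlt R \<cdot> (mlt R \<otimes> Idn C (carr R)) = mlt R \<cdot> (Idn C (carr R) \<otimes> mlt R) \<cdot> Assc C (carr R) (carr R) (carr R)"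
    "mlt R \<cdot> (unt R \<otimes> Idn C (carr R)) = Lun C (carr R)"
    "mlt R \<cdot> (Idn C (carr R) \<otimes> unt R) = Run C (carr R)"
    "mlt R \<cdot> Brd C (carr R) (carr R) = mlt R"
    "s \<in> Arr C" "Dom C s = carr R" "Cod C s = carr R \<odot> carr R" "mlt R \<cdot> s = Idn C (carr R)"
    "s \<cdot> mlt R = (mlt R \<otimes> Idn C (carr R)) \<cdot> Inv C (Assc C (carr R) (carr R) (carr R)) \<cdot> (Idn C (carr R) \<otimes> s)"
    "s \<cdot> mlt R = (Idn C (carr R) \<otimes> mlt R) \<cdot> Assc C (carr R) (carr R) (carr R) \<cdot> (s \<otimes> Idn C (carr R))"
  shows "tt_ring C R"
proof -
  have "ring_object C R" unfolding ring_object_def Let_def Hom_iff using assms(1-10) by blast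
  moreover have "commutative_ring C R" unfolding commutative_ring_def by (rule assms(11))
  moreover have "separable_ring C R" unfolding separable_ring_def Let_def
    by (rule bexI[of _ s]) (use assms(12-) in \<open>auto simp: Hom_iff\<close>)
  ultimately show ?thesis unfolding tt_ring_def by blast
qed

lemma ring_modulesI: "tt_ring C R \<Longrightarrow> ring_modules C R"
  by unfold_locales

context
  fixes R S :: "('o, 'a) ring_data"
  assumes R: "tt_ring C R" and S: "tt_ring C S"
begin

interpretation R: ring_modules C R using R by (rule ring_modulesI)
interpretation S: ring_modules C S using S by (rule ring_modulesI)

lemma prod_ring_carr [simp]: "carr (prod_ring C R S) = DSum C (carr R) (carr S)"
  by (simp add: prod_ring_def Let_def)

lemma prod_ring_typed [simp]:
  "mlt (prod_ring C R S) \<in> Arr C"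
  "Dom C (mlt (prod_ring C R S)) = DSum C (carr R) (carr S) \<odot> DSum C (carr R) (carr S)"
  "Cod C (mlt (prod_ring C R S)) = DSum C (carr R) (carr S)"
  "unt (prod_ring C R S) \<in> Arr C" "Dom C (unt (prod_ring C R S)) = One C"
  "Cod C (unt (prod_ring C R S)) = DSum C (carr R) (carr S)"
  by (simp_all add: prod_ring_def Let_def)

lemma prod_ring_prj:
  "Prj1 C (carr R) (carr S) \<cdot> mlt (prod_ring C R S)
    = mlt R \<cdot> (Prj1 C (carr R) (carr S) \<otimes> Prj1 C (carr R) (carr S))"
  "Prj2 C (carr R) (carr S) \<cdot> mlt (prod_ring C R S)
    = mlt S \<cdot> (Prj2 C (carr R) (carr S) \<otimes> Prj2 C (carr R) (carr S))"
  "Prj1 C (carr R) (carr S) \<cdot> unt (prod_ring C R S) = unt R"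
  "Prj2 C (carr R) (carr S) \<cdot> unt (prod_ring C R S) = unt S"
  by (simp_all add: prod_ring_def Let_def Prj_into_dsum)

text \<open>Multiplication by an element of one factor kills the other component. In this form it
  reduces the bimodule laws of the product to those of the factors.\<close>

lemma prod_ring_inj:
  "mlt (prod_ring C R S) \<cdot> (Idn C (DSum C (carr R) (carr S)) \<otimes> Inj1 C (carr R) (carr S))
    = Inj1 C (carr R) (carr S) \<cdot> mlt R \<cdot> (Prj1 C (carr R) (carr S) \<otimes> Idn C (carr R))"
  "mlt (prod_ring C R S) \<cdot> (Idn C (DSum C (carr R) (carr S)) \<otimes> Inj2 C (carr R) (carr S))
    = Inj2 C (carr R) (carr S) \<cdot> mlt S \<cdot> (Prj2 C (carr R) (carr S) \<otimes> Idn C (carr S))"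
  "mlt (prod_ring C R S) \<cdot> (Inj1 C (carr R) (carr S) \<otimes> Idn C (DSum C (carr R) (carr S)))
    = Inj1 C (carr R) (carr S) \<cdot> mlt R \<cdot> (Idn C (carr R) \<otimes> Prj1 C (carr R) (carr S))"
  "mlt (prod_ring C R S) \<cdot> (Inj2 C (carr R) (carr S) \<otimes> Idn C (DSum C (carr R) (carr S)))
    = Inj2 C (carr R) (carr S) \<cdot> mlt S \<cdot> (Idn C (carr S) \<otimes> Prj2 C (carr R) (carr S))"
  by (rule dsum_eqI[of "carr R" "carr S"],
      simp_all add: tail[OF prod_ring_prj(1)] tail[OF prod_ring_prj(2)] merge ten_Zer_right ten_Zer_left
        comp_Zer_right comp_Zer_left)+

text \<open>The bimodule section is the sum of those of the factors, placed in the two diagonal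
  summands of \<open>?P \<odot> ?P\<close>; its components in the mixed summands are zero, matching
  the fact that products of elements from different factors vanish.\<close>

lemma tt_ring_prod: "tt_ring C (prod_ring C R S)"
proof -
  let ?x = "carr R" and ?y = "carr S"
  let ?P = "DSum C ?x ?y" and ?I = "Idn C (DSum C ?x ?y)" and ?m = "mlt (prod_ring C R S)" and ?u = "unt (prod_ring C R S)"
  let ?p = "Prj1 C ?x ?y" and ?q = "Prj2 C ?x ?y" and ?i = "Inj1 C ?x ?y" and ?j = "Inj2 C ?x ?y"
  note t = tail[OF prod_ring_prj(1)] tail[OF prod_ring_prj(2)]
  obtain s where s: "s \<in> Arr C" "Dom C s = ?x" "Cod C s = ?x \<odot> ?x" and s1: "mlt R \<cdot> s = Idn C ?x"
    and s2: "s \<cdot> mlt R = (mlt R \<otimes> Idn C ?x) \<cdot> Inv C (Assc C ?x ?x ?x) \<cdot> (Idn C ?x \<otimes> s)"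
    and s3: "s \<cdot> mlt R = (Idn C ?x \<otimes> mlt R) \<cdot> Assc C ?x ?x ?x \<cdot> (s \<otimes> Idn C ?x)"
    by (rule R.A_separable)
  obtain r where r: "r \<in> Arr C" "Dom C r = ?y" "Cod C r = ?y \<odot> ?y" and r1: "mlt S \<cdot> r = Idn C ?y"
    and r2: "r \<cdot> mlt S = (mlt S \<otimes> Idn C ?y) \<cdot> Inv C (Assc C ?y ?y ?y) \<cdot> (Idn C ?y \<otimes> r)"
    and r3: "r \<cdot> mlt S = (Idn C ?y \<otimes> mlt S) \<cdot> Assc C ?y ?y ?y \<cdot> (r \<otimes> Idn C ?y)"
    by (rule S.A_separable)
  \<comment> \<open>One factor \<open>K\<close> at a time, with inclusion \<open>k\<close> and
    projection \<open>e\<close>: multiplying \<open>(k \<otimes> k) \<cdot> s \<cdot> e\<close> from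
    the left and from the right gives the same map. The bimodule laws for the sum of both factors
    follow by additivity.\<close>
  have left: "(?m \<otimes> ?I) \<cdot> Inv C (Assc C ?P ?P ?P) \<cdot> (?I \<otimes> ((k \<otimes> k) \<cdot> s \<cdot> e)) = (k \<otimes> k) \<cdot> (s \<cdot> mlt K) \<cdot> (e \<otimes> e)"
    and right: "(?I \<otimes> ?m) \<cdot> Assc C ?P ?P ?P \<cdot> (((k \<otimes> k) \<cdot> s \<cdot> e) \<otimes> ?I) = (k \<otimes> k) \<cdot> (s \<cdot> mlt K) \<cdot> (e \<otimes> e)"
    if K: "carr K \<in> Obj C" "mlt K \<in> Arr C" "Dom C (mlt K) = carr K \<odot> carr K" "Cod C (mlt K) = carr K"
      and k: "k \<in> Arr C" "Dom C k = carr K" "Cod C k = ?P" and e: "e \<in> Arr C" "Dom C e = ?P" "Cod C e = carr K"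
      and s: "s \<in> Arr C" "Dom C s = carr K" "Cod C s = carr K \<odot> carr K"
      and s2: "s \<cdot> mlt K = (mlt K \<otimes> Idn C (carr K)) \<cdot> Inv C (Assc C (carr K) (carr K) (carr K)) \<cdot> (Idn C (carr K) \<otimes> s)"
      and s3: "s \<cdot> mlt K = (Idn C (carr K) \<otimes> mlt K) \<cdot> Assc C (carr K) (carr K) (carr K) \<cdot> (s \<otimes> Idn C (carr K))"
      and mk: "?m \<cdot> (?I \<otimes> k) = k \<cdot> mlt K \<cdot> (e \<otimes> Idn C (carr K))"
      and km: "?m \<cdot> (k \<otimes> ?I) = k \<cdot> mlt K \<cdot> (Idn C (carr K) \<otimes> e)" for K k s e
  proof -
    let ?z = "carr K"
    have "(?m \<otimes> ?I) \<cdot> Inv C (Assc C ?P ?P ?P) \<cdot> (?I \<otimes> ((k \<otimes> k) \<cdot> s \<cdot> e))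
      = (?m \<otimes> ?I) \<cdot> (Inv C (Assc C ?P ?P ?P) \<cdot> (?I \<otimes> (k \<otimes> k))) \<cdot> (?I \<otimes> (s \<cdot> e))"
      using K k e s by (simp add: merge)
    also have "\<dots> = (?m \<otimes> ?I) \<cdot> ((?I \<otimes> k) \<otimes> k) \<cdot> Inv C (Assc C ?P ?z ?z) \<cdot> (?I \<otimes> (s \<cdot> e))"
      using K k e s by (simp add: assc_inv_nat)
    also have "\<dots> = ((k \<cdot> mlt K \<cdot> (e \<otimes> Idn C ?z)) \<otimes> k) \<cdot> Inv C (Assc C ?P ?z ?z) \<cdot> (?I \<otimes> (s \<cdot> e))"
      using K k e s by (simp add: merge mk)
    also have "\<dots> = ((k \<cdot> mlt K) \<otimes> k) \<cdot> (((e \<otimes> Idn C ?z) \<otimes> Idn C ?z) \<cdot> Inv C (Assc C ?P ?z ?z)) \<cdot> (?I \<otimes> (s \<cdot> e))"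
      using K k e s by (simp add: merge)
    also have "\<dots> = ((k \<cdot> mlt K) \<otimes> k) \<cdot> (Inv C (Assc C ?z ?z ?z) \<cdot> (e \<otimes> Idn C (?z \<odot> ?z))) \<cdot> (?I \<otimes> (s \<cdot> e))"
      using K k e s by (simp add: assc_inv_nat_Idn)
    also have "\<dots> = (k \<otimes> k) \<cdot> ((mlt K \<otimes> Idn C ?z) \<cdot> Inv C (Assc C ?z ?z ?z) \<cdot> (Idn C ?z \<otimes> s)) \<cdot> (e \<otimes> e)"
      using K k e s by (simp add: merge)
    finally show "(?m \<otimes> ?I) \<cdot> Inv C (Assc C ?P ?P ?P) \<cdot> (?I \<otimes> ((k \<otimes> k) \<cdot> s \<cdot> e)) = (k \<otimes> k) \<cdot> (s \<cdot> mlt K) \<cdot> (e \<otimes> e)"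
      unfolding s2 .
    have "(?I \<otimes> ?m) \<cdot> Assc C ?P ?P ?P \<cdot> (((k \<otimes> k) \<cdot> s \<cdot> e) \<otimes> ?I)
      = (?I \<otimes> ?m) \<cdot> (Assc C ?P ?P ?P \<cdot> ((k \<otimes> k) \<otimes> ?I)) \<cdot> ((s \<cdot> e) \<otimes> ?I)"
      using K k e s by (simp add: merge)
    also have "\<dots> = (?I \<otimes> ?m) \<cdot> (k \<otimes> (k \<otimes> ?I)) \<cdot> Assc C ?z ?z ?P \<cdot> ((s \<cdot> e) \<otimes> ?I)"
      using K k e s by (simp add: assc_nat)
    also have "\<dots> = (k \<otimes> (k \<cdot> mlt K \<cdot> (Idn C ?z \<otimes> e))) \<cdot> Assc C ?z ?z ?P \<cdot> ((s \<cdot> e) \<otimes> ?I)"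
      using K k e s by (simp add: merge km)
    also have "\<dots> = (k \<otimes> (k \<cdot> mlt K)) \<cdot> ((Idn C ?z \<otimes> (Idn C ?z \<otimes> e)) \<cdot> Assc C ?z ?z ?P) \<cdot> ((s \<cdot> e) \<otimes> ?I)"
      using K k e s by (simp add: merge)
    also have "\<dots> = (k \<otimes> (k \<cdot> mlt K)) \<cdot> (Assc C ?z ?z ?z \<cdot> (Idn C (?z \<odot> ?z) \<otimes> e)) \<cdot> ((s \<cdot> e) \<otimes> ?I)"
      using K k e s by (simp add: assc_nat_Idn)
    also have "\<dots> = (k \<otimes> k) \<cdot> ((Idn C ?z \<otimes> mlt K) \<cdot> Assc C ?z ?z ?z \<cdot> (s \<otimes> Idn C ?z)) \<cdot> (e \<otimes> e)"
      using K k e s by (simp add: merge)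
    finally show "(?I \<otimes> ?m) \<cdot> Assc C ?P ?P ?P \<cdot> (((k \<otimes> k) \<cdot> s \<cdot> e) \<otimes> ?I) = (k \<otimes> k) \<cdot> (s \<cdot> mlt K) \<cdot> (e \<otimes> e)"
      unfolding s3 .
  qed
  note RL = left[OF R.A_typed(1-4) _ _ _ _ _ _ s s2 s3 prod_ring_inj(1,3), simplified]
    right[OF R.A_typed(1-4) _ _ _ _ _ _ s s2 s3 prod_ring_inj(1,3), simplified]
  note SL = left[OF S.A_typed(1-4) _ _ _ _ _ _ r r2 r3 prod_ring_inj(2,4), simplified]
    right[OF S.A_typed(1-4) _ _ _ _ _ _ r r2 r3 prod_ring_inj(2,4), simplified]
  let ?s = "(?i \<otimes> ?i) \<cdot> s \<cdot> ?p" and ?r = "(?j \<otimes> ?j) \<cdot> r \<cdot> ?q"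
  define e where "e = ?s \<oplus> ?r"
  have e: "e \<in> Arr C" "Dom C e = ?P" "Cod C e = ?P \<odot> ?P" unfolding e_def using s r by simp_all
  have assocP: "f \<cdot> (?m \<cdot> (?m \<otimes> ?I)) = f \<cdot> (?m \<cdot> (?I \<otimes> ?m) \<cdot> Assc C ?P ?P ?P)"
    if K: "carr K \<in> Obj C" "mlt K \<in> Arr C" "Dom C (mlt K) = carr K \<odot> carr K" "Cod C (mlt K) = carr K"
      and a: "mlt K \<cdot> (mlt K \<otimes> Idn C (carr K)) = mlt K \<cdot> (Idn C (carr K) \<otimes> mlt K) \<cdot> Assc C (carr K) (carr K) (carr K)"
      and f: "f \<in> Arr C" "Dom C f = ?P" "Cod C f = carr K" and fm: "f \<cdot> ?m = mlt K \<cdot> (f \<otimes> f)" for f K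
  proof -
    have "f \<cdot> (?m \<cdot> (?m \<otimes> ?I)) = (mlt K \<cdot> (mlt K \<otimes> Idn C (carr K))) \<cdot> ((f \<otimes> f) \<otimes> f)"
      using K f by (simp add: tail[OF fm] merge fm)
    also have "\<dots> = mlt K \<cdot> (Idn C (carr K) \<otimes> mlt K) \<cdot> (f \<otimes> (f \<otimes> f)) \<cdot> Assc C ?P ?P ?P"
      unfolding a using K f by (simp add: assc_nat)
    also have "\<dots> = f \<cdot> (?m \<cdot> (?I \<otimes> ?m) \<cdot> Assc C ?P ?P ?P)"
      using K f by (simp add: tail[OF fm] merge fm)
    finally show ?thesis .
  qed
  show ?thesis
  proof (rule tt_ringI[where s = e]; (simp only: prod_ring_carr)?)
    show "?m \<cdot> (?m \<otimes> ?I) = ?m \<cdot> (?I \<otimes> ?m) \<cdot> Assc C ?P ?P ?P"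
      by (rule dsum_eqI[OF _ _ _ _ _ _ _ assocP[of R ?p] assocP[of S ?q]])
        (simp_all add: R.A_assoc S.A_assoc prod_ring_prj)
    show "?m \<cdot> (?u \<otimes> ?I) = Lun C ?P"
      using tail[OF R.A_unit_left, of "Idn C (One C) \<otimes> ?p"] tail[OF S.A_unit_left, of "Idn C (One C) \<otimes> ?q"]
      by - (rule dsum_eqI[of ?x ?y], simp_all add: t merge prod_ring_prj lun_nat)
    show "?m \<cdot> (?I \<otimes> ?u) = Run C ?P"
      using tail[OF R.A_unit_right, of "?p \<otimes> Idn C (One C)"] tail[OF S.A_unit_right, of "?q \<otimes> Idn C (One C)"]
      by - (rule dsum_eqI[of ?x ?y], simp_all add: t merge prod_ring_prj run_nat)
    show "?m \<cdot> Brd C ?P ?P = ?m"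
      using tail[OF R.A_comm, of "?p \<otimes> ?p"] tail[OF S.A_comm, of "?q \<otimes> ?q"]
      by - (rule dsum_eqI[of ?x ?y], simp_all add: t prod_ring_prj brd_nat)
    show "?m \<cdot> e = ?I"
    proof (rule dsum_eqI[of ?x ?y])
      show "?p \<cdot> (?m \<cdot> e) = ?p \<cdot> ?I"
        unfolding e_def using s r
        by (simp add: t plus_right merge ten_Zer_left ten_Zer_right comp_Zer_left comp_Zer_right plus_Zer_right
            tail[OF s1])
      show "?q \<cdot> (?m \<cdot> e) = ?q \<cdot> ?I"
        unfolding e_def using s r
        by (simp add: t plus_right merge ten_Zer_left ten_Zer_right comp_Zer_left comp_Zer_right plus_Zer_left
            tail[OF r1])
    qed (use e in auto)
    have em: "e \<cdot> ?m = (?i \<otimes> ?i) \<cdot> s \<cdot> mlt R \<cdot> (?p \<otimes> ?p) \<oplus> (?j \<otimes> ?j) \<cdot> r \<cdot> mlt S \<cdot> (?q \<otimes> ?q)"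
      unfolding e_def using s r by (simp add: plus_left prod_ring_prj)
    show "e \<cdot> ?m = (?m \<otimes> ?I) \<cdot> Inv C (Assc C ?P ?P ?P) \<cdot> (?I \<otimes> e)"
      unfolding em unfolding e_def using s r RL SL by (simp add: ten_plus_right plus_right)
    show "e \<cdot> ?m = (?I \<otimes> ?m) \<cdot> Assc C ?P ?P ?P \<cdot> (e \<otimes> ?I)"
      unfolding em unfolding e_def using s r RL SL by (simp add: ten_plus_left plus_right)
  qed (use e in simp_all)
qed

end

end

section \<open>Algebras over \<open>A\<close> as rings in \<open>A\<close>-modules\<close>

context ring_modules
begin

lemma und_assc_inv_proj:
  assumes m: "module l" "module m" "module n"
  shows "Inv C (und_assc l m n) \<cdot> (proj l (Ten m n) \<cdot> (Idn C (fst l) \<otimes> proj m n))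
      = proj (Ten l m) n \<cdot> ((proj l m \<otimes> Idn C (fst n)) \<cdot> Inv C (Assc C (fst l) (fst m) (fst n)))"
    "\<lbrakk>k \<in> Arr C; Cod C k = fst l \<odot> (fst m \<odot> fst n)\<rbrakk> \<Longrightarrow>
     Inv C (und_assc l m n) \<cdot> (proj l (Ten m n) \<cdot> ((Idn C (fst l) \<otimes> proj m n) \<cdot> k))
      = proj (Ten l m) n \<cdot> ((proj l m \<otimes> Idn C (fst n)) \<cdot> (Inv C (Assc C (fst l) (fst m) (fst n)) \<cdot> k))"
proof -
  note [simp] = und_assc_iso[OF m]
  let ?A = "Assc C (fst l) (fst m) (fst n)"
  show *: "Inv C (und_assc l m n) \<cdot> (proj l (Ten m n) \<cdot> (Idn C (fst l) \<otimes> proj m n))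
      = proj (Ten l m) n \<cdot> ((proj l m \<otimes> Idn C (fst n)) \<cdot> Inv C ?A)"
  proof (rule iso_cancel_left[of "und_assc l m n"])
    show "und_assc l m n \<cdot> (Inv C (und_assc l m n) \<cdot> (proj l (Ten m n) \<cdot> (Idn C (fst l) \<otimes> proj m n)))
      = und_assc l m n \<cdot> (proj (Ten l m) n \<cdot> ((proj l m \<otimes> Idn C (fst n)) \<cdot> Inv C ?A))"
      using m by (simp add: und_assc_proj)
  qed (use m in simp_all)
  show "\<lbrakk>k \<in> Arr C; Cod C k = fst l \<odot> (fst m \<odot> fst n)\<rbrakk> \<Longrightarrow>
     Inv C (und_assc l m n) \<cdot> (proj l (Ten m n) \<cdot> ((Idn C (fst l) \<otimes> proj m n) \<cdot> k))
      = proj (Ten l m) n \<cdot> ((proj l m \<otimes> Idn C (fst n)) \<cdot> (Inv C ?A \<cdot> k))"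
    using m by (subst tail3[OF *]) auto
qed

lemma Inv_Assc_Modc:
  assumes m: "module l" "module m" "module n"
  shows "Inv D (Ten (Ten l m) n, und_assc l m n, Ten l (Ten m n)) = (Ten l (Ten m n), Inv C (und_assc l m n), Ten (Ten l m) n)"
  using Modc_iso[of "(Ten (Ten l m) n, und_assc l m n, Ten l (Ten m n))"] und_assc_iso[OF m] m by simp

lemma Inv_und_assc_linear:
  "module l \<Longrightarrow> module m \<Longrightarrow> module n \<Longrightarrow> linear (Ten l (Ten m n)) (Inv C (und_assc l m n)) (Ten (Ten l m) n)"
  by (rule linear_Inv) (simp_all add: und_assc_iso)

definition und_mlt where
  "und_mlt f B = descend C (proj (alg_mod C f B) (alg_mod C f B)) (mlt B)"

lemma alg_ring_sel:
  "carr (alg_ring C A f B) = alg_mod C f B"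
  "mlt (alg_ring C A f B) = (Ten (alg_mod C f B) (alg_mod C f B), und_mlt f B, alg_mod C f B)"
  "unt (alg_ring C A f B) = ((a, mlt A), f, alg_mod C f B)"
  by (simp_all add: alg_ring_def Let_def und_mlt_def)

lemma fst_alg_mod [simp]: "fst (alg_mod C f B) = carr B"
  by (simp add: alg_mod_def)

lemma snd_alg_mod: "snd (alg_mod C f B) = mlt B \<cdot> (f \<otimes> Idn C (carr B))"
  by (simp add: alg_mod_def)

context
  fixes B f
  assumes B: "tt_ring C B" and f: "tt_ring_hom C A B f"
begin

interpretation B: ring_modules C B using B by (rule ring_modulesI)

abbreviation (input) "b \<equiv> carr B"
abbreviation (input) "M \<equiv> alg_mod C f B"

lemma alg_hom:
  "f \<in> Arr C" "Dom C f = a" "Cod C f = b" "f \<cdot> mlt A = mlt B \<cdot> (f \<otimes> f)" "f \<cdot> unt A = unt B"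
  using f by (auto simp: tt_ring_hom_def Hom_iff)

lemma alg_mod_module [simp]: "module M"
proof (rule moduleI; (simp only: fst_alg_mod snd_alg_mod)?)
  note h = alg_hom
  have "(mlt B \<cdot> (f \<otimes> Idn C b)) \<cdot> (mlt A \<otimes> Idn C b) = (mlt B \<cdot> (mlt B \<otimes> Idn C b)) \<cdot> ((f \<otimes> f) \<otimes> Idn C b)"
    using h by (simp add: merge)
  also have "\<dots> = mlt B \<cdot> (Idn C b \<otimes> mlt B) \<cdot> (f \<otimes> (f \<otimes> Idn C b)) \<cdot> Assc C a a b"
    unfolding B.A_assoc using h by (simp add: assc_nat)
  also have "\<dots> = (mlt B \<cdot> (f \<otimes> Idn C b)) \<cdot> (Idn C a \<otimes> (mlt B \<cdot> (f \<otimes> Idn C b))) \<cdot> Assc C a a b"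
    using h by (simp add: merge)
  finally show "(mlt B \<cdot> (f \<otimes> Idn C b)) \<cdot> (mlt A \<otimes> Idn C b)
    = (mlt B \<cdot> (f \<otimes> Idn C b)) \<cdot> (Idn C a \<otimes> (mlt B \<cdot> (f \<otimes> Idn C b))) \<cdot> Assc C a a b" .
  show "(mlt B \<cdot> (f \<otimes> Idn C b)) \<cdot> (unt A \<otimes> Idn C b) = Lun C b"
    using h by (simp add: merge B.A_unit_left)
qed (use alg_hom in simp_all)

text \<open>Commutativity of \<open>B\<close>, in the form of \<open>act_act_past\<close> for
  \<open>B\<close> acting on itself, moves the image of a scalar under \<open>f\<close> from the
  first factor to the second.\<close>

lemma mlt_balanced: "balanced M M (mlt B)"
proof -
  note h = alg_hom
  have "mlt B \<cdot> ((mlt B \<cdot> (f \<otimes> Idn C b)) \<otimes> Idn C b) = (mlt B \<cdot> (mlt B \<otimes> Idn C b)) \<cdot> ((f \<otimes> Idn C b) \<otimes> Idn C b)"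
    using h by (simp add: merge)
  also have "\<dots> = (mlt B \<cdot> (Idn C b \<otimes> mlt B) \<cdot> past b b b) \<cdot> ((f \<otimes> Idn C b) \<otimes> Idn C b)"
    using B.act_act_past[OF B.A_module] by (simp add: B.A_assoc)
  also have "\<dots> = mlt B \<cdot> (Idn C b \<otimes> (mlt B \<cdot> (f \<otimes> Idn C b))) \<cdot> past a b b"
    using h by (simp add: past_nat) (simp add: merge)
  finally show ?thesis using h by (simp add: balanced_def snd_alg_mod)
qed

lemma und_mlt_typed [simp]:
  "und_mlt f B \<in> Arr C" "Dom C (und_mlt f B) = fst (Ten M M)" "Cod C (und_mlt f B) = b"
  and und_mlt_proj: "und_mlt f B \<cdot> proj M M = mlt B"
  "\<lbrakk>k \<in> Arr C; Cod C k = b \<odot> b\<rbrakk> \<Longrightarrow> und_mlt f B \<cdot> (proj M M \<cdot> k) = mlt B \<cdot> k"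
proof -
  note d = descend_proj[OF _ _ mlt_balanced, folded und_mlt_def]
  show t: "und_mlt f B \<in> Arr C" "Dom C (und_mlt f B) = fst (Ten M M)" "Cod C (und_mlt f B) = b"
    and e: "und_mlt f B \<cdot> proj M M = mlt B"
    using d by simp_all
  show "\<lbrakk>k \<in> Arr C; Cod C k = b \<odot> b\<rbrakk> \<Longrightarrow> und_mlt f B \<cdot> (proj M M \<cdot> k) = mlt B \<cdot> k"
    using t by (subst tail[OF e]) simp_all
qed

lemma und_mlt_linear [simp]: "linear (Ten M M) (und_mlt f B) M"
proof -
  note h = alg_hom
  have "und_mlt f B \<cdot> snd (Ten M M) = snd M \<cdot> (Idn C a \<otimes> und_mlt f B)"
  proof (rule split_epi_cancel[of "Idn C a \<otimes> proj M M"])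
    have "(und_mlt f B \<cdot> snd (Ten M M)) \<cdot> (Idn C a \<otimes> proj M M)
      = (mlt B \<cdot> (mlt B \<otimes> Idn C b)) \<cdot> (((f \<otimes> Idn C b) \<otimes> Idn C b) \<cdot> Inv C (Assc C a b b))"
      using h by (simp add: und_mlt_proj) (simp add: snd_alg_mod merge)
    also have "\<dots> = mlt B \<cdot> (Idn C b \<otimes> mlt B) \<cdot> (f \<otimes> Idn C (b \<odot> b))"
      unfolding B.A_assoc assc_inv_nat_Idn(1)[of b b f b, unfolded h, OF B.A_typed(1,1) h(1) refl, symmetric]
      using h by simp
    also have "\<dots> = (snd M \<cdot> (Idn C a \<otimes> und_mlt f B)) \<cdot> (Idn C a \<otimes> proj M M)"
      using h by (simp add: snd_alg_mod merge und_mlt_proj)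
    finally show "(und_mlt f B \<cdot> snd (Ten M M)) \<cdot> (Idn C a \<otimes> proj M M)
      = (snd M \<cdot> (Idn C a \<otimes> und_mlt f B)) \<cdot> (Idn C a \<otimes> proj M M)" .
  qed (auto intro!: split_epi_ten)
  then show ?thesis by (simp add: linear_iff)
qed

lemma structure_linear [simp]: "linear (a, mlt A) f M"
  using alg_hom by (simp add: linear_iff snd_alg_mod merge)

text \<open>Each law is that of \<open>B\<close> after precomposition with projections. The bimodule
  section is that of \<open>B\<close> followed by \<open>proj M M\<close>.\<close>

lemma tt_ring_alg: "tt_ring D (alg_ring C A f B)"
proof -
  interpret D: additive_monoidal_cat D by (rule Modc_additive_monoidal)
  note h = alg_hom
  let ?m = "und_mlt f B" and ?I = "Idn C b" and ?q = "proj M M" and ?Q = "Ten M M"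
  note I = linear_Idn[OF alg_mod_module, simplified]
  obtain s where s: "s \<in> Arr C" "Dom C s = b" "Cod C s = b \<odot> b" and s1: "mlt B \<cdot> s = Idn C b"
    and s2: "s \<cdot> mlt B = (mlt B \<otimes> ?I) \<cdot> Inv C (Assc C b b b) \<cdot> (?I \<otimes> s)"
    and s3: "s \<cdot> mlt B = (?I \<otimes> mlt B) \<cdot> Assc C b b b \<cdot> (s \<otimes> ?I)"
    by (rule B.A_separable)
  \<comment> \<open>Linearity over \<open>A\<close> is left linearity of \<open>s\<close> over
    \<open>B\<close>, restricted along \<open>f\<close>.\<close>
  have "?q \<cdot> s \<cdot> snd M = snd ?Q \<cdot> (Idn C a \<otimes> (?q \<cdot> s))"
  proof -
    have "?q \<cdot> s \<cdot> snd M = ?q \<cdot> (s \<cdot> mlt B) \<cdot> (f \<otimes> ?I)" using h s by (simp add: snd_alg_mod)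
    also have "\<dots> = ?q \<cdot> (mlt B \<otimes> ?I) \<cdot> (Inv C (Assc C b b b) \<cdot> (f \<otimes> Idn C (b \<odot> b))) \<cdot> (Idn C a \<otimes> s)"
      unfolding s2 using h s by (simp add: merge)
    also have "\<dots> = ?q \<cdot> (mlt B \<otimes> ?I) \<cdot> ((f \<otimes> ?I) \<otimes> ?I) \<cdot> Inv C (Assc C a b b) \<cdot> (Idn C a \<otimes> s)"
      using h s by (simp add: assc_inv_nat_Idn)
    also have "\<dots> = snd ?Q \<cdot> (Idn C a \<otimes> (?q \<cdot> s))" using h s by (simp add: snd_alg_mod merge)
    finally show ?thesis .
  qed
  then have ls: "linear M (?q \<cdot> s) ?Q" using s by (simp add: linear_iff)
  note li = linear_Inv[OF und_linear(5) und_assc_iso]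
  have assoc': "?m \<cdot> und_ten ?Q M M M ?m ?I = ?m \<cdot> und_ten M ?Q M M ?I ?m \<cdot> und_assc M M M"
    by (rule proj_assc_cancel[of M M M])
      (use I und_assc_proj[of M M M] in \<open>simp_all add: und_ten_proj und_mlt_proj merge B.A_assoc\<close>)
  have unit1: "?m \<cdot> und_ten (a, mlt A) M M M f ?I = und_lun M"
    by (rule proj_cancel[of "(a, mlt A)" M])
      (use I in \<open>simp_all add: und_ten_proj und_mlt_proj und_lun_proj snd_alg_mod h\<close>)
  have unit2: "?m \<cdot> und_ten M (a, mlt A) M M ?I f = und_run M"
    by (rule proj_cancel[of M "(a, mlt A)"])
      (use I tail[OF B.A_comm, of "?I \<otimes> f"] in
        \<open>simp_all add: und_ten_proj und_mlt_proj und_lun_proj snd_alg_mod h brd_nat\<close>)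
  have comm: "?m \<cdot> und_brd M M = ?m"
    by (rule proj_cancel[of M M]) (simp_all add: und_mlt_proj und_brd_proj B.A_comm)
  have sep1: "?m \<cdot> ?q \<cdot> s = ?I" using s s1 by (simp add: und_mlt_proj)
  have sep2: "(?q \<cdot> s) \<cdot> ?m = und_ten ?Q M M M ?m ?I \<cdot> Inv C (und_assc M M M) \<cdot> und_ten M M M ?Q ?I (?q \<cdot> s)"
  proof (rule proj_cancel[of M M])
    have "(und_ten ?Q M M M ?m ?I \<cdot> Inv C (und_assc M M M) \<cdot> und_ten M M M ?Q ?I (?q \<cdot> s)) \<cdot> ?q
      = und_ten ?Q M M M ?m ?I \<cdot> (Inv C (und_assc M M M) \<cdot> (proj M ?Q \<cdot> (?I \<otimes> ?q))) \<cdot> (?I \<otimes> s)"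
      using I ls s und_assc_iso[of M M M] by (simp add: und_ten_proj) (simp add: merge)
    also have "\<dots> = ?q \<cdot> ((?m \<cdot> ?q) \<otimes> ?I) \<cdot> Inv C (Assc C b b b) \<cdot> (?I \<otimes> s)"
      using I s und_assc_inv_proj(1)[of M M M] by (simp add: und_ten_proj) (simp add: merge)
    also have "\<dots> = ((?q \<cdot> s) \<cdot> ?m) \<cdot> ?q" using s by (simp add: und_mlt_proj s2)
    finally show "((?q \<cdot> s) \<cdot> ?m) \<cdot> ?q
      = (und_ten ?Q M M M ?m ?I \<cdot> Inv C (und_assc M M M) \<cdot> und_ten M M M ?Q ?I (?q \<cdot> s)) \<cdot> ?q" by simp
  qed (use I ls s und_assc_iso[of M M M] in simp_all)
  have sep3: "(?q \<cdot> s) \<cdot> ?m = und_ten M ?Q M M ?I ?m \<cdot> und_assc M M M \<cdot> und_ten M M ?Q M (?q \<cdot> s) ?I"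
  proof (rule proj_cancel[of M M])
    have "(und_ten M ?Q M M ?I ?m \<cdot> und_assc M M M \<cdot> und_ten M M ?Q M (?q \<cdot> s) ?I) \<cdot> ?q
      = und_ten M ?Q M M ?I ?m \<cdot> (und_assc M M M \<cdot> (proj ?Q M \<cdot> (?q \<otimes> ?I))) \<cdot> (s \<otimes> ?I)"
      using I ls s by (simp add: und_ten_proj) (simp add: merge)
    also have "\<dots> = ?q \<cdot> (?I \<otimes> (?m \<cdot> ?q)) \<cdot> Assc C b b b \<cdot> (s \<otimes> ?I)"
      using I s und_assc_proj(1)[of M M M] by (simp add: und_ten_proj) (simp add: merge)
    also have "\<dots> = ((?q \<cdot> s) \<cdot> ?m) \<cdot> ?q" using s by (simp add: und_mlt_proj s3)
    finally show "((?q \<cdot> s) \<cdot> ?m) \<cdot> ?q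
      = (und_ten M ?Q M M ?I ?m \<cdot> und_assc M M M \<cdot> und_ten M M ?Q M (?q \<cdot> s) ?I) \<cdot> ?q" by simp
  qed (use I ls s in simp_all)
  show ?thesis
    by (rule D.tt_ringI[where s = "(M, ?q \<cdot> s, ?Q)"])
      (simp_all add: alg_ring_sel Modc_sel Inv_Assc_Modc ls assoc' unit1 unit2 comm sep1 sep2[symmetric] sep3[symmetric])
qed

end

end

section \<open>Splittings as maps in the base category\<close>

context additive_monoidal_cat
begin

lemma tt_ring_typed:
  assumes "tt_ring C R"
  shows "carr R \<in> Obj C" "mlt R \<in> Arr C" "Dom C (mlt R) = carr R \<odot> carr R" "Cod C (mlt R) = carr R"
    "unt R \<in> Arr C" "Dom C (unt R) = One C" "Cod C (unt R) = carr R"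
proof -
  interpret R: ring_modules C R using assms by (rule ring_modulesI)
  show "carr R \<in> Obj C" "mlt R \<in> Arr C" "Dom C (mlt R) = carr R \<odot> carr R" "Cod C (mlt R) = carr R"
    "unt R \<in> Arr C" "Dom C (unt R) = One C" "Cod C (unt R) = carr R" by simp_all
qed

lemma tt_ring_hom_typed:
  assumes "tt_ring_hom C R S u"
  shows "u \<in> Arr C" "Dom C u = carr R" "Cod C u = carr S" "u \<cdot> mlt R = mlt S \<cdot> (u \<otimes> u)" "u \<cdot> unt R = unt S"
  using assms by (auto simp: tt_ring_hom_def Hom_iff)

lemma tt_ring_hom_comp:
  assumes R: "tt_ring C R" "tt_ring C S" "tt_ring C T" and u: "tt_ring_hom C R S u" and v: "tt_ring_hom C S T v"
  shows "tt_ring_hom C R T (v \<cdot> u)"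
proof -
  note [simp] = tt_ring_typed[OF R(1)] tt_ring_typed[OF R(2)] tt_ring_typed[OF R(3)]
  note hu = tt_ring_hom_typed[OF u] and hv = tt_ring_hom_typed[OF v]
  note [simp] = hu(1-3) hv(1-3)
  have "(v \<cdot> u) \<cdot> mlt R = mlt T \<cdot> ((v \<cdot> u) \<otimes> (v \<cdot> u))"
    using tail[OF hv(4), of "u \<otimes> u"] by (simp add: hu(4) merge)
  moreover have "(v \<cdot> u) \<cdot> unt R = unt T" by (simp add: hu(5) hv(5))
  ultimately show ?thesis by (simp add: tt_ring_hom_def Hom_iff)
qed

lemma tt_ring_hom_Idn: "tt_ring C R \<Longrightarrow> tt_ring_hom C R R (Idn C (carr R))"
  by (simp add: tt_ring_hom_def Hom_iff tt_ring_typed)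

lemma interchange_typed [simp]:
  assumes "w \<in> Obj C" "x \<in> Obj C" "y \<in> Obj C" "z \<in> Obj C"
  shows "interchange C w x y z \<in> Arr C" "Dom C (interchange C w x y z) = (w \<odot> x) \<odot> (y \<odot> z)"
    "Cod C (interchange C w x y z) = (w \<odot> y) \<odot> (x \<odot> z)"
  unfolding interchange_def using assms by simp_all

text \<open>The unit \<open>1 \<otimes> 1\<close> is the image of \<open>1\<close> under the
  structure map, so compatibility with structure maps already forces preservation of units. For this
  reason \<open>splitting_map\<close> lists multiplicativity and the structure map only.\<close>

lemma unit_from_structure:
  assumes R: "tt_ring C R" and S: "tt_ring C S" and g: "tt_ring_hom C R S g"
    and h: "h \<in> Arr C" "Dom C h = carr R \<odot> carr R" "Cod C h = DSum C (carr R) (carr S)"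
    and e: "h \<cdot> (Idn C (carr R) \<otimes> unt R) \<cdot> Inv C (Run C (carr R))
      = Inj1 C (carr R) (carr S) \<oplus> Inj2 C (carr R) (carr S) \<cdot> g"
  shows "h \<cdot> unt (tensor_ring C R R) = unt (prod_ring C R S)"
proof -
  note [simp] = tt_ring_typed[OF R] tt_ring_typed[OF S] tt_ring_hom_typed(1-3)[OF g]
  have "h \<cdot> unt (tensor_ring C R R)
    = h \<cdot> (Idn C (carr R) \<otimes> unt R) \<cdot> (unt R \<otimes> Idn C (One C)) \<cdot> Inv C (Run C (One C))"
    using h by (simp add: tensor_ring_def merge lun_One_eq_run_One)
  also have "\<dots> = (h \<cdot> (Idn C (carr R) \<otimes> unt R) \<cdot> Inv C (Run C (carr R))) \<cdot> unt R"
    using h by (simp add: run_inv_nat)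
  also have "\<dots> = unt (prod_ring C R S)"
    unfolding e by (simp add: prod_ring_def Let_def plus_left tt_ring_hom_typed(5)[OF g])
  finally show ?thesis .
qed

end

context ring_modules
begin

text \<open>An equality, not just an isomorphism: the unit of \<open>A\<close>-modules is
  \<open>A\<close> with the identity as structure map. Since \<open>splitting_tower\<close> demands
  equality at stage 0, this is what lets the new tower begin with the shifted old one.\<close>

lemma unit_ring_Modc: "unit_ring D = alg_ring C A (Idn C a) A"
  by (simp add: unit_ring_def alg_ring_def alg_mod_def Modc_sel Let_def und_lun_def)

lemma alg_hom_linear:
  assumes B: "tt_ring C B" and S: "tt_ring C S" and f: "tt_ring_hom C A B f" and g: "tt_ring_hom C B S g"
  shows "linear (alg_mod C f B) g (alg_mod C (g \<cdot> f) S)"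
proof -
  note [simp] = tt_ring_typed[OF B] tt_ring_typed[OF S] tt_ring_hom_typed(1-3)[OF g] tt_ring_hom_typed(1-3)[OF f]
  note gf = tt_ring_hom_comp[OF A B S f g]
  note [simp] = alg_mod_module[OF B f] alg_mod_module[OF S gf]
  show ?thesis
    using tail[OF tt_ring_hom_typed(4)[OF g], of "f \<otimes> Idn C (carr B)"]
    by (simp add: linear_iff snd_alg_mod merge)
qed

lemma alg_ring_hom:
  assumes B: "tt_ring C B" and S: "tt_ring C S" and f: "tt_ring_hom C A B f" and g: "tt_ring_hom C B S g"
  shows "tt_ring_hom D (alg_ring C A f B) (alg_ring C A (g \<cdot> f) S) (alg_mod C f B, g, alg_mod C (g \<cdot> f) S)"
proof -
  note [simp] = tt_ring_typed[OF B] tt_ring_typed[OF S] tt_ring_hom_typed(1-3)[OF g] tt_ring_hom_typed(1-3)[OF f]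
  note gf = tt_ring_hom_comp[OF A B S f g]
  let ?M = "alg_mod C f B" and ?N = "alg_mod C (g \<cdot> f) S"
  note [simp] = alg_mod_module[OF B f] alg_mod_module[OF S gf] und_mlt_typed[OF B f] und_mlt_typed[OF S gf]
  note l = alg_hom_linear[OF assms]
  have "g \<cdot> und_mlt f B = und_mlt (g \<cdot> f) S \<cdot> und_ten ?M ?M ?N ?N g g"
    by (rule proj_cancel[of ?M ?M])
      (use l in \<open>simp_all add: und_ten_proj und_mlt_proj[OF B f] und_mlt_proj[OF S gf] tt_ring_hom_typed(4)[OF g]\<close>)
  then show ?thesis
    using l unfolding tt_ring_hom_def by (simp add: Modc_Hom_iff Modc_sel alg_ring_sel)
qed

context
  fixes B S f g
  assumes B: "tt_ring C B" and S: "tt_ring C S" and f: "tt_ring_hom C A B f" and g: "tt_ring_hom C A S g"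
begin

lemma prod_structure_hom:
  "tt_ring_hom C A (prod_ring C B S) (Inj1 C (carr B) (carr S) \<cdot> f \<oplus> Inj2 C (carr B) (carr S) \<cdot> g)"
proof -
  note [simp] = tt_ring_typed[OF B] tt_ring_typed[OF S] tt_ring_hom_typed(1-3)[OF g] tt_ring_hom_typed(1-3)[OF f]
    prod_ring_carr[OF B S] prod_ring_typed[OF B S]
  let ?u = "Inj1 C (carr B) (carr S) \<cdot> f \<oplus> Inj2 C (carr B) (carr S) \<cdot> g"
  have "?u \<cdot> mlt A = mlt (prod_ring C B S) \<cdot> (?u \<otimes> ?u)"
    by (rule dsum_eqI[of "carr B" "carr S"])
      (simp_all add: tail[OF prod_ring_prj(1)[OF B S]] tail[OF prod_ring_prj(2)[OF B S]] merge Prj_into_dsum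
        plus_left plus_right plus_Zer_left plus_Zer_right tt_ring_hom_typed(4)[OF f] tt_ring_hom_typed(4)[OF g])
  moreover have "?u \<cdot> unt A = unt (prod_ring C B S)"
    by (simp add: prod_ring_def Let_def plus_left tt_ring_hom_typed(5)[OF f] tt_ring_hom_typed(5)[OF g])
  ultimately show ?thesis by (simp add: tt_ring_hom_def Hom_iff)
qed

lemma alg_mod_prod:
  "alg_mod C (Inj1 C (carr B) (carr S) \<cdot> f \<oplus> Inj2 C (carr B) (carr S) \<cdot> g) (prod_ring C B S)
    = dsum_obj C A (alg_mod C f B) (alg_mod C g S)"
proof -
  note [simp] = tt_ring_typed[OF B] tt_ring_typed[OF S] tt_ring_hom_typed(1-3)[OF g] tt_ring_hom_typed(1-3)[OF f]
    prod_ring_carr[OF B S] prod_ring_typed[OF B S]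
  note [simp] = alg_mod_module[OF B f] alg_mod_module[OF S g]
  let ?u = "Inj1 C (carr B) (carr S) \<cdot> f \<oplus> Inj2 C (carr B) (carr S) \<cdot> g"
  note d = dsum_act[OF alg_mod_module[OF B f] alg_mod_module[OF S g], unfolded fst_alg_mod]
  have "mlt (prod_ring C B S) \<cdot> (?u \<otimes> Idn C (DSum C (carr B) (carr S)))
    = snd (dsum_obj C A (alg_mod C f B) (alg_mod C g S))"
    by (rule dsum_eqI[of "carr B" "carr S"])
      (simp_all add: tail[OF prod_ring_prj(1)[OF B S]] tail[OF prod_ring_prj(2)[OF B S]] merge Prj_into_dsum
        d snd_alg_mod)
  then show ?thesis by (auto simp: alg_mod_def prod_eq_iff)
qed

text \<open>Again an equality, since the chosen biproduct of modules is that of \<open>C\<close>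
  with componentwise action. A product of rings in modules can therefore be treated as the product
  formed in \<open>C\<close>, viewed as an \<open>A\<close>-algebra.\<close>

lemma prod_ring_Modc:
  "prod_ring D (alg_ring C A f B) (alg_ring C A g S)
    = alg_ring C A (Inj1 C (carr B) (carr S) \<cdot> f \<oplus> Inj2 C (carr B) (carr S) \<cdot> g) (prod_ring C B S)"
proof -
  note [simp] = tt_ring_typed[OF B] tt_ring_typed[OF S] tt_ring_hom_typed(1-3)[OF g] tt_ring_hom_typed(1-3)[OF f]
    prod_ring_carr[OF B S] prod_ring_typed[OF B S]
  let ?M = "alg_mod C f B" and ?N = "alg_mod C g S" and ?P = "prod_ring C B S"
  let ?u = "Inj1 C (carr B) (carr S) \<cdot> f \<oplus> Inj2 C (carr B) (carr S) \<cdot> g"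
  let ?S = "dsum_obj C A ?M ?N"
  let ?p = "Prj1 C (carr B) (carr S)" and ?q = "Prj2 C (carr B) (carr S)"
  note m = alg_mod_module[OF B f] alg_mod_module[OF S g]
  note l = dsum_linear[OF m, unfolded fst_alg_mod]
  note P = tt_ring_prod[OF B S] and u = prod_structure_hom
  note [simp] = m und_mlt_typed[OF B f] und_mlt_typed[OF S g]
    und_mlt_typed[OF P u, unfolded alg_mod_prod] dsum_module[OF m]
  have "Inj1 C (carr B) (carr S) \<cdot> und_mlt f B \<cdot> und_ten ?S ?S ?M ?M ?p ?p
      \<oplus> Inj2 C (carr B) (carr S) \<cdot> und_mlt g S \<cdot> und_ten ?S ?S ?N ?N ?q ?q = und_mlt ?u ?P"
  proof (rule proj_cancel[of ?S ?S])
    show "(Inj1 C (carr B) (carr S) \<cdot> und_mlt f B \<cdot> und_ten ?S ?S ?M ?M ?p ?p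
      \<oplus> Inj2 C (carr B) (carr S) \<cdot> und_mlt g S \<cdot> und_ten ?S ?S ?N ?N ?q ?q) \<cdot> proj ?S ?S
      = und_mlt ?u ?P \<cdot> proj ?S ?S"
      using l und_mlt_proj[OF P u, unfolded alg_mod_prod]
      by (simp add: plus_left und_ten_proj und_mlt_proj[OF B f] und_mlt_proj[OF S g])
        (simp add: prod_ring_def Let_def)
  qed (use l in simp_all)
  moreover have "descend C (proj ?S ?S) (mlt ?P) = und_mlt ?u ?P" by (simp add: und_mlt_def alg_mod_prod)
  ultimately show ?thesis
    by (simp add: prod_ring_def[of D] Let_def alg_ring_sel Modc_sel alg_ring_def[of C A ?u] alg_mod_prod)
qed

end

definition und_inter where
  "und_inter l m n k = Inv C (und_assc l n (Ten m k)) \<cdot>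
     und_ten l (Ten m (Ten n k)) l (Ten n (Ten m k)) (Idn C (fst l))
       (und_assc n m k \<cdot> und_ten (Ten m n) k (Ten n m) k (und_brd m n) (Idn C (fst k)) \<cdot> Inv C (und_assc m n k)) \<cdot>
     und_assc l m (Ten n k)"

context
  fixes l m n k
  assumes m [simp]: "module l" "module m" "module n" "module k"
begin

lemma interchange_Modc:
  "interchange D l m n k = (Ten (Ten l m) (Ten n k), und_inter l m n k, Ten (Ten l n) (Ten m k))"
  by (simp add: interchange_def Modc_sel Inv_Assc_Modc und_inter_def)

text \<open>Each factor of the interchange covers its counterpart in \<open>C\<close>, so the
  composite does so along \<open>proj \<otimes> proj\<close>. This compares the multiplication of a
  tensor product over \<open>A\<close> with the one in \<open>C\<close>.\<close>

lemma und_inter: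
  "linear (Ten (Ten l m) (Ten n k)) (und_inter l m n k) (Ten (Ten l n) (Ten m k))"
  "und_inter l m n k \<cdot> proj (Ten l m) (Ten n k) \<cdot> (proj l m \<otimes> proj n k)
    = proj (Ten l n) (Ten m k) \<cdot> (proj l n \<otimes> proj m k) \<cdot> interchange C (fst l) (fst m) (fst n) (fst k)"
proof -
  let ?w = "fst l" and ?x = "fst m" and ?y = "fst n" and ?z = "fst k" and ?i = "Idn C"
  let ?X = "und_ten (Ten m n) k (Ten n m) k (und_brd m n) (Idn C ?z)"
  let ?Z = "und_assc n m k \<cdot> ?X \<cdot> Inv C (und_assc m n k)"
  let ?G = "und_ten l (Ten m (Ten n k)) l (Ten n (Ten m k)) (Idn C ?w) ?Z"
  let ?v = "Assc C ?y ?x ?z \<cdot> (Brd C ?x ?y \<otimes> ?i ?z) \<cdot> Inv C (Assc C ?x ?y ?z)"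
  note [simp] = und_assc_iso[of m n k] und_assc_iso[of l n "Ten m k"]
  have lX: "linear (Ten (Ten m n) k) ?X (Ten (Ten n m) k)" by simp
  have lZ: "linear (Ten m (Ten n k)) ?Z (Ten n (Ten m k))"
    by (rule linear_comp[OF linear_comp[OF Inv_und_assc_linear lX] und_linear(5)]) simp_all
  have lG: "linear (Ten l (Ten m (Ten n k))) ?G (Ten l (Ten n (Ten m k)))"
    using lZ by simp
  show "linear (Ten (Ten l m) (Ten n k)) (und_inter l m n k) (Ten (Ten l n) (Ten m k))"
    unfolding und_inter_def
    by (rule linear_comp[OF linear_comp[OF und_linear(5) lG] Inv_und_assc_linear]) simp_all
  have Zt: "?Z \<in> Arr C" "Dom C ?Z = fst (Ten m (Ten n k))" "Cod C ?Z = fst (Ten n (Ten m k))" by simp_all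
  have Z: "?Z \<cdot> (proj m (Ten n k) \<cdot> (?i ?x \<otimes> proj n k)) = proj n (Ten m k) \<cdot> (?i ?y \<otimes> proj m k) \<cdot> ?v"
  proof -
    have "?Z \<cdot> (proj m (Ten n k) \<cdot> (?i ?x \<otimes> proj n k))
      = und_assc n m k \<cdot> ?X \<cdot> proj (Ten m n) k \<cdot> ((proj m n \<otimes> ?i ?z) \<cdot> Inv C (Assc C ?x ?y ?z))"
      by (simp add: und_assc_inv_proj)
    also have "\<dots> = und_assc n m k \<cdot> proj (Ten n m) k \<cdot> ((und_brd m n \<cdot> proj m n) \<otimes> ?i ?z) \<cdot> Inv C (Assc C ?x ?y ?z)"
      by (simp add: und_ten_proj) (simp add: merge)
    also have "\<dots> = (und_assc n m k \<cdot> (proj (Ten n m) k \<cdot> (proj n m \<otimes> ?i ?z))) \<cdot> (Brd C ?x ?y \<otimes> ?i ?z) \<cdot> Inv C (Assc C ?x ?y ?z)"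
      by (simp add: und_brd_proj) (simp add: merge)
    also have "\<dots> = proj n (Ten m k) \<cdot> (?i ?y \<otimes> proj m k) \<cdot> ?v" by (simp add: und_assc_proj)
    finally show ?thesis .
  qed
  have "und_inter l m n k \<cdot> proj (Ten l m) (Ten n k) \<cdot> (proj l m \<otimes> proj n k)
    = Inv C (und_assc l n (Ten m k)) \<cdot> ?G \<cdot> (und_assc l m (Ten n k) \<cdot> (proj (Ten l m) (Ten n k) \<cdot> (proj l m \<otimes> ?i (fst (Ten n k)))))
      \<cdot> (?i (?w \<odot> ?x) \<otimes> proj n k)"
    unfolding und_inter_def using lZ by (simp add: merge)
  also have "\<dots> = Inv C (und_assc l n (Ten m k)) \<cdot> ?G \<cdot> proj l (Ten m (Ten n k)) \<cdot> (?i ?w \<otimes> proj m (Ten n k))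
      \<cdot> (Assc C ?w ?x (fst (Ten n k)) \<cdot> (?i (?w \<odot> ?x) \<otimes> proj n k))"
    using lZ by (simp add: und_assc_proj)
  also have "\<dots> = Inv C (und_assc l n (Ten m k)) \<cdot> (?G \<cdot> proj l (Ten m (Ten n k))) \<cdot> (?i ?w \<otimes> (proj m (Ten n k) \<cdot> (?i ?x \<otimes> proj n k)))
      \<cdot> Assc C ?w ?x (?y \<odot> ?z)"
    using lZ by (simp add: assc_nat_Idn) (simp add: merge)
  also have "?G \<cdot> proj l (Ten m (Ten n k)) = proj l (Ten n (Ten m k)) \<cdot> (?i ?w \<otimes> ?Z)"
    using lZ by (intro und_ten_proj) simp_all
  also have "Inv C (und_assc l n (Ten m k)) \<cdot> (proj l (Ten n (Ten m k)) \<cdot> (?i ?w \<otimes> ?Z)) \<cdot> (?i ?w \<otimes> (proj m (Ten n k) \<cdot> (?i ?x \<otimes> proj n k)))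
      \<cdot> Assc C ?w ?x (?y \<odot> ?z)
    = Inv C (und_assc l n (Ten m k)) \<cdot> proj l (Ten n (Ten m k)) \<cdot> (?i ?w \<otimes> (?Z \<cdot> (proj m (Ten n k) \<cdot> (?i ?x \<otimes> proj n k))))
      \<cdot> Assc C ?w ?x (?y \<odot> ?z)"
    using Zt by (simp add: merge)
  also have "\<dots> = (Inv C (und_assc l n (Ten m k)) \<cdot> (proj l (Ten n (Ten m k)) \<cdot> (?i ?w \<otimes> proj n (Ten m k))))
      \<cdot> (?i ?w \<otimes> (?i ?y \<otimes> proj m k)) \<cdot> (?i ?w \<otimes> ?v) \<cdot> Assc C ?w ?x (?y \<odot> ?z)"
    unfolding Z by (simp add: merge)
  also have "\<dots> = proj (Ten l n) (Ten m k) \<cdot> (proj l n \<otimes> ?i (fst (Ten m k)))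
      \<cdot> (Inv C (Assc C ?w ?y (fst (Ten m k))) \<cdot> (?i ?w \<otimes> (?i ?y \<otimes> proj m k))) \<cdot> (?i ?w \<otimes> ?v) \<cdot> Assc C ?w ?x (?y \<odot> ?z)"
    by (simp add: und_assc_inv_proj)
  also have "\<dots> = proj (Ten l n) (Ten m k) \<cdot> (proj l n \<otimes> proj m k) \<cdot> Inv C (Assc C ?w ?y (?x \<odot> ?z))
      \<cdot> (?i ?w \<otimes> ?v) \<cdot> Assc C ?w ?x (?y \<odot> ?z)"
    by (simp add: assc_inv_nat) (simp add: merge)
  finally show "und_inter l m n k \<cdot> proj (Ten l m) (Ten n k) \<cdot> (proj l m \<otimes> proj n k)
    = proj (Ten l n) (Ten m k) \<cdot> (proj l n \<otimes> proj m k) \<cdot> interchange C ?w ?x ?y ?z"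
    by (simp add: interchange_def)
qed

end

text \<open>
  The composite of the projection \<open>B \<otimes> B \<rightarrow> B \<otimes>\<^sub>A B\<close> with an isomorphism to \<open>B \<times> S\<close> as in
  \<open>is_splitting\<close>; the last two conditions and balancedness say that \<open>h\<close> is a coequalizer.
\<close>

definition splitting_map where
  "splitting_map f B S g h \<longleftrightarrow>
    h \<in> Arr C \<and> Dom C h = carr B \<odot> carr B \<and> Cod C h = DSum C (carr B) (carr S) \<and>
    h \<cdot> mlt (tensor_ring C B B) = mlt (prod_ring C B S) \<cdot> (h \<otimes> h) \<and>
    h \<cdot> (Idn C (carr B) \<otimes> unt B) \<cdot> Inv C (Run C (carr B))
      = Inj1 C (carr B) (carr S) \<oplus> Inj2 C (carr B) (carr S) \<cdot> g \<and>
    Prj1 C (carr B) (carr S) \<cdot> h = mlt B \<and>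
    balanced (alg_mod C f B) (alg_mod C f B) h \<and>
    h \<cdot> (snd (alg_mod C f B) \<otimes> Idn C (carr B)) \<cdot> Inv C (Assc C a (carr B) (carr B))
      = snd (dsum_obj C A (alg_mod C f B) (alg_mod C (g \<cdot> f) S)) \<cdot> (Idn C a \<otimes> h) \<and>
    (\<exists>\<gamma>\<in>Arr C. Dom C \<gamma> = DSum C (carr B) (carr S) \<and> \<gamma> \<cdot> h = proj (alg_mod C f B) (alg_mod C f B)) \<and>
    (\<forall>u\<in>Arr C. \<forall>v\<in>Arr C. Dom C u = Cod C h \<and> Dom C v = Cod C h \<and> u \<cdot> h = v \<cdot> h \<longrightarrow> u = v)"

text \<open>The inverse sends \<open>x\<close> to the class of \<open>x \<otimes> 1\<close>. The
  explicit form serves to compute the structure map in \<open>is_splitting\<close>, which is written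
  with the inverse right unitor.\<close>

lemma Inv_und_run:
  assumes m: "module m"
  shows "is_iso C (und_run m)" "Inv C (und_run m) = proj m (a, mlt A) \<cdot> (Idn C (fst m) \<otimes> unt A) \<cdot> Inv C (Run C (fst m))"
proof -
  interpret D: additive_monoidal_cat D by (rule Modc_additive_monoidal)
  let ?g = "proj m (a, mlt A) \<cdot> (Idn C (fst m) \<otimes> unt A) \<cdot> Inv C (Run C (fst m))"
  have "is_iso D (Run D m)" using m by (intro D.coherence_typed) (simp add: Modc_sel)
  then obtain G where "inverse_arr D (Run D m) G" by (auto simp: is_iso_def)
  then have G: "linear m (und G) (Ten m (a, mlt A))" "und G \<cdot> und_run m = Idn C (fst (Ten m (a, mlt A)))"
    "und_run m \<cdot> und G = Idn C (fst m)"
    using m by (auto simp: inverse_arr_def Modc_sel Modc_Hom_iff)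
  then show i: "is_iso C (und_run m)"
    using m by (intro is_isoI[where g = "und G"]) (auto simp: linear_iff)
  have e: "und_run m \<cdot> ?g = Idn C (fst m)"
  proof -
    have "und_run m \<cdot> ?g = snd m \<cdot> (Brd C (fst m) a \<cdot> (Idn C (fst m) \<otimes> unt A)) \<cdot> Inv C (Run C (fst m))"
      using m by (simp add: und_lun_proj)
    also have "\<dots> = (snd m \<cdot> (unt A \<otimes> Idn C (fst m))) \<cdot> Brd C (fst m) (One C) \<cdot> Inv C (Run C (fst m))"
      using m by (simp add: brd_nat)
    also have "\<dots> = Idn C (fst m)" unfolding act_unt[OF m] using m by (simp add: tail[OF lun_brd])
    finally show ?thesis .
  qed
  show "Inv C (und_run m) = ?g"
    by (rule iso_cancel_left[OF i]) (use m i e in simp_all)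
qed

lemma Modc_iso_und:
  assumes "is_iso D F"
  shows "is_iso C (und F)"
proof -
  obtain G where "inverse_arr D F G" using assms by (auto simp: is_iso_def)
  then have "linear (fst F) (und F) (snd (snd F))" "linear (snd (snd F)) (und G) (fst F)"
    "und G \<cdot> und F = Idn C (fst (fst F))" "und F \<cdot> und G = Idn C (fst (snd (snd F)))"
    by (auto simp: inverse_arr_def Modc_sel Modc_Hom_iff prod_eq_iff)
  then show ?thesis by (intro is_isoI[where g = "und G"]) (auto simp: linear_iff)
qed

section \<open>Splittings in modules compared with splitting maps\<close>

context
  fixes B S f g
  assumes B: "tt_ring C B" and S: "tt_ring C S" and f: "tt_ring_hom C A B f" and g: "tt_ring_hom C B S g"
begin

abbreviation (input) "MB \<equiv> alg_mod C f B"
abbreviation (input) "MS \<equiv> alg_mod C (g \<cdot> f) S"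
abbreviation (input) "MP \<equiv> dsum_obj C A MB MS"

context
  fixes k
  assumes k: "linear (Ten MB MB) k MP"
begin

text \<open>The projection from \<open>B \<odot> B\<close> to the tensor product over
  \<open>A\<close> is multiplicative, and the tensor square of the latter is covered by the split
  epimorphism \<open>?p\<close>; so multiplicativity of \<open>k\<close> can be tested on
  \<open>k \<cdot> proj\<close>.\<close>

lemma splitting_mult_iff:
  "(Ten MB MB, k, MP) \<cdot>\<^bsub>D\<^esub> mlt (tensor_ring D (alg_ring C A f B) (alg_ring C A f B))
      = mlt (prod_ring D (alg_ring C A f B) (alg_ring C A (g \<cdot> f) S)) \<cdot>\<^bsub>D\<^esub> ((Ten MB MB, k, MP) \<otimes>\<^bsub>D\<^esub> (Ten MB MB, k, MP))
    \<longleftrightarrow> (k \<cdot> proj MB MB) \<cdot> mlt (tensor_ring C B B) = mlt (prod_ring C B S) \<cdot> ((k \<cdot> proj MB MB) \<otimes> (k \<cdot> proj MB MB))"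
proof -
  note gf = tt_ring_hom_comp[OF A B S f g]
  note [simp] = tt_ring_typed[OF B] tt_ring_typed[OF S] alg_mod_module[OF B f] alg_mod_module[OF S gf]
    prod_ring_carr[OF B S] prod_ring_typed[OF B S] und_mlt_typed[OF B f] und_mlt_linear[OF B f]
  note tP = tt_ring_prod[OF B S] and u = prod_structure_hom[OF B S f gf]
  let ?u = "Inj1 C (carr B) (carr S) \<cdot> f \<oplus> Inj2 C (carr B) (carr S) \<cdot> (g \<cdot> f)"
  note ap = alg_mod_prod[OF B S f gf]
  note [simp] = und_mlt_typed[OF tP u, unfolded ap]
  let ?m = "und_mlt ?u (prod_ring C B S)" and ?b = "und_mlt f B"
  let ?Q = "Ten MB MB" and ?q = "proj MB MB"
  let ?p = "proj ?Q ?Q \<cdot> (?q \<otimes> ?q)"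
  have kt [simp]: "k \<in> Arr C" "Dom C k = fst ?Q" "Cod C k = DSum C (carr B) (carr S)"
    using k by (auto simp: linear_iff)
  have it [simp]: "und_inter MB MB MB MB \<in> Arr C" "Dom C (und_inter MB MB MB MB) = fst (Ten ?Q ?Q)"
    "Cod C (und_inter MB MB MB MB) = fst (Ten ?Q ?Q)"
    using und_inter(1)[of MB MB MB MB] by (auto simp: linear_iff)
  let ?l = "k \<cdot> und_ten ?Q ?Q MB MB ?b ?b \<cdot> und_inter MB MB MB MB" and ?r = "?m \<cdot> und_ten ?Q ?Q MP MP k k"
  have lp: "?l \<cdot> ?p = (k \<cdot> ?q) \<cdot> mlt (tensor_ring C B B)"
  proof -
    have "?l \<cdot> ?p = k \<cdot> und_ten ?Q ?Q MB MB ?b ?b \<cdot> (und_inter MB MB MB MB \<cdot> proj ?Q ?Q \<cdot> (?q \<otimes> ?q))"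
      by simp
    also have "\<dots> = k \<cdot> ?q \<cdot> ((?b \<cdot> ?q) \<otimes> (?b \<cdot> ?q)) \<cdot> interchange C (carr B) (carr B) (carr B) (carr B)"
      using und_inter(2)[of MB MB MB MB] by (simp add: und_ten_proj) (simp add: merge)
    also have "\<dots> = (k \<cdot> ?q) \<cdot> mlt (tensor_ring C B B)"
      by (simp add: und_mlt_proj[OF B f] tensor_ring_def)
    finally show ?thesis .
  qed
  have rp: "?r \<cdot> ?p = mlt (prod_ring C B S) \<cdot> ((k \<cdot> ?q) \<otimes> (k \<cdot> ?q))"
    using k und_mlt_proj[OF tP u, unfolded ap] by (simp add: und_ten_proj) (simp add: merge)
  have "?l = ?r \<longleftrightarrow> ?l \<cdot> ?p = ?r \<cdot> ?p"
  proof
    assume "?l \<cdot> ?p = ?r \<cdot> ?p"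
    then show "?l = ?r"
      by (rule split_epi_cancel[rotated]) (use k in \<open>auto intro!: split_epi_comp split_epi_ten\<close>)
  qed (simp only:)
  then show ?thesis
    unfolding lp rp prod_ring_Modc[OF B S f gf]
    by (simp add: tensor_ring_def alg_ring_sel Modc_sel interchange_Modc ap)
qed

text \<open>The unit of \<open>B\<close> as a ring in modules is \<open>f\<close>, and
  \<open>f\<close> sends the unit of \<open>A\<close> to that of \<open>B\<close>; both sides send
  \<open>b\<close> to the image of the class of \<open>b \<otimes> 1\<close>.\<close>

lemma splitting_structure:
  "k \<cdot> und_ten MB (a, mlt A) MB MB (Idn C (carr B)) f \<cdot> Inv C (und_run MB)
    = (k \<cdot> proj MB MB) \<cdot> (Idn C (carr B) \<otimes> unt B) \<cdot> Inv C (Run C (carr B))"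
proof -
  note [simp] = tt_ring_typed[OF B] tt_ring_typed[OF S] alg_mod_module[OF B f] structure_linear[OF B f]
    tt_ring_hom_typed(1-3)[OF f]
  have kt [simp]: "k \<in> Arr C" "Dom C k = fst (Ten MB MB)" "Cod C k = DSum C (carr B) (carr S)"
    using k by (auto simp: linear_iff)
  note I = linear_Idn[OF alg_mod_module[OF B f], simplified]
  show ?thesis
    using I by (simp add: Inv_und_run und_ten_proj) (simp add: merge tt_ring_hom_typed(5)[OF f])
qed

lemma splitting_structure_iff:
  "(Ten MB MB, k, MP) \<cdot>\<^bsub>D\<^esub> (Idn D MB \<otimes>\<^bsub>D\<^esub> unt (alg_ring C A f B)) \<cdot>\<^bsub>D\<^esub> Inv D (Run D MB)
      = Inj1 D MB MS \<oplus>\<^bsub>D\<^esub> (Inj2 D MB MS \<cdot>\<^bsub>D\<^esub> (MB, g, MS))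
    \<longleftrightarrow> (k \<cdot> proj MB MB) \<cdot> (Idn C (carr B) \<otimes> unt B) \<cdot> Inv C (Run C (carr B))
      = Inj1 C (carr B) (carr S) \<oplus> Inj2 C (carr B) (carr S) \<cdot> g"
proof -
  note [simp] = alg_mod_module[OF B f]
  have Run: "Inv D (Run D MB) = (MB, Inv C (und_run MB), Ten MB (a, mlt A))"
    using Modc_iso[of "Run D MB"] Inv_und_run(1)[of MB] by (simp add: Modc_sel)
  show ?thesis
    unfolding splitting_structure[symmetric] alg_ring_sel Run by (simp add: Modc_sel)
qed

lemma splitting_prj_iff:
  "Prj1 D MB MS \<cdot>\<^bsub>D\<^esub> (Ten MB MB, k, MP) = mlt (alg_ring C A f B)
    \<longleftrightarrow> Prj1 C (carr B) (carr S) \<cdot> (k \<cdot> proj MB MB) = mlt B"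
proof -
  note gf = tt_ring_hom_comp[OF A B S f g]
  note [simp] = tt_ring_typed[OF B] tt_ring_typed[OF S] alg_mod_module[OF B f] alg_mod_module[OF S gf] und_mlt_typed[OF B f]
  have kt [simp]: "k \<in> Arr C" "Dom C k = fst (Ten MB MB)" "Cod C k = DSum C (carr B) (carr S)"
    using k by (auto simp: linear_iff)
  have "Prj1 C (carr B) (carr S) \<cdot> k = und_mlt f B \<longleftrightarrow> (Prj1 C (carr B) (carr S) \<cdot> k) \<cdot> proj MB MB = und_mlt f B \<cdot> proj MB MB"
  proof
    assume "(Prj1 C (carr B) (carr S) \<cdot> k) \<cdot> proj MB MB = und_mlt f B \<cdot> proj MB MB"
    then show "Prj1 C (carr B) (carr S) \<cdot> k = und_mlt f B"
      by (rule proj_cancel[rotated 2]) simp_all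
  qed (simp only:)
  then show ?thesis by (simp add: alg_ring_sel Modc_sel und_mlt_proj[OF B f])
qed

end

text \<open>Balancedness produces the factor \<open>k\<close> of \<open>h\<close> through
  \<open>proj\<close>, and \<open>\<gamma>\<close> factors \<open>proj\<close> through
  \<open>h\<close>. The two are mutually inverse: one composite by cancelling \<open>proj\<close>,
  the other by the cancellation clause for \<open>h\<close>.\<close>

lemma splitting_map_iso:
  assumes h: "splitting_map f B S g h"
  shows "is_iso C (descend C (proj MB MB) h)" "descend C (proj MB MB) h \<cdot> proj MB MB = h"
    "linear (Ten MB MB) (descend C (proj MB MB) h) MP" "split_epi h"
proof -
  note gf = tt_ring_hom_comp[OF A B S f g]
  note [simp] = tt_ring_typed[OF B] tt_ring_typed[OF S] alg_mod_module[OF B f] alg_mod_module[OF S gf]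
  have ht [simp]: "h \<in> Arr C" "Dom C h = carr B \<odot> carr B" "Cod C h = DSum C (carr B) (carr S)"
    and h4: "balanced MB MB h"
    and h5: "h \<cdot> (snd MB \<otimes> Idn C (carr B)) \<cdot> Inv C (Assc C a (carr B) (carr B)) = snd MP \<cdot> (Idn C a \<otimes> h)"
    and h6: "\<exists>\<gamma>\<in>Arr C. Dom C \<gamma> = DSum C (carr B) (carr S) \<and> \<gamma> \<cdot> h = proj MB MB"
    and h7: "\<forall>u\<in>Arr C. \<forall>v\<in>Arr C. Dom C u = Cod C h \<and> Dom C v = Cod C h \<and> u \<cdot> h = v \<cdot> h \<longrightarrow> u = v"
    using h unfolding splitting_map_def by blast+
  let ?q = "proj MB MB"
  define k where "k = descend C ?q h"
  note d = descend_proj[OF _ _ h4, folded k_def]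
  have kt [simp]: "k \<in> Arr C" "Dom C k = fst (Ten MB MB)" "Cod C k = DSum C (carr B) (carr S)"
    and kq: "k \<cdot> ?q = h" using d by simp_all
  have "k \<cdot> snd (Ten MB MB) = snd MP \<cdot> (Idn C a \<otimes> k)"
  proof (rule split_epi_cancel[of "Idn C a \<otimes> ?q"])
    have "(k \<cdot> snd (Ten MB MB)) \<cdot> (Idn C a \<otimes> ?q) = (k \<cdot> ?q) \<cdot> (snd MB \<otimes> Idn C (carr B)) \<cdot> Inv C (Assc C a (carr B) (carr B))"
      by simp
    also have "\<dots> = snd MP \<cdot> (Idn C a \<otimes> (k \<cdot> ?q))" unfolding kq by (rule h5)
    also have "\<dots> = (snd MP \<cdot> (Idn C a \<otimes> k)) \<cdot> (Idn C a \<otimes> ?q)"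
      using dsum_act[of MB MS] by (simp add: merge)
    finally show "(k \<cdot> snd (Ten MB MB)) \<cdot> (Idn C a \<otimes> ?q) = (snd MP \<cdot> (Idn C a \<otimes> k)) \<cdot> (Idn C a \<otimes> ?q)" .
  qed (use dsum_act[of MB MS] in \<open>auto intro!: split_epi_ten\<close>)
  then have l: "linear (Ten MB MB) k MP" by (simp add: linear_iff)
  obtain \<gamma> where \<gamma>: "\<gamma> \<in> Arr C" "Dom C \<gamma> = DSum C (carr B) (carr S)" and \<gamma>h: "\<gamma> \<cdot> h = ?q" using h6 by blast
  have "Cod C (\<gamma> \<cdot> h) = Cod C ?q" unfolding \<gamma>h ..
  then have \<gamma>c: "Cod C \<gamma> = fst (Ten MB MB)" using \<gamma> by simp
  have "\<gamma> \<cdot> k = Idn C (fst (Ten MB MB))"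
    by (rule proj_cancel[of MB MB]) (use \<gamma> \<gamma>c \<gamma>h kq in simp_all)
  moreover have "k \<cdot> \<gamma> = Idn C (DSum C (carr B) (carr S))"
  proof -
    have "(k \<cdot> \<gamma>) \<cdot> h = Idn C (DSum C (carr B) (carr S)) \<cdot> h" using \<gamma> \<gamma>c \<gamma>h kq by simp
    then show ?thesis
      using h7 \<gamma> \<gamma>c by (metis biprod_typed(1) comp_typed Idn_typed ht(3) kt tt_ring_typed(1)[OF B] tt_ring_typed(1)[OF S])
  qed
  ultimately have i: "is_iso C k" by (intro is_isoI[where g = \<gamma>]) (use \<gamma> \<gamma>c in simp_all)
  show "is_iso C (descend C ?q h)" "descend C ?q h \<cdot> ?q = h" "linear (Ten MB MB) (descend C ?q h) MP"
    using i kq l unfolding k_def by simp_all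
  show "split_epi h" unfolding kq[symmetric] using i by (auto intro!: split_epi_comp intro: iso_split_epi)
qed

text \<open>The dictionary is \<open>h = k \<cdot> proj\<close>, with \<open>k\<close> the
  underlying arrow of the isomorphism. On the right the chosen tensor product occurs only through
  its projection, as something that factors through \<open>h\<close>, and this form can be carried
  from one base to another.\<close>

lemma is_splitting_iff:
  "is_splitting D (alg_ring C A f B) (alg_ring C A (g \<cdot> f) S) (MB, g, MS) \<longleftrightarrow> (\<exists>h. splitting_map f B S g h)"
proof -
  interpret D: additive_monoidal_cat D by (rule Modc_additive_monoidal)
  note gf = tt_ring_hom_comp[OF A B S f g]
  note [simp] = tt_ring_typed[OF B] tt_ring_typed[OF S] alg_mod_module[OF B f] alg_mod_module[OF S gf]
    tt_ring_hom_typed(1-3)[OF f] tt_ring_hom_typed(1-3)[OF g] structure_linear[OF B f] und_mlt_typed[OF B f]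
  let ?A = "alg_ring C A f B" and ?A' = "alg_ring C A (g \<cdot> f) S"
  let ?ij = "Inj1 C (carr B) (carr S) \<oplus> Inj2 C (carr B) (carr S) \<cdot> g"
  note tt = tt_ring_alg[OF B f] tt_ring_alg[OF S gf] and hom = alg_ring_hom[OF B S f g]
  have carrs: "carr (tensor_ring D ?A ?A) = Ten MB MB" "carr (prod_ring D ?A ?A') = MP"
    by (simp_all add: tensor_ring_def prod_ring_def Let_def alg_ring_sel Modc_sel)
  have cA: "carr ?A = MB" "carr ?A' = MS" by (simp_all add: alg_ring_sel)
  note struct = splitting_structure_iff and prj = splitting_prj_iff
  show ?thesis
  proof
    assume "is_splitting D ?A ?A' (MB, g, MS)"
    then obtain F where iso: "tt_ring_iso D (tensor_ring D ?A ?A) (prod_ring D ?A ?A') F"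
      and F2: "F \<cdot>\<^bsub>D\<^esub> (Idn D (carr ?A) \<otimes>\<^bsub>D\<^esub> unt ?A) \<cdot>\<^bsub>D\<^esub> Inv D (Run D (carr ?A))
        = Inj1 D (carr ?A) (carr ?A') \<oplus>\<^bsub>D\<^esub> (Inj2 D (carr ?A) (carr ?A') \<cdot>\<^bsub>D\<^esub> (MB, g, MS))"
      and F3: "Prj1 D (carr ?A) (carr ?A') \<cdot>\<^bsub>D\<^esub> F = mlt ?A"
      unfolding is_splitting_def Let_def by blast
    note F2 = F2[unfolded cA] and F3 = F3[unfolded cA]
    define k where "k = und F"
    have l: "linear (Ten MB MB) k MP" and F: "F = (Ten MB MB, k, MP)"
      using iso by (auto simp: tt_ring_iso_def tt_ring_hom_def carrs Modc_Hom_iff k_def prod_eq_iff)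
    have kt [simp]: "k \<in> Arr C" "Dom C k = fst (Ten MB MB)" "Cod C k = DSum C (carr B) (carr S)"
      and lk: "k \<cdot> snd (Ten MB MB) = snd MP \<cdot> (Idn C a \<otimes> k)"
      using l by (auto simp: linear_iff)
    have ki: "is_iso C k" using Modc_iso_und[of F] iso by (simp add: F tt_ring_iso_def)
    let ?q = "proj MB MB"
    let ?h = "k \<cdot> ?q"
    have 1: "?h \<cdot> mlt (tensor_ring C B B) = mlt (prod_ring C B S) \<cdot> (?h \<otimes> ?h)"
      using iso splitting_mult_iff[OF l] unfolding F tt_ring_iso_def tt_ring_hom_def by blast
    have 2: "?h \<cdot> (Idn C (carr B) \<otimes> unt B) \<cdot> Inv C (Run C (carr B)) = ?ij"
      using F2 struct[OF l] unfolding F by blast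
    have 3: "Prj1 C (carr B) (carr S) \<cdot> ?h = mlt B"
      using F3 prj[OF l] unfolding F by blast
    have 4: "balanced MB MB ?h"
      using proj_balanced[of MB MB] unfolding balanced_def by simp
    have 5: "?h \<cdot> (snd MB \<otimes> Idn C (carr B)) \<cdot> Inv C (Assc C a (carr B) (carr B)) = snd MP \<cdot> (Idn C a \<otimes> ?h)"
    proof -
      have "?h \<cdot> (snd MB \<otimes> Idn C (carr B)) \<cdot> Inv C (Assc C a (carr B) (carr B)) = (k \<cdot> snd (Ten MB MB)) \<cdot> (Idn C a \<otimes> ?q)"
        by simp
      also have "\<dots> = snd MP \<cdot> (Idn C a \<otimes> ?h)"
        unfolding lk using dsum_act[of MB MS] by (simp add: merge)
      finally show ?thesis .
    qed
    have 6: "\<exists>\<gamma>\<in>Arr C. Dom C \<gamma> = DSum C (carr B) (carr S) \<and> \<gamma> \<cdot> ?h = ?q"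
      by (rule bexI[of _ "Inv C k"]) (use ki in simp_all)
    have se: "split_epi ?h" using ki by (auto intro!: split_epi_comp intro: iso_split_epi)
    have 7: "\<forall>u\<in>Arr C. \<forall>v\<in>Arr C. Dom C u = Cod C ?h \<and> Dom C v = Cod C ?h \<and> u \<cdot> ?h = v \<cdot> ?h \<longrightarrow> u = v"
      using split_epi_cancel[OF se] by blast
    have "?h \<in> Arr C" "Dom C ?h = carr B \<odot> carr B" "Cod C ?h = DSum C (carr B) (carr S)" by simp_all
    then have "splitting_map f B S g ?h"
      unfolding splitting_map_def using 1 2 3 4 5 6 7 by blast
    then show "\<exists>h. splitting_map f B S g h" by blast
  next
    assume "\<exists>h. splitting_map f B S g h"
    then obtain h where h: "splitting_map f B S g h" by blast
    have h1: "h \<cdot> mlt (tensor_ring C B B) = mlt (prod_ring C B S) \<cdot> (h \<otimes> h)"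
      and h2: "h \<cdot> (Idn C (carr B) \<otimes> unt B) \<cdot> Inv C (Run C (carr B)) = ?ij"
      and h3: "Prj1 C (carr B) (carr S) \<cdot> h = mlt B"
      using h unfolding splitting_map_def by blast+
    define k where "k = descend C (proj MB MB) h"
    note i = splitting_map_iso[OF h, folded k_def]
    note ki = i(1) and kq = i(2) and l = i(3)
    let ?F = "(Ten MB MB, k, MP)"
    have "is_iso D ?F" using Modc_iso[of ?F] l ki by simp
    moreover have F2: "?F \<cdot>\<^bsub>D\<^esub> (Idn D MB \<otimes>\<^bsub>D\<^esub> unt ?A) \<cdot>\<^bsub>D\<^esub> Inv D (Run D MB)
        = Inj1 D MB MS \<oplus>\<^bsub>D\<^esub> (Inj2 D MB MS \<cdot>\<^bsub>D\<^esub> (MB, g, MS))"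
      using struct[OF l] kq h2 by simp
    moreover have "?F \<cdot>\<^bsub>D\<^esub> mlt (tensor_ring D ?A ?A) = mlt (prod_ring D ?A ?A') \<cdot>\<^bsub>D\<^esub> (?F \<otimes>\<^bsub>D\<^esub> ?F)"
      using splitting_mult_iff[OF l] kq h1 by simp
    \<comment> \<open>Preservation of the unit comes from the structure-map identity
      \<open>F2\<close>, by \<open>unit_from_structure\<close> inside
      \<open>A\<close>-modules.\<close>
    moreover have "?F \<cdot>\<^bsub>D\<^esub> unt (tensor_ring D ?A ?A) = unt (prod_ring D ?A ?A')"
      by (rule D.unit_from_structure[OF tt hom, unfolded cA, OF _ _ _ F2]) (use l in \<open>simp_all add: alg_ring_sel Modc_sel\<close>)
    moreover have "?F \<in> Hom D (carr (tensor_ring D ?A ?A)) (carr (prod_ring D ?A ?A'))"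
      using l by (simp add: carrs Modc_Hom_iff)
    moreover have "Prj1 D MB MS \<cdot>\<^bsub>D\<^esub> ?F = mlt ?A"
      using prj[OF l] kq h3 by simp
    ultimately show "is_splitting D ?A ?A' (MB, g, MS)"
      unfolding is_splitting_def Let_def cA tt_ring_iso_def tt_ring_hom_def[of D "tensor_ring D ?A ?A"]
      using tt hom by blast
  qed
qed

end

section \<open>Base change along the tower\<close>

context
  fixes S B R f s g
  assumes S: "tt_ring C S" and B: "tt_ring C B" and R: "tt_ring C R"
    and f: "tt_ring_hom C A S f" and s: "tt_ring_hom C S B s" and g: "tt_ring_hom C B R g"
begin

interpretation D: additive_monoidal_cat D by (rule Modc_additive_monoidal)
interpretation S: ring_modules C S using S by (rule ring_modulesI)
interpretation E: ring_modules D "alg_ring C A f S" using tt_ring_alg[OF S f] by (rule D.ring_modulesI)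

abbreviation (input) "mS \<equiv> alg_mod C f S"
abbreviation (input) "mB \<equiv> alg_mod C (s \<cdot> f) B"
abbreviation (input) "mR \<equiv> alg_mod C (g \<cdot> s \<cdot> f) R"
abbreviation (input) "rB \<equiv> alg_ring C A (s \<cdot> f) B"
abbreviation (input) "rR \<equiv> alg_ring C A (g \<cdot> s \<cdot> f) R"
abbreviation (input) "sT \<equiv> (mS, s, mB)"
abbreviation (input) "gT \<equiv> (mB, g, mR)"
abbreviation (input) "mod2 \<equiv> alg_mod D sT rB"
text \<open>The action of \<open>S\<close> on \<open>B\<close> inside \<open>A\<close>-modules, a
  map out of the tensor product of \<open>S\<close> and \<open>B\<close> over \<open>A\<close>; by
  \<open>act2_proj\<close> it covers the action in \<open>C\<close>.\<close>

abbreviation (input) "act2 \<equiv> und_mlt (s \<cdot> f) B \<cdot> und_ten mS mB mB mB s (Idn C (carr B))"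

lemma sf: "tt_ring_hom C A B (s \<cdot> f)" and gs: "tt_ring_hom C S R (g \<cdot> s)"
  and gsf: "tt_ring_hom C A R (g \<cdot> s \<cdot> f)"
  using tt_ring_hom_comp[OF A S B f s] tt_ring_hom_comp[OF S B R s g]
    tt_ring_hom_comp[OF A B R tt_ring_hom_comp[OF A S B f s] g] by auto

lemmas base_simps [simp] = tt_ring_typed[OF S] tt_ring_typed[OF B] tt_ring_typed[OF R]
  tt_ring_hom_typed(1-3)[OF f] tt_ring_hom_typed(1-3)[OF s] tt_ring_hom_typed(1-3)[OF g]
  alg_mod_module[OF S f] alg_mod_module[OF B sf] alg_mod_module[OF R gsf]
  und_mlt_typed[OF B sf] und_mlt_linear[OF B sf] alg_hom_linear[OF S B f s] alg_hom_linear[OF B R sf g]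
  linear_Idn[OF alg_mod_module[OF B sf], unfolded fst_alg_mod]

lemma mod2_sel: "fst mod2 = mB" "snd mod2 = (Ten mS mB, act2, mB)"
  by (simp_all add: alg_mod_def[of D] alg_ring_sel Modc_sel)

lemma act2_linear [simp]: "linear (Ten mS mB) act2 mB"
  by (rule linear_comp[where m = "Ten mB mB"]) simp_all

lemma act2_typed [simp]: "act2 \<in> Arr C" "Dom C act2 = fst (Ten mS mB)" "Cod C act2 = carr B"
  by simp_all

lemma act2_proj: "act2 \<cdot> proj mS mB = mlt B \<cdot> (s \<otimes> Idn C (carr B))"
  by (simp add: und_ten_proj und_mlt_proj[OF B sf])

text \<open>The heart of base change; \<open>S.\<close> refers to \<open>S\<close>-modules in
  \<open>C\<close>, \<open>E.\<close> to \<open>S\<close>-modules inside \<open>A\<close>-modules.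
  Balancedness in the latter sense is an equation between maps out of an iterated tensor product of
  \<open>S\<close>, \<open>B\<close>, \<open>B\<close> over \<open>A\<close>. The split epimorphism
  \<open>?p\<close> and the projections pull it back to \<open>C\<close>, where it is balancedness
  over \<open>S\<close> of \<open>k \<cdot> proj mB mB\<close>.\<close>

lemma balanced2_iff:
  assumes k: "linear (Ten mB mB) k n"
  shows "E.balanced mod2 mod2 (Ten mB mB, k, n) \<longleftrightarrow>
    S.balanced (alg_mod C s B) (alg_mod C s B) (k \<cdot> proj mB mB)"
proof -
  let ?I = "Idn C (carr B)" and ?q = "proj mB mB"
  have kt: "k \<in> Arr C" "Dom C k = fst (Ten mB mB)" "Cod C k = fst n" "module n" using k by (auto simp: linear_iff)
  \<comment> \<open>A single name keeps the action from being expanded into its factors; only its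
    type, its linearity and \<open>rp\<close> enter.\<close>
  obtain r where r: "r = act2" by simp
  have rt: "r \<in> Arr C" "Dom C r = fst (Ten mS mB)" "Cod C r = carr B" "linear (Ten mS mB) r mB"
    and rp: "r \<cdot> proj mS mB = mlt B \<cdot> (s \<otimes> ?I)"
    unfolding r using act2_typed act2_linear act2_proj by blast+
  let ?L = "k \<cdot> und_ten (Ten mS mB) mB mB mB r ?I"
  let ?R = "k \<cdot> und_ten mB (Ten mS mB) mB mB ?I r \<cdot> und_assc mB mS mB
    \<cdot> und_ten (Ten mS mB) mB (Ten mB mS) mB (und_brd mS mB) ?I"
  let ?p = "proj (Ten mS mB) mB \<cdot> (proj mS mB \<otimes> Idn C (fst mB))"
  have L: "?L \<cdot> ?p = (k \<cdot> ?q) \<cdot> ((mlt B \<cdot> (s \<otimes> ?I)) \<otimes> ?I)"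
    using kt rt by (simp add: und_ten_proj) (simp add: merge rp)
  have "?R \<cdot> ?p = k \<cdot> und_ten mB (Ten mS mB) mB mB ?I r
      \<cdot> (und_assc mB mS mB \<cdot> (proj (Ten mB mS) mB \<cdot> (proj mB mS \<otimes> Idn C (fst mB)))) \<cdot> (Brd C (carr S) (carr B) \<otimes> ?I)"
    using kt rt by (simp add: und_ten_proj) (simp add: merge und_brd_proj)
  also have "\<dots> = k \<cdot> ?q \<cdot> (?I \<otimes> (r \<cdot> proj mS mB)) \<cdot> past (carr S) (carr B) (carr B)"
    using kt rt by (simp add: und_assc_proj[of mB mS mB, unfolded fst_alg_mod] und_ten_proj past_def) (simp add: merge)
  finally have Rp: "?R \<cdot> ?p = (k \<cdot> ?q) \<cdot> (?I \<otimes> (mlt B \<cdot> (s \<otimes> ?I))) \<cdot> past (carr S) (carr B) (carr B)"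
    unfolding rp using kt by simp
  have "?L = ?R \<longleftrightarrow> ?L \<cdot> ?p = ?R \<cdot> ?p"
  proof
    assume "?L \<cdot> ?p = ?R \<cdot> ?p"
    then show "?L = ?R" by (rule proj_assc_cancel[rotated 3]) (use kt rt in simp_all)
  qed (simp only:)
  then show ?thesis
    unfolding L Rp using kt k
    by (simp add: E.balanced_def S.balanced_def mod2_sel Modc_sel D.past_def alg_ring_sel S.snd_alg_mod r[symmetric])
qed

text \<open>\<open>A\<close> acts through \<open>S\<close>, so \<open>h\<close> is also balanced
  over \<open>A\<close> and factors through \<open>proj mB mB\<close>. After composition with
  projections, the algebraic clauses for the factor \<open>k\<close> become those for
  \<open>h\<close>. The coequalizer clauses require more: \<open>k\<close> inherits a section from
  \<open>h\<close>, and the factor of the projection over \<open>S\<close> has to be shown linear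
  over \<open>A\<close>.\<close>

lemma descended_splitting_map:
  assumes h: "S.splitting_map s B R g h"
  shows "E.splitting_map sT rB rR gT (Ten mB mB, descend C (proj mB mB) h, dsum_obj C A mB mR)"
proof -
  let ?I = "Idn C (carr B)" and ?q = "proj mB mB" and ?P = "dsum_obj C A mB mR"
  let ?SB = "alg_mod C s B" and ?SR = "alg_mod C (g \<cdot> s) R"
  let ?SP = "dsum_obj C S ?SB ?SR"
  let ?i = "Inj1 C (carr B) (carr R)" and ?j = "Inj2 C (carr B) (carr R)"
  let ?u = "?i \<cdot> s \<oplus> ?j \<cdot> g \<cdot> s" and ?Pr = "prod_ring C B R"
  have ht [simp]: "h \<in> Arr C" "Dom C h = carr B \<odot> carr B" "Cod C h = DSum C (carr B) (carr R)"
    and h1: "h \<cdot> mlt (tensor_ring C B B) = mlt (prod_ring C B R) \<cdot> (h \<otimes> h)"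
    and h2: "h \<cdot> (?I \<otimes> unt B) \<cdot> Inv C (Run C (carr B)) = ?i \<oplus> ?j \<cdot> g"
    and h3: "Prj1 C (carr B) (carr R) \<cdot> h = mlt B"
    and h4: "S.balanced ?SB ?SB h"
    and h5: "h \<cdot> (snd ?SB \<otimes> ?I) \<cdot> Inv C (Assc C (carr S) (carr B) (carr B)) = snd ?SP \<cdot> (Idn C (carr S) \<otimes> h)"
    using h unfolding S.splitting_map_def by blast+
  have se: "split_epi h" by (rule S.splitting_map_iso(4)[OF B R s g h])
  note [simp] = prod_ring_carr[OF B R] prod_ring_typed[OF B R] S.alg_mod_module[OF B s] S.alg_mod_module[OF R gs]
  have uf: "?u \<cdot> f = ?i \<cdot> s \<cdot> f \<oplus> ?j \<cdot> g \<cdot> s \<cdot> f" by (simp add: plus_left)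
  have SP: "snd ?SP = mlt ?Pr \<cdot> (?u \<otimes> Idn C (DSum C (carr B) (carr R)))"
    by (subst S.alg_mod_prod[OF B R s gs, symmetric]) (simp add: S.snd_alg_mod)
  have P: "snd ?P = mlt ?Pr \<cdot> ((?u \<cdot> f) \<otimes> Idn C (DSum C (carr B) (carr R)))"
    unfolding uf by (subst alg_mod_prod[OF B R sf gsf, symmetric]) (simp add: snd_alg_mod)
  have b: "balanced mB mB h"
  proof -
    have e: "h \<cdot> ((mlt B \<cdot> (s \<otimes> ?I)) \<otimes> ?I) = h \<cdot> (?I \<otimes> (mlt B \<cdot> (s \<otimes> ?I))) \<cdot> past (carr S) (carr B) (carr B)"
      using h4 by (simp add: S.balanced_def S.snd_alg_mod)
    have "h \<cdot> ((mlt B \<cdot> ((s \<cdot> f) \<otimes> ?I)) \<otimes> ?I) = (h \<cdot> ((mlt B \<cdot> (s \<otimes> ?I)) \<otimes> ?I)) \<cdot> ((f \<otimes> ?I) \<otimes> ?I)"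
      by (simp add: merge)
    also have "\<dots> = h \<cdot> (?I \<otimes> (mlt B \<cdot> ((s \<cdot> f) \<otimes> ?I))) \<cdot> past a (carr B) (carr B)"
      unfolding e by (simp add: past_nat) (simp add: merge)
    finally show ?thesis by (simp add: balanced_def snd_alg_mod)
  qed
  define k where "k = descend C ?q h"
  note d = descend_proj[OF _ _ b, folded k_def]
  have kt [simp]: "k \<in> Arr C" "Dom C k = fst (Ten mB mB)" "Cod C k = DSum C (carr B) (carr R)"
    and kq: "k \<cdot> ?q = h" using d by simp_all
  have kq': "k \<cdot> (?q \<cdot> x) = h \<cdot> x" if "x \<in> Arr C" "Cod C x = carr B \<odot> carr B" for x
    using tail[OF kq, of x] that by simp
  have l: "linear (Ten mB mB) k ?P"
  proof -
    have "k \<cdot> snd (Ten mB mB) = snd ?P \<cdot> (Idn C a \<otimes> k)"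
    proof (rule split_epi_cancel[of "Idn C a \<otimes> ?q"])
      have "(k \<cdot> snd (Ten mB mB)) \<cdot> (Idn C a \<otimes> ?q)
        = h \<cdot> ((mlt B \<cdot> (s \<otimes> ?I)) \<otimes> ?I) \<cdot> (((f \<otimes> ?I) \<otimes> ?I) \<cdot> Inv C (Assc C a (carr B) (carr B)))"
        by (simp add: kq' snd_alg_mod merge)
      also have "\<dots> = (h \<cdot> (snd ?SB \<otimes> ?I) \<cdot> Inv C (Assc C (carr S) (carr B) (carr B))) \<cdot> (f \<otimes> Idn C (carr B \<odot> carr B))"
        using assc_inv_nat_Idn(1)[of "carr B" "carr B" f "carr S"] by (simp add: S.snd_alg_mod)
      also have "\<dots> = snd ?P \<cdot> (Idn C a \<otimes> (k \<cdot> ?q))"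
        unfolding h5 SP P kq by (simp add: merge)
      also have "\<dots> = (snd ?P \<cdot> (Idn C a \<otimes> k)) \<cdot> (Idn C a \<otimes> ?q)"
        using dsum_act[of mB mR] by (simp add: merge)
      finally show "(k \<cdot> snd (Ten mB mB)) \<cdot> (Idn C a \<otimes> ?q) = (snd ?P \<cdot> (Idn C a \<otimes> k)) \<cdot> (Idn C a \<otimes> ?q)" .
    qed (use dsum_act[of mB mR] in \<open>auto intro!: split_epi_ten\<close>)
    then show ?thesis by (simp add: linear_iff)
  qed
  \<comment> \<open>A section of \<open>h\<close> followed by \<open>?q\<close> is a section of
    \<open>k\<close>. It is a section in \<open>C\<close> and no linearity is claimed.\<close>
  have kse: "split_epi k"
  proof -
    obtain x where x: "x \<in> Arr C" "Dom C x = Cod C h" "Cod C x = Dom C h" "h \<cdot> x = Idn C (Cod C h)"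
      using se by (rule split_epiE)
    show ?thesis by (rule split_epiI[where s = "?q \<cdot> x"]) (use x kq' in simp_all)
  qed
  let ?H = "(Ten mB mB, k, ?P)"
  note rB = tt_ring_alg[OF B sf] and rR = tt_ring_alg[OF R gsf]
  have sTgT: "gT \<cdot>\<^bsub>D\<^esub> sT = (mS, g \<cdot> s, mR)" by (simp add: Modc_sel)
  have sTh: "tt_ring_hom D (alg_ring C A f S) rB sT" by (rule alg_ring_hom[OF S B f s])
  have gTh: "tt_ring_hom D rB rR gT" by (rule alg_ring_hom[OF B R sf g])
  have gsTh: "tt_ring_hom D (alg_ring C A f S) rR (gT \<cdot>\<^bsub>D\<^esub> sT)"
    by (rule D.tt_ring_hom_comp[OF tt_ring_alg[OF S f] rB rR sTh gTh])
  have c: "carr rB = mB" "carr rR = mR" by (simp_all add: alg_ring_sel)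
  have Hd: "?H \<in> Arr D" "Dom D ?H = carr rB \<odot>\<^bsub>D\<^esub> carr rB" "Cod D ?H = DSum D (carr rB) (carr rR)"
    using l by (simp_all add: Modc_sel c)
  have H1: "?H \<cdot>\<^bsub>D\<^esub> mlt (tensor_ring D rB rB) = mlt (prod_ring D rB rR) \<cdot>\<^bsub>D\<^esub> (?H \<otimes>\<^bsub>D\<^esub> ?H)"
    unfolding splitting_mult_iff[OF B R sf g l] kq by (rule h1)
  have H2: "?H \<cdot>\<^bsub>D\<^esub> (Idn D (carr rB) \<otimes>\<^bsub>D\<^esub> unt rB) \<cdot>\<^bsub>D\<^esub> Inv D (Run D (carr rB))
      = Inj1 D (carr rB) (carr rR) \<oplus>\<^bsub>D\<^esub> (Inj2 D (carr rB) (carr rR) \<cdot>\<^bsub>D\<^esub> gT)"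
    unfolding c splitting_structure_iff[OF B R sf g l] kq by (rule h2)
  have H3: "Prj1 D (carr rB) (carr rR) \<cdot>\<^bsub>D\<^esub> ?H = mlt rB"
    unfolding c splitting_prj_iff[OF B R sf g l] kq by (rule h3)
  have H4: "E.balanced mod2 mod2 ?H"
    unfolding balanced2_iff[OF l] kq by (rule h4)
  have H5: "?H \<cdot>\<^bsub>D\<^esub> (snd mod2 \<otimes>\<^bsub>D\<^esub> Idn D (carr rB)) \<cdot>\<^bsub>D\<^esub> Inv D (Assc D (carr (alg_ring C A f S)) (carr rB) (carr rB))
      = snd (dsum_obj D (alg_ring C A f S) mod2 (alg_mod D (gT \<cdot>\<^bsub>D\<^esub> sT) rR)) \<cdot>\<^bsub>D\<^esub> (Idn D (carr (alg_ring C A f S)) \<otimes>\<^bsub>D\<^esub> ?H)"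
  proof -
    let ?uT = "Inj1 D (carr rB) (carr rR) \<cdot>\<^bsub>D\<^esub> sT \<oplus>\<^bsub>D\<^esub> Inj2 D (carr rB) (carr rR) \<cdot>\<^bsub>D\<^esub> (gT \<cdot>\<^bsub>D\<^esub> sT)"
    have uT: "?uT = (mS, ?u, ?P)" by (simp add: Modc_sel c)
    note PR = tt_ring_prod[OF B R] and uu = prod_structure_hom[OF B R sf gsf]
    note ap = alg_mod_prod[OF B R sf gsf]
    let ?uf = "?i \<cdot> s \<cdot> f \<oplus> ?j \<cdot> g \<cdot> s \<cdot> f"
    note [simp] = und_mlt_typed[OF PR uu, unfolded ap] und_mlt_linear[OF PR uu, unfolded ap]
    have lu: "linear mS ?u ?P"
      using alg_hom_linear[OF S PR f S.prod_structure_hom[OF B R s gs]]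
      unfolding uf ap .
    have lI: "linear ?P (Idn C (DSum C (carr B) (carr R))) ?P"
      using linear_Idn[of ?P] by simp
    \<comment> \<open>The action on the biproduct comes from the ring map \<open>?u\<close> from
      \<open>S\<close> into the product of \<open>B\<close> and \<open>R\<close>, in
      \<open>C\<close> as well as inside \<open>A\<close>-modules. Both sides of the clause thus
      become multiplication in \<open>?Pr\<close> by the image of a scalar.\<close>
    have sd: "snd (dsum_obj D (alg_ring C A f S) mod2 (alg_mod D (gT \<cdot>\<^bsub>D\<^esub> sT) rR))
      = (Ten mS ?P, und_mlt ?uf ?Pr \<cdot> und_ten mS ?P ?P ?P ?u (Idn C (DSum C (carr B) (carr R))), ?P)"
      unfolding E.alg_mod_prod[OF rB rR sTh gsTh, symmetric]
      unfolding uT prod_ring_Modc[OF B R sf gsf]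
      by (simp add: alg_mod_def[of D] alg_ring_sel Modc_sel ap)
    let ?L = "k \<cdot> und_ten (Ten mS mB) mB mB mB act2 ?I \<cdot> Inv C (und_assc mS mB mB)"
    let ?R = "(und_mlt ?uf ?Pr \<cdot> und_ten mS ?P ?P ?P ?u (Idn C (DSum C (carr B) (carr R)))) \<cdot> und_ten mS (Ten mB mB) mS ?P (Idn C (carr S)) k"
    let ?p = "proj mS (Ten mB mB) \<cdot> (Idn C (fst mS) \<otimes> ?q)"
    note IS = linear_Idn[OF alg_mod_module[OF S f], unfolded fst_alg_mod]
    obtain r where r: "r = act2" by simp
    have rt: "r \<in> Arr C" "Dom C r = fst (Ten mS mB)" "Cod C r = carr B" "linear (Ten mS mB) r mB"
      and rp: "r \<cdot> proj mS mB = mlt B \<cdot> (s \<otimes> ?I)"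
      unfolding r using act2_typed act2_linear act2_proj by blast+
    note ia [simp] = und_assc_iso[of mS mB mB]
    have "?L = ?R"
    proof (rule split_epi_cancel[of ?p])
      have "?L \<cdot> ?p = k \<cdot> und_ten (Ten mS mB) mB mB mB r ?I \<cdot> (Inv C (und_assc mS mB mB) \<cdot> (proj mS (Ten mB mB) \<cdot> (Idn C (fst mS) \<otimes> ?q)))"
        unfolding r[symmetric] using rt by simp
      also have "\<dots> = k \<cdot> ?q \<cdot> ((r \<cdot> proj mS mB) \<otimes> ?I) \<cdot> Inv C (Assc C (carr S) (carr B) (carr B))"
        using rt by (subst und_assc_inv_proj(1)) (simp_all add: und_ten_proj, simp add: merge)
      also have "\<dots> = h \<cdot> (snd ?SB \<otimes> ?I) \<cdot> Inv C (Assc C (carr S) (carr B) (carr B))"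
        unfolding rp by (simp add: kq' S.snd_alg_mod)
      also have "\<dots> = mlt ?Pr \<cdot> (?u \<otimes> h)"
        unfolding h5 SP by (simp add: merge)
      also have "\<dots> = ?R \<cdot> ?p"
        using lu lI l IS und_mlt_proj[OF PR uu, unfolded ap] by (simp add: und_ten_proj merge kq)
      finally show "?L \<cdot> ?p = ?R \<cdot> ?p" .
    qed (use l lu lI IS in \<open>auto intro!: split_epi_ten split_epi_comp\<close>)
    then show ?thesis
      unfolding sd mod2_sel by (simp add: alg_ring_sel Modc_sel Inv_Assc_Modc)
  qed
  have m2: "E.module mod2" by (rule E.alg_mod_module[OF rB sTh])
  have H6: "\<exists>\<gamma>\<in>Arr D. Dom D \<gamma> = DSum D (carr rB) (carr rR) \<and> \<gamma> \<cdot>\<^bsub>D\<^esub> ?H = E.proj mod2 mod2"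
  proof -
    \<comment> \<open>The chosen projection over \<open>S\<close> inside \<open>A\<close>-modules;
      only its type and its balancedness are known.\<close>
    obtain Q where Q: "Q = E.proj mod2 mod2" by simp
    have "Q \<in> Arr D" "Dom D Q = mB \<odot>\<^bsub>D\<^esub> mB"
      unfolding Q using E.proj_typed[OF m2 m2] by (simp_all add: c)
    then have Qt: "fst Q = Ten mB mB" "linear (Ten mB mB) (und Q) (snd (snd Q))" by (auto simp: Modc_sel)
    then have Qe: "Q = (Ten mB mB, und Q, snd (snd Q))" by (simp add: prod_eq_iff)
    have "E.balanced mod2 mod2 (Ten mB mB, und Q, snd (snd Q))"
      unfolding Qe[symmetric] unfolding Q using m2 m2 by (rule E.proj_split)
    then have "S.balanced ?SB ?SB (und Q \<cdot> ?q)" unfolding balanced2_iff[OF Qt(2)] .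
    then obtain \<beta> where \<beta>: "\<beta> \<in> Arr C" "Dom C \<beta> = fst (S.Ten ?SB ?SB)" "Cod C \<beta> = Cod C (und Q \<cdot> ?q)"
      and \<beta>q: "\<beta> \<cdot> S.proj ?SB ?SB = und Q \<cdot> ?q"
      using S.descend_proj[of ?SB ?SB] by (metis S.alg_mod_module[OF B s])
    obtain \<delta> where \<delta>: "\<delta> \<in> Arr C" "Dom C \<delta> = DSum C (carr B) (carr R)" and \<delta>h: "\<delta> \<cdot> h = S.proj ?SB ?SB"
      using h unfolding S.splitting_map_def by blast
    have "Cod C (\<delta> \<cdot> h) = fst (S.Ten ?SB ?SB)" unfolding \<delta>h by simp
    then have \<delta>c: "Cod C \<delta> = fst (S.Ten ?SB ?SB)" using \<delta> by simp
    have Qu: "und Q \<in> Arr C" "Dom C (und Q) = fst (Ten mB mB)" "Cod C (und Q) = fst (snd (snd Q))" "module (snd (snd Q))"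
      and Ql: "und Q \<cdot> snd (Ten mB mB) = snd (snd (snd Q)) \<cdot> (Idn C a \<otimes> und Q)"
      using Qt(2) by (auto simp: linear_iff)
    \<comment> \<open>Composed with \<open>?q\<close>, the projection \<open>Q\<close> becomes
      balanced over \<open>S\<close> in \<open>C\<close>, so it factors through
      \<open>S.proj\<close> by \<open>\<beta>\<close>, and \<open>S.proj\<close> factors through
      \<open>h\<close> by \<open>\<delta>\<close>. Linearity of the composite over \<open>A\<close>
      is tested after \<open>Idn C a \<otimes> k\<close>, which is a split epimorphism by
      \<open>kse\<close>.\<close>
    let ?\<gamma> = "\<beta> \<cdot> \<delta>"
    have \<gamma>t: "?\<gamma> \<in> Arr C" "Dom C ?\<gamma> = DSum C (carr B) (carr R)" "Cod C ?\<gamma> = fst (snd (snd Q))"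
      using \<beta> \<delta> \<delta>c Qu by simp_all
    have \<gamma>h: "?\<gamma> \<cdot> h = und Q \<cdot> ?q" using \<beta> \<delta> \<delta>c by (simp add: \<delta>h \<beta>q)
    have \<gamma>k: "?\<gamma> \<cdot> k = und Q"
    proof (rule proj_cancel[of mB mB])
      show "(?\<gamma> \<cdot> k) \<cdot> ?q = und Q \<cdot> ?q" unfolding \<gamma>h[symmetric] kq[symmetric] using \<beta> \<delta> \<delta>c by simp
    qed (use \<gamma>t Qu in simp_all)
    obtain \<gamma> where \<gamma>: "\<gamma> = ?\<gamma>" by simp
    note \<gamma>t = \<gamma>t[folded \<gamma>] and \<gamma>k = \<gamma>k[folded \<gamma>]
    have lk: "k \<cdot> snd (Ten mB mB) = snd ?P \<cdot> (Idn C a \<otimes> k)" using l by (simp add: linear_iff)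
    note dd = dsum_act(1-3)[of mB mR, simplified]
    have "\<gamma> \<cdot> snd ?P = snd (snd (snd Q)) \<cdot> (Idn C a \<otimes> \<gamma>)"
    proof (rule split_epi_cancel[of "Idn C a \<otimes> k"])
      have "(\<gamma> \<cdot> snd ?P) \<cdot> (Idn C a \<otimes> k) = \<gamma> \<cdot> (k \<cdot> snd (Ten mB mB))"
        unfolding lk using \<gamma>t dd by simp
      also have "\<dots> = (\<gamma> \<cdot> k) \<cdot> snd (Ten mB mB)" using \<gamma>t by simp
      also have "\<dots> = snd (snd (snd Q)) \<cdot> (Idn C a \<otimes> (\<gamma> \<cdot> k))" unfolding \<gamma>k by (rule Ql)
      also have "\<dots> = (snd (snd (snd Q)) \<cdot> (Idn C a \<otimes> \<gamma>)) \<cdot> (Idn C a \<otimes> k)" using \<gamma>t Qu by (simp add: merge)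
      finally show "(\<gamma> \<cdot> snd ?P) \<cdot> (Idn C a \<otimes> k) = (snd (snd (snd Q)) \<cdot> (Idn C a \<otimes> \<gamma>)) \<cdot> (Idn C a \<otimes> k)" .
    qed (use \<gamma>t Qu dd kse in \<open>auto intro!: split_epi_ten\<close>)
    then have "linear ?P \<gamma> (snd (snd Q))" using \<gamma>t Qu by (simp add: linear_iff)
    then show ?thesis
      by (intro bexI[of _ "(?P, \<gamma>, snd (snd Q))"])
        (use \<gamma>k Qt in \<open>auto simp: Modc_sel c Q[symmetric] prod_eq_iff\<close>)
  qed
  have H7: "\<forall>u\<in>Arr D. \<forall>v\<in>Arr D. Dom D u = Cod D ?H \<and> Dom D v = Cod D ?H \<and> u \<cdot>\<^bsub>D\<^esub> ?H = v \<cdot>\<^bsub>D\<^esub> ?H \<longrightarrow> u = v"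
  proof (intro ballI impI)
    fix u v assume u: "u \<in> Arr D" and v: "v \<in> Arr D"
      and e: "Dom D u = Cod D ?H \<and> Dom D v = Cod D ?H \<and> u \<cdot>\<^bsub>D\<^esub> ?H = v \<cdot>\<^bsub>D\<^esub> ?H"
    then have "und u \<cdot> k = und v \<cdot> k" "fst u = ?P" "fst v = ?P" "snd (snd u) = snd (snd v)" by (auto simp: Modc_sel)
    moreover have "und u = und v"
      by (rule split_epi_cancel[OF kse calculation(1)]) (use u v calculation(2,3) in \<open>auto simp: Modc_sel linear_iff\<close>)
    ultimately show "u = v" by (simp add: prod_eq_iff)
  qed
  show ?thesis
    unfolding E.splitting_map_def k_def[symmetric] using Hd H1 H2 H3 H4 H5 H6 H7 by blast
qed

text \<open>\<open>is_splitting_iff\<close> is used twice, over \<open>S\<close> in \<open>C\<close>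
  and over \<open>S\<close> inside \<open>A\<close>-modules; between the two only the map
  \<open>h\<close> is transported.\<close>

lemma base_change_splitting:
  assumes "is_splitting (Modc C S) (alg_ring C S s B) (alg_ring C S (g \<cdot> s) R)
    (alg_mod C s B, g, alg_mod C (g \<cdot> s) R)"
  shows "is_splitting (Modc D (alg_ring C A f S)) (alg_ring D (alg_ring C A f S) sT rB)
    (alg_ring D (alg_ring C A f S) (gT \<cdot>\<^bsub>D\<^esub> sT) rR) (mod2, gT, alg_mod D (gT \<cdot>\<^bsub>D\<^esub> sT) rR)"
proof -
  obtain h where "S.splitting_map s B R g h"
    using assms unfolding S.is_splitting_iff[OF B R s g] by blast
  from descended_splitting_map[OF this]
  show ?thesis
    unfolding E.is_splitting_iff[OF tt_ring_alg[OF B sf] tt_ring_alg[OF R gsf] alg_ring_hom[OF S B f s] alg_ring_hom[OF B R sf g]]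
    by blast
qed

end

end

section \<open>Extension of scalars\<close>

context additive_monoidal_cat
begin

text \<open>Serves \<open>ext_ring\<close>: in place of a proof that extension of scalars is a
  monoidal functor, its multiplication and unit satisfy the ring laws because an isomorphism carries
  them to those of a ring. Each law is checked after \<open>u\<close> or
  \<open>u \<otimes> u\<close>, and the bimodule section is conjugated by \<open>u\<close>.\<close>

lemma tt_ring_transport:
  assumes S: "tt_ring C S"
    and R: "carr R \<in> Obj C" "mlt R \<in> Arr C" "Dom C (mlt R) = carr R \<odot> carr R" "Cod C (mlt R) = carr R"
      "unt R \<in> Arr C" "Dom C (unt R) = One C" "Cod C (unt R) = carr R"
    and u: "tt_ring_iso C R S u"
  shows "tt_ring C R"
proof -
  interpret S: ring_modules C S using S by (rule ring_modulesI)
  let ?x = "carr R" and ?y = "carr S" and ?m = "mlt R" and ?I = "Idn C (carr R)"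
  have ui [simp]: "is_iso C u" using u by (simp add: tt_ring_iso_def)
  have ut [simp]: "u \<in> Arr C" "Dom C u = ?x" "Cod C u = ?y" and um: "u \<cdot> ?m = mlt S \<cdot> (u \<otimes> u)" and uu: "u \<cdot> unt R = unt S"
    using u by (auto simp: tt_ring_iso_def tt_ring_hom_def Hom_iff)
  note [simp] = R
  note um' = tail[OF um]
  obtain s where s [simp]: "s \<in> Arr C" "Dom C s = ?y" "Cod C s = ?y \<odot> ?y" and s1: "mlt S \<cdot> s = Idn C ?y"
    and s2: "s \<cdot> mlt S = (mlt S \<otimes> Idn C ?y) \<cdot> Inv C (Assc C ?y ?y ?y) \<cdot> (Idn C ?y \<otimes> s)"
    and s3: "s \<cdot> mlt S = (Idn C ?y \<otimes> mlt S) \<cdot> Assc C ?y ?y ?y \<cdot> (s \<otimes> Idn C ?y)"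
    by (rule S.A_separable)
  let ?v = "Inv C u"
  obtain r where r: "r = (?v \<otimes> ?v) \<cdot> s \<cdot> u" by simp
  have rt [simp]: "r \<in> Arr C" "Dom C r = ?x" "Cod C r = ?x \<odot> ?x" unfolding r by simp_all
  have ur: "(u \<otimes> u) \<cdot> r = s \<cdot> u" unfolding r by (simp add: merge(2))
  have uir: "(u \<otimes> (u \<otimes> u)) \<cdot> (?I \<otimes> r) = (Idn C ?y \<otimes> s) \<cdot> (u \<otimes> u)" by (simp add: merge ur)
  have uri: "((u \<otimes> u) \<otimes> u) \<cdot> (r \<otimes> ?I) = (s \<otimes> Idn C ?y) \<cdot> (u \<otimes> u)" by (simp add: merge ur)
  show ?thesis
  proof (rule tt_ringI[where s = r])
    show "?m \<cdot> (?m \<otimes> ?I) = ?m \<cdot> (?I \<otimes> ?m) \<cdot> Assc C ?x ?x ?x"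
    proof (rule iso_cancel_left[OF ui])
      have "u \<cdot> ?m \<cdot> (?m \<otimes> ?I) = (mlt S \<cdot> (mlt S \<otimes> Idn C ?y)) \<cdot> ((u \<otimes> u) \<otimes> u)"
        by (simp add: um' merge um)
      also have "\<dots> = mlt S \<cdot> (Idn C ?y \<otimes> mlt S) \<cdot> (u \<otimes> (u \<otimes> u)) \<cdot> Assc C ?x ?x ?x"
        unfolding S.A_assoc by (simp add: assc_nat)
      also have "\<dots> = u \<cdot> ?m \<cdot> (?I \<otimes> ?m) \<cdot> Assc C ?x ?x ?x"
        by (simp add: um' merge um)
      finally show "u \<cdot> ?m \<cdot> (?m \<otimes> ?I) = u \<cdot> ?m \<cdot> (?I \<otimes> ?m) \<cdot> Assc C ?x ?x ?x" .
    qed simp_all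
    show "?m \<cdot> (unt R \<otimes> ?I) = Lun C ?x"
    proof (rule iso_cancel_left[OF ui])
      have "u \<cdot> ?m \<cdot> (unt R \<otimes> ?I) = (mlt S \<cdot> (unt S \<otimes> Idn C ?y)) \<cdot> (Idn C (One C) \<otimes> u)"
        by (simp add: um' merge uu)
      also have "\<dots> = u \<cdot> Lun C ?x" unfolding S.A_unit_left by (simp add: lun_nat)
      finally show "u \<cdot> ?m \<cdot> (unt R \<otimes> ?I) = u \<cdot> Lun C ?x" .
    qed simp_all
    show "?m \<cdot> (?I \<otimes> unt R) = Run C ?x"
    proof (rule iso_cancel_left[OF ui])
      have "u \<cdot> ?m \<cdot> (?I \<otimes> unt R) = (mlt S \<cdot> (Idn C ?y \<otimes> unt S)) \<cdot> (u \<otimes> Idn C (One C))"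
        by (simp add: um' merge uu)
      also have "\<dots> = u \<cdot> Run C ?x" unfolding S.A_unit_right by (simp add: run_nat)
      finally show "u \<cdot> ?m \<cdot> (?I \<otimes> unt R) = u \<cdot> Run C ?x" .
    qed simp_all
    show "?m \<cdot> Brd C ?x ?x = ?m"
    proof (rule iso_cancel_left[OF ui])
      have "u \<cdot> ?m \<cdot> Brd C ?x ?x = (mlt S \<cdot> Brd C ?y ?y) \<cdot> (u \<otimes> u)"
        by (simp add: um' brd_nat)
      also have "\<dots> = u \<cdot> ?m" unfolding S.A_comm um ..
      finally show "u \<cdot> ?m \<cdot> Brd C ?x ?x = u \<cdot> ?m" .
    qed simp_all
    show "?m \<cdot> r = ?I"
    proof (rule iso_cancel_left[OF ui])
      have "u \<cdot> ?m \<cdot> r = (mlt S \<cdot> s) \<cdot> u" by (simp add: um' ur)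
      then show "u \<cdot> ?m \<cdot> r = u \<cdot> ?I" unfolding s1 by simp
    qed simp_all
    have rm: "(u \<otimes> u) \<cdot> r \<cdot> ?m = (s \<cdot> mlt S) \<cdot> (u \<otimes> u)"
      using tail[OF ur, of ?m] by (simp add: um)
    show "r \<cdot> ?m = (?m \<otimes> ?I) \<cdot> Inv C (Assc C ?x ?x ?x) \<cdot> (?I \<otimes> r)"
    proof (rule iso_cancel_left[of "u \<otimes> u"])
      have "(u \<otimes> u) \<cdot> (?m \<otimes> ?I) \<cdot> Inv C (Assc C ?x ?x ?x) \<cdot> (?I \<otimes> r)
        = (mlt S \<otimes> Idn C ?y) \<cdot> (((u \<otimes> u) \<otimes> u) \<cdot> Inv C (Assc C ?x ?x ?x)) \<cdot> (?I \<otimes> r)"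
        by (simp add: merge um)
      also have "\<dots> = (mlt S \<otimes> Idn C ?y) \<cdot> Inv C (Assc C ?y ?y ?y) \<cdot> ((u \<otimes> (u \<otimes> u)) \<cdot> (?I \<otimes> r))"
        by (simp add: assc_inv_nat)
      also have "\<dots> = (u \<otimes> u) \<cdot> r \<cdot> ?m" unfolding uir rm s2 by simp
      finally show "(u \<otimes> u) \<cdot> r \<cdot> ?m = (u \<otimes> u) \<cdot> (?m \<otimes> ?I) \<cdot> Inv C (Assc C ?x ?x ?x) \<cdot> (?I \<otimes> r)" by simp
    qed simp_all
    show "r \<cdot> ?m = (?I \<otimes> ?m) \<cdot> Assc C ?x ?x ?x \<cdot> (r \<otimes> ?I)"
    proof (rule iso_cancel_left[of "u \<otimes> u"])
      have "(u \<otimes> u) \<cdot> (?I \<otimes> ?m) \<cdot> Assc C ?x ?x ?x \<cdot> (r \<otimes> ?I)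
        = (Idn C ?y \<otimes> mlt S) \<cdot> ((u \<otimes> (u \<otimes> u)) \<cdot> Assc C ?x ?x ?x) \<cdot> (r \<otimes> ?I)"
        by (simp add: merge um)
      also have "\<dots> = (Idn C ?y \<otimes> mlt S) \<cdot> Assc C ?y ?y ?y \<cdot> (((u \<otimes> u) \<otimes> u) \<cdot> (r \<otimes> ?I))"
        by (simp add: assc_nat)
      also have "\<dots> = (u \<otimes> u) \<cdot> r \<cdot> ?m" unfolding uri rm s3 by simp
      finally show "(u \<otimes> u) \<cdot> r \<cdot> ?m = (u \<otimes> u) \<cdot> (?I \<otimes> ?m) \<cdot> Assc C ?x ?x ?x \<cdot> (r \<otimes> ?I)" by simp
    qed simp_all
  qed simp_all
qed

text \<open>\<open>past\<close> with its source bracketed to the right. In this form it is its own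
  inverse up to exchanging the arguments, and it is the middle part of
  \<open>interchange\<close>.\<close>

definition swap :: "'o \<Rightarrow> 'o \<Rightarrow> 'o \<Rightarrow> 'a" where
  "swap x b y = past x b y \<cdot> Inv C (Assc C x b y)"

lemma swap_typed [simp]:
  assumes "x \<in> Obj C" "b \<in> Obj C" "y \<in> Obj C"
  shows "swap x b y \<in> Arr C" "Dom C (swap x b y) = x \<odot> (b \<odot> y)" "Cod C (swap x b y) = b \<odot> (x \<odot> y)"
  unfolding swap_def using assms by simp_all

lemma swap_swap:
  assumes "x \<in> Obj C" "b \<in> Obj C" "y \<in> Obj C"
  shows "swap b x y \<cdot> swap x b y = Idn C (x \<odot> (b \<odot> y))"
  unfolding swap_def past_def using assms by (simp add: merge)

lemma swap_nat:
  assumes "f \<in> Arr C" "g \<in> Arr C" "h \<in> Arr C" "Cod C f = x'" "Cod C g = b'" "Cod C h = y'"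
  shows "swap x' b' y' \<cdot> (f \<otimes> (g \<otimes> h)) = (g \<otimes> (f \<otimes> h)) \<cdot> swap (Dom C f) (Dom C g) (Dom C h)"
proof -
  have "x' \<in> Obj C" "b' \<in> Obj C" "y' \<in> Obj C" using assms by auto
  then show ?thesis unfolding swap_def using assms by (simp add: assc_inv_nat past_nat)
qed

text \<open>\<open>past_ten\<close> and \<open>past_assc\<close> in right-bracketed form:
  \<open>c\<close> crosses \<open>b\<close> and then \<open>x\<close>.\<close>

lemma swap_ten:
  assumes "c \<in> Obj C" "b \<in> Obj C" "x \<in> Obj C" "w \<in> Obj C"
  shows "swap c (b \<odot> x) w \<cdot> (Idn C c \<otimes> Inv C (Assc C b x w))
    = Inv C (Assc C b x (c \<odot> w)) \<cdot> (Idn C b \<otimes> swap c x w) \<cdot> swap c b (x \<odot> w)"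
proof -
  have 1: "Assc C b (c \<odot> x) w \<cdot> (past c b x \<otimes> Idn C w)
    = (Idn C b \<otimes> Inv C (Assc C c x w)) \<cdot> past c b (x \<odot> w) \<cdot> Assc C (c \<odot> b) x w"
    using assms past_assc[of c b x w, symmetric] by (simp add: merge)
  have 2: "Assc C (c \<odot> b) x w \<cdot> (Inv C (Assc C c b x) \<otimes> Idn C w) \<cdot> Inv C (Assc C c (b \<odot> x) w)
    = Inv C (Assc C c b (x \<odot> w)) \<cdot> (Idn C c \<otimes> Assc C b x w)"
    using assms by (simp add: pentagon_inv)
  have "Inv C (Assc C b x (c \<odot> w)) \<cdot> ((Idn C b \<otimes> past c x w) \<cdot> Assc C b (c \<odot> x) w \<cdot> (past c b x \<otimes> Idn C w))
    = past c (b \<odot> x) w \<cdot> (Assc C c b x \<otimes> Idn C w)"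
    unfolding past_ten[OF assms] using assms by simp
  then have 3: "past c (b \<odot> x) w = Inv C (Assc C b x (c \<odot> w)) \<cdot> (Idn C b \<otimes> past c x w) \<cdot> Assc C b (c \<odot> x) w
      \<cdot> (past c b x \<otimes> Idn C w) \<cdot> (Inv C (Assc C c b x) \<otimes> Idn C w)"
    using assms
      tail[of "Inv C (Assc C b x (c \<odot> w))" "(Idn C b \<otimes> past c x w) \<cdot> Assc C b (c \<odot> x) w \<cdot> (past c b x \<otimes> Idn C w)"
        "past c (b \<odot> x) w \<cdot> (Assc C c b x \<otimes> Idn C w)" "Inv C (Assc C c b x) \<otimes> Idn C w"]
    by (simp add: merge)
  have "swap c (b \<odot> x) w \<cdot> (Idn C c \<otimes> Inv C (Assc C b x w))
    = Inv C (Assc C b x (c \<odot> w)) \<cdot> (Idn C b \<otimes> past c x w) \<cdot> (Assc C b (c \<odot> x) w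
      \<cdot> (past c b x \<otimes> Idn C w)) \<cdot> (Inv C (Assc C c b x) \<otimes> Idn C w) \<cdot> Inv C (Assc C c (b \<odot> x) w)
      \<cdot> (Idn C c \<otimes> Inv C (Assc C b x w))"
    unfolding swap_def 3 using assms by simp
  also have "\<dots> = Inv C (Assc C b x (c \<odot> w)) \<cdot> (Idn C b \<otimes> swap c x w) \<cdot> past c b (x \<odot> w) \<cdot> (Assc C (c \<odot> b) x w
      \<cdot> (Inv C (Assc C c b x) \<otimes> Idn C w) \<cdot> Inv C (Assc C c (b \<odot> x) w)) \<cdot> (Idn C c \<otimes> Inv C (Assc C b x w))"
    unfolding 1 swap_def using assms by (simp add: merge)
  also have "\<dots> = Inv C (Assc C b x (c \<odot> w)) \<cdot> (Idn C b \<otimes> swap c x w) \<cdot> swap c b (x \<odot> w)"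
    unfolding 2 swap_def[of c b] using assms by (simp add: merge)
  finally show ?thesis .
qed

text \<open>\<open>swap_ten\<close> read backwards: as the crossings are mutually inverse, moving
  \<open>c\<close> to the left across \<open>b \<odot> x\<close> also splits into two steps.\<close>

lemma ten_swap:
  assumes o: "b \<in> Obj C" "x \<in> Obj C" "c \<in> Obj C" "w \<in> Obj C"
  shows "(Idn C b \<otimes> swap x c w) \<cdot> Assc C b x (c \<odot> w)
    = swap c b (x \<odot> w) \<cdot> (Idn C c \<otimes> Assc C b x w) \<cdot> swap (b \<odot> x) c w"
proof -
  have "swap c b (x \<odot> w) = (Idn C b \<otimes> swap x c w) \<cdot> (Idn C b \<otimes> swap c x w) \<cdot> swap c b (x \<odot> w)"
    using o by (simp add: merge swap_swap)
  also have "\<dots> = (Idn C b \<otimes> swap x c w) \<cdot> Assc C b x (c \<odot> w) \<cdot> (swap c (b \<odot> x) w \<cdot> (Idn C c \<otimes> Inv C (Assc C b x w)))"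
    unfolding swap_ten[OF o(3,1,2,4)] using o by simp
  finally have "swap c b (x \<odot> w) \<cdot> (Idn C c \<otimes> Assc C b x w) \<cdot> swap (b \<odot> x) c w
    = ((Idn C b \<otimes> swap x c w) \<cdot> Assc C b x (c \<odot> w) \<cdot> (swap c (b \<odot> x) w \<cdot> (Idn C c \<otimes> Inv C (Assc C b x w))))
      \<cdot> (Idn C c \<otimes> Assc C b x w) \<cdot> swap (b \<odot> x) c w" by simp
  also have "\<dots> = (Idn C b \<otimes> swap x c w) \<cdot> Assc C b x (c \<odot> w) \<cdot> (swap c (b \<odot> x) w \<cdot> swap (b \<odot> x) c w)"
    using o by (simp add: merge)
  finally show ?thesis using o by (simp add: swap_swap)
qed

lemma interchange_swap:
  "interchange C w x y z = Inv C (Assc C w y (x \<odot> z)) \<cdot> (Idn C w \<otimes> swap x y z) \<cdot> Assc C w x (y \<odot> z)"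
  if "w \<in> Obj C" "x \<in> Obj C" "y \<in> Obj C" "z \<in> Obj C"
  using that by (simp add: interchange_def swap_def past_def)

lemma interchange_nat:
  assumes "f \<in> Arr C" "g \<in> Arr C" "h \<in> Arr C" "k \<in> Arr C" "Cod C f = w'" "Cod C g = x'" "Cod C h = y'" "Cod C k = z'"
  shows "interchange C w' x' y' z' \<cdot> ((f \<otimes> g) \<otimes> (h \<otimes> k))
    = ((f \<otimes> h) \<otimes> (g \<otimes> k)) \<cdot> interchange C (Dom C f) (Dom C g) (Dom C h) (Dom C k)"
proof -
  have o: "w' \<in> Obj C" "x' \<in> Obj C" "y' \<in> Obj C" "z' \<in> Obj C" using assms by auto
  have "interchange C w' x' y' z' \<cdot> ((f \<otimes> g) \<otimes> (h \<otimes> k))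
    = Inv C (Assc C w' y' (x' \<odot> z')) \<cdot> (f \<otimes> (swap x' y' z' \<cdot> (g \<otimes> (h \<otimes> k)))) \<cdot> Assc C (Dom C f) (Dom C g) (Dom C h \<odot> Dom C k)"
    using assms o by (simp add: interchange_swap assc_nat) (simp add: merge)
  also have "\<dots> = (Inv C (Assc C w' y' (x' \<odot> z')) \<cdot> (f \<otimes> (h \<otimes> (g \<otimes> k)))) \<cdot> (Idn C (Dom C f) \<otimes> swap (Dom C g) (Dom C h) (Dom C k))
      \<cdot> Assc C (Dom C f) (Dom C g) (Dom C h \<odot> Dom C k)"
    using assms o by (simp add: swap_nat merge)
  also have "\<dots> = ((f \<otimes> h) \<otimes> (g \<otimes> k)) \<cdot> interchange C (Dom C f) (Dom C g) (Dom C h) (Dom C k)"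
    using assms o by (simp add: interchange_swap assc_inv_nat)
  finally show ?thesis .
qed

text \<open>With the unit as second factor the interchange is a mere rebracketing. It identifies
  left multiplication by \<open>c \<otimes> 1\<close> in the tensor square of a ring with the action
  on a free module.\<close>

lemma interchange_One:
  assumes o: "w \<in> Obj C" "y \<in> Obj C" "z \<in> Obj C"
  shows "(Idn C (w \<odot> y) \<otimes> Lun C z) \<cdot> interchange C w (One C) y z
    = Inv C (Assc C w y z) \<cdot> (Run C w \<otimes> Idn C (y \<odot> z))"
proof -
  have rb: "Run C y \<cdot> Brd C (One C) y = Lun C y"
    using o by (simp add: lun_brd[symmetric])
  have "(Idn C y \<otimes> Lun C z) \<cdot> swap (One C) y z = ((Idn C y \<otimes> Lun C z) \<cdot> Assc C y (One C) z)
      \<cdot> (Brd C (One C) y \<otimes> Idn C z) \<cdot> Inv C (Assc C (One C) y z)"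
    using o by (simp add: swap_def past_def)
  also have "\<dots> = Lun C (y \<odot> z)"
    using o by (simp add: triangle_axiom merge rb lun_ten[symmetric])
  finally have 1: "(Idn C y \<otimes> Lun C z) \<cdot> swap (One C) y z = Lun C (y \<odot> z)" .
  have "(Idn C (w \<odot> y) \<otimes> Lun C z) \<cdot> interchange C w (One C) y z
    = (((Idn C w \<otimes> Idn C y) \<otimes> Lun C z) \<cdot> Inv C (Assc C w y (One C \<odot> z))) \<cdot> (Idn C w \<otimes> swap (One C) y z) \<cdot> Assc C w (One C) (y \<odot> z)"
    using o by (simp add: interchange_swap)
  also have "\<dots> = (Inv C (Assc C w y z) \<cdot> (Idn C w \<otimes> (Idn C y \<otimes> Lun C z))) \<cdot> (Idn C w \<otimes> swap (One C) y z) \<cdot> Assc C w (One C) (y \<odot> z)"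
    using o by (subst assc_inv_nat(1)) simp_all
  also have "\<dots> = Inv C (Assc C w y z) \<cdot> (Run C w \<otimes> Idn C (y \<odot> z))"
    using o by (simp add: merge(2) 1 triangle_axiom)
  finally show ?thesis .
qed

end

section \<open>Free modules and the comparison map of extension of scalars\<close>

context ring_modules
begin

lemma ext_obj_sel: "fst (ext_obj C A x) = a \<odot> x" "snd (ext_obj C A x) = (mlt A \<otimes> Idn C x) \<cdot> Inv C (Assc C a a x)"
  by (simp_all add: ext_obj_def)

lemma ext_module [simp]:
  assumes x: "x \<in> Obj C"
  shows "module (ext_obj C A x)"
proof (rule moduleI; (simp only: ext_obj_sel)?)
  let ?l = "(mlt A \<otimes> Idn C x) \<cdot> Inv C (Assc C a a x)"
  have "?l \<cdot> (mlt A \<otimes> Idn C (a \<odot> x)) = ((mlt A \<cdot> (mlt A \<otimes> Idn C a)) \<otimes> Idn C x) \<cdot> Inv C (Assc C (a \<odot> a) a x)"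
    using x by (simp add: assc_inv_nat_Idn) (simp add: merge)
  also have "\<dots> = (mlt A \<otimes> Idn C x) \<cdot> ((Idn C a \<otimes> mlt A) \<otimes> Idn C x) \<cdot> ((Assc C a a a \<otimes> Idn C x) \<cdot> Inv C (Assc C (a \<odot> a) a x))"
    unfolding A_assoc using x by (simp add: merge)
  also have "(Assc C a a a \<otimes> Idn C x) \<cdot> Inv C (Assc C (a \<odot> a) a x)
    = Inv C (Assc C a (a \<odot> a) x) \<cdot> (Idn C a \<otimes> Inv C (Assc C a a x)) \<cdot> Assc C a a (a \<odot> x)"
  proof (rule iso_cancel_left[of "Assc C a (a \<odot> a) x"])
    have "(Idn C a \<otimes> Inv C (Assc C a a x)) \<cdot> Assc C a a (a \<odot> x)
      = (Idn C a \<otimes> Inv C (Assc C a a x)) \<cdot> (Assc C a a (a \<odot> x) \<cdot> Assc C (a \<odot> a) a x) \<cdot> Inv C (Assc C (a \<odot> a) a x)"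
      using x by simp
    also have "\<dots> = Assc C a (a \<odot> a) x \<cdot> (Assc C a a a \<otimes> Idn C x) \<cdot> Inv C (Assc C (a \<odot> a) a x)"
      using x by (subst pentagon) (simp_all add: merge)
    finally show "Assc C a (a \<odot> a) x \<cdot> (Assc C a a a \<otimes> Idn C x) \<cdot> Inv C (Assc C (a \<odot> a) a x)
      = Assc C a (a \<odot> a) x \<cdot> Inv C (Assc C a (a \<odot> a) x) \<cdot> (Idn C a \<otimes> Inv C (Assc C a a x)) \<cdot> Assc C a a (a \<odot> x)"
      using x by simp
  qed (use x in simp_all)
  also have "(mlt A \<otimes> Idn C x) \<cdot> ((Idn C a \<otimes> mlt A) \<otimes> Idn C x) \<cdot> Inv C (Assc C a (a \<odot> a) x) \<cdot> (Idn C a \<otimes> Inv C (Assc C a a x)) \<cdot> Assc C a a (a \<odot> x)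
    = (mlt A \<otimes> Idn C x) \<cdot> (((Idn C a \<otimes> mlt A) \<otimes> Idn C x) \<cdot> Inv C (Assc C a (a \<odot> a) x)) \<cdot> (Idn C a \<otimes> Inv C (Assc C a a x)) \<cdot> Assc C a a (a \<odot> x)"
    using x by simp
  also have "\<dots> = (mlt A \<otimes> Idn C x) \<cdot> (Inv C (Assc C a a x) \<cdot> (Idn C a \<otimes> (mlt A \<otimes> Idn C x))) \<cdot> (Idn C a \<otimes> Inv C (Assc C a a x)) \<cdot> Assc C a a (a \<odot> x)"
    using x by (simp add: assc_inv_nat)
  also have "\<dots> = ?l \<cdot> (Idn C a \<otimes> ?l) \<cdot> Assc C a a (a \<odot> x)"
    using x by (simp add: merge)
  finally show "?l \<cdot> (mlt A \<otimes> Idn C (a \<odot> x)) = ?l \<cdot> (Idn C a \<otimes> ?l) \<cdot> Assc C a a (a \<odot> x)" .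
  have "?l \<cdot> (unt A \<otimes> Idn C (a \<odot> x)) = ((mlt A \<cdot> (unt A \<otimes> Idn C a)) \<otimes> Idn C x) \<cdot> Inv C (Assc C (One C) a x)"
    using x by (simp add: assc_inv_nat_Idn) (simp add: merge)
  also have "\<dots> = Lun C (a \<odot> x)" unfolding A_unit_left using x by (simp add: lun_ten[symmetric])
  finally show "?l \<cdot> (unt A \<otimes> Idn C (a \<odot> x)) = Lun C (a \<odot> x)" .
qed (use x in simp_all)

text \<open>The map is \<open>(b \<otimes> x) \<otimes> (c \<otimes> y) \<mapsto> b c \<otimes> (x
  \<otimes> y)\<close>. Each side is rewritten as two successive scalar actions on the free module
  on \<open>x \<odot> y\<close>; the results differ by the order of the two scalars, which
  \<open>lsw\<close> settles by commutativity of \<open>A\<close>.\<close>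

lemma ext_tensor_balanced:
  assumes x: "x \<in> Obj C" and y: "y \<in> Obj C"
  shows "balanced (ext_obj C A x) (ext_obj C A y) ((mlt A \<otimes> Idn C (x \<odot> y)) \<cdot> interchange C a x a y)"
proof -
  let ?l = "\<lambda>w. (mlt A \<otimes> Idn C w) \<cdot> Inv C (Assc C a a w)"
  let ?V = "swap x a y"
  define \<beta> where "\<beta> = (mlt A \<otimes> Idn C (x \<odot> y)) \<cdot> interchange C a x a y"
  have \<beta>t [simp]: "\<beta> \<in> Arr C" "Dom C \<beta> = (a \<odot> x) \<odot> (a \<odot> y)" "Cod C \<beta> = a \<odot> (x \<odot> y)"
    unfolding \<beta>_def using x y by simp_all
  have \<beta>: "\<beta> = ?l (x \<odot> y) \<cdot> (Idn C a \<otimes> ?V) \<cdot> Assc C a x (a \<odot> y)"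
    unfolding \<beta>_def using x y by (simp add: interchange_swap)
  have ll: "?l w \<cdot> (Idn C a \<otimes> h) = (Idn C a \<otimes> k) \<cdot> ?l v"
    if "h = Idn C a \<otimes> k" "k \<in> Arr C" "Dom C k = v" "Cod C k = w" for h k v w
  proof -
    have vw: "v \<in> Obj C" "w \<in> Obj C" using that(2-4) by auto
    have "?l w \<cdot> (Idn C a \<otimes> (Idn C a \<otimes> k)) = (mlt A \<otimes> Idn C w) \<cdot> (Idn C (a \<odot> a) \<otimes> k) \<cdot> Inv C (Assc C a a v)"
      using that(2-4) vw by (simp add: assc_inv_nat)
    then show ?thesis using that vw by (simp add: merge)
  qed
  let ?W = "x \<odot> (a \<odot> y)"
  have A1: "Assc C a x (a \<odot> y) \<cdot> (?l x \<otimes> Idn C (a \<odot> y)) = ?l ?W \<cdot> (Idn C a \<otimes> Assc C a x (a \<odot> y)) \<cdot> Assc C a (a \<odot> x) (a \<odot> y)"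
  proof -
    have "Assc C a x (a \<odot> y) \<cdot> (?l x \<otimes> Idn C (a \<odot> y))
      = (Assc C a x (a \<odot> y) \<cdot> ((mlt A \<otimes> Idn C x) \<otimes> Idn C (a \<odot> y))) \<cdot> (Inv C (Assc C a a x) \<otimes> Idn C (a \<odot> y))"
      using x y by (simp add: merge)
    also have "\<dots> = (mlt A \<otimes> Idn C ?W) \<cdot> (Assc C (a \<odot> a) x (a \<odot> y) \<cdot> (Inv C (Assc C a a x) \<otimes> Idn C (a \<odot> y)) \<cdot> Inv C (Assc C a (a \<odot> x) (a \<odot> y))) \<cdot> Assc C a (a \<odot> x) (a \<odot> y)"
      using x y by (simp add: assc_nat)
    also have "\<dots> = ?l ?W \<cdot> (Idn C a \<otimes> Assc C a x (a \<odot> y)) \<cdot> Assc C a (a \<odot> x) (a \<odot> y)"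
      using x y by (simp add: pentagon_inv[symmetric])
    finally show ?thesis .
  qed
  have "\<beta> \<cdot> (?l x \<otimes> Idn C (a \<odot> y)) = ?l (x \<odot> y) \<cdot> ((Idn C a \<otimes> ?V) \<cdot> ?l ?W) \<cdot> (Idn C a \<otimes> Assc C a x (a \<odot> y)) \<cdot> Assc C a (a \<odot> x) (a \<odot> y)"
    unfolding \<beta> using x y A1 by simp
  also have "(Idn C a \<otimes> ?V) \<cdot> ?l ?W = ?l (a \<odot> (x \<odot> y)) \<cdot> (Idn C a \<otimes> (Idn C a \<otimes> ?V))"
    using x y by (intro ll[OF refl, symmetric]) simp_all
  also have "?l (x \<odot> y) \<cdot> (?l (a \<odot> (x \<odot> y)) \<cdot> (Idn C a \<otimes> (Idn C a \<otimes> ?V))) \<cdot> (Idn C a \<otimes> Assc C a x (a \<odot> y)) \<cdot> Assc C a (a \<odot> x) (a \<odot> y)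
    = (?l (x \<odot> y) \<cdot> ?l (a \<odot> (x \<odot> y))) \<cdot> (Idn C a \<otimes> ((Idn C a \<otimes> ?V) \<cdot> Assc C a x (a \<odot> y))) \<cdot> Assc C a (a \<odot> x) (a \<odot> y)"
    using x y by (simp add: merge)
  also have "?l (x \<odot> y) \<cdot> ?l (a \<odot> (x \<odot> y)) = ?l (x \<odot> y) \<cdot> (Idn C a \<otimes> ?l (x \<odot> y))"
    using x y act_act[OF ext_module[of "x \<odot> y"]] by (simp add: ext_obj_sel)
  finally have L: "\<beta> \<cdot> (?l x \<otimes> Idn C (a \<odot> y))
    = (?l (x \<odot> y) \<cdot> (Idn C a \<otimes> ?l (x \<odot> y))) \<cdot> (Idn C a \<otimes> ((Idn C a \<otimes> ?V) \<cdot> Assc C a x (a \<odot> y))) \<cdot> Assc C a (a \<odot> x) (a \<odot> y)" .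
  \<comment> \<open>Crossing \<open>x\<close> by a product of two scalars is crossing by each of
    them and multiplying afterwards.\<close>
  have V1: "?V \<cdot> (Idn C x \<otimes> ?l y) = ?l (x \<odot> y) \<cdot> (Idn C a \<otimes> ?V) \<cdot> swap x a (a \<odot> y)"
  proof -
    have "?V \<cdot> (Idn C x \<otimes> ?l y) = (?V \<cdot> (Idn C x \<otimes> (mlt A \<otimes> Idn C y))) \<cdot> (Idn C x \<otimes> Inv C (Assc C a a y))"
      using x y by (simp add: merge)
    also have "\<dots> = (mlt A \<otimes> Idn C (x \<odot> y)) \<cdot> (swap x (a \<odot> a) y \<cdot> (Idn C x \<otimes> Inv C (Assc C a a y)))"
      using x y by (simp add: swap_nat)
    also have "\<dots> = ?l (x \<odot> y) \<cdot> (Idn C a \<otimes> ?V) \<cdot> swap x a (a \<odot> y)"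
      using x y by (simp add: swap_ten)
    finally show ?thesis .
  qed
  have V3: "swap (a \<odot> x) a (a \<odot> y) \<cdot> past a (a \<odot> x) (a \<odot> y) = Assc C a (a \<odot> x) (a \<odot> y)"
    unfolding swap_def past_def using x y by (simp add: merge)
  have lsw: "?l (x \<odot> y) \<cdot> (Idn C a \<otimes> ?l (x \<odot> y)) \<cdot> swap a a (a \<odot> (x \<odot> y)) = ?l (x \<odot> y) \<cdot> (Idn C a \<otimes> ?l (x \<odot> y))"
  proof -
    have "(?l (x \<odot> y) \<cdot> (Idn C a \<otimes> ?l (x \<odot> y)) \<cdot> past a a (a \<odot> (x \<odot> y))) \<cdot> Inv C (Assc C a a (a \<odot> (x \<odot> y)))
      = (?l (x \<odot> y) \<cdot> (Idn C a \<otimes> ?l (x \<odot> y)) \<cdot> Assc C a a (a \<odot> (x \<odot> y))) \<cdot> Inv C (Assc C a a (a \<odot> (x \<odot> y)))"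
      using x y act_act_past[OF ext_module[of "x \<odot> y"]] by (simp only: ext_obj_sel ten_typed)
    then show ?thesis unfolding swap_def using x y by simp
  qed
  have "\<beta> \<cdot> (Idn C (a \<odot> x) \<otimes> ?l y) \<cdot> past a (a \<odot> x) (a \<odot> y)
    = ?l (x \<odot> y) \<cdot> (Idn C a \<otimes> ?V) \<cdot> (Assc C a x (a \<odot> y) \<cdot> (Idn C (a \<odot> x) \<otimes> ?l y)) \<cdot> past a (a \<odot> x) (a \<odot> y)"
    unfolding \<beta> using x y by simp
  also have "\<dots> = ?l (x \<odot> y) \<cdot> (Idn C a \<otimes> (?V \<cdot> (Idn C x \<otimes> ?l y))) \<cdot> Assc C a x (a \<odot> (a \<odot> y)) \<cdot> past a (a \<odot> x) (a \<odot> y)"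
    using x y by (simp add: assc_nat_Idn) (simp add: merge)
  also have "\<dots> = ?l (x \<odot> y) \<cdot> (Idn C a \<otimes> ?l (x \<odot> y)) \<cdot> (Idn C a \<otimes> (Idn C a \<otimes> ?V))
      \<cdot> ((Idn C a \<otimes> swap x a (a \<odot> y)) \<cdot> Assc C a x (a \<odot> (a \<odot> y))) \<cdot> past a (a \<odot> x) (a \<odot> y)"
    unfolding V1 using x y by (simp add: merge)
  also have "\<dots> = ?l (x \<odot> y) \<cdot> (Idn C a \<otimes> ?l (x \<odot> y)) \<cdot> ((Idn C a \<otimes> (Idn C a \<otimes> ?V)) \<cdot> swap a a ?W)
      \<cdot> (Idn C a \<otimes> Assc C a x (a \<odot> y)) \<cdot> (swap (a \<odot> x) a (a \<odot> y) \<cdot> past a (a \<odot> x) (a \<odot> y))"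
    using x y by (subst ten_swap) simp_all
  also have "(Idn C a \<otimes> (Idn C a \<otimes> ?V)) \<cdot> swap a a ?W = swap a a (a \<odot> (x \<odot> y)) \<cdot> (Idn C a \<otimes> (Idn C a \<otimes> ?V))"
    using x y by (simp add: swap_nat)
  also have "?l (x \<odot> y) \<cdot> (Idn C a \<otimes> ?l (x \<odot> y)) \<cdot> (swap a a (a \<odot> (x \<odot> y)) \<cdot> (Idn C a \<otimes> (Idn C a \<otimes> ?V)))
      \<cdot> (Idn C a \<otimes> Assc C a x (a \<odot> y)) \<cdot> (swap (a \<odot> x) a (a \<odot> y) \<cdot> past a (a \<odot> x) (a \<odot> y))
    = (?l (x \<odot> y) \<cdot> (Idn C a \<otimes> ?l (x \<odot> y)) \<cdot> swap a a (a \<odot> (x \<odot> y)))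
      \<cdot> (Idn C a \<otimes> ((Idn C a \<otimes> ?V) \<cdot> Assc C a x (a \<odot> y))) \<cdot> Assc C a (a \<odot> x) (a \<odot> y)"
    unfolding V3 using x y by (simp add: merge)
  also have "\<dots> = \<beta> \<cdot> (?l x \<otimes> Idn C (a \<odot> y))"
    unfolding lsw L ..
  finally show ?thesis
    unfolding \<beta>_def[symmetric] balanced_def by (simp add: ext_obj_sel)
qed

end

section \<open>The theorem\<close>

context ring_modules
begin

text \<open>An isomorphism of rings in \<open>C\<close> becomes one in \<open>A\<close>-modules as
  soon as it is linear. At this point multiplication and unit of \<open>ext_ring\<close> are raw
  data; \<open>h\<close> compares them with those of the product, and the ring laws follow by
  \<open>tt_ring_transport\<close>.\<close>

lemma ext_splitting:
  assumes R: "tt_ring C R" and g: "tt_ring_hom C A R g"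
    and h: "h \<in> Arr C" "Dom C h = a \<odot> a" "Cod C h = DSum C a (carr R)" and hi: "is_iso C h"
    and h1: "h \<cdot> mlt (tensor_ring C A A) = mlt (prod_ring C A R) \<cdot> (h \<otimes> h)"
    and h2: "h \<cdot> (Idn C a \<otimes> unt A) \<cdot> Inv C (Run C a) = Inj1 C a (carr R) \<oplus> Inj2 C a (carr R) \<cdot> g"
  shows "isomorphic_tt_rings D (ext_ring C A A) (prod_ring D (unit_ring D) (alg_ring C A g R))"
proof -
  interpret D: additive_monoidal_cat D by (rule Modc_additive_monoidal)
  note [simp] = h tt_ring_typed[OF R] tt_ring_hom_typed(1-3)[OF g] alg_mod_module[OF R g] hi
    prod_ring_carr[OF A R] prod_ring_typed[OF A R]
  note idh = tt_ring_hom_Idn[OF A]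
  have am: "alg_mod C (Idn C a) A = (a, mlt A)" by (simp add: alg_mod_def)
  let ?X = "ext_obj C A a" and ?N = "alg_mod C g R" and ?Pr = "prod_ring C A R"
  let ?P = "dsum_obj C A (a, mlt A) ?N"
  let ?u = "Inj1 C a (carr R) \<oplus> Inj2 C a (carr R) \<cdot> g"
  have u: "Inj1 C a (carr R) \<cdot> Idn C a \<oplus> Inj2 C a (carr R) \<cdot> g = ?u" by simp
  note PR = tt_ring_prod[OF A R] and uh = prod_structure_hom[OF A R idh g, unfolded u]
  have ap: "alg_mod C ?u ?Pr = ?P" using alg_mod_prod[OF A R idh g] unfolding am u .
  have pr: "prod_ring D (unit_ring D) (alg_ring C A g R) = alg_ring C A ?u ?Pr"
    unfolding unit_ring_Modc prod_ring_Modc[OF A R idh g] u ..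
  note [simp] = und_mlt_typed[OF PR uh, unfolded ap] und_mlt_linear[OF PR uh, unfolded ap]
    structure_linear[OF PR uh, unfolded ap]
  \<comment> \<open>The free action is multiplication in \<open>A \<odot> A\<close> after
    \<open>?i\<close>, that is, by \<open>c \<otimes> 1\<close>. By \<open>h1\<close> and
    \<open>h2\<close> the map \<open>h\<close> turns this into multiplication by the image of
    \<open>c\<close> in the product.\<close>
  have act: "h \<cdot> snd ?X = snd ?P \<cdot> (Idn C a \<otimes> h)"
  proof -
    let ?i = "(Idn C a \<otimes> unt A) \<cdot> Inv C (Run C a)" and ?I = "Idn C a"
    have "mlt (tensor_ring C A A) \<cdot> (?i \<otimes> Idn C (a \<odot> a))
      = (mlt A \<otimes> mlt A) \<cdot> (interchange C a a a a \<cdot> ((?I \<otimes> unt A) \<otimes> (?I \<otimes> ?I))) \<cdot> (Inv C (Run C a) \<otimes> Idn C (a \<odot> a))"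
      by (simp add: tensor_ring_def merge)
    also have "\<dots> = (mlt A \<otimes> (mlt A \<cdot> (unt A \<otimes> ?I))) \<cdot> interchange C a (One C) a a \<cdot> (Inv C (Run C a) \<otimes> Idn C (a \<odot> a))"
      by (subst interchange_nat) (simp_all add: merge)
    also have "\<dots> = (mlt A \<otimes> ?I) \<cdot> ((Idn C (a \<odot> a) \<otimes> Lun C a) \<cdot> interchange C a (One C) a a) \<cdot> (Inv C (Run C a) \<otimes> Idn C (a \<odot> a))"
      unfolding A_unit_left by (simp add: merge)
    also have "\<dots> = snd ?X"
      by (simp add: interchange_One merge ext_obj_sel)
    finally have "h \<cdot> snd ?X = (h \<cdot> mlt (tensor_ring C A A)) \<cdot> (?i \<otimes> Idn C (a \<odot> a))"
      by (simp add: tensor_ring_def)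
    also have "\<dots> = mlt ?Pr \<cdot> ((h \<cdot> ?i) \<otimes> h)"
      unfolding h1 by (simp add: merge)
    also have "\<dots> = snd ?P \<cdot> (Idn C a \<otimes> h)"
      unfolding h2 by (subst ap[symmetric]) (simp add: snd_alg_mod merge)
    finally show ?thesis .
  qed
  have l [simp]: "linear ?X h ?P" using act by (simp add: linear_iff ext_obj_sel)
  let ?\<beta> = "(mlt A \<otimes> Idn C (a \<odot> a)) \<cdot> interchange C a a a a"
  define w where "w = descend C (proj ?X ?X) ?\<beta>"
  note d = descend_proj[OF ext_module ext_module ext_tensor_balanced[of a a], simplified, folded w_def]
  have wt [simp]: "w \<in> Arr C" "Dom C w = fst (Ten ?X ?X)" "Cod C w = a \<odot> (a \<odot> a)" and wp: "w \<cdot> proj ?X ?X = ?\<beta>"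
    using d by simp_all
  let ?m = "(Idn C a \<otimes> mlt A) \<cdot> w" and ?e = "(Idn C a \<otimes> unt A) \<cdot> Inv C (Run C a)"
  have sel: "carr (ext_ring C A A) = ?X" "mlt (ext_ring C A A) = (Ten ?X ?X, ?m, ?X)"
    "unt (ext_ring C A A) = ((a, mlt A), ?e, ?X)"
    by (simp_all add: ext_ring_def ext_arr_def ext_tensor_def ext_one_def Modc_sel w_def)
  have hm: "h \<cdot> ?m = und_mlt ?u ?Pr \<cdot> und_ten ?X ?X ?P ?P h h"
  proof (rule proj_cancel[of ?X ?X])
    have "(h \<cdot> ?m) \<cdot> proj ?X ?X = h \<cdot> (Idn C a \<otimes> mlt A) \<cdot> (w \<cdot> proj ?X ?X)" by (simp add: ext_obj_sel)
    also have "\<dots> = h \<cdot> mlt (tensor_ring C A A)" unfolding wp by (simp add: tensor_ring_def merge)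
    also have "\<dots> = (und_mlt ?u ?Pr \<cdot> und_ten ?X ?X ?P ?P h h) \<cdot> proj ?X ?X"
      unfolding h1 using und_mlt_proj[OF PR uh, unfolded ap] by (simp add: und_ten_proj ext_obj_sel)
    finally show "(h \<cdot> ?m) \<cdot> proj ?X ?X = (und_mlt ?u ?Pr \<cdot> und_ten ?X ?X ?P ?P h h) \<cdot> proj ?X ?X" .
  qed simp_all
  have lv: "linear ?P (Inv C h) ?X" by (rule linear_Inv) simp_all
  \<comment> \<open>The multiplication and unit of \<open>ext_ring\<close> are linear because
    \<open>h\<close> carries them to linear maps and \<open>Inv C h\<close> is linear.\<close>
  have "?m = Inv C h \<cdot> (h \<cdot> ?m)" by simp
  then have lm: "linear (Ten ?X ?X) ?m ?X"
    using linear_comp[OF linear_comp[OF und_linear(1)[OF l l] und_mlt_linear[OF PR uh, unfolded ap]] lv]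
    unfolding hm[symmetric] by simp
  have "?e = Inv C h \<cdot> (h \<cdot> ?e)" by simp
  then have le: "linear (a, mlt A) ?e ?X"
    using linear_comp[OF structure_linear[OF PR uh, unfolded ap] lv] unfolding h2[symmetric] by simp
  let ?H = "(?X, h, ?P)"
  have iso: "tt_ring_iso D (ext_ring C A A) (alg_ring C A ?u ?Pr) ?H"
    unfolding tt_ring_iso_def tt_ring_hom_def
    using hm h2 Modc_iso[of ?H] by (simp add: sel alg_ring_sel ap Modc_sel Modc_Hom_iff)
  have tt: "tt_ring D (alg_ring C A ?u ?Pr)" by (rule tt_ring_alg[OF PR uh])
  have "tt_ring D (ext_ring C A A)"
    by (rule D.tt_ring_transport[OF tt _ _ _ _ _ _ _ iso]) (use lm le in \<open>simp_all add: sel Modc_sel\<close>)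
  then show ?thesis unfolding isomorphic_tt_rings_def pr using tt iso by blast
qed

end

context additive_monoidal_cat
begin

text \<open>The identity of \<open>A \<odot> A\<close> itself descends along the projection, which
  makes the projection left invertible. With \<open>\<gamma>\<close> this gives a left inverse of
  \<open>h\<close>, and \<open>h\<close> is already a split epimorphism.\<close>

lemma splitting_map_unit_iso:
  assumes U: "tt_ring C (unit_ring C)" and A: "tt_ring C A" and R: "tt_ring C R"
    and f: "tt_ring_hom C (unit_ring C) A (unt A)" and g: "tt_ring_hom C A R g"
    and h: "ring_modules.splitting_map C (unit_ring C) (unt A) A R g h"
  shows "is_iso C h"
proof -
  interpret U: ring_modules C "unit_ring C" using U by (rule ring_modulesI)
  interpret A: ring_modules C A using A by (rule ring_modulesI)
  let ?a = "carr A" and ?M = "alg_mod C (unt A) A"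
  note [simp] = U.alg_mod_module[OF A f] tt_ring_typed[OF R]
  have cU: "carr (unit_ring C) = One C" by (simp add: unit_ring_def)
  have ht [simp]: "h \<in> Arr C" "Dom C h = ?a \<odot> ?a" "Cod C h = DSum C ?a (carr R)"
    using h unfolding U.splitting_map_def by blast+
  have rb: "Run C ?a \<cdot> Brd C (One C) ?a = Lun C ?a" by (simp add: lun_brd[symmetric])
  have "(Idn C ?a \<otimes> Lun C ?a) \<cdot> past (One C) ?a ?a = ((Idn C ?a \<otimes> Lun C ?a) \<cdot> Assc C ?a (One C) ?a) \<cdot> (Brd C (One C) ?a \<otimes> Idn C ?a)"
    by (simp add: past_def)
  also have "\<dots> = Lun C ?a \<otimes> Idn C ?a" by (simp add: triangle_axiom merge rb)
  finally have "U.balanced ?M ?M (Idn C (?a \<odot> ?a))"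
    unfolding U.balanced_def by (simp add: U.snd_alg_mod cU A.A_unit_left)
  note d = U.descend_proj[OF _ _ this, simplified]
  obtain \<gamma> where \<gamma>: "\<gamma> \<in> Arr C" "Dom C \<gamma> = DSum C ?a (carr R)" and \<gamma>h: "\<gamma> \<cdot> h = U.proj ?M ?M"
    using h unfolding U.splitting_map_def by blast
  have "Cod C (\<gamma> \<cdot> h) = fst (U.Ten ?M ?M)" unfolding \<gamma>h by simp
  then have \<gamma>c: "Cod C \<gamma> = fst (U.Ten ?M ?M)" using \<gamma> by simp
  let ?k = "descend C (U.proj ?M ?M) (Idn C (?a \<odot> ?a)) \<cdot> \<gamma>"
  have kt: "?k \<in> Arr C" "Dom C ?k = DSum C ?a (carr R)" "Cod C ?k = ?a \<odot> ?a" using d \<gamma> \<gamma>c by simp_all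
  have kh: "?k \<cdot> h = Idn C (?a \<odot> ?a)" using d \<gamma> \<gamma>c by (simp add: \<gamma>h)
  have se: "split_epi h" by (rule U.splitting_map_iso(4)[OF A R f g h])
  obtain k where k: "k = ?k" by simp
  have "h \<cdot> k = Idn C (DSum C ?a (carr R))"
    by (rule split_epi_cancel[OF se]) (use kt kh in \<open>simp_all add: k[symmetric]\<close>)
  then show ?thesis by (intro is_isoI[where g = k]) (use kt kh in \<open>simp_all add: k[symmetric]\<close>)
qed

end

lemma (in tt_category) additive_monoidal: "additive_monoidal_cat C"
proof unfold_locales
  fix x f g
  assume x: "x \<in> Obj C" and fg: "f \<in> Arr C" "g \<in> Arr C" "Dom C g = Dom C f" "Cod C g = Cod C f"
  show "Idn C x \<otimes> (f \<oplus> g) = (Idn C x \<otimes> f) \<oplus> (Idn C x \<otimes> g)"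
    using tensor_exact_right[OF x] fg unfolding exact_functor_def additive_functor_def by blast
  show "(f \<oplus> g) \<otimes> Idn C x = (f \<otimes> Idn C x) \<oplus> (g \<otimes> Idn C x)"
    using tensor_exact_left[OF x] fg unfolding exact_functor_def additive_functor_def by blast
qed

theorem theorem3p6:
  fixes K :: "('o, 'a) tt_data"
    and A :: "('o, 'a) ring_data"
    and T :: "nat \<Rightarrow> ('o, 'a) ring_data"
    and t :: "nat \<Rightarrow> 'a"
    and d :: nat
  assumes "tt_category K"
    and "tt_ring K A"
    and "splitting_tower K A T t"
    and "tower_degree K T d"
  shows "isomorphic_tt_rings (Modc K A) (ext_ring K A A)
           (prod_ring (Modc K A) (unit_ring (Modc K A)) (alg_ring K A (t 1) (T 2)))
         \<and> (1 \<le> d \<longrightarrow> has_degree (Modc K A) (alg_ring K A (t 1) (T 2)) (d - 1))"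
proof -
  interpret additive_monoidal_cat K using assms(1) by (rule tt_category.additive_monoidal)
  interpret A: ring_modules K A using assms(2) by (rule ring_modulesI)
  have T0: "T 0 = unit_ring K" and T1: "T (Suc 0) = A" and t0: "t 0 = unt A"
    and tt: "\<And>n. tt_ring K (T n)" and hom: "\<And>n. tt_ring_hom K (T n) (T (Suc n)) (t n)"
    using assms(3) by (auto simp: splitting_tower_def)
  \<comment> \<open>The tower condition with its index raised by one, so that the step from
    \<open>T (n + 1)\<close> to \<open>T (n + 2)\<close> is taken over the base
    \<open>T n\<close>.\<close>
  have spl: "is_splitting (Modc K (T n)) (alg_ring K (T n) (t n) (T (Suc n)))
      (alg_ring K (T n) (t (Suc n) \<cdot>\<^bsub>K\<^esub> t n) (T (Suc (Suc n))))
      (alg_mod K (t n) (T (Suc n)), t (Suc n), alg_mod K (t (Suc n) \<cdot>\<^bsub>K\<^esub> t n) (T (Suc (Suc n))))" for n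
  proof -
    interpret Tn: ring_modules K "T n" using tt by (rule ring_modulesI)
    have "\<forall>n\<ge>1. let S = T (n - 1); s = t (n - 1); B = alg_ring K S s (T n);
        B' = alg_ring K S (t n \<cdot>\<^bsub>K\<^esub> s) (T (n + 1)) in is_splitting (Modc K S) B B' (carr B, t n, carr B')"
      using assms(3) unfolding splitting_tower_def by blast
    from this[rule_format, of "Suc n"] show ?thesis by (simp add: Let_def Tn.alg_ring_sel)
  qed
  have t1h: "tt_ring_hom K A (T (Suc (Suc 0))) (t (Suc 0))" using hom[of "Suc 0"] T1 by simp
  have 1: "isomorphic_tt_rings (Modc K A) (ext_ring K A A)
      (prod_ring (Modc K A) (unit_ring (Modc K A)) (alg_ring K A (t 1) (T 2)))"
  proof -
    interpret U: ring_modules K "T 0" using tt by (rule ring_modulesI)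
    note f = hom[of 0, unfolded T1]
    obtain h where h: "U.splitting_map (t 0) A (T (Suc (Suc 0))) (t (Suc 0)) h"
      using spl[of 0] unfolding T1 U.is_splitting_iff[OF assms(2) tt f t1h] by blast
    have "is_iso K h"
      by (rule splitting_map_unit_iso[OF tt[of 0, unfolded T0] assms(2) tt f[unfolded T0 t0] t1h h[unfolded T0 t0]])
    then show ?thesis
      using h unfolding U.splitting_map_def numeral_2_eq_2 One_nat_def
      by (intro A.ext_splitting[OF tt t1h]) auto
  qed
  \<comment> \<open>For \<open>d = 0\<close> the ring \<open>A\<close> is zero, and so is the unit
    of \<open>A\<close>-modules; truncated subtraction would still name the degree 0.\<close>
  have 2: "has_degree (Modc K A) (alg_ring K A (t 1) (T 2)) (d - 1)" if d: "1 \<le> d"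
  proof -
    \<comment> \<open>The composite structure map from \<open>A\<close> to \<open>T (n + 1)\<close>.
      It starts with the identity because the new tower is the old one shifted: its stage 0 is
      \<open>T 1 = A\<close>, regarded as the unit of \<open>A\<close>-modules.\<close>
    define c where "c = rec_nat (Idn K (carr A)) (\<lambda>n x. t (Suc n) \<cdot>\<^bsub>K\<^esub> x)"
    have c0: "c 0 = Idn K (carr A)" and cS: "c (Suc n) = t (Suc n) \<cdot>\<^bsub>K\<^esub> c n" for n by (simp_all add: c_def)
    have ch: "tt_ring_hom K A (T (Suc n)) (c n)" for n
    proof (induction n)
      case 0
      show ?case unfolding c0 T1 by (rule tt_ring_hom_Idn[OF assms(2)])
    next
      case (Suc n)
      show ?case unfolding cS by (rule tt_ring_hom_comp[OF assms(2) tt tt Suc hom])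
    qed
    have c1: "c (Suc 0) = t (Suc 0)" unfolding cS c0 using tt_ring_hom_typed[OF t1h] by simp
    define T' where "T' n = alg_ring K A (c n) (T (Suc n))" for n
    define t' where "t' n = (alg_mod K (c n) (T (Suc n)), t (Suc n), alg_mod K (c (Suc n)) (T (Suc (Suc n))))" for n
    have am: "alg_mod K (Idn K (carr A)) A = (carr A, mlt A)" by (simp add: alg_mod_def)
    have carr': "carr (T' n) = alg_mod K (c n) (T (Suc n))" for n by (simp add: T'_def A.alg_ring_sel)
    have "splitting_tower (Modc K A) (alg_ring K A (t 1) (T 2)) T' t'"
      unfolding splitting_tower_def
    proof (intro conjI allI impI)
      show "T' 0 = unit_ring (Modc K A)" by (simp add: T'_def c0 T1 A.unit_ring_Modc)
      show "T' 1 = alg_ring K A (t 1) (T 2)" by (simp add: T'_def c1 numeral_2_eq_2)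
      show "t' 0 = unt (alg_ring K A (t 1) (T 2))"
        by (simp add: t'_def c0 c1 T1 am A.alg_ring_sel numeral_2_eq_2)
      show "tt_ring (Modc K A) (T' n)" for n
        unfolding T'_def by (rule A.tt_ring_alg[OF tt ch])
      show "tt_ring_hom (Modc K A) (T' n) (T' (n + 1)) (t' n)" for n
        using A.alg_ring_hom[OF tt tt ch hom, of n] by (simp add: T'_def t'_def cS)
      \<comment> \<open>Condition \<open>m + 1\<close> for the new tower is the base change along
        \<open>c m\<close> of condition \<open>m + 2\<close> for the old one, whose base is
        \<open>T (m + 1)\<close>.\<close>
      fix n :: nat assume "1 \<le> n"
      then obtain m where n: "n = Suc m" by (cases n) auto
      interpret D: additive_monoidal_cat "Modc K A" by (rule A.Modc_additive_monoidal)
      interpret E: ring_modules "Modc K A" "T' m"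
        unfolding T'_def by (rule D.ring_modulesI[OF A.tt_ring_alg[OF tt ch]])
      have "is_splitting (Modc (Modc K A) (T' m)) (alg_ring (Modc K A) (T' m) (t' m) (T' (Suc m)))
          (alg_ring (Modc K A) (T' m) (t' (Suc m) \<cdot>\<^bsub>Modc K A\<^esub> t' m) (T' (Suc (Suc m))))
          (alg_mod (Modc K A) (t' m) (T' (Suc m)), t' (Suc m),
           alg_mod (Modc K A) (t' (Suc m) \<cdot>\<^bsub>Modc K A\<^esub> t' m) (T' (Suc (Suc m))))"
        using A.base_change_splitting[OF tt tt tt ch hom hom spl, of m] unfolding T'_def t'_def cS .
      then show "let S = T' (n - 1); s = t' (n - 1); B = alg_ring (Modc K A) S s (T' n);
          B' = alg_ring (Modc K A) S (t' n \<cdot>\<^bsub>Modc K A\<^esub> s) (T' (n + 1))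
        in is_splitting (Modc (Modc K A) S) B B' (carr B, t' n, carr B')"
        by (simp add: n Let_def E.alg_ring_sel)
    qed
    moreover have "tower_degree (Modc K A) T' (d - 1)"
    proof -
      \<comment> \<open>The shift by one stage is what lowers the degree from \<open>d\<close> to
        \<open>d - 1\<close>.\<close>
      have "zero_object (Modc K A) (carr (T' n)) \<longleftrightarrow> zero_object K (carr (T (Suc n)))" for n
        unfolding carr' using A.Modc_zero_object[OF A.alg_mod_module[OF tt ch]] by simp
      then show ?thesis using assms(4) d by (simp add: tower_degree_def)
    qed
    ultimately show ?thesis unfolding has_degree_def by blast
  qed
  from 1 2 show ?thesis by blast
qed

end
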